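(* Consider the random-graph network interference model described in the context (undirected graph, graphon model with sparsity $\rho_n$, anonymous interference, smooth potential outcome functions, treatments i.i.d. $\mathrm{Bernoulli}(\pi)$ with $0<\pi<1$). Suppose that there are constants $c_l>0$ and $c_u$ such that $g_1(u):=\int_0^1\min(1,G(u,t))\,dt\ge c_l$ for all $u\in[0,1]$ and $\mathbb{E}[G(U_1,U_2)^k]\le c_u^k$ for $k=1,2$. Suppose also that $\liminf_{n\to\infty}\log\rho_n/\log n>-1$. For $i\neq j$ let $$R_i=\frac{f_i(1,\pi)}{\pi}+\frac{f_i(0,\pi)}{1-\pi},\qquad Q_i=\mathbb{E}\left[\frac{G(U_i,U_j)\,(f_j'(1,\pi)-f_j'(0,\pi))}{g(U_j)}\,\Big|\,U_i\right],$$ where $g(u)=\int_0^1G(u,t)\,dt$. Then, as $n\to\infty$, $$\sqrt n\,(\hat\tau^{\mathrm{HT}}_{\mathrm{DIR}}-\bar\tau_{\mathrm{DIR}})\Rightarrow\mathcal N\big(0,\ \pi(1-\pi)\,\mathbb{E}[(R_i+Q_i)^2]\big),$$ $$\sqrt n\,(\hat\tau^{\mathrm{HAJ}}_{\mathrm{DIR}}-\bar\tau_{\mathrm{DIR}})\Rightarrow\mathcal N\big(0,\ \pi(1-\pi)\,\{\mathrm{Var}[R_i+Q_i]+(\mathbb{E}[Q_i])^2\}\big).$$ If furthermore $\sqrt n\,\rho_n\to\infty$, then with $\sigma_0^2=\mathrm{Var}[f_i(1,\pi)-f_i(0,\pi)]$, $$\sqrt n\,(\hat\tau^{\mathrm{HT}}_{\mathrm{DIR}}-\tau_{\mathrm{DIR}})\Rightarrow\mathcal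 N\big(0,\ \sigma_0^2+\pi(1-\pi)\,\mathbb{E}[(R_i+Q_i)^2]\big),$$ $$\sqrt n\,(\hat\tau^{\mathrm{HAJ}}_{\mathrm{DIR}}-\tau_{\mathrm{DIR}})\Rightarrow\mathcal N\big(0,\ \sigma_0^2+\pi(1-\pi)\,\{\mathrm{Var}[R_i+Q_i]+(\mathbb{E}[Q_i])^2\}\big).$$
   Context: Model. For each $n$ there are units $i=1,\dots,n$. The pairs $(U_i,f_i)$ are i.i.d. from a fixed distribution on $[0,1]\times\mathcal F$ with $U_i\sim\mathrm{Uniform}[0,1]$, where $\mathcal F$ is a class of functions $f:\{0,1\}\times[0,1]\to\mathbb R$. Derivatives $f',f'',f'''$ are with respect to the second argument. Smoothness: for a constant $B$, $|f(w,x)|,|f'(w,x)|,|f''(w,x)|,|f'''(w,x)|\le B$ for all $f\in\mathcal F$, $w\in\{0,1\}$, $x\in[0,1]$. Graph: conditionally on the $(U_i,f_i)$, the edges $E_{ij}\in\{0,1\}$, $i<j$, are independent with $E_{ij}\sim\mathrm{Bernoulli}(G_n(U_i,U_j))$, and $E_{ji}=E_{ij}$, $E_{ii}=0$. Here $G_n(u,v)=\min\{1,\rho_nG(u,v)\}$, where $G$ is a fixed symmetric non-negative measurable function on $[0,1]^2$ and $0<\rho_n\le1$ satisfies either $\rho_n=1$ for all $n$ (dense case, in which $G_n=G$, i.e. $G$ takes values in $[0,1]$), or $\rho_n\to0$ and $n\rho_n\to\infty$ (sparse case). Treatments $W_1,\dots,W_n$ are i.i.d. $\mathrm{Bernoulli}(\pi)$,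 independent of the graph and of the $(U_i,f_i)$. Potential outcomes (anonymous interference): for $w\in\{0,1\}^n$, $Y_i(w)=f_i\big(w_i,\ \sum_{j\ne i}E_{ij}w_j/\sum_{j\neq i}E_{ij}\big)$ with the convention $0/0=0$; the observed outcome is $Y_i=Y_i(W)$. $Y_j(w_i=x;W_{-i})$ denotes the potential outcome of unit $j$ when unit $i$ has treatment $x$ and all other units have their realized treatments. Estimands: $\bar\tau_{\mathrm{DIR}}=\frac1n\sum_i\mathbb{E}[Y_i(w_i=1;W_{-i})-Y_i(w_i=0;W_{-i})\mid Y(\cdot)]$, where the expectation is over $W$ only, conditionally on all potential outcomes (graph and functions $f_i$); $\tau_{\mathrm{DIR}}=\lim_{n\to\infty}\mathbb{E}[\bar\tau_{\mathrm{DIR}}]$. Estimators: $\hat\tau^{\mathrm{HT}}_{\mathrm{DIR}}=\frac1n\sum_i\frac{W_iY_i}{\pi}-\frac1n\sum_i\frac{(1-W_i)Y_i}{1-\pi}$ and $\hat\tau^{\mathrm{HAJ}}_{\mathrm{DIR}}=\frac{\sum_iW_iY_i}{\sum_iW_i}-\frac{\sum_i(1-W_i)Y_i}{\sum_i(1-W_i)}$. $\Rightarrow$ denotes convergence in distribution as $n\to\infty$. *)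

theory Defs
  imports "HOL-Probability.Probability"
begin

text \<open>
  Treatments and edges take values in \<^typ>\<open>bool\<close> instead of \<open>{0, 1}\<close>, and units are numbered
  \<open>0, \<dots>, n - 1\<close>. A response \<open>f\<close> maps a treatment and a fraction of treated neighbours to an outcome;
  only its values for fractions in \<open>{0..1}\<close> matter. A unit is a pair \<open>(U\<^sub>i, f\<^sub>i)\<close>.
\<close>

type_synonym response = "bool \<Rightarrow> real \<Rightarrow> real"
type_synonym unit_type = "real \<times> response"

text \<open>Derivatives are taken within \<open>{0..1}\<close>, hence are one-sided at the end points.\<close>

definition deriv01 :: "(real \<Rightarrow> real) \<Rightarrow> real \<Rightarrow> real" where
  "deriv01 h x = vector_derivative h (at x within {0..1})"

definition smooth3 :: "real \<Rightarrow> (real \<Rightarrow> real) \<Rightarrow> bool" where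
  "smooth3 B h \<longleftrightarrow>
     (\<forall>k<3. (deriv01 ^^ k) h differentiable_on {0..1}) \<and>
     (\<forall>k\<le>3. \<forall>x\<in>{0..1}. \<bar>(deriv01 ^^ k) h x\<bar> \<le> B)"

definition edge_prob :: "(nat \<Rightarrow> real) \<Rightarrow> (real \<Rightarrow> real \<Rightarrow> real) \<Rightarrow> nat \<Rightarrow> real \<Rightarrow> real \<Rightarrow> real" where
  "edge_prob \<rho> G n u v = min 1 (\<rho> n * G u v)"

text \<open>The \<open>\<sigma>\<close>-algebra generated by all the pairs \<open>(U\<^sub>i, f\<^sub>i)\<close>.\<close>

definition units_algebra ::
    "'a measure \<Rightarrow> unit_type measure \<Rightarrow> nat \<Rightarrow> (nat \<Rightarrow> 'a \<Rightarrow> unit_type) \<Rightarrow> 'a measure" where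
  "units_algebra M D n Z =
     vimage_algebra (space M) (\<lambda>\<omega>. \<lambda>i\<in>{..<n}. Z i \<omega>) (PiM {..<n} (\<lambda>_. D))"

text \<open>
  The experiment with \<open>n\<close> units lives on its own probability space \<open>M n\<close>; nothing is assumed about the
  relation between different \<open>n\<close>. The measure \<open>FF\<close> serves as a measurable space only: its space is
  the class of admissible responses, and its \<open>\<sigma>\<close>-algebra may be any for which the evaluations are
  measurable. \<open>D\<close> is the common distribution of the pairs \<open>(U\<^sub>i, f\<^sub>i)\<close>.
\<close>

locale network_interference =
  fixes M :: "nat \<Rightarrow> 'a measure"
    and FF :: "response measure"
    and D :: "unit_type measure"
    and B :: real
    and G :: "real \<Rightarrow> real \<Rightarrow> real"
    and \<rho> :: "nat \<Rightarrow> real"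
    and \<pi> :: real
    and Z :: "nat \<Rightarrow> nat \<Rightarrow> 'a \<Rightarrow> unit_type"
    and E :: "nat \<Rightarrow> nat \<Rightarrow> nat \<Rightarrow> 'a \<Rightarrow> bool"
    and W :: "nat \<Rightarrow> nat \<Rightarrow> 'a \<Rightarrow> bool"
  assumes prob_space_M: "\<And>n. prob_space (M n)"
    and evaluation_measurable:
      "\<And>w x. x \<in> {0..1} \<Longrightarrow> (\<lambda>f. f w x) \<in> borel_measurable FF"
    and smooth: "\<And>f w. f \<in> space FF \<Longrightarrow> smooth3 B (f w)"
    and prob_space_D: "prob_space D"
    and sets_D: "sets D = sets (restrict_space borel {0..1} \<Otimes>\<^sub>M FF)"
    and uniform_D: "distr D borel fst = uniform_measure lborel {0..1}"
    and G_measurable: "case_prod G \<in> borel_measurable (restrict_space borel ({0..1} \<times> {0..1}))"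
    and G_sym: "\<And>u v. u \<in> {0..1} \<Longrightarrow> v \<in> {0..1} \<Longrightarrow> G u v = G v u"
    and G_nonneg: "\<And>u v. u \<in> {0..1} \<Longrightarrow> v \<in> {0..1} \<Longrightarrow> 0 \<le> G u v"
    and rho_range: "\<And>n. 0 < \<rho> n \<and> \<rho> n \<le> 1"
    and dense_or_sparse:
      "(\<forall>n. \<rho> n = 1) \<and> (\<forall>u\<in>{0..1}. \<forall>v\<in>{0..1}. G u v \<le> 1) \<or>
       \<rho> \<longlonglongrightarrow> 0 \<and> filterlim (\<lambda>n. real n * \<rho> n) at_top sequentially"
    and pi_range: "0 < \<pi>" "\<pi> < 1"
    and Z_indep: "\<And>n. prob_space.indep_vars (M n) (\<lambda>_. D) (Z n) {..<n}"
    and Z_distr: "\<And>n i. i < n \<Longrightarrow> distr (M n) D (Z n i) = D"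
    and E_measurable: "\<And>n i j. i < n \<Longrightarrow> j < n \<Longrightarrow> E n i j \<in> measurable (M n) (count_space UNIV)"
    and E_sym: "\<And>n i j \<omega>. i < n \<Longrightarrow> j < n \<Longrightarrow> \<omega> \<in> space (M n) \<Longrightarrow> E n i j \<omega> = E n j i \<omega>"
    and E_irrefl: "\<And>n i \<omega>. i < n \<Longrightarrow> \<omega> \<in> space (M n) \<Longrightarrow> \<not> E n i i \<omega>"
    and E_cond_law:
      \<comment> \<open>given all \<open>(U\<^sub>i, f\<^sub>i)\<close>, the edges \<open>E\<^sub>i\<^sub>j\<close> with \<open>i < j\<close> are independent Bernoulli variables\<close>
      "\<And>n e. AE \<omega> in M n.
         real_cond_exp (M n) (units_algebra (M n) D n (Z n))
           (indicator {\<omega> \<in> space (M n). \<forall>j<n. \<forall>i<j. E n i j \<omega> = e i j}) \<omega> =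
         (\<Prod>(i, j)\<in>{(i, j). i < j \<and> j < n}.
            pmf (bernoulli_pmf (edge_prob \<rho> G n (fst (Z n i \<omega>)) (fst (Z n j \<omega>)))) (e i j))"
    and W_indep: "\<And>n. prob_space.indep_vars (M n) (\<lambda>_. count_space UNIV) (W n) {..<n}"
    and W_distr: "\<And>n i. i < n \<Longrightarrow>
      distr (M n) (count_space UNIV) (W n i) = measure_pmf (bernoulli_pmf \<pi>)"
    and W_indep_rest:
      "\<And>n. prob_space.indep_set (M n)
         (sets (vimage_algebra (space (M n)) (\<lambda>\<omega>. \<lambda>i\<in>{..<n}. W n i \<omega>)
            (PiM {..<n} (\<lambda>_. count_space UNIV))))
         (sets (vimage_algebra (space (M n))
            (\<lambda>\<omega>. (\<lambda>i\<in>{..<n}. Z n i \<omega>, \<lambda>(i, j)\<in>{..<n} \<times> {..<n}. E n i j \<omega>))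
            (PiM {..<n} (\<lambda>_. D) \<Otimes>\<^sub>M PiM ({..<n} \<times> {..<n}) (\<lambda>_. count_space UNIV))))"

text \<open>The convention \<open>0 / 0 = 0\<close> for units without neighbours is that of the division of HOL.\<close>

definition potential_outcome ::
    "nat \<Rightarrow> (nat \<Rightarrow> 'a \<Rightarrow> unit_type) \<Rightarrow> (nat \<Rightarrow> nat \<Rightarrow> 'a \<Rightarrow> bool) \<Rightarrow> nat \<Rightarrow> (nat \<Rightarrow> bool) \<Rightarrow> 'a \<Rightarrow> real" where
  "potential_outcome n Z E i w \<omega> =
     snd (Z i \<omega>) (w i)
       ((\<Sum>j\<in>{..<n} - {i}. of_bool (E i j \<omega>) * of_bool (w j)) /
        (\<Sum>j\<in>{..<n} - {i}. of_bool (E i j \<omega>)))"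

definition observed_outcome ::
    "nat \<Rightarrow> (nat \<Rightarrow> 'a \<Rightarrow> unit_type) \<Rightarrow> (nat \<Rightarrow> nat \<Rightarrow> 'a \<Rightarrow> bool) \<Rightarrow> (nat \<Rightarrow> 'a \<Rightarrow> bool) \<Rightarrow> nat \<Rightarrow> 'a \<Rightarrow> real" where
  "observed_outcome n Z E W i \<omega> = potential_outcome n Z E i (\<lambda>j. W j \<omega>) \<omega>"

text \<open>
  The \<open>\<sigma>\<close>-algebra generated by \<open>Y(\<cdot>)\<close>, that is, by all \<open>Y\<^sub>i(w)\<close> with \<open>i < n\<close> and \<open>w \<in> {0, 1}\<^sup>n\<close>.
  As \<open>W\<close> is independent of the graph and the responses, conditioning on it averages over \<open>W\<close> only.
\<close>

definition outcomes_algebra ::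
    "'a measure \<Rightarrow> nat \<Rightarrow> (nat \<Rightarrow> 'a \<Rightarrow> unit_type) \<Rightarrow> (nat \<Rightarrow> nat \<Rightarrow> 'a \<Rightarrow> bool) \<Rightarrow> 'a measure" where
  "outcomes_algebra M n Z E =
     vimage_algebra (space M)
       (\<lambda>\<omega>. \<lambda>(i, w)\<in>{..<n} \<times> PiE {..<n} (\<lambda>_. UNIV). potential_outcome n Z E i w \<omega>)
       (PiM ({..<n} \<times> PiE {..<n} (\<lambda>_. UNIV)) (\<lambda>_. borel))"

definition tau_bar_DIR ::
    "'a measure \<Rightarrow> nat \<Rightarrow> (nat \<Rightarrow> 'a \<Rightarrow> unit_type) \<Rightarrow> (nat \<Rightarrow> nat \<Rightarrow> 'a \<Rightarrow> bool) \<Rightarrow> (nat \<Rightarrow> 'a \<Rightarrow> bool) \<Rightarrow> 'a \<Rightarrow> real" where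
  "tau_bar_DIR M n Z E W \<omega> =
     (1 / real n) * (\<Sum>i<n. real_cond_exp M (outcomes_algebra M n Z E)
        (\<lambda>\<omega>. potential_outcome n Z E i ((\<lambda>j. W j \<omega>)(i := True)) \<omega> -
             potential_outcome n Z E i ((\<lambda>j. W j \<omega>)(i := False)) \<omega>) \<omega>)"

definition tau_DIR ::
    "(nat \<Rightarrow> 'a measure) \<Rightarrow> (nat \<Rightarrow> nat \<Rightarrow> 'a \<Rightarrow> unit_type) \<Rightarrow> (nat \<Rightarrow> nat \<Rightarrow> nat \<Rightarrow> 'a \<Rightarrow> bool) \<Rightarrow>
     (nat \<Rightarrow> nat \<Rightarrow> 'a \<Rightarrow> bool) \<Rightarrow> real" where
  "tau_DIR M Z E W = lim (\<lambda>n. integral\<^sup>L (M n) (tau_bar_DIR (M n) n (Z n) (E n) (W n)))"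

definition tau_HT ::
    "real \<Rightarrow> nat \<Rightarrow> (nat \<Rightarrow> 'a \<Rightarrow> unit_type) \<Rightarrow> (nat \<Rightarrow> nat \<Rightarrow> 'a \<Rightarrow> bool) \<Rightarrow> (nat \<Rightarrow> 'a \<Rightarrow> bool) \<Rightarrow> 'a \<Rightarrow> real" where
  "tau_HT \<pi> n Z E W \<omega> =
     (1 / real n) * (\<Sum>i<n. of_bool (W i \<omega>) * observed_outcome n Z E W i \<omega> / \<pi>) -
     (1 / real n) * (\<Sum>i<n. (1 - of_bool (W i \<omega>)) * observed_outcome n Z E W i \<omega> / (1 - \<pi>))"

definition tau_HAJ ::
    "nat \<Rightarrow> (nat \<Rightarrow> 'a \<Rightarrow> unit_type) \<Rightarrow> (nat \<Rightarrow> nat \<Rightarrow> 'a \<Rightarrow> bool) \<Rightarrow> (nat \<Rightarrow> 'a \<Rightarrow> bool) \<Rightarrow> 'a \<Rightarrow> real" where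
  "tau_HAJ n Z E W \<omega> =
     (\<Sum>i<n. of_bool (W i \<omega>) * observed_outcome n Z E W i \<omega>) / (\<Sum>i<n. of_bool (W i \<omega>)) -
     (\<Sum>i<n. (1 - of_bool (W i \<omega>)) * observed_outcome n Z E W i \<omega>) / (\<Sum>i<n. 1 - of_bool (W i \<omega>))"

definition graphon_degree :: "(real \<Rightarrow> real \<Rightarrow> real) \<Rightarrow> real \<Rightarrow> real" where
  "graphon_degree G u = (LINT t:{0..1}|lborel. G u t)"

text \<open>
  \<open>R\<^sub>i\<close> and \<open>Q\<^sub>i\<close> for generic \<open>i \<noteq> j\<close>, as random variables on the product space \<open>D \<Otimes>\<^sub>M D\<close> carrying the
  joint distribution of \<open>((U\<^sub>i, f\<^sub>i), (U\<^sub>j, f\<^sub>j))\<close>.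
\<close>

definition R_var :: "real \<Rightarrow> unit_type \<times> unit_type \<Rightarrow> real" where
  "R_var \<pi> = (\<lambda>((u, f), _). f True \<pi> / \<pi> + f False \<pi> / (1 - \<pi>))"

definition Q_var ::
    "unit_type measure \<Rightarrow> (real \<Rightarrow> real \<Rightarrow> real) \<Rightarrow> real \<Rightarrow> unit_type \<times> unit_type \<Rightarrow> real" where
  "Q_var D G \<pi> =
     real_cond_exp (D \<Otimes>\<^sub>M D)
       (vimage_algebra (space (D \<Otimes>\<^sub>M D)) (\<lambda>((u, _), _). u) borel)
       (\<lambda>((u, _), (v, f)).
          G u v * (deriv01 (f True) \<pi> - deriv01 (f False) \<pi>) / graphon_degree G v)"

text \<open>
  The normal law with given mean and variance. The case distinction is needed because
  \<^term>\<open>normal_density m 0\<close> vanishes everywhere and so is not a density of the point mass at \<open>m\<close>.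
\<close>

definition normal_law :: "real \<Rightarrow> real \<Rightarrow> real measure" where
  "normal_law m v =
     (if v = 0 then return borel m else density lborel (\<lambda>x. ennreal (normal_density m (sqrt v) x)))"

definition conv_in_distribution ::
    "(nat \<Rightarrow> 'a measure) \<Rightarrow> (nat \<Rightarrow> 'a \<Rightarrow> real) \<Rightarrow> real measure \<Rightarrow> bool" where
  "conv_in_distribution M X L \<longleftrightarrow> weak_conv_m (\<lambda>n. distr (M n) borel (X n)) L"

end

theory Submission
  imports Defs "HOL-Real_Asymp.Real_Asymp"
begin

text \<open>
  Write \<open>\<epsilon>\<^sub>i = W\<^sub>i - \<pi>\<close>, let \<open>X\<^sub>i\<close> be the fraction of treated neighbours of unit \<open>i\<close>, and put
  \<open>d\<^sub>i(x) = f\<^sub>i(1, x) - f\<^sub>i(0, x)\<close> and \<open>r\<^sub>i(x) = f\<^sub>i(1, x) / \<pi> + f\<^sub>i(0, x) / (1 - \<pi>)\<close>. Then \<open>n\<close> times the error of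
  the Horvitz-Thompson estimator is exactly \<open>\<Sum>\<^sub>i \<epsilon>\<^sub>i r\<^sub>i(X\<^sub>i) + \<Sum>\<^sub>i (d\<^sub>i(X\<^sub>i) - E\<^sub>W d\<^sub>i(X\<^sub>i))\<close>, where \<open>E\<^sub>W\<close>
  averages over the treatments only. Given the graph, resampling single treatments and the
  Efron-Stein inequality show that, up to terms that are negligible after division by \<open>n\<^sup>1\<^sup>/\<^sup>2\<close>,
  the first sum is \<open>\<Sum>\<^sub>i \<epsilon>\<^sub>i R\<^sub>i\<close> and the second one is linear in the treatments, that is, equal to
  \<open>\<Sum>\<^sub>j \<epsilon>\<^sub>j Q'\<^sub>j\<close> with \<open>Q'\<^sub>j = \<Sum>\<^sub>i E\<^sub>i\<^sub>j d\<^sub>i'(\<pi>) / deg i\<close>. The degrees concentrate uniformly around their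
  conditional means, and a variance computation in the star of neighbours of \<open>j\<close> replaces \<open>Q'\<^sub>j\<close> by
  \<open>Q\<^sub>j\<close>. What remains is a sum of i.i.d. variables. The normalisation of the Hajek estimator
  subtracts the mean of \<open>R\<close> from \<open>R\<^sub>i\<close>. If \<open>n\<^sup>1\<^sup>/\<^sup>2 \<rho>\<^sub>n \<rightarrow> \<infinity>\<close>, the estimand differs from its limit by the
  average of the centred \<open>d\<^sub>i(\<pi>)\<close>, and this is uncorrelated with the \<open>\<epsilon>\<^sub>i (R\<^sub>i + Q\<^sub>i)\<close>.
\<close>

section \<open>Convergence in probability and in distribution\<close>

text \<open>Different \<open>n\<close> live on unrelated probability spaces and only two moments of
  \<open>G\<close> are controlled, so all approximations are in mean square: first over the
  treatments with the graph held fixed, on the event \<open>Good n\<close> that every degree is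
  close to its conditional mean, then over the graph. The law of the edges enters only through the
  star at one unit. Two orders of magnitude decide what is negligible. The total weight
  \<open>sum_i E_ik / deg i\<close> with which unit \<open>k\<close> acts on its neighbours is of
  order one in mean square, whereas \<open>1 / deg i\<close> is at most of order
  \<open>1 / (n \<rho>\<^sub>n)\<close>. Replacing an exposure by \<pi> next to a centred treatment,
  or passing to the second-order part of a direct effect, gains a factor \<open>1 / deg\<close>; the
  linear part of the direct effects gains none and survives as \<open>Q\<close>. The same count
  explains the extra hypothesis for the fixed estimand: averaging a direct effect over the
  treatments leaves a bias of order \<open>1 / (n \<rho>\<^sub>n)\<close>, as the linear part has
  mean zero exactly, and this must be small compared with \<open>1 / sqrt n\<close>.\<close>

lemma char_power_tendsto_normal:
  assumes "real_distribution \<mu>"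
    and int2: "integrable \<mu> (\<lambda>x. x\<^sup>2)"
    and mean: "(LINT x|\<mu>. x) = 0"
    and var: "(LINT x|\<mu>. x\<^sup>2) = v"
  shows "(\<lambda>n. char \<mu> (t / sqrt (real n)) ^ n) \<longlonglongrightarrow> complex_of_real (exp (- (v * t\<^sup>2) / 2))"
proof -
  interpret real_distribution \<mu> by fact
  have int1: "integrable \<mu> (\<lambda>x. x)"
    by (rule square_integrable_imp_integrable[OF _ int2]) simp
  have v0: "0 \<le> v" unfolding var[symmetric] by (rule Bochner_Integration.integral_nonneg) simp
  \<comment> \<open>This is \<open>n\<close> times the third-order Taylor error of the
    characteristic function at \<open>t / sqrt n\<close>. The minimum lies below
    \<open>6 * x^2\<close>, so a second moment suffices for dominated convergence.\<close>
  define b where "b n = t\<^sup>2 / 6 * (LINT x|\<mu>. min (6 * x\<^sup>2) (\<bar>t / sqrt (real n)\<bar> * \<bar>x\<bar> ^ 3))" for n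
  have main: "\<forall>\<^sub>F n in sequentially.
      norm (char \<mu> (t / sqrt (real n)) ^ n - complex_of_real ((1 + (- (v * t\<^sup>2) / 2) / real n) ^ n)) \<le> b n"
  proof (rule eventually_sequentiallyI)
    fix n :: nat
    \<comment> \<open>The approximating base \<open>1 - v t^2 / (2 n)\<close> then lies in
      \<open>[-1, 1]\<close>. Both bases must have norm at most 1 in order to bound the difference
      of their \<open>n\<close>-th powers by \<open>n\<close> times their difference.\<close>
    assume "n \<ge> nat \<lceil>v * t\<^sup>2 / 4\<rceil> + 1"
    then have n: "v * t\<^sup>2 / 4 \<le> real n" and n0: "n > 0"
      by linarith+
    let ?t = "t / sqrt (real n)"
    let ?w = "1 + (- (v * t\<^sup>2) / 2) / real n"
    have "norm (char \<mu> ?t - complex_of_real (1 - ?t\<^sup>2 * v / 2)) \<le> ?t\<^sup>2 / 6 * (LINT x|\<mu>. min (6 * x\<^sup>2) (\<bar>?t\<bar> * \<bar>x\<bar> ^ 3))"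
      using char_approx3[OF int1 mean int2, of v ?t] var mean by simp
    moreover have "?w = 1 - ?t\<^sup>2 * v / 2"
      using n0 by (simp add: power_divide field_simps)
    ultimately have *: "norm (char \<mu> ?t - complex_of_real ?w) \<le>
        ?t\<^sup>2 / 6 * (LINT x|\<mu>. min (6 * x\<^sup>2) (\<bar>?t\<bar> * \<bar>x\<bar> ^ 3))"
      by (simp only:)
    have "\<bar>?w\<bar> \<le> 1"
      using n n0 v0 by (auto simp: abs_le_iff field_simps)
    then have "norm (complex_of_real ?w) \<le> 1" by (simp only: norm_of_real)
    then have "norm (char \<mu> ?t ^ n - complex_of_real ?w ^ n) \<le> real n * norm (char \<mu> ?t - complex_of_real ?w)"
      by (intro norm_power_diff cmod_char_le_1)
    also have "\<dots> \<le> real n * (?t\<^sup>2 / 6 * (LINT x|\<mu>. min (6 * x\<^sup>2) (\<bar>?t\<bar> * \<bar>x\<bar> ^ 3)))"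
      by (intro mult_left_mono *) simp
    also have "\<dots> = b n"
      using n0 by (simp add: b_def power_divide)
    finally show "norm (char \<mu> ?t ^ n - complex_of_real (?w ^ n)) \<le> b n"
      by simp
  qed
  have "(\<lambda>n. LINT x|\<mu>. min (6 * x\<^sup>2) (\<bar>t / sqrt (real n)\<bar> * \<bar>x\<bar> ^ 3)) \<longlonglongrightarrow> (LINT x|\<mu>. 0)"
  proof (rule integral_dominated_convergence[where w = "\<lambda>x. 6 * x\<^sup>2"])
    show "integrable \<mu> (\<lambda>x. 6 * x\<^sup>2)" using int2 by simp
    show "AE x in \<mu>. (\<lambda>n. min (6 * x\<^sup>2) (\<bar>t / sqrt (real n)\<bar> * \<bar>x\<bar> ^ 3)) \<longlonglongrightarrow> 0"
    proof (rule AE_I2)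
      fix x :: real
      have "(\<lambda>n. \<bar>t / sqrt (real n)\<bar> * \<bar>x\<bar> ^ 3) \<longlonglongrightarrow> 0"
      proof -
        have "(\<lambda>n. c / sqrt (real n)) \<longlonglongrightarrow> 0" for c :: real
          by real_asymp
        from this[of "\<bar>t\<bar> * \<bar>x\<bar> ^ 3"] show ?thesis by simp
      qed
      then have "(\<lambda>n. min (6 * x\<^sup>2) (\<bar>t / sqrt (real n)\<bar> * \<bar>x\<bar> ^ 3)) \<longlonglongrightarrow> min (6 * x\<^sup>2) 0"
        by (intro tendsto_min tendsto_const)
      then show "(\<lambda>n. min (6 * x\<^sup>2) (\<bar>t / sqrt (real n)\<bar> * \<bar>x\<bar> ^ 3)) \<longlonglongrightarrow> 0"
        by simp
    qed
  qed auto
  then have "b \<longlonglongrightarrow> t\<^sup>2 / 6 * 0"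
    unfolding b_def by (intro tendsto_mult tendsto_const) simp
  then have b0: "b \<longlonglongrightarrow> 0" by simp
  have "(\<lambda>n. complex_of_real ((1 + (- (v * t\<^sup>2) / 2) / real n) ^ n)) \<longlonglongrightarrow>
      complex_of_real (exp (- (v * t\<^sup>2) / 2))"
    by (intro tendsto_of_real tendsto_exp_limit_sequentially)
  then show ?thesis
    by (rule Lim_transform) (rule Lim_null_comparison[OF main b0])
qed

text \<open>Scaling a standard normal variable covers \<open>v = 0\<close> and \<open>v > 0\<close>
  by one formula, so the characteristic function needs no case distinction.\<close>

lemma normal_law_eq_distr:
  assumes "0 \<le> v"
  shows "normal_law 0 v = distr std_normal_distribution borel (\<lambda>x. sqrt v * x)"
proof (cases "v = 0")
  case True
  interpret prob_space std_normal_distribution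
    by (rule prob_space_normal_density) simp
  have "distr std_normal_distribution borel (\<lambda>x. sqrt v * x) = return borel 0"
    using True by (simp add: distr_const)
  with True show ?thesis by (simp add: normal_law_def)
next
  case False
  interpret prob_space std_normal_distribution
    by (rule prob_space_normal_density) simp
  have "distributed std_normal_distribution lborel (\<lambda>x. x) std_normal_density"
    by (auto simp: distributed_def intro!: distr_id2)
  from normal_density_affine[OF this, of "sqrt v" 0] False assms
  have "distributed std_normal_distribution lborel (\<lambda>x. sqrt v * x) (normal_density 0 (sqrt v))"
    by simp
  then have "distr std_normal_distribution lborel (\<lambda>x. sqrt v * x) = density lborel (normal_density 0 (sqrt v))"
    by (simp add: distributed_def)
  moreover have "distr std_normal_distribution lborel (\<lambda>x. sqrt v * x) =
      distr std_normal_distribution borel (\<lambda>x. sqrt v * x)"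
    by (intro distr_cong) auto
  ultimately show ?thesis
    using False by (simp add: normal_law_def)
qed

lemma
  assumes "0 \<le> v"
  shows real_distribution_normal_law: "real_distribution (normal_law 0 v)"
    and char_normal_law: "char (normal_law 0 v) t = complex_of_real (exp (- (v * t\<^sup>2) / 2))"
proof -
  interpret prob_space std_normal_distribution
    by (rule prob_space_normal_density) simp
  show "real_distribution (normal_law 0 v)"
    unfolding normal_law_eq_distr[OF assms] by (rule real_distribution_distr) simp
  have "char (normal_law 0 v) t = char std_normal_distribution (t * sqrt v)"
    unfolding normal_law_eq_distr[OF assms] char_def
    by (subst integral_distr) (auto simp: mult_ac)
  also have "\<dots> = complex_of_real (exp (- (v * t\<^sup>2) / 2))"
    using assms by (simp add: char_std_normal_distribution power_mult_distrib mult_ac)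
  finally show "char (normal_law 0 v) t = complex_of_real (exp (- (v * t\<^sup>2) / 2))" .
qed

lemma norm_iexp_diff_le: "norm (iexp x - iexp y) \<le> \<bar>x - y\<bar>"
proof -
  have "iexp x - iexp y = iexp y * (iexp (x - y) - 1)"
    by (simp add: algebra_simps flip: exp_add)
  then have "norm (iexp x - iexp y) = norm (iexp (x - y) - 1)"
    by (simp add: norm_mult)
  also have "\<dots> \<le> \<bar>x - y\<bar>"
    using iexp_approx1[of "x - y" 0] by simp
  finally show ?thesis .
qed

text \<open>Slutsky's lemma on the level of characteristic functions: \<open>iexp\<close> is
  Lipschitz where \<open>X\<close> and \<open>Y\<close> are close, and the two values differ by at
  most 2 on the rare event where they are not. Levy's continuity theorem then gives weak
  convergence.\<close>

lemma weak_conv_via_approximation: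
  fixes M :: "nat \<Rightarrow> 'a measure" and X Y :: "nat \<Rightarrow> 'a \<Rightarrow> real"
  assumes prob: "\<And>n. prob_space (M n)"
    and X: "\<And>n. X n \<in> borel_measurable (M n)"
    and Y: "\<And>n. Y n \<in> borel_measurable (M n)"
    and close: "\<And>\<eta>. \<eta> > 0 \<Longrightarrow> (\<lambda>n. measure (M n) {\<omega> \<in> space (M n). \<eta> < \<bar>X n \<omega> - Y n \<omega>\<bar>}) \<longlonglongrightarrow> 0"
    and L: "real_distribution L"
    and char: "\<And>t. (\<lambda>n. LINT \<omega>|M n. iexp (t * Y n \<omega>)) \<longlonglongrightarrow> char L t"
  shows "conv_in_distribution M X L"
  unfolding conv_in_distribution_def
proof (rule levy_continuity)
  fix n
  interpret prob_space "M n" by (rule prob)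
  show "real_distribution (distr (M n) borel (X n))"
    by (rule real_distribution_distr) (rule X)
next
  show "real_distribution L" by (rule L)
next
  fix t
  have "(\<lambda>n. char (distr (M n) borel (X n)) t - (LINT \<omega>|M n. iexp (t * Y n \<omega>))) \<longlonglongrightarrow> 0"
  proof (rule tendsto_norm_zero_cancel, rule tendstoI)
    fix e :: real assume "e > 0"
    \<comment> \<open>The added 1 covers \<open>t = 0\<close>. The Lipschitz part stays below
      \<open>e / 2\<close>, and a probability below \<open>e / 4\<close>, counted twice, takes the
      other half.\<close>
    define \<eta> where "\<eta> = e / (2 * (\<bar>t\<bar> + 1))"
    have \<eta>: "\<eta> > 0" "\<bar>t\<bar> * \<eta> < e / 2 + 0"
      using \<open>e > 0\<close> by (auto simp: \<eta>_def field_simps)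
    have "\<forall>\<^sub>F n in sequentially. measure (M n) {\<omega> \<in> space (M n). \<eta> < \<bar>X n \<omega> - Y n \<omega>\<bar>} < e / 4"
      using order_tendstoD(2)[OF close[OF \<eta>(1)], of "e / 4"] \<open>e > 0\<close> by simp
    then show "\<forall>\<^sub>F n in sequentially.
        dist (norm (char (distr (M n) borel (X n)) t - (LINT \<omega>|M n. iexp (t * Y n \<omega>)))) 0 < e"
    proof eventually_elim
      case (elim n)
      interpret prob_space "M n" by (rule prob)
      note [measurable] = X[of n] Y[of n]
      let ?A = "{\<omega> \<in> space (M n). \<eta> < \<bar>X n \<omega> - Y n \<omega>\<bar>}"
      have iX: "integrable (M n) (\<lambda>\<omega>. iexp (t * X n \<omega>))" and iY: "integrable (M n) (\<lambda>\<omega>. iexp (t * Y n \<omega>))"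
        by (auto intro!: integrable_const_bound[where B=1] simp: norm_exp_i_times simp del: of_real_mult)
      have "char (distr (M n) borel (X n)) t - (LINT \<omega>|M n. iexp (t * Y n \<omega>)) =
          (LINT \<omega>|M n. iexp (t * X n \<omega>) - iexp (t * Y n \<omega>))"
        unfolding char_def using iX iY by (subst integral_distr) (auto simp: Bochner_Integration.integral_diff)
      also have "norm \<dots> \<le> (LINT \<omega>|M n. norm (iexp (t * X n \<omega>) - iexp (t * Y n \<omega>)))"
        by (rule integral_norm_bound)
      also have "\<dots> \<le> (LINT \<omega>|M n. \<bar>t\<bar> * \<eta> + 2 * indicator ?A \<omega>)"
      proof (rule integral_mono)
        show "integrable (M n) (\<lambda>\<omega>. norm (iexp (t * X n \<omega>) - iexp (t * Y n \<omega>)))"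
          using iX iY by auto
        show "integrable (M n) (\<lambda>\<omega>. \<bar>t\<bar> * \<eta> + 2 * indicator ?A \<omega>)"
          by (intro Bochner_Integration.integrable_add integrable_const Bochner_Integration.integrable_mult_right
              integrable_real_indicator) (auto simp: emeasure_eq_measure)
        fix \<omega> assume "\<omega> \<in> space (M n)"
        show "norm (iexp (t * X n \<omega>) - iexp (t * Y n \<omega>)) \<le> \<bar>t\<bar> * \<eta> + 2 * indicator ?A \<omega>"
        proof (cases "\<omega> \<in> ?A")
          case True
          have "norm (iexp (t * X n \<omega>) - iexp (t * Y n \<omega>)) \<le> norm (iexp (t * X n \<omega>)) + norm (iexp (t * Y n \<omega>))"
            by (rule norm_triangle_ineq4)
          also have "\<dots> = 2" by (simp add: norm_exp_i_times del: of_real_mult)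
          also have "\<dots> \<le> \<bar>t\<bar> * \<eta> + 2" using \<eta>(1) by simp
          finally show ?thesis using True by simp
        next
          case False
          then have "\<bar>X n \<omega> - Y n \<omega>\<bar> \<le> \<eta>" using \<open>\<omega> \<in> space (M n)\<close> by auto
          have "norm (iexp (t * X n \<omega>) - iexp (t * Y n \<omega>)) \<le> \<bar>t * X n \<omega> - t * Y n \<omega>\<bar>"
            by (rule norm_iexp_diff_le)
          also have "\<dots> = \<bar>t\<bar> * \<bar>X n \<omega> - Y n \<omega>\<bar>"
            by (simp add: abs_mult flip: right_diff_distrib)
          also have "\<dots> \<le> \<bar>t\<bar> * \<eta>"
            by (rule mult_left_mono) (fact, simp)
          finally show ?thesis using False by simp
        qed
      qed
      also have "\<dots> = \<bar>t\<bar> * \<eta> + 2 * prob ?A"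
        by (subst Bochner_Integration.integral_add) (auto simp: emeasure_eq_measure prob_space)
      also have "\<dots> < e"
        using \<eta>(2) elim by simp
      finally show ?case by simp
    qed
  qed
  from tendsto_add[OF this char[of t]]
  show "(\<lambda>n. char (distr (M n) borel (X n)) t) \<longlonglongrightarrow> char L t"
    by simp
qed

text \<open>Measurability is built in because \<open>measure\<close> is 0 on sets outside the
  \<sigma>-algebra, where the limit would hold vacuously.\<close>

definition conv_prob_zero :: "(nat \<Rightarrow> 'a measure) \<Rightarrow> (nat \<Rightarrow> 'a \<Rightarrow> real) \<Rightarrow> bool" where
  "conv_prob_zero M X \<longleftrightarrow> (\<forall>n. X n \<in> borel_measurable (M n)) \<and>
     (\<forall>\<eta>>0. (\<lambda>n. measure (M n) {\<omega> \<in> space (M n). \<eta> < \<bar>X n \<omega>\<bar>}) \<longlonglongrightarrow> 0)"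

lemma conv_prob_zeroD:
  "conv_prob_zero M X \<Longrightarrow> X n \<in> borel_measurable (M n)"
  "conv_prob_zero M X \<Longrightarrow> \<eta> > 0 \<Longrightarrow> (\<lambda>n. measure (M n) {\<omega> \<in> space (M n). \<eta> < \<bar>X n \<omega>\<bar>}) \<longlonglongrightarrow> 0"
  by (auto simp: conv_prob_zero_def)

text \<open>The common core of closure rules below: a large \<open>Z\<close> forces one of
  \<open>X\<close> and \<open>Y\<close> to be large. Requiring this only almost surely and for large
  \<open>n\<close> admits versions of conditional expectations and excludes
  \<open>n = 0\<close>.\<close>

lemma conv_prob_zero_union_bound:
  assumes prob: "\<And>n. prob_space (M n)"
    and X: "conv_prob_zero M X" and Y: "conv_prob_zero M Y"
    and Z: "\<And>n. Z n \<in> borel_measurable (M n)"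
    and le: "\<And>\<eta>. \<eta> > 0 \<Longrightarrow> \<exists>a>0. \<exists>b>0. \<forall>\<^sub>F n in sequentially. AE \<omega> in M n.
      \<eta> < \<bar>Z n \<omega>\<bar> \<longrightarrow> a < \<bar>X n \<omega>\<bar> \<or> b < \<bar>Y n \<omega>\<bar>"
  shows "conv_prob_zero M Z"
  unfolding conv_prob_zero_def
proof (intro conjI allI impI Z)
  fix \<eta> :: real assume "\<eta> > 0"
  from le[OF this] obtain a b where ab: "a > 0" "b > 0"
    and ev: "\<forall>\<^sub>F n in sequentially. AE \<omega> in M n. \<eta> < \<bar>Z n \<omega>\<bar> \<longrightarrow> a < \<bar>X n \<omega>\<bar> \<or> b < \<bar>Y n \<omega>\<bar>"
    by blast
  have lim: "(\<lambda>n. measure (M n) {\<omega> \<in> space (M n). a < \<bar>X n \<omega>\<bar>} +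
      measure (M n) {\<omega> \<in> space (M n). b < \<bar>Y n \<omega>\<bar>}) \<longlonglongrightarrow> 0"
    using tendsto_add[OF conv_prob_zeroD(2)[OF X ab(1)] conv_prob_zeroD(2)[OF Y ab(2)]] by simp
  show "(\<lambda>n. measure (M n) {\<omega> \<in> space (M n). \<eta> < \<bar>Z n \<omega>\<bar>}) \<longlonglongrightarrow> 0"
  proof (rule tendsto_sandwich[OF _ _ tendsto_const lim])
    show "\<forall>\<^sub>F n in sequentially. measure (M n) {\<omega> \<in> space (M n). \<eta> < \<bar>Z n \<omega>\<bar>}
        \<le> measure (M n) {\<omega> \<in> space (M n). a < \<bar>X n \<omega>\<bar>} + measure (M n) {\<omega> \<in> space (M n). b < \<bar>Y n \<omega>\<bar>}"
      using ev
    proof eventually_elim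
      case (elim n)
      interpret prob_space "M n" by (rule prob)
      note [measurable] = conv_prob_zeroD(1)[OF X, of n] conv_prob_zeroD(1)[OF Y, of n] Z[of n]
      have "prob {\<omega> \<in> space (M n). \<eta> < \<bar>Z n \<omega>\<bar>} \<le>
          prob ({\<omega> \<in> space (M n). a < \<bar>X n \<omega>\<bar>} \<union> {\<omega> \<in> space (M n). b < \<bar>Y n \<omega>\<bar>})"
        by (rule finite_measure_mono_AE) (use elim in \<open>auto\<close>)
      also have "\<dots> \<le> prob {\<omega> \<in> space (M n). a < \<bar>X n \<omega>\<bar>} + prob {\<omega> \<in> space (M n). b < \<bar>Y n \<omega>\<bar>}"
        by (rule measure_Un_le) auto
      finally show ?case .
    qed
  qed auto
qed

lemma conv_prob_zero_cong:
  assumes prob: "\<And>n. prob_space (M n)"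
    and X: "conv_prob_zero M X"
    and Z: "\<And>n. Z n \<in> borel_measurable (M n)"
    and eq: "\<forall>\<^sub>F n in sequentially. AE \<omega> in M n. Z n \<omega> = X n \<omega>"
  shows "conv_prob_zero M Z"
proof (rule conv_prob_zero_union_bound[OF prob X X Z])
  fix \<eta> :: real assume "\<eta> > 0"
  have "\<forall>\<^sub>F n in sequentially. AE \<omega> in M n. \<eta> < \<bar>Z n \<omega>\<bar> \<longrightarrow> \<eta> < \<bar>X n \<omega>\<bar> \<or> \<eta> < \<bar>X n \<omega>\<bar>"
    using eq by eventually_elim auto
  with \<open>\<eta> > 0\<close> show "\<exists>a>0. \<exists>b>0. \<forall>\<^sub>F n in sequentially. AE \<omega> in M n. \<eta> < \<bar>Z n \<omega>\<bar> \<longrightarrow> a < \<bar>X n \<omega>\<bar> \<or> b < \<bar>X n \<omega>\<bar>"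
    by blast
qed

lemma conv_prob_zero_add:
  assumes prob: "\<And>n. prob_space (M n)"
    and X: "conv_prob_zero M X" and Y: "conv_prob_zero M Y"
  shows "conv_prob_zero M (\<lambda>n \<omega>. X n \<omega> + Y n \<omega>)"
proof (rule conv_prob_zero_union_bound[OF prob X Y])
  show "(\<lambda>\<omega>. X n \<omega> + Y n \<omega>) \<in> borel_measurable (M n)" for n
    using conv_prob_zeroD(1)[OF X, of n] conv_prob_zeroD(1)[OF Y, of n] by simp
  fix \<eta> :: real assume "\<eta> > 0"
  then show "\<exists>a>0. \<exists>b>0. \<forall>\<^sub>F n in sequentially. AE \<omega> in M n.
      \<eta> < \<bar>X n \<omega> + Y n \<omega>\<bar> \<longrightarrow> a < \<bar>X n \<omega>\<bar> \<or> b < \<bar>Y n \<omega>\<bar>"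
    by (intro exI[of _ "\<eta> / 2"] conjI) (auto intro!: always_eventually AE_I2)
qed

lemma conv_prob_zero_cmult:
  assumes prob: "\<And>n. prob_space (M n)" and X: "conv_prob_zero M X"
  shows "conv_prob_zero M (\<lambda>n \<omega>. c * X n \<omega>)"
proof (rule conv_prob_zero_union_bound[OF prob X X])
  show "(\<lambda>\<omega>. c * X n \<omega>) \<in> borel_measurable (M n)" for n
    using conv_prob_zeroD(1)[OF X, of n] by simp
  fix \<eta> :: real assume "\<eta> > 0"
  have "\<eta> / (\<bar>c\<bar> + 1) < \<bar>x\<bar>" if "\<eta> < \<bar>c * x\<bar>" for x :: real
  proof -
    have "\<eta> < (\<bar>c\<bar> + 1) * \<bar>x\<bar>"
      using that by (simp add: abs_mult algebra_simps)
    then show ?thesis by (simp add: field_simps)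
  qed
  then show "\<exists>a>0. \<exists>b>0. \<forall>\<^sub>F n in sequentially. AE \<omega> in M n.
      \<eta> < \<bar>c * X n \<omega>\<bar> \<longrightarrow> a < \<bar>X n \<omega>\<bar> \<or> b < \<bar>X n \<omega>\<bar>"
    using \<open>\<eta> > 0\<close> by (intro exI[of _ "\<eta> / (\<bar>c\<bar> + 1)"] conjI) (auto intro!: always_eventually AE_I2)
qed

text \<open>A factor with bounded second moments is tight by Chebyshev's inequality, hence cannot
  offset a factor that vanishes in probability.\<close>

lemma conv_prob_zero_mult_bounded_second_moment:
  assumes prob: "\<And>n. prob_space (M n)"
    and X: "conv_prob_zero M X"
    and Y: "\<And>n. Y n \<in> borel_measurable (M n)"
    and Y2: "\<And>n. integrable (M n) (\<lambda>\<omega>. (Y n \<omega>)\<^sup>2)" "\<And>n. (LINT \<omega>|M n. (Y n \<omega>)\<^sup>2) \<le> C"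
  shows "conv_prob_zero M (\<lambda>n \<omega>. X n \<omega> * Y n \<omega>)"
  unfolding conv_prob_zero_def
proof (intro conjI allI impI)
  show "(\<lambda>\<omega>. X n \<omega> * Y n \<omega>) \<in> borel_measurable (M n)" for n
    using conv_prob_zeroD(1)[OF X, of n] Y[of n] by simp
  fix \<eta> :: real assume \<eta>: "\<eta> > 0"
  have C0: "0 \<le> C" using Y2(2)[of 0] by (rule order.trans[rotated]) simp
  show "(\<lambda>n. measure (M n) {\<omega> \<in> space (M n). \<eta> < \<bar>X n \<omega> * Y n \<omega>\<bar>}) \<longlonglongrightarrow> 0"
  proof (rule tendstoI)
    fix e :: real assume e: "e > 0"
    \<comment> \<open>Makes Chebyshev's bound \<open>C / K^2\<close> at most \<open>e / 2\<close>;
      the added 1 keeps \<open>K\<close> positive when \<open>C = 0\<close>.\<close>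
    define K where "K = sqrt (2 * (C + 1) / e)"
    have K: "K > 0" "K\<^sup>2 = 2 * (C + 1) / e" using e C0 by (auto simp: K_def)
    have "\<forall>\<^sub>F n in sequentially. measure (M n) {\<omega> \<in> space (M n). \<eta> / K < \<bar>X n \<omega>\<bar>} < e / 2"
      using order_tendstoD(2)[OF conv_prob_zeroD(2)[OF X, of "\<eta> / K"], of "e / 2"] e K \<eta> by simp
    then show "\<forall>\<^sub>F n in sequentially. dist (measure (M n) {\<omega> \<in> space (M n). \<eta> < \<bar>X n \<omega> * Y n \<omega>\<bar>}) 0 < e"
    proof eventually_elim
      case (elim n)
      interpret prob_space "M n" by (rule prob)
      note [measurable] = conv_prob_zeroD(1)[OF X, of n] Y[of n]
      have sub: "\<eta> / K < \<bar>x\<bar> \<or> K \<le> \<bar>y\<bar>" if "\<eta> < \<bar>x * y\<bar>" for x y :: real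
      proof (rule ccontr)
        assume "\<not> ?thesis"
        then have "\<bar>x\<bar> * \<bar>y\<bar> \<le> (\<eta> / K) * K"
          using K \<eta> by (intro mult_mono) auto
        with that K show False by (simp add: abs_mult)
      qed
      have "prob {\<omega> \<in> space (M n). \<eta> < \<bar>X n \<omega> * Y n \<omega>\<bar>} \<le>
          prob ({\<omega> \<in> space (M n). \<eta> / K < \<bar>X n \<omega>\<bar>} \<union> {\<omega> \<in> space (M n). K \<le> \<bar>Y n \<omega>\<bar>})"
        by (rule finite_measure_mono) (use sub in auto)
      also have "\<dots> \<le> prob {\<omega> \<in> space (M n). \<eta> / K < \<bar>X n \<omega>\<bar>} + prob {\<omega> \<in> space (M n). K \<le> \<bar>Y n \<omega>\<bar>}"
        by (rule measure_Un_le) auto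
      also have "prob {\<omega> \<in> space (M n). K \<le> \<bar>Y n \<omega>\<bar>} \<le> C / K\<^sup>2"
      proof -
        have "prob {\<omega> \<in> space (M n). K \<le> \<bar>Y n \<omega>\<bar>} \<le> (LINT \<omega>|M n. (Y n \<omega>)\<^sup>2) / K\<^sup>2"
          using second_moment_method[OF _ Y2(1)[of n] K(1)] by simp
        also have "\<dots> \<le> C / K\<^sup>2" by (intro divide_right_mono Y2) simp
        finally show ?thesis .
      qed
      also have "C / K\<^sup>2 \<le> e / 2"
        using C0 e by (simp add: K field_simps)
      finally show ?case using elim by simp
    qed
  qed
qed

lemma conv_prob_zeroI_second_moment:
  assumes prob: "\<And>n. prob_space (M n)"
    and X: "\<And>n. X n \<in> borel_measurable (M n)"
    and A: "\<And>n. A n \<in> sets (M n)"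
    and PA: "(\<lambda>n. measure (M n) (space (M n) - A n)) \<longlonglongrightarrow> 0"
    and int: "\<forall>\<^sub>F n in sequentially. integrable (M n) (\<lambda>\<omega>. indicator (A n) \<omega> * (X n \<omega>)\<^sup>2)"
    and bound: "\<forall>\<^sub>F n in sequentially. (LINT \<omega>|M n. indicator (A n) \<omega> * (X n \<omega>)\<^sup>2) \<le> b n"
    and b: "b \<longlonglongrightarrow> 0"
  shows "conv_prob_zero M X"
  unfolding conv_prob_zero_def
proof (intro conjI allI impI X)
  fix \<eta> :: real assume \<eta>: "\<eta> > 0"
  have lim: "(\<lambda>n. measure (M n) (space (M n) - A n) + b n / \<eta>\<^sup>2) \<longlonglongrightarrow> 0"
    using tendsto_add[OF PA tendsto_divide[OF b tendsto_const]] \<eta> by simp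
  show "(\<lambda>n. measure (M n) {\<omega> \<in> space (M n). \<eta> < \<bar>X n \<omega>\<bar>}) \<longlonglongrightarrow> 0"
  proof (rule tendsto_sandwich[OF _ _ tendsto_const lim])
    show "\<forall>\<^sub>F n in sequentially. measure (M n) {\<omega> \<in> space (M n). \<eta> < \<bar>X n \<omega>\<bar>}
        \<le> measure (M n) (space (M n) - A n) + b n / \<eta>\<^sup>2"
      using int bound
    proof eventually_elim
      case (elim n)
      interpret prob_space "M n" by (rule prob)
      note [measurable] = X[of n] A[of n]
      let ?Y = "\<lambda>\<omega>. indicator (A n) \<omega> * X n \<omega>"
      have sq: "(?Y \<omega>)\<^sup>2 = indicator (A n) \<omega> * (X n \<omega>)\<^sup>2" for \<omega>
        by (simp add: indicator_def)
      have "prob {\<omega> \<in> space (M n). \<eta> < \<bar>X n \<omega>\<bar>} \<le>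
          prob ((space (M n) - A n) \<union> {\<omega> \<in> space (M n). \<eta> \<le> \<bar>?Y \<omega>\<bar>})"
        by (rule finite_measure_mono) (auto simp: indicator_def)
      also have "\<dots> \<le> prob (space (M n) - A n) + prob {\<omega> \<in> space (M n). \<eta> \<le> \<bar>?Y \<omega>\<bar>}"
        by (rule measure_Un_le) auto
      also have "prob {\<omega> \<in> space (M n). \<eta> \<le> \<bar>?Y \<omega>\<bar>} \<le> (LINT \<omega>|M n. (?Y \<omega>)\<^sup>2) / \<eta>\<^sup>2"
        using second_moment_method[of ?Y \<eta>] elim(1) \<eta> unfolding sq by simp
      also have "\<dots> \<le> b n / \<eta>\<^sup>2"
        using elim(2) unfolding sq by (intro divide_right_mono) simp_all
      finally show ?case by simp
    qed
  qed auto
qed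

section \<open>Bernoulli designs on a fixed graph\<close>

locale bernoulli_design =
  fixes n :: nat and p :: real
  assumes p_range: "0 < p" "p < 1"
begin

text \<open>Assignments are total functions with the default \<open>False\<close> from
  \<open>n\<close> on, so the support is finite and every expectation is a finite sum.\<close>

definition design :: "(nat \<Rightarrow> bool) pmf" where
  "design = Pi_pmf {..<n} False (\<lambda>_. bernoulli_pmf p)"

abbreviation EW :: "((nat \<Rightarrow> bool) \<Rightarrow> real) \<Rightarrow> real" where
  "EW F \<equiv> measure_pmf.expectation design F"

definition eps :: "nat \<Rightarrow> (nat \<Rightarrow> bool) \<Rightarrow> real" where
  "eps i w = of_bool (w i) - p"

lemma finite_set_design: "finite (set_pmf design)"
  unfolding design_def by (subst set_Pi_pmf) (auto intro!: finite_PiE_dflt)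

lemma integrable_design [simp, intro]: "integrable (measure_pmf design) (F :: _ \<Rightarrow> real)"
  by (rule integrable_measure_pmf_finite) (rule finite_set_design)

lemma EW_mono: "(\<And>w. F w \<le> F' w) \<Longrightarrow> EW F \<le> EW F'"
  by (rule integral_mono) auto

lemma EW_abs: "\<bar>EW F\<bar> \<le> EW (\<lambda>w. \<bar>F w\<bar>)"
  by (rule integral_abs_bound)

text \<open>Redrawing one treatment does not change the law. The moment computations of this section
  all rest on this identity.\<close>

lemma EW_resample:
  assumes "k < n"
  shows "EW F = EW (\<lambda>w. p * F (w(k := True)) + (1 - p) * F (w(k := False)))"
proof -
  define J where "J = {..<n} - {k}"
  define PJ where "PJ = Pi_pmf J False (\<lambda>_. bernoulli_pmf p)"
  have J: "finite J" "k \<notin> J" "{..<n} = insert k J" using assms by (auto simp: J_def)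
  have fin: "finite (set_pmf PJ)"
    unfolding PJ_def using J(1) by (subst set_Pi_pmf) (auto intro!: finite_PiE_dflt)
  have int: "integrable (measure_pmf PJ) (H :: _ \<Rightarrow> real)" for H
    by (rule integrable_measure_pmf_finite) (rule fin)
  have eq: "EW H = measure_pmf.expectation PJ (\<lambda>f. p * H (f(k := True)) + (1 - p) * H (f(k := False)))" for H
  proof -
    have "design = bind_pmf (bernoulli_pmf p) (\<lambda>y. map_pmf (\<lambda>f. f(k := y)) PJ)"
      unfolding design_def J(3) PJ_def using J(1,2) by (simp add: Pi_pmf_insert' map_pmf_def)
    then have "EW H = (\<Sum>a\<in>UNIV. pmf (bernoulli_pmf p) a *\<^sub>R
        measure_pmf.expectation (map_pmf (\<lambda>f. f(k := a)) PJ) H)"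
      by (simp only:) (rule pmf_expectation_bind, auto simp: fin)
    then show ?thesis
      using p_range int by (simp add: UNIV_bool)
  qed
  \<comment> \<open>The averaged function ignores coordinate \<open>k\<close>, so both sides reduce
    to the same expectation over the other coordinates.\<close>
  show ?thesis
    unfolding eq[of F] eq[of "\<lambda>w. p * F (w(k := True)) + (1 - p) * F (w(k := False))"]
    by (simp add: algebra_simps)
qed

lemma EW_eps_mult_eq_0:
  assumes "k < n" and "\<And>w b. F (w(k := b)) = F w"
  shows "EW (\<lambda>w. eps k w * F w) = 0"
  by (subst EW_resample[OF assms(1)]) (simp add: assms(2) eps_def algebra_simps)

lemma EW_eps_eps:
  assumes "j < n" "k < n"
  shows "EW (\<lambda>w. eps j w * eps k w) = (if j = k then p * (1 - p) else 0)"
proof (cases "j = k")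
  case True
  have "EW (\<lambda>w. eps k w * eps k w) = EW (\<lambda>w. p * (1 - p))"
    by (subst EW_resample[OF assms(2)]) (simp add: eps_def algebra_simps)
  with True show ?thesis by simp
next
  case False
  with EW_eps_mult_eq_0[OF assms(1), of "eps k"] show ?thesis by (simp add: eps_def)
qed

lemma EW_linear_eq_0:
  assumes "J \<subseteq> {..<n}"
  shows "EW (\<lambda>w. \<Sum>j\<in>J. c j * eps j w) = 0"
proof -
  have "EW (eps j) = 0" if "j < n" for j
    using EW_eps_mult_eq_0[OF that, of "\<lambda>_. 1"] by simp
  then show ?thesis using assms by (auto intro!: sum.neutral)
qed

lemma EW_linear_sq:
  assumes "J \<subseteq> {..<n}"
  shows "EW (\<lambda>w. (\<Sum>j\<in>J. c j * eps j w)\<^sup>2) = p * (1 - p) * (\<Sum>j\<in>J. (c j)\<^sup>2)"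
proof -
  have fin: "finite J" using assms finite_subset by blast
  have "EW (\<lambda>w. (\<Sum>j\<in>J. c j * eps j w)\<^sup>2) = EW (\<lambda>w. \<Sum>j\<in>J. \<Sum>k\<in>J. c j * c k * (eps j w * eps k w))"
    by (simp add: power2_eq_square sum_product mult_ac)
  also have "\<dots> = (\<Sum>j\<in>J. \<Sum>k\<in>J. c j * c k * EW (\<lambda>w. eps j w * eps k w))"
    by simp
  also have "\<dots> = (\<Sum>j\<in>J. \<Sum>k\<in>J. if k = j then c j * c k * (p * (1 - p)) else 0)"
    using assms by (intro sum.cong refl) (auto simp: EW_eps_eps subset_iff)
  also have "\<dots> = p * (1 - p) * (\<Sum>j\<in>J. (c j)\<^sup>2)"
    using fin by (simp add: sum.delta sum_distrib_left power2_eq_square mult_ac)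
  finally show ?thesis .
qed

text \<open>Induction over the coordinates. Averaging out coordinate \<open>k\<close> splits the
  second moment exactly into that of the average \<open>F'\<close> and a multiple of the squared
  difference in direction \<open>k\<close>; by Jensen's inequality the other differences of
  \<open>F'\<close> are in mean square no larger than those of \<open>F\<close>.\<close>

lemma efron_stein_aux:
  assumes "finite J"
  shows "J \<subseteq> {..<n} \<Longrightarrow> (\<And>w w'. (\<And>j. j \<in> J \<Longrightarrow> w j = w' j) \<Longrightarrow> F w = F w') \<Longrightarrow>
    EW (\<lambda>w. (F w)\<^sup>2) - (EW F)\<^sup>2 \<le>
      (\<Sum>k\<in>J. p * (1 - p) * EW (\<lambda>w. (F (w(k := True)) - F (w(k := False)))\<^sup>2))"
  using assms
proof (induction J arbitrary: F rule: finite_induct)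
  case empty
  then have "F = (\<lambda>_. F undefined)" by blast
  then obtain c where "F = (\<lambda>_. c)" by blast
  then show ?case by simp
next
  case (insert k J)
  define F' where "F' = (\<lambda>w. p * F (w(k := True)) + (1 - p) * F (w(k := False)))"
  define dF where "dF l H w = (H (w(l := True)) - H (w(l := False)))" for l :: nat and H :: "_ \<Rightarrow> real" and w
  have k: "k < n" using insert.prems(1) by auto
  have dep': "F' w = F' w'" if "\<And>j. j \<in> J \<Longrightarrow> w j = w' j" for w w'
  proof -
    have "F (w(k := b)) = F (w'(k := b))" for b
      by (rule insert.prems(2)) (use that in auto)
    then show ?thesis by (simp add: F'_def)
  qed
  have IH: "EW (\<lambda>w. (F' w)\<^sup>2) - (EW F')\<^sup>2 \<le> (\<Sum>l\<in>J. p * (1 - p) * EW (\<lambda>w. (dF l F' w)\<^sup>2))"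
    unfolding dF_def by (rule insert.IH[of F', OF _ dep']) (use insert.prems(1) in auto)
  have EF: "EW F = EW F'"
    unfolding F'_def by (rule EW_resample[OF k])
  have "EW (\<lambda>w. (F w)\<^sup>2) = EW (\<lambda>w. (F' w)\<^sup>2 + p * (1 - p) * (dF k F w)\<^sup>2)"
    by (subst EW_resample[OF k], intro Bochner_Integration.integral_cong refl)
       (simp add: F'_def dF_def power2_eq_square algebra_simps)
  also have "\<dots> = EW (\<lambda>w. (F' w)\<^sup>2) + p * (1 - p) * EW (\<lambda>w. (dF k F w)\<^sup>2)"
    by simp
  finally have EF2: "EW (\<lambda>w. (F w)\<^sup>2) = EW (\<lambda>w. (F' w)\<^sup>2) + p * (1 - p) * EW (\<lambda>w. (dF k F w)\<^sup>2)" .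
  \<comment> \<open>Taking the difference at \<open>l\<close> and averaging at \<open>k\<close>
    commute for \<open>l \<noteq> k\<close>, and the square of an average is at most the average of
    the squares.\<close>
  have le: "EW (\<lambda>w. (dF l F' w)\<^sup>2) \<le> EW (\<lambda>w. (dF l F w)\<^sup>2)" if "l \<in> J" for l
  proof -
    have "l \<noteq> k" using that insert.hyps by auto
    have "(dF l F' w)\<^sup>2 \<le> p * (dF l F (w(k := True)))\<^sup>2 + (1 - p) * (dF l F (w(k := False)))\<^sup>2" for w
    proof -
      have "dF l F' w = p * dF l F (w(k := True)) + (1 - p) * dF l F (w(k := False))"
      proof -
        have "w(l := a, k := b) = w(k := b, l := a)" for a b
          using \<open>l \<noteq> k\<close> by (rule fun_upd_twist)
        then show ?thesis by (simp add: dF_def F'_def algebra_simps)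
      qed
      moreover have "(p * a + (1 - p) * b)\<^sup>2 \<le> p * a\<^sup>2 + (1 - p) * b\<^sup>2" for a b :: real
      proof -
        have "p * a\<^sup>2 + (1 - p) * b\<^sup>2 - (p * a + (1 - p) * b)\<^sup>2 = p * (1 - p) * (a - b)\<^sup>2"
          by (simp add: power2_eq_square algebra_simps)
        also have "\<dots> \<ge> 0" using p_range by simp
        finally show ?thesis by simp
      qed
      ultimately show ?thesis by simp
    qed
    then have "EW (\<lambda>w. (dF l F' w)\<^sup>2) \<le>
        EW (\<lambda>w. p * (dF l F (w(k := True)))\<^sup>2 + (1 - p) * (dF l F (w(k := False)))\<^sup>2)"
      by (rule EW_mono)
    also have "\<dots> = EW (\<lambda>w. (dF l F w)\<^sup>2)"
      by (rule EW_resample[OF k, symmetric])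
    finally show ?thesis .
  qed
  have "(\<Sum>l\<in>J. p * (1 - p) * EW (\<lambda>w. (dF l F' w)\<^sup>2)) \<le> (\<Sum>l\<in>J. p * (1 - p) * EW (\<lambda>w. (dF l F w)\<^sup>2))"
    using p_range le by (intro sum_mono mult_left_mono) auto
  moreover have "(\<Sum>l\<in>insert k J. p * (1 - p) * EW (\<lambda>w. (dF l F w)\<^sup>2)) =
      p * (1 - p) * EW (\<lambda>w. (dF k F w)\<^sup>2) + (\<Sum>l\<in>J. p * (1 - p) * EW (\<lambda>w. (dF l F w)\<^sup>2))"
    by (rule sum.insert) (fact insert.hyps)+
  ultimately have "EW (\<lambda>w. (F w)\<^sup>2) - (EW F)\<^sup>2 \<le> (\<Sum>l\<in>insert k J. p * (1 - p) * EW (\<lambda>w. (dF l F w)\<^sup>2))"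
    unfolding EF EF2 using IH by linarith
  then show ?case unfolding dF_def .
qed

lemma efron_stein:
  assumes "\<And>w w'. (\<And>j. j < n \<Longrightarrow> w j = w' j) \<Longrightarrow> F w = F w'"
  shows "EW (\<lambda>w. (F w - EW F)\<^sup>2) \<le> (\<Sum>k<n. EW (\<lambda>w. (F (w(k := True)) - F (w(k := False)))\<^sup>2))"
proof -
  have "EW (\<lambda>w. (F w - EW F)\<^sup>2) = EW (\<lambda>w. (F w)\<^sup>2 - 2 * EW F * F w + (EW F)\<^sup>2)"
    by (intro Bochner_Integration.integral_cong refl) (simp add: power2_eq_square algebra_simps)
  also have "\<dots> = EW (\<lambda>w. (F w)\<^sup>2) - (EW F)\<^sup>2"
    by (simp add: power2_eq_square)
  also have "\<dots> \<le> (\<Sum>k\<in>{..<n}. p * (1 - p) * EW (\<lambda>w. (F (w(k := True)) - F (w(k := False)))\<^sup>2))"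
    by (rule efron_stein_aux[OF finite_lessThan subset_refl assms]) simp
  also have "\<dots> \<le> (\<Sum>k\<in>{..<n}. 1 * EW (\<lambda>w. (F (w(k := True)) - F (w(k := False)))\<^sup>2))"
    using p_range by (intro sum_mono mult_right_mono mult_le_one) auto
  finally show ?thesis by simp
qed

end

section \<open>Exposures on a fixed graph with positive degrees\<close>

definition deg :: "nat \<Rightarrow> (nat \<Rightarrow> nat \<Rightarrow> bool) \<Rightarrow> nat \<Rightarrow> real" where
  "deg n e i = (\<Sum>j\<in>{..<n} - {i}. of_bool (e i j))"

definition frac_treated :: "nat \<Rightarrow> (nat \<Rightarrow> nat \<Rightarrow> bool) \<Rightarrow> nat \<Rightarrow> (nat \<Rightarrow> bool) \<Rightarrow> real" where
  "frac_treated n e i w = (\<Sum>j\<in>{..<n} - {i}. of_bool (e i j) * of_bool (w j)) / deg n e i"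

lemma of_bool_divide_sq: "(of_bool b / c)\<^sup>2 = of_bool b / (c :: real)\<^sup>2"
  by (cases b) (simp_all add: power_divide)

lemma deg_nonneg: "0 \<le> deg n e i"
  by (simp add: deg_def sum_nonneg)

lemma frac_treated_range: "frac_treated n e i w \<in> {0..1}"
proof -
  have "(\<Sum>j\<in>{..<n} - {i}. of_bool (e i j) * of_bool (w j)) \<le> deg n e i"
    unfolding deg_def by (intro sum_mono) auto
  then show ?thesis
    by (auto simp: frac_treated_def divide_le_eq_1 deg_nonneg less_le intro!: divide_nonneg_nonneg sum_nonneg)
qed

lemma frac_treated_cong:
  "(\<And>j. j < n \<Longrightarrow> j \<noteq> i \<Longrightarrow> w j = w' j) \<Longrightarrow> frac_treated n e i w = frac_treated n e i w'"
  unfolding frac_treated_def by (intro arg_cong2[where f = "(/)"] sum.cong) auto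

lemma frac_treated_upd_self [simp]: "frac_treated n e i (w(i := b)) = frac_treated n e i w"
  by (rule frac_treated_cong) auto

locale bernoulli_design_graph = bernoulli_design +
  fixes e :: "nat \<Rightarrow> nat \<Rightarrow> bool"
  assumes e_sym: "\<And>i j. i < n \<Longrightarrow> j < n \<Longrightarrow> e i j = e j i"
    and e_irrefl: "\<And>i. i < n \<Longrightarrow> \<not> e i i"
    and deg_pos: "\<And>i. i < n \<Longrightarrow> 0 < deg n e i"
begin

abbreviation N :: "nat \<Rightarrow> real" where "N \<equiv> deg n e"
abbreviation X :: "nat \<Rightarrow> (nat \<Rightarrow> bool) \<Rightarrow> real" where "X \<equiv> frac_treated n e"

lemma deg_ge_1: "i < n \<Longrightarrow> 1 \<le> N i"
proof -
  assume "i < n"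
  have "N i = real (card (({..<n} - {i}) \<inter> Collect (e i)))"
    by (simp add: deg_def)
  then obtain m :: nat where "N i = real m" by blast
  with deg_pos[OF \<open>i < n\<close>] show ?thesis by (simp add: Suc_leI)
qed

lemma deg_eq_sum: "i < n \<Longrightarrow> N i = (\<Sum>j<n. of_bool (e i j))"
  unfolding deg_def by (rule sum.mono_neutral_left) (use e_irrefl in auto)

lemma X_diff:
  assumes "i < n" "k < n"
  shows "X i (w(k := True)) - X i (w(k := False)) = of_bool (e i k) / N i"
proof (cases "k = i")
  case True
  then show ?thesis using e_irrefl[OF assms(1)] by simp
next
  case False
  have "(\<Sum>j\<in>{..<n} - {i}. of_bool (e i j) * of_bool ((w(k := True)) j)) -
      (\<Sum>j\<in>{..<n} - {i}. of_bool (e i j) * of_bool ((w(k := False)) j)) =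
      (\<Sum>j\<in>{..<n} - {i}. if j = k then of_bool (e i k) else 0 :: real)"
    unfolding sum_subtractf[symmetric] by (intro sum.cong) auto
  also have "\<dots> = of_bool (e i k)"
    using False assms by (simp add: sum.delta)
  finally show ?thesis
    by (simp add: frac_treated_def flip: diff_divide_distrib)
qed

lemma X_upd_dist:
  assumes "i < n" "k < n"
  shows "\<bar>X i (w(k := b)) - X i w\<bar> \<le> of_bool (e i k) / N i"
proof -
  have "0 \<le> of_bool (e i k) / N i" by (simp add: deg_nonneg)
  then have "\<bar>X i (w(k := b)) - X i (w(k := c))\<bar> \<le> of_bool (e i k) / N i" for c
    using X_diff[OF assms, of w] by (cases b; cases c; simp only:; linarith)
  from this[of "w k"] show ?thesis by simp
qed

lemma X_centred:
  assumes "i < n"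
  shows "X i w - p = (\<Sum>j\<in>{..<n} - {i}. (of_bool (e i j) / N i) * eps j w)"
proof -
  have "(\<Sum>j\<in>{..<n} - {i}. (of_bool (e i j) / N i) * eps j w) =
      (\<Sum>j\<in>{..<n} - {i}. of_bool (e i j) * of_bool (w j) / N i - p / N i * of_bool (e i j))"
    by (intro sum.cong) (auto simp: eps_def diff_divide_distrib)
  also have "\<dots> = X i w - p / N i * N i"
    by (simp only: sum_subtractf flip: sum_divide_distrib sum_distrib_left frac_treated_def deg_def)
  also have "\<dots> = X i w - p"
    using deg_pos[OF assms] by simp
  finally show ?thesis ..
qed

lemma EW_X_centred: "i < n \<Longrightarrow> EW (\<lambda>w. X i w - p) = 0"
  unfolding X_centred by (rule EW_linear_eq_0) auto

lemma EW_X_sq: "i < n \<Longrightarrow> EW (\<lambda>w. (X i w - p)\<^sup>2) \<le> 1 / N i"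
proof -
  assume i: "i < n"
  have "EW (\<lambda>w. (X i w - p)\<^sup>2) = p * (1 - p) * (\<Sum>j\<in>{..<n} - {i}. (of_bool (e i j) / N i)\<^sup>2)"
    unfolding X_centred[OF i] by (rule EW_linear_sq) auto
  also have "(\<Sum>j\<in>{..<n} - {i}. (of_bool (e i j) / N i)\<^sup>2) = N i / (N i)\<^sup>2"
    by (simp only: of_bool_divide_sq flip: sum_divide_distrib deg_def)
  also have "\<dots> = 1 / N i"
    using deg_pos[OF i] by (simp add: power2_eq_square)
  also have "p * (1 - p) * (1 / N i) \<le> 1 * (1 / N i)"
    using p_range deg_pos[OF i] by (intro mult_right_mono mult_le_one) auto
  finally show ?thesis by simp
qed

text \<open>Unit \<open>i\<close> carries the weight \<open>1 / (N i)^2\<close> once for each of its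
  \<open>N i\<close> neighbours.\<close>

lemma sum_edges_inverse_square: "(\<Sum>i<n. \<Sum>k<n. of_bool (e i k) / (N i)\<^sup>2) = (\<Sum>i<n. 1 / N i)"
proof (intro sum.cong refl)
  fix i assume "i \<in> {..<n}"
  then have i: "i < n" by simp
  have "(\<Sum>k<n. of_bool (e i k) / (N i)\<^sup>2) = N i / (N i)\<^sup>2"
    by (simp add: deg_eq_sum[OF i] flip: sum_divide_distrib)
  then show "(\<Sum>k<n. of_bool (e i k) / (N i)\<^sup>2) = 1 / N i"
    using deg_pos[OF i] by (simp add: power2_eq_square)
qed

text \<open>
  Resampling \<open>w\<^sub>i\<close> and \<open>w\<^sub>k\<close> turns the cross term of \<open>i \<noteq> k\<close> into a product of two discrete
  derivatives, each of which is at most \<open>L / N\<close> and vanishes unless \<open>i\<close> and \<open>k\<close> are adjacent.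
\<close>

lemma EW_eps_lipschitz_sq:
  assumes lip: "\<And>i x y. i < n \<Longrightarrow> x \<in> {0..1} \<Longrightarrow> y \<in> {0..1} \<Longrightarrow> \<bar>h i x - h i y\<bar> \<le> L * \<bar>x - y\<bar>"
    and zero: "\<And>i. i < n \<Longrightarrow> h i p = 0"
  shows "EW (\<lambda>w. (\<Sum>i<n. eps i w * h i (X i w))\<^sup>2) \<le> 2 * L\<^sup>2 * (\<Sum>i<n. 1 / N i)"
proof -
  have p01: "p \<in> {0..1}" using p_range by simp
  define T where "T i k = EW (\<lambda>w. (eps i w * h i (X i w)) * (eps k w * h k (X k w)))" for i k
  have pp: "0 \<le> p * (1 - p)" "p * (1 - p) \<le> 1"
    using p_range by (auto intro: mult_le_one)
  have diag: "T i i \<le> L\<^sup>2 * (1 / N i)" if i: "i < n" for i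
  proof -
    have "T i i \<le> EW (\<lambda>w. L\<^sup>2 * (X i w - p)\<^sup>2)"
      unfolding T_def
    proof (rule EW_mono)
      fix w
      have "\<bar>h i (X i w)\<bar> \<le> L * \<bar>X i w - p\<bar>"
        using lip[OF i frac_treated_range p01] zero[OF i] by simp
      then have "\<bar>h i (X i w)\<bar>\<^sup>2 \<le> (L * \<bar>X i w - p\<bar>)\<^sup>2" by (intro power_mono) auto
      moreover have "\<bar>eps i w\<bar>\<^sup>2 \<le> 1\<^sup>2" using p_range by (intro power_mono) (auto simp: eps_def)
      ultimately have "(eps i w)\<^sup>2 * (h i (X i w))\<^sup>2 \<le> 1 * (L\<^sup>2 * (X i w - p)\<^sup>2)"
        by (intro mult_mono) (auto simp: power_mult_distrib)
      then show "(eps i w * h i (X i w)) * (eps i w * h i (X i w)) \<le> L\<^sup>2 * (X i w - p)\<^sup>2"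
        by (simp add: power2_eq_square mult_ac)
    qed
    also have "\<dots> \<le> L\<^sup>2 * (1 / N i)"
      using EW_X_sq[OF i] by (simp add: mult_left_mono del: times_divide_eq_right)
    finally show ?thesis .
  qed
  have off: "T i k \<le> L\<^sup>2 * (of_bool (e i k) / (N i)\<^sup>2 / 2 + of_bool (e k i) / (N k)\<^sup>2 / 2)"
    if i: "i < n" and k: "k < n" and "i \<noteq> k" for i k
  proof -
    define dh where "dh i k w = h i (X i (w(k := True))) - h i (X i (w(k := False)))" for i k w
    have dh: "\<bar>dh i k w\<bar> \<le> L * (of_bool (e i k) / N i)" if "i < n" "k < n" for i k w
    proof -
      have "\<bar>dh i k w\<bar> \<le> L * \<bar>X i (w(k := True)) - X i (w(k := False))\<bar>"
        unfolding dh_def by (intro lip that frac_treated_range)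
      then show ?thesis
        unfolding X_diff[OF that] using deg_nonneg[of n e i] by simp
    qed
    have twist: "w(i := a, k := b) = w(k := b, i := a)" for w :: "nat \<Rightarrow> bool" and a b
      using \<open>i \<noteq> k\<close> by (rule fun_upd_twist)
    have Xk: "X k (w(i := a, k := b)) = X k (w(i := a))" for w a b
      by simp
    have Xi: "X i (w(i := a, k := b)) = X i (w(k := b))" for w a b
      unfolding twist by simp
    \<comment> \<open>An exposure ignores the unit's own treatment. Hence averaging over
      \<open>w i\<close> and \<open>w k\<close> leaves only the change of the exposure of
      \<open>i\<close> caused by \<open>w k\<close> and that of \<open>k\<close> caused by
      \<open>w i\<close>.\<close>
    have "T i k = EW (\<lambda>w. (p * (1 - p) * dh i k w) * (p * (1 - p) * dh k i w))"
      unfolding T_def using \<open>i \<noteq> k\<close>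
      by (subst EW_resample[OF k], subst EW_resample[OF i], intro Bochner_Integration.integral_cong refl)
        (simp add: eps_def Xi Xk dh_def algebra_simps)
    also have "\<dots> \<le> EW (\<lambda>w. L * (of_bool (e i k) / N i) * (L * (of_bool (e k i) / N k)))"
    proof (rule EW_mono)
      fix w
      have *: "\<bar>p * (1 - p) * dh i k w\<bar> \<le> L * (of_bool (e i k) / N i)" if "i < n" "k < n" for i k
      proof -
        have "\<bar>p * (1 - p) * dh i k w\<bar> \<le> 1 * \<bar>dh i k w\<bar>"
          unfolding abs_mult[of "p * (1 - p)"] using pp by (intro mult_right_mono) auto
        with dh[OF that, of w] show ?thesis by simp
      qed
      have "(p * (1 - p) * dh i k w) * (p * (1 - p) * dh k i w) \<le>
          \<bar>p * (1 - p) * dh i k w\<bar> * \<bar>p * (1 - p) * dh k i w\<bar>"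
        by (metis abs_ge_self abs_mult)
      also have "\<dots> \<le> L * (of_bool (e i k) / N i) * (L * (of_bool (e k i) / N k))"
        by (rule mult_mono[OF *[OF i k] *[OF k i]]) (use *[OF i k] in \<open>auto intro: order.trans[OF abs_ge_zero]\<close>)
      finally show "(p * (1 - p) * dh i k w) * (p * (1 - p) * dh k i w) \<le>
          L * (of_bool (e i k) / N i) * (L * (of_bool (e k i) / N k))" .
    qed
    also have "\<dots> = L\<^sup>2 * ((of_bool (e i k) / N i) * (of_bool (e k i) / N k))"
      by (simp add: power2_eq_square)
    \<comment> \<open>The arithmetic-geometric mean inequality separates the two degrees, so that
      each half can be summed over the neighbours of the unit whose degree it contains.\<close>
    also have "\<dots> \<le> L\<^sup>2 * ((of_bool (e i k) / N i)\<^sup>2 / 2 + (of_bool (e k i) / N k)\<^sup>2 / 2)"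
    proof (rule mult_left_mono)
      show "a * b \<le> a\<^sup>2 / 2 + b\<^sup>2 / 2" for a b :: real
        using sum_squares_bound[of a b] by simp
    qed simp
    finally show ?thesis unfolding of_bool_divide_sq .
  qed
  have "T i k \<le> L\<^sup>2 * ((if k = i then 1 / N i else 0) +
      (of_bool (e i k) / (N i)\<^sup>2 / 2 + of_bool (e k i) / (N k)\<^sup>2 / 2))"
    if i: "i < n" and k: "k < n" for i k
    using diag[OF i] off[OF i k] e_irrefl[OF i] by (cases "k = i") auto
  then have "(\<Sum>i<n. \<Sum>k<n. T i k) \<le> (\<Sum>i<n. \<Sum>k<n. L\<^sup>2 * ((if k = i then 1 / N i else 0) +
      (of_bool (e i k) / (N i)\<^sup>2 / 2 + of_bool (e k i) / (N k)\<^sup>2 / 2)))"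
    by (intro sum_mono) auto
  also have "\<dots> = L\<^sup>2 * ((\<Sum>i<n. \<Sum>k<n. if k = i then 1 / N i else 0) +
      ((\<Sum>i<n. \<Sum>k<n. of_bool (e i k) / (N i)\<^sup>2) / 2 + (\<Sum>i<n. \<Sum>k<n. of_bool (e k i) / (N k)\<^sup>2) / 2))"
    by (simp only: sum.distrib sum_distrib_left sum_divide_distrib distrib_left)
  also have "(\<Sum>i<n. \<Sum>k<n. of_bool (e k i) / (N k)\<^sup>2) = (\<Sum>k<n. \<Sum>i<n. of_bool (e k i) / (N k)\<^sup>2)"
    by (rule sum.swap)
  also have "L\<^sup>2 * ((\<Sum>i<n. \<Sum>k<n. if k = i then 1 / N i else 0) +
      ((\<Sum>i<n. \<Sum>k<n. of_bool (e i k) / (N i)\<^sup>2) / 2 + (\<Sum>k<n. \<Sum>i<n. of_bool (e k i) / (N k)\<^sup>2) / 2))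
      = 2 * L\<^sup>2 * (\<Sum>i<n. 1 / N i)"
    unfolding sum_edges_inverse_square by (simp add: sum.delta)
  finally show ?thesis
    by (simp add: T_def power2_eq_square sum_product)
qed

text \<open>
  The hypothesis on \<open>q\<close> holds for the remainder of a first-order Taylor expansion at \<open>p\<close>, whose
  derivative at \<open>x\<close> is of order \<open>x - p\<close>.
\<close>

lemma EW_second_order_var:
  assumes q: "\<And>i x y. i < n \<Longrightarrow> x \<in> {0..1} \<Longrightarrow> y \<in> {0..1} \<Longrightarrow>
      \<bar>q i x - q i y\<bar> \<le> L * \<bar>x - y\<bar> * (\<bar>x - p\<bar> + \<bar>y - p\<bar>)"
    and L: "0 \<le> L"
  defines "F \<equiv> \<lambda>w. \<Sum>i<n. q i (X i w)"
  shows "EW (\<lambda>w. (F w - EW F)\<^sup>2) \<le>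
    16 * L\<^sup>2 * (\<Sum>k<n. (\<Sum>i<n. of_bool (e i k) / N i) * (\<Sum>i<n. of_bool (e i k) / (N i)\<^sup>2))"
proof -
  have "EW (\<lambda>w. (F w - EW F)\<^sup>2) \<le> (\<Sum>k<n. EW (\<lambda>w. (F (w(k := True)) - F (w(k := False)))\<^sup>2))"
  proof (rule efron_stein)
    fix w w' :: "nat \<Rightarrow> bool" assume "\<And>j. j < n \<Longrightarrow> w j = w' j"
    then have "X i w = X i w'" for i by (intro frac_treated_cong) auto
    then show "F w = F w'" by (simp add: F_def)
  qed
  also have "\<dots> \<le> (\<Sum>k<n. 16 * L\<^sup>2 * ((\<Sum>i<n. of_bool (e i k) / N i) * (\<Sum>i<n. of_bool (e i k) / (N i)\<^sup>2)))"
  proof (rule sum_mono)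
    fix k assume "k \<in> {..<n}"
    then have k: "k < n" by simp
    define c where "c i = of_bool (e i k) / N i" for i
    have c0: "0 \<le> c i" for i by (simp add: c_def deg_nonneg)
    have diff: "\<bar>F (w(k := True)) - F (w(k := False))\<bar> \<le> L * (\<Sum>i<n. c i * (2 * \<bar>X i w - p\<bar> + 2 / N i))" for w
    proof -
      have "F (w(k := True)) - F (w(k := False)) =
          (\<Sum>i<n. q i (X i (w(k := True))) - q i (X i (w(k := False))))"
        by (simp only: F_def sum_subtractf)
      then have "\<bar>F (w(k := True)) - F (w(k := False))\<bar> \<le>
          (\<Sum>i<n. \<bar>q i (X i (w(k := True))) - q i (X i (w(k := False)))\<bar>)"
        by (simp only: sum_abs)
      also have "\<dots> \<le> (\<Sum>i<n. L * (c i * (2 * \<bar>X i w - p\<bar> + 2 / N i)))"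
      proof (rule sum_mono)
        fix i assume "i \<in> {..<n}"
        then have i: "i < n" by simp
        have near: "\<bar>X i (w(k := b)) - p\<bar> \<le> \<bar>X i w - p\<bar> + 1 / N i" for b
        proof -
          have "of_bool (e i k) / N i \<le> 1 / N i"
            by (intro divide_right_mono deg_nonneg) auto
          with X_upd_dist[OF i k, of w b] show ?thesis by linarith
        qed
        have "\<bar>q i (X i (w(k := True))) - q i (X i (w(k := False)))\<bar> \<le>
            L * \<bar>X i (w(k := True)) - X i (w(k := False))\<bar> *
            (\<bar>X i (w(k := True)) - p\<bar> + \<bar>X i (w(k := False)) - p\<bar>)"
          by (intro q i frac_treated_range)
        also have "\<dots> = L * (c i * (\<bar>X i (w(k := True)) - p\<bar> + \<bar>X i (w(k := False)) - p\<bar>))"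
          unfolding X_diff[OF i k] using deg_nonneg[of n e i] by (simp add: c_def)
        also have "\<dots> \<le> L * (c i * (2 * \<bar>X i w - p\<bar> + 2 / N i))"
          using near[of True] near[of False] by (intro mult_left_mono L c0) simp
        finally show "\<bar>q i (X i (w(k := True))) - q i (X i (w(k := False)))\<bar> \<le>
            L * (c i * (2 * \<bar>X i w - p\<bar> + 2 / N i))" .
      qed
      finally show ?thesis by (simp add: sum_distrib_left)
    qed
    have "EW (\<lambda>w. (F (w(k := True)) - F (w(k := False)))\<^sup>2) \<le>
        EW (\<lambda>w. L\<^sup>2 * ((\<Sum>i<n. c i) * (\<Sum>i<n. c i * (8 * (X i w - p)\<^sup>2 + 8 / (N i)\<^sup>2))))"
    proof (rule EW_mono)
      fix w
      define y where "y i = 2 * \<bar>X i w - p\<bar> + 2 / N i" for i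
      have "(F (w(k := True)) - F (w(k := False)))\<^sup>2 \<le> (L * (\<Sum>i<n. c i * y i))\<^sup>2"
        using power_mono[OF diff[of w], of 2] by (simp add: y_def)
      \<comment> \<open>Cauchy-Schwarz with \<open>c i\<close> shared equally between the factors:
        the total weight \<open>sum c i\<close>, of order one, is split off, and only first powers
        of \<open>c i\<close> remain next to the squares.\<close>
      also have "(\<Sum>i<n. c i * y i)\<^sup>2 = (\<Sum>i<n. sqrt (c i) * (sqrt (c i) * y i))\<^sup>2"
        using c0 by (simp flip: mult.assoc)
      then have "(L * (\<Sum>i<n. c i * y i))\<^sup>2 = L\<^sup>2 * (\<Sum>i<n. sqrt (c i) * (sqrt (c i) * y i))\<^sup>2"
        by (simp add: power_mult_distrib)
      also have "\<dots> \<le> L\<^sup>2 * ((\<Sum>i<n. (sqrt (c i))\<^sup>2) * (\<Sum>i<n. (sqrt (c i) * y i)\<^sup>2))"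
        by (intro mult_left_mono Cauchy_Schwarz_ineq_sum) simp
      also have "\<dots> = L\<^sup>2 * ((\<Sum>i<n. c i) * (\<Sum>i<n. c i * (y i)\<^sup>2))"
        using c0 by (simp add: power_mult_distrib)
      also have "\<dots> \<le> L\<^sup>2 * ((\<Sum>i<n. c i) * (\<Sum>i<n. c i * (8 * (X i w - p)\<^sup>2 + 8 / (N i)\<^sup>2)))"
      proof (intro mult_left_mono sum_mono c0 sum_nonneg)
        fix i
        have "(a + b)\<^sup>2 \<le> 2 * a\<^sup>2 + 2 * b\<^sup>2" for a b :: real
          using sum_squares_bound[of a b] by (simp add: power2_sum)
        from this[of "2 * \<bar>X i w - p\<bar>" "2 / N i"]
        show "(y i)\<^sup>2 \<le> 8 * (X i w - p)\<^sup>2 + 8 / (N i)\<^sup>2"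
          by (simp add: y_def power_mult_distrib power_divide)
      qed simp
      finally show "(F (w(k := True)) - F (w(k := False)))\<^sup>2 \<le>
          L\<^sup>2 * ((\<Sum>i<n. c i) * (\<Sum>i<n. c i * (8 * (X i w - p)\<^sup>2 + 8 / (N i)\<^sup>2)))" .
    qed
    also have "\<dots> = L\<^sup>2 * ((\<Sum>i<n. c i) * (\<Sum>i<n. c i * (8 * EW (\<lambda>w. (X i w - p)\<^sup>2) + 8 / (N i)\<^sup>2)))"
      by simp
    also have "\<dots> \<le> L\<^sup>2 * ((\<Sum>i<n. c i) * (\<Sum>i<n. c i * (16 * (1 / N i))))"
    proof (intro mult_left_mono sum_mono c0 sum_nonneg)
      fix i assume "i \<in> {..<n}"
      then have i: "i < n" by simp
      \<comment> \<open>A positive degree is at least 1, so this term merges with the variance bound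
        into \<open>16 / N i\<close>.\<close>
      have "1 / (N i)\<^sup>2 \<le> 1 / N i"
        using deg_ge_1[OF i] by (simp add: power2_eq_square divide_simps)
      then show "8 * EW (\<lambda>w. (X i w - p)\<^sup>2) + 8 / (N i)\<^sup>2 \<le> 16 * (1 / N i)"
        using EW_X_sq[OF i] by simp
    qed simp
    also have "(\<Sum>i<n. c i * (16 * (1 / N i))) = 16 * (\<Sum>i<n. of_bool (e i k) / (N i)\<^sup>2)"
      by (simp add: c_def sum_distrib_left power2_eq_square mult_ac)
    also have "L\<^sup>2 * ((\<Sum>i<n. c i) * (16 * (\<Sum>i<n. of_bool (e i k) / (N i)\<^sup>2))) =
        16 * L\<^sup>2 * ((\<Sum>i<n. of_bool (e i k) / N i) * (\<Sum>i<n. of_bool (e i k) / (N i)\<^sup>2))"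
      by (simp add: c_def)
    finally show "EW (\<lambda>w. (F (w(k := True)) - F (w(k := False)))\<^sup>2) \<le>
        16 * L\<^sup>2 * ((\<Sum>i<n. of_bool (e i k) / N i) * (\<Sum>i<n. of_bool (e i k) / (N i)\<^sup>2))" .
  qed
  finally show ?thesis by (simp add: sum_distrib_left)
qed

end

section \<open>Smooth responses and potential outcomes\<close>

lemma deriv01_has_derivative:
  assumes "h differentiable_on {0..1}" "x \<in> {0..1}"
  shows "(h has_real_derivative deriv01 h x) (at x within {0..1})"
proof -
  have "h differentiable (at x within {0..1})"
    using assms by (auto simp: differentiable_on_def)
  then have "(h has_vector_derivative vector_derivative h (at x within {0..1})) (at x within {0..1})"
    by (simp add: vector_derivative_works)
  then show ?thesis
    by (simp add: deriv01_def has_real_derivative_iff_has_vector_derivative)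
qed

lemma smooth3_bounds:
  assumes "smooth3 B h" "x \<in> {0..1}"
  shows "\<bar>h x\<bar> \<le> B" "\<bar>deriv01 h x\<bar> \<le> B"
    "(h has_real_derivative deriv01 h x) (at x within {0..1})"
    "\<bar>deriv01 (deriv01 h) x\<bar> \<le> B"
    "(deriv01 h has_real_derivative deriv01 (deriv01 h) x) (at x within {0..1})"
proof -
  have D: "\<And>k. k < 3 \<Longrightarrow> (deriv01 ^^ k) h differentiable_on {0..1}"
    and Bd: "\<And>k. k \<le> 3 \<Longrightarrow> \<bar>(deriv01 ^^ k) h x\<bar> \<le> B"
    using assms by (auto simp: smooth3_def)
  show "\<bar>h x\<bar> \<le> B" "\<bar>deriv01 h x\<bar> \<le> B" "\<bar>deriv01 (deriv01 h) x\<bar> \<le> B"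
    using Bd[of 0] Bd[of 1] Bd[of 2] by (simp_all add: numeral_2_eq_2)
  show "(h has_real_derivative deriv01 h x) (at x within {0..1})"
    "(deriv01 h has_real_derivative deriv01 (deriv01 h) x) (at x within {0..1})"
    using deriv01_has_derivative[OF D[of 0] assms(2)] deriv01_has_derivative[OF D[of 1] assms(2)] by simp_all
qed

lemma smooth3_lipschitz:
  assumes "smooth3 B h" "x \<in> {0..1}" "y \<in> {0..1}"
  shows "\<bar>h x - h y\<bar> \<le> B * \<bar>x - y\<bar>" "\<bar>deriv01 h x - deriv01 h y\<bar> \<le> B * \<bar>x - y\<bar>"
proof -
  have "norm (h x - h y) \<le> B * norm (x - y)"
    by (rule field_differentiable_bound[of "{0..1}" h "deriv01 h"]) (use smooth3_bounds[OF assms(1)] assms in auto)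
  then show "\<bar>h x - h y\<bar> \<le> B * \<bar>x - y\<bar>" by simp
  have "norm (deriv01 h x - deriv01 h y) \<le> B * norm (x - y)"
    by (rule field_differentiable_bound[of "{0..1}" "deriv01 h" "deriv01 (deriv01 h)"])
      (use smooth3_bounds[OF assms(1)] assms in auto)
  then show "\<bar>deriv01 h x - deriv01 h y\<bar> \<le> B * \<bar>x - y\<bar>" by simp
qed

text \<open>The function \<open>h z - deriv01 h p * z\<close> has derivative
  \<open>deriv01 h z - deriv01 h p\<close>, which is at most \<open>B * |z - p|\<close>. The mean
  value inequality is applied on the segment from \<open>x\<close> to \<open>y\<close> only, where
  \<open>|z - p|\<close> is bounded by the sum of the distances at the end points.\<close>

lemma smooth3_taylor_remainder:
  assumes h: "smooth3 B h" and x: "x \<in> {0..1}" and y: "y \<in> {0..1}" and p: "p \<in> {0..1}"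
  shows "\<bar>(h x - deriv01 h p * x) - (h y - deriv01 h p * y)\<bar> \<le> B * \<bar>x - y\<bar> * (\<bar>x - p\<bar> + \<bar>y - p\<bar>)"
proof -
  have B0: "0 \<le> B" using smooth3_bounds(1)[OF h p] by simp
  have sub: "closed_segment x y \<subseteq> {0..1}"
    using x y by (auto simp: closed_segment_eq_real_ivl)
  have "norm ((h x - deriv01 h p * x) - (h y - deriv01 h p * y)) \<le> (B * (\<bar>x - p\<bar> + \<bar>y - p\<bar>)) * norm (x - y)"
  proof (rule field_differentiable_bound[of "closed_segment x y"])
    fix z assume z: "z \<in> closed_segment x y"
    then have z01: "z \<in> {0..1}" using sub by auto
    show "((\<lambda>x. h x - deriv01 h p * x) has_field_derivative (deriv01 h z - deriv01 h p)) (at z within closed_segment x y)"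
      by (rule DERIV_subset[OF _ sub]) (auto intro!: derivative_eq_intros smooth3_bounds(3)[OF h z01])
    have "\<bar>deriv01 h z - deriv01 h p\<bar> \<le> B * \<bar>z - p\<bar>"
      by (rule smooth3_lipschitz(2)[OF h z01 p])
    also have "\<dots> \<le> B * (\<bar>x - p\<bar> + \<bar>y - p\<bar>)"
      using z B0 by (intro mult_left_mono) (auto simp: closed_segment_eq_real_ivl split: if_splits)
    finally show "norm (deriv01 h z - deriv01 h p) \<le> B * (\<bar>x - p\<bar> + \<bar>y - p\<bar>)" by simp
  qed auto
  then show ?thesis by (simp add: mult_ac)
qed

text \<open>Responses are assumed measurable only at each fixed fraction. Since realised fractions
  are rational, evaluating a response at one of them is a countable case distinction and hence
  measurable.\<close>

lemma frac_treated_Rats: "frac_treated n e i w \<in> \<rat>"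
  unfolding frac_treated_def deg_def by (intro Rats_divide Rats_sum Rats_mult) (auto simp: of_bool_def)

definition dfun :: "unit_type \<Rightarrow> real \<Rightarrow> real" where
  "dfun z x = snd z True x - snd z False x"

definition rfun :: "real \<Rightarrow> unit_type \<Rightarrow> real \<Rightarrow> real" where
  "rfun p z x = snd z True x / p + snd z False x / (1 - p)"

definition dslope :: "real \<Rightarrow> unit_type \<Rightarrow> real" where
  "dslope p z = deriv01 (snd z True) p - deriv01 (snd z False) p"

lemma potential_outcome_eq:
  "potential_outcome n Z E i w \<omega> = snd (Z i \<omega>) (w i) (frac_treated n (\<lambda>i j. E i j \<omega>) i w)"
  by (simp add: potential_outcome_def frac_treated_def deg_def)

lemma potential_outcome_cong:
  assumes "i < n" "\<And>j. j < n \<Longrightarrow> w j = w' j"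
  shows "potential_outcome n Z E i w \<omega> = potential_outcome n Z E i w' \<omega>"
  using assms unfolding potential_outcome_eq by (simp add: frac_treated_cong[of n i w w'])

section \<open>Measurability and uniform bounds of the responses\<close>

context network_interference
begin

sublocale M: prob_space "M n" for n by (rule prob_space_M)
sublocale D: prob_space D by (rule prob_space_D)
sublocale BD: bernoulli_design n \<pi> for n by standard (rule pi_range)+

lemma pi01: "\<pi> \<in> {0..1}" using pi_range by simp

lemma space_D: "space D = {0..1} \<times> space FF"
  using sets_eq_imp_space_eq[OF sets_D] by (simp add: space_pair_measure)

lemma
  assumes "z \<in> space D"
  shows smooth_D: "smooth3 B (snd z b)" and fst_D: "fst z \<in> {0..1}"
  using assms smooth by (auto simp: space_D)

lemma snd_measurable [measurable]: "snd \<in> measurable D FF"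
  unfolding measurable_cong_sets[OF sets_D refl] by simp

lemma fst_measurable_restrict: "fst \<in> measurable D (restrict_space borel {0..1})"
  unfolding measurable_cong_sets[OF sets_D refl] by simp

lemma fst_measurable [measurable]: "fst \<in> borel_measurable D"
  using fst_measurable_restrict by (simp add: measurable_restrict_space2_iff)

lemma eval_measurable [measurable]: "x \<in> {0..1} \<Longrightarrow> (\<lambda>z. snd z b x) \<in> borel_measurable D"
  using measurable_compose[OF snd_measurable evaluation_measurable] by auto

lemma eval_pi_measurable [measurable]: "(\<lambda>z. snd z b \<pi>) \<in> borel_measurable D"
  by (rule eval_measurable[OF pi01])

text \<open>Only evaluations at fixed points are measurable by assumption. The derivative is the
  pointwise limit of difference quotients along the points \<open>\<pi> + s k\<close>, which stay
  inside \<open>{0..1}\<close> because \<open>\<pi> < 1\<close>.\<close>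

lemma deriv_pi_measurable [measurable]: "(\<lambda>z. deriv01 (snd z b) \<pi>) \<in> borel_measurable D"
proof -
  define s where "s k = (1 - \<pi>) / real (k + 2)" for k :: nat
  have s: "s k > 0" "\<pi> + s k \<in> {0..1}" for k
  proof -
    show "s k > 0" using pi_range by (simp add: s_def)
    have "s k \<le> (1 - \<pi>) / 1" unfolding s_def using pi_range by (intro divide_left_mono) auto
    then show "\<pi> + s k \<in> {0..1}" using \<open>s k > 0\<close> pi_range by simp
  qed
  have s0: "s \<longlonglongrightarrow> 0" unfolding s_def by real_asymp
  show ?thesis
  proof (rule borel_measurable_LIMSEQ_real)
    show "(\<lambda>z. (snd z b (\<pi> + s k) - snd z b \<pi>) / s k) \<in> borel_measurable D" for k
      using eval_measurable[OF s(2)[of k]] by measurable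
    fix z assume z: "z \<in> space D"
    have "((\<lambda>y. (snd z b y - snd z b \<pi>) / (y - \<pi>)) \<longlongrightarrow> deriv01 (snd z b) \<pi>) (at \<pi> within {0..1})"
      using smooth3_bounds(3)[OF smooth_D[OF z] pi01] by (simp add: has_field_derivative_iff)
    moreover have "filterlim (\<lambda>k. \<pi> + s k) (at \<pi> within {0..1}) sequentially"
      unfolding filterlim_at
    proof
      have "(\<lambda>k. \<pi> + s k) \<longlonglongrightarrow> \<pi> + 0" by (intro tendsto_add tendsto_const s0)
      then show "(\<lambda>k. \<pi> + s k) \<longlonglongrightarrow> \<pi>" by simp
      show "\<forall>\<^sub>F k in sequentially. \<pi> + s k \<in> {0..1} \<and> \<pi> + s k \<noteq> \<pi>"
        using s by (intro always_eventually) (metis add_cancel_left_right less_irrefl)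
    qed
    ultimately have "((\<lambda>y. (snd z b y - snd z b \<pi>) / (y - \<pi>)) \<circ> (\<lambda>k. \<pi> + s k)) \<longlonglongrightarrow> deriv01 (snd z b) \<pi>"
      unfolding comp_def by (rule filterlim_compose)
    then show "(\<lambda>k. (snd z b (\<pi> + s k) - snd z b \<pi>) / s k) \<longlonglongrightarrow> deriv01 (snd z b) \<pi>"
      by (simp add: comp_def)
  qed
qed

lemma dslope_measurable [measurable]: "dslope \<pi> \<in> borel_measurable D"
  unfolding dslope_def by measurable

lemma dfun_pi_measurable [measurable]: "(\<lambda>z. dfun z \<pi>) \<in> borel_measurable D"
  unfolding dfun_def by measurable

lemma rfun_pi_measurable [measurable]: "(\<lambda>z. rfun \<pi> z \<pi>) \<in> borel_measurable D"
  unfolding rfun_def by measurable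

text \<open>Serves both as a bound and as a Lipschitz constant for
  \<open>rfun \<pi> z\<close>.\<close>

definition R_const :: real where "R_const = B / \<pi> + B / (1 - \<pi>)"

lemma B_nonneg: "0 \<le> B"
proof -
  obtain z where "z \<in> space D" using D.not_empty by auto
  from smooth3_bounds(1)[OF smooth_D[OF this] pi01, of True] show ?thesis by simp
qed

lemma
  assumes z: "z \<in> space D" and x: "x \<in> {0..1}"
  shows snd_bound: "\<bar>snd z b x\<bar> \<le> B"
    and dfun_bound: "\<bar>dfun z x\<bar> \<le> 2 * B"
    and rfun_bound: "\<bar>rfun \<pi> z x\<bar> \<le> R_const"
    and dslope_bound: "\<bar>dslope \<pi> z\<bar> \<le> 2 * B"
proof -
  have b: "\<bar>snd z b x\<bar> \<le> B" for b by (rule smooth3_bounds(1)[OF smooth_D[OF z] x])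
  show "\<bar>snd z b x\<bar> \<le> B" by (rule b)
  show "\<bar>dfun z x\<bar> \<le> 2 * B" using b[of True] b[of False] by (simp add: dfun_def)
  have "\<bar>rfun \<pi> z x\<bar> \<le> \<bar>snd z True x / \<pi>\<bar> + \<bar>snd z False x / (1 - \<pi>)\<bar>"
    unfolding rfun_def by (rule abs_triangle_ineq)
  also have "\<dots> \<le> R_const"
    unfolding R_const_def abs_divide using pi_range b B_nonneg by (intro add_mono frac_le) auto
  finally show "\<bar>rfun \<pi> z x\<bar> \<le> R_const" .
  show "\<bar>dslope \<pi> z\<bar> \<le> 2 * B"
    using smooth3_bounds(2)[OF smooth_D[OF z, of True] pi01] smooth3_bounds(2)[OF smooth_D[OF z, of False] pi01]
    by (simp add: dslope_def)
qed

lemma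
  assumes z: "z \<in> space D" and x: "x \<in> {0..1}" and y: "y \<in> {0..1}"
  shows snd_lipschitz: "\<bar>snd z b x - snd z b y\<bar> \<le> B * \<bar>x - y\<bar>"
    and rfun_lipschitz: "\<bar>rfun \<pi> z x - rfun \<pi> z y\<bar> \<le> R_const * \<bar>x - y\<bar>"
    and dfun_remainder: "\<bar>(dfun z x - dslope \<pi> z * x) - (dfun z y - dslope \<pi> z * y)\<bar> \<le>
      (2 * B) * \<bar>x - y\<bar> * (\<bar>x - \<pi>\<bar> + \<bar>y - \<pi>\<bar>)"
proof -
  have l: "\<bar>snd z b x - snd z b y\<bar> \<le> B * \<bar>x - y\<bar>" for b
    by (rule smooth3_lipschitz(1)[OF smooth_D[OF z] x y])
  then show "\<bar>snd z b x - snd z b y\<bar> \<le> B * \<bar>x - y\<bar>" .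
  have "\<bar>rfun \<pi> z x - rfun \<pi> z y\<bar> = \<bar>(snd z True x - snd z True y) / \<pi> + (snd z False x - snd z False y) / (1 - \<pi>)\<bar>"
    by (simp add: rfun_def diff_divide_distrib)
  also have "\<dots> \<le> \<bar>snd z True x - snd z True y\<bar> / \<pi> + \<bar>snd z False x - snd z False y\<bar> / (1 - \<pi>)"
    using pi_range by (intro order.trans[OF abs_triangle_ineq]) (simp add: abs_divide)
  also have "\<dots> \<le> (B * \<bar>x - y\<bar>) / \<pi> + (B * \<bar>x - y\<bar>) / (1 - \<pi>)"
    using pi_range by (intro add_mono divide_right_mono l) auto
  finally show "\<bar>rfun \<pi> z x - rfun \<pi> z y\<bar> \<le> R_const * \<bar>x - y\<bar>"
    by (simp add: R_const_def distrib_right)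
  have r: "\<bar>(snd z b x - deriv01 (snd z b) \<pi> * x) - (snd z b y - deriv01 (snd z b) \<pi> * y)\<bar> \<le>
      B * \<bar>x - y\<bar> * (\<bar>x - \<pi>\<bar> + \<bar>y - \<pi>\<bar>)" for b
    by (rule smooth3_taylor_remainder[OF smooth_D[OF z] x y pi01])
  have "(dfun z x - dslope \<pi> z * x) - (dfun z y - dslope \<pi> z * y) =
      ((snd z True x - deriv01 (snd z True) \<pi> * x) - (snd z True y - deriv01 (snd z True) \<pi> * y)) -
      ((snd z False x - deriv01 (snd z False) \<pi> * x) - (snd z False y - deriv01 (snd z False) \<pi> * y))"
    by (simp add: dfun_def dslope_def algebra_simps)
  then show "\<bar>(dfun z x - dslope \<pi> z * x) - (dfun z y - dslope \<pi> z * y)\<bar> \<le>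
      (2 * B) * \<bar>x - y\<bar> * (\<bar>x - \<pi>\<bar> + \<bar>y - \<pi>\<bar>)"
    using r[of True] r[of False] by linarith
qed

section \<open>The information in the units and the graph, and that in the treatments\<close>

lemma Z_measurable [measurable]: "i < n \<Longrightarrow> Z n i \<in> measurable (M n) D"
  using Z_indep[of n] by (auto simp: M.indep_vars_def2)

lemma W_measurable [measurable]: "i < n \<Longrightarrow> W n i \<in> measurable (M n) (count_space UNIV)"
  using W_indep[of n] by (auto simp: M.indep_vars_def2)

lemma Z_space: "i < n \<Longrightarrow> \<omega> \<in> space (M n) \<Longrightarrow> Z n i \<omega> \<in> space D"
  using measurable_space[OF Z_measurable] .

abbreviation Gr :: "nat \<Rightarrow> 'a \<Rightarrow> nat \<Rightarrow> nat \<Rightarrow> bool" where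
  "Gr n \<omega> \<equiv> (\<lambda>i j. E n i j \<omega>)"

text \<open>The treatments are cut off at \<open>n\<close> because \<open>W n j\<close> is
  unconstrained for \<open>j \<ge> n\<close>, while the realised assignment has to lie in the
  support of \<open>design n\<close>.\<close>

definition wv :: "nat \<Rightarrow> 'a \<Rightarrow> nat \<Rightarrow> bool" where
  "wv n \<omega> j \<longleftrightarrow> j < n \<and> W n j \<omega>"

text \<open>The generating map is the one that occurs in the independence assumption on
  \<open>W\<close>, so independence of \<open>WW n\<close> is this assumption as it stands.\<close>

definition GG :: "nat \<Rightarrow> 'a measure" where
  "GG n = vimage_algebra (space (M n))
     (\<lambda>\<omega>. (\<lambda>i\<in>{..<n}. Z n i \<omega>, \<lambda>(i, j)\<in>{..<n} \<times> {..<n}. E n i j \<omega>))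
     (PiM {..<n} (\<lambda>_. D) \<Otimes>\<^sub>M PiM ({..<n} \<times> {..<n}) (\<lambda>_. count_space UNIV))"

definition WW :: "nat \<Rightarrow> 'a measure" where
  "WW n = vimage_algebra (space (M n)) (\<lambda>\<omega>. \<lambda>i\<in>{..<n}. W n i \<omega>) (PiM {..<n} (\<lambda>_. count_space UNIV))"

lemma indep_WW_GG: "M.indep_set n (sets (WW n)) (sets (GG n))"
  unfolding WW_def GG_def by (rule W_indep_rest)

lemma ZE_measurable:
  "(\<lambda>\<omega>. (\<lambda>i\<in>{..<n}. Z n i \<omega>, \<lambda>(i, j)\<in>{..<n} \<times> {..<n}. E n i j \<omega>)) \<in>
    measurable (M n) (PiM {..<n} (\<lambda>_. D) \<Otimes>\<^sub>M PiM ({..<n} \<times> {..<n}) (\<lambda>_. count_space UNIV))"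
proof (rule measurable_Pair)
  show "(\<lambda>\<omega>. \<lambda>i\<in>{..<n}. Z n i \<omega>) \<in> measurable (M n) (PiM {..<n} (\<lambda>_. D))"
    by (rule measurable_restrict) simp
  have "(\<lambda>\<omega>. \<lambda>x\<in>{..<n} \<times> {..<n}. E n (fst x) (snd x) \<omega>) \<in> measurable (M n) (PiM ({..<n} \<times> {..<n}) (\<lambda>_. count_space UNIV))"
    by (rule measurable_restrict) (auto intro!: E_measurable)
  then show "(\<lambda>\<omega>. \<lambda>(i, j)\<in>{..<n} \<times> {..<n}. E n i j \<omega>) \<in> measurable (M n) (PiM ({..<n} \<times> {..<n}) (\<lambda>_. count_space UNIV))"
    by (simp add: case_prod_unfold)
qed

lemma space_GG [simp]: "space (GG n) = space (M n)" by (simp add: GG_def)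
lemma space_WW [simp]: "space (WW n) = space (M n)" by (simp add: WW_def)

lemma subalgebra_GG: "subalgebra (M n) (GG n)"
  unfolding subalgebra_def
proof
  show "sets (GG n) \<subseteq> sets (M n)"
    unfolding GG_def sets_vimage_algebra using ZE_measurable[of n]
    by (intro sets.sigma_sets_subset) (auto simp: measurable_def)
qed simp

lemma Z_GG [measurable]: "i < n \<Longrightarrow> Z n i \<in> measurable (GG n) D"
proof -
  assume i: "i < n"
  have "(\<lambda>\<omega>. (\<lambda>i\<in>{..<n}. Z n i \<omega>, \<lambda>(i, j)\<in>{..<n} \<times> {..<n}. E n i j \<omega>)) \<in>
      measurable (GG n) (PiM {..<n} (\<lambda>_. D) \<Otimes>\<^sub>M PiM ({..<n} \<times> {..<n}) (\<lambda>_. count_space UNIV))"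
    unfolding GG_def by (rule measurable_vimage_algebra1) (use measurable_space[OF ZE_measurable] in blast)
  from measurable_compose[OF measurable_compose[OF this measurable_fst] measurable_component_singleton[of i]]
  show "Z n i \<in> measurable (GG n) D"
    using i by simp
qed

lemma E_GG [measurable]: "i < n \<Longrightarrow> j < n \<Longrightarrow> E n i j \<in> measurable (GG n) (count_space UNIV)"
proof -
  assume i: "i < n" "j < n"
  have "(\<lambda>\<omega>. (\<lambda>i\<in>{..<n}. Z n i \<omega>, \<lambda>(i, j)\<in>{..<n} \<times> {..<n}. E n i j \<omega>)) \<in>
      measurable (GG n) (PiM {..<n} (\<lambda>_. D) \<Otimes>\<^sub>M PiM ({..<n} \<times> {..<n}) (\<lambda>_. count_space UNIV))"
    unfolding GG_def by (rule measurable_vimage_algebra1) (use measurable_space[OF ZE_measurable] in blast)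
  from measurable_compose[OF measurable_compose[OF this measurable_snd] measurable_component_singleton[of "(i, j)"]]
  show "E n i j \<in> measurable (GG n) (count_space UNIV)"
    using i by simp
qed

lemma W_WW [measurable]: "i < n \<Longrightarrow> W n i \<in> measurable (WW n) (count_space UNIV)"
proof -
  assume i: "i < n"
  have "(\<lambda>\<omega>. \<lambda>i\<in>{..<n}. W n i \<omega>) \<in> measurable (WW n) (PiM {..<n} (\<lambda>_. count_space UNIV))"
    unfolding WW_def by (rule measurable_vimage_algebra1) (auto simp: space_PiM)
  from measurable_compose[OF this measurable_component_singleton[of i]]
  show "W n i \<in> measurable (WW n) (count_space UNIV)"
    using i by simp
qed

lemma GG_to_M: "f \<in> measurable (GG n) N \<Longrightarrow> f \<in> measurable (M n) N"
  by (rule measurable_from_subalg[OF subalgebra_GG])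

lemma deg_GG [measurable]: "i < n \<Longrightarrow> (\<lambda>\<omega>. deg n (Gr n \<omega>) i) \<in> borel_measurable (GG n)"
  unfolding deg_def by measurable

lemma frac_GG [measurable]: "i < n \<Longrightarrow> (\<lambda>\<omega>. frac_treated n (Gr n \<omega>) i w) \<in> borel_measurable (GG n)"
  unfolding frac_treated_def by measurable

lemma response_GG [measurable]:
  assumes i: "i < n"
  shows "(\<lambda>\<omega>. snd (Z n i \<omega>) b (frac_treated n (Gr n \<omega>) i w)) \<in> borel_measurable (GG n)"
proof (rule measurable_compose_countable'[where I = "\<rat> \<inter> {0..1}" and f = "\<lambda>x \<omega>. snd (Z n i \<omega>) b x"
      and g = "\<lambda>\<omega>. frac_treated n (Gr n \<omega>) i w"])
  show "(\<lambda>\<omega>. snd (Z n i \<omega>) b x) \<in> borel_measurable (GG n)" if "x \<in> \<rat> \<inter> {0..1}" for x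
    using measurable_compose[OF Z_GG[OF i] eval_measurable] that by auto
  show "(\<lambda>\<omega>. frac_treated n (Gr n \<omega>) i w) \<in> measurable (GG n) (count_space (\<rat> \<inter> {0..1}))"
    unfolding measurable_count_space_eq_countable[OF countable_Int1[OF countable_rat]]
  proof (intro conjI ballI)
    show "(\<lambda>\<omega>. frac_treated n (Gr n \<omega>) i w) \<in> space (GG n) \<rightarrow> \<rat> \<inter> {0..1}"
      using frac_treated_Rats frac_treated_range by auto
    fix a :: real
    show "(\<lambda>\<omega>. frac_treated n (Gr n \<omega>) i w) -` {a} \<inter> space (GG n) \<in> sets (GG n)"
      by (rule measurable_sets[OF frac_GG[OF i]]) simp
  qed
  show "countable (\<rat> \<inter> {0..1} :: real set)" by (rule countable_Int1[OF countable_rat])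
qed

section \<open>Averaging over the treatments with the graph held fixed\<close>

abbreviation design :: "nat \<Rightarrow> (nat \<Rightarrow> bool) pmf" where "design n \<equiv> bernoulli_design.design n \<pi>"
abbreviation EW :: "nat \<Rightarrow> ((nat \<Rightarrow> bool) \<Rightarrow> real) \<Rightarrow> real" where
  "EW n F \<equiv> measure_pmf.expectation (design n) F"

lemma set_design: "set_pmf (design n) = {w. \<forall>j\<ge>n. \<not> w j}"
  unfolding BD.design_def using pi_range
  by (subst set_Pi_pmf) (auto simp: PiE_dflt_def not_less)

lemma wv_set: "wv n \<omega> \<in> set_pmf (design n)"
  by (simp add: set_design wv_def)

lemma wv_event: "w \<in> set_pmf (design n) \<Longrightarrow>
    {\<omega> \<in> space (M n). wv n \<omega> = w} = {\<omega> \<in> space (M n). \<forall>j<n. W n j \<omega> = w j}"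
  by (auto simp: set_design wv_def fun_eq_iff) (metis linorder_not_less)+

lemma wv_event_WW:
  assumes "w \<in> set_pmf (design n)"
  shows "{\<omega> \<in> space (M n). wv n \<omega> = w} \<in> sets (WW n)"
proof -
  have "{\<omega> \<in> space (WW n). \<forall>j\<in>{..<n}. W n j \<omega> = w j} \<in> sets (WW n)"
  proof (rule sets.sets_Collect_finite_All)
    fix j assume "j \<in> {..<n}"
    then have "W n j -` {w j} \<inter> space (WW n) \<in> sets (WW n)"
      by (intro measurable_sets[OF W_WW[of j n], of "{w j}"]) auto
    also have "W n j -` {w j} \<inter> space (WW n) = {\<omega> \<in> space (WW n). W n j \<omega> = w j}" by auto
    finally show "{\<omega> \<in> space (WW n). W n j \<omega> = w j} \<in> sets (WW n)" .
  qed simp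
  also have "{\<omega> \<in> space (WW n). \<forall>j\<in>{..<n}. W n j \<omega> = w j} = {\<omega> \<in> space (M n). wv n \<omega> = w}"
    unfolding wv_event[OF assms] by auto
  finally show ?thesis .
qed

lemma prob_wv:
  assumes w: "w \<in> set_pmf (design n)"
  shows "measure (M n) {\<omega> \<in> space (M n). wv n \<omega> = w} = pmf (design n) w"
proof -
  have pmf: "pmf (design n) w = (\<Prod>j<n. pmf (bernoulli_pmf \<pi>) (w j))"
    unfolding BD.design_def by (rule pmf_Pi') (use w in \<open>auto simp: set_design\<close>)
  show ?thesis
  \<comment> \<open>The product formula needs a nonempty index set: an intersection over no indices
    would be the whole type.\<close>
  proof (cases "n = 0")
    case True
    with w have "{\<omega> \<in> space (M n). wv n \<omega> = w} = space (M n)"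
      by (auto simp: wv_event)
    then show ?thesis unfolding pmf using True by (simp add: M.prob_space)
  next
    case False
    have "measure (M n) (\<Inter>j\<in>{..<n}. W n j -` {w j} \<inter> space (M n)) = (\<Prod>j<n. measure (M n) (W n j -` {w j} \<inter> space (M n)))"
      by (rule M.indep_varsD_finite[OF W_indep]) (use False in auto)
    also have "\<dots> = (\<Prod>j<n. pmf (bernoulli_pmf \<pi>) (w j))"
    proof (rule prod.cong)
      fix j assume "j \<in> {..<n}"
      then have j: "j < n" by simp
      have "measure (M n) (W n j -` {w j} \<inter> space (M n)) = measure (distr (M n) (count_space UNIV) (W n j)) {w j}"
        by (rule measure_distr[symmetric]) (use j in auto)
      then show "measure (M n) (W n j -` {w j} \<inter> space (M n)) = pmf (bernoulli_pmf \<pi>) (w j)"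
        by (simp add: W_distr[OF j] measure_pmf_single)
    qed simp
    also have "(\<Inter>j\<in>{..<n}. W n j -` {w j} \<inter> space (M n)) = {\<omega> \<in> space (M n). wv n \<omega> = w}"
      unfolding wv_event[OF w] using False by auto
    finally show ?thesis by (simp add: pmf)
  qed
qed

text \<open>The event is determined by the treatments and \<open>F\<close> by the units and the
  graph. The value type is left general because real second moments and complex exponentials are
  both treated this way.\<close>

lemma wv_independent:
  fixes F :: "'a \<Rightarrow> 'b::{real_normed_field, banach, second_countable_topology}"
  assumes w: "w \<in> set_pmf (design n)"
    and F: "F \<in> borel_measurable (GG n)" and int: "integrable (M n) F"
  shows "(LINT \<omega>|M n. indicator {\<omega> \<in> space (M n). wv n \<omega> = w} \<omega> * F \<omega>) = of_real (pmf (design n) w) * (LINT \<omega>|M n. F \<omega>)"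
    and "integrable (M n) (\<lambda>\<omega>. indicator {\<omega> \<in> space (M n). wv n \<omega> = w} \<omega> * F \<omega>)"
proof -
  let ?A = "{\<omega> \<in> space (M n). wv n \<omega> = w}"
  let ?I = "indicator ?A :: 'a \<Rightarrow> 'b"
  have WWM: "sets (WW n) \<subseteq> M.events n" and GGM: "sets (GG n) \<subseteq> M.events n"
    using M.indep_setD_ev1[OF indep_WW_GG] M.indep_setD_ev2[OF indep_WW_GG] by auto
  have A: "?A \<in> sets (WW n)" "?A \<in> sets (M n)" using wv_event_WW[OF w] WWM by auto
  have IW: "?I \<in> borel_measurable (WW n)" using A(1) by simp
  have s1: "sigma_sets (space (M n)) {?I -` B \<inter> space (M n) |B. B \<in> sets borel} \<subseteq> sets (WW n)"
    using measurable_sets[OF IW] by (subst space_WW[symmetric], intro sets.sigma_sets_subset) auto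
  have s2: "sigma_sets (space (M n)) {F -` B \<inter> space (M n) |B. B \<in> sets borel} \<subseteq> sets (GG n)"
    using measurable_sets[OF F] by (subst space_GG[symmetric], intro sets.sigma_sets_subset) auto
  have indep: "M.indep_var n borel ?I borel F"
    unfolding M.indep_var_eq
  proof (intro conjI)
    show "?I \<in> borel_measurable (M n)" by (rule borel_measurable_indicator[OF A(2)])
    show "F \<in> borel_measurable (M n)" using F by (rule GG_to_M)
    show "M.indep_set n (sigma_sets (space (M n)) {?I -` B \<inter> space (M n) |B. B \<in> sets borel})
        (sigma_sets (space (M n)) {F -` B \<inter> space (M n) |B. B \<in> sets borel})"
    proof (rule M.indep_setI)
      fix a b
      assume "a \<in> sigma_sets (space (M n)) {?I -` B \<inter> space (M n) |B. B \<in> sets borel}"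
        "b \<in> sigma_sets (space (M n)) {F -` B \<inter> space (M n) |B. B \<in> sets borel}"
      then show "M.prob n (a \<inter> b) = M.prob n a * M.prob n b"
        by (intro M.indep_setD[OF indep_WW_GG] subsetD[OF s1] subsetD[OF s2])
    qed (fact order.trans[OF s1 WWM] order.trans[OF s2 GGM])+
  qed
  have intI: "integrable (M n) ?I"
    using A(2) by (intro M.integrable_const_bound[where B=1]) (auto simp: indicator_def)
  show "(LINT \<omega>|M n. ?I \<omega> * F \<omega>) = of_real (pmf (design n) w) * (LINT \<omega>|M n. F \<omega>)"
  proof -
    have "(LINT \<omega>|M n. ?I \<omega>) = of_real (LINT \<omega>|M n. indicator ?A \<omega>)"
    proof -
      have "integrable (M n) (indicator ?A :: 'a \<Rightarrow> real)"
        using A(2) by (intro integrable_real_indicator) (auto simp: M.emeasure_eq_measure)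
      then have "of_real (LINT \<omega>|M n. indicator ?A \<omega>) = (LINT \<omega>|M n. of_real (indicator ?A \<omega>) :: 'b)"
        by (simp add: integral_of_real)
      also have "\<dots> = (LINT \<omega>|M n. ?I \<omega>)"
        by (intro Bochner_Integration.integral_cong refl) (simp add: indicator_def)
      finally show ?thesis ..
    qed
    also have "\<dots> = of_real (pmf (design n) w)"
      using A(2) prob_wv[OF w] by simp
    finally show ?thesis
      using M.indep_var_lebesgue_integral[OF indep intI int] by simp
  qed
  show "integrable (M n) (\<lambda>\<omega>. ?I \<omega> * F \<omega>)"
    by (rule M.indep_var_integrable[OF indep intI int])
qed

text \<open>Fubini's theorem for graph and treatments without a product space: only finitely many
  assignments occur, so \<open>F\<close> at the realised one is a finite sum over the events on
  which each of them occurs.\<close>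

lemma
  fixes F :: "'a \<Rightarrow> (nat \<Rightarrow> bool) \<Rightarrow> 'b::{real_normed_field, banach, second_countable_topology}"
  assumes F: "\<And>w. (\<lambda>\<omega>. F \<omega> w) \<in> borel_measurable (GG n)" and int: "\<And>w. integrable (M n) (\<lambda>\<omega>. F \<omega> w)"
  shows integrable_wv: "integrable (M n) (\<lambda>\<omega>. F \<omega> (wv n \<omega>))"
    and integral_wv_sum: "(LINT \<omega>|M n. F \<omega> (wv n \<omega>)) =
      (\<Sum>w\<in>set_pmf (design n). of_real (pmf (design n) w) * (LINT \<omega>|M n. F \<omega> w))"
proof -
  let ?S = "set_pmf (design n)"
  have eq: "F \<omega> (wv n \<omega>) = (\<Sum>w\<in>?S. indicator {\<omega> \<in> space (M n). wv n \<omega> = w} \<omega> * F \<omega> w)"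
    if "\<omega> \<in> space (M n)" for \<omega>
  proof -
    have "(\<Sum>w\<in>?S. indicator {\<omega> \<in> space (M n). wv n \<omega> = w} \<omega> * F \<omega> w) =
        (\<Sum>w\<in>?S. if w = wv n \<omega> then F \<omega> w else 0)"
      using that by (intro sum.cong) (auto simp: indicator_def)
    then show ?thesis using BD.finite_set_design[of n] wv_set[of n \<omega>] by (simp add: sum.delta)
  qed
  have int': "integrable (M n) (\<lambda>\<omega>. \<Sum>w\<in>?S. indicator {\<omega> \<in> space (M n). wv n \<omega> = w} \<omega> * F \<omega> w)"
    by (intro Bochner_Integration.integrable_sum wv_independent F int)
  show "integrable (M n) (\<lambda>\<omega>. F \<omega> (wv n \<omega>))"
    by (subst Bochner_Integration.integrable_cong[OF refl eq]) (simp_all add: int')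
  have "(LINT \<omega>|M n. F \<omega> (wv n \<omega>)) =
      (LINT \<omega>|M n. (\<Sum>w\<in>?S. indicator {\<omega> \<in> space (M n). wv n \<omega> = w} \<omega> * F \<omega> w))"
    by (rule Bochner_Integration.integral_cong[OF refl eq])
  also have "\<dots> = (\<Sum>w\<in>?S. (LINT \<omega>|M n. indicator {\<omega> \<in> space (M n). wv n \<omega> = w} \<omega> * F \<omega> w))"
    by (intro Bochner_Integration.integral_sum wv_independent F int)
  also have "\<dots> = (\<Sum>w\<in>?S. of_real (pmf (design n) w) * (LINT \<omega>|M n. F \<omega> w))"
    by (intro sum.cong refl wv_independent F int)
  finally show "(LINT \<omega>|M n. F \<omega> (wv n \<omega>)) =
      (\<Sum>w\<in>?S. of_real (pmf (design n) w) * (LINT \<omega>|M n. F \<omega> w))" .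
qed

lemma EW_eq_sum: "EW n F = (\<Sum>w\<in>set_pmf (design n). pmf (design n) w * F w)"
  by (subst integral_measure_pmf_real[OF BD.finite_set_design[of n]]) (auto simp: mult_ac)

lemma EW_measurable [measurable (raw)]:
  "(\<And>w. (\<lambda>\<omega>. F \<omega> w) \<in> borel_measurable N) \<Longrightarrow> (\<lambda>\<omega>. EW n (F \<omega>)) \<in> borel_measurable N"
  unfolding EW_eq_sum by measurable

lemma
  fixes F :: "'a \<Rightarrow> (nat \<Rightarrow> bool) \<Rightarrow> real"
  assumes F: "\<And>w. (\<lambda>\<omega>. F \<omega> w) \<in> borel_measurable (GG n)" and int: "\<And>w. integrable (M n) (\<lambda>\<omega>. F \<omega> w)"
  shows integrable_EW: "integrable (M n) (\<lambda>\<omega>. EW n (F \<omega>))"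
    and integral_wv: "(LINT \<omega>|M n. F \<omega> (wv n \<omega>)) = (LINT \<omega>|M n. EW n (F \<omega>))"
proof -
  show "integrable (M n) (\<lambda>\<omega>. EW n (F \<omega>))"
    unfolding EW_eq_sum by (intro Bochner_Integration.integrable_sum integrable_mult_right int)
  show "(LINT \<omega>|M n. F \<omega> (wv n \<omega>)) = (LINT \<omega>|M n. EW n (F \<omega>))"
    unfolding EW_eq_sum using integral_wv_sum[of F n, OF F int] int by simp
qed

section \<open>The conditional estimand as an average over the treatments\<close>

lemma po_GG [measurable]: "i < n \<Longrightarrow> potential_outcome n (Z n) (E n) i w \<in> borel_measurable (GG n)"
  unfolding potential_outcome_eq[abs_def] by measurable

abbreviation OA :: "nat \<Rightarrow> 'a measure" where
  "OA n \<equiv> outcomes_algebra (M n) n (Z n) (E n)"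

lemma outcomes_map_measurable:
  assumes N: "space N = space (M n)"
    and m: "\<And>i w. i < n \<Longrightarrow> potential_outcome n (Z n) (E n) i w \<in> borel_measurable N"
  shows "(\<lambda>\<omega>. \<lambda>(i, w)\<in>{..<n} \<times> PiE {..<n} (\<lambda>_. UNIV). potential_outcome n (Z n) (E n) i w \<omega>) \<in>
    measurable N (PiM ({..<n} \<times> PiE {..<n} (\<lambda>_. UNIV)) (\<lambda>_. borel))"
proof -
  have "(\<lambda>\<omega>. \<lambda>x\<in>{..<n} \<times> PiE {..<n} (\<lambda>_. UNIV). potential_outcome n (Z n) (E n) (fst x) (snd x) \<omega>) \<in>
      measurable N (PiM ({..<n} \<times> PiE {..<n} (\<lambda>_. UNIV)) (\<lambda>_. borel))"
  proof (rule measurable_restrict)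
    fix x assume "x \<in> {..<n} \<times> PiE {..<n} (\<lambda>_. UNIV :: bool set)"
    then have "fst x < n" by (cases x) simp
    then show "potential_outcome n (Z n) (E n) (fst x) (snd x) \<in> borel_measurable N" by (rule m)
  qed
  then show ?thesis by (simp add: case_prod_unfold)
qed

lemma space_OA [simp]: "space (OA n) = space (M n)"
  by (simp add: outcomes_algebra_def)

lemma sets_OA: "sets (OA n) \<subseteq> sets (GG n)"
  unfolding outcomes_algebra_def sets_vimage_algebra
  using outcomes_map_measurable[of "GG n" n, OF _ po_GG]
  by (subst space_GG[symmetric], intro sets.sigma_sets_subset) (auto simp: measurable_def)

lemma subalgebra_OA: "subalgebra (M n) (OA n)"
  using sets_OA[of n] subalgebra_GG[of n] by (auto simp: subalgebra_def)

lemma po_OA: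
  assumes i: "i < n"
  shows "potential_outcome n (Z n) (E n) i w \<in> borel_measurable (OA n)"
proof -
  let ?I = "{..<n} \<times> PiE {..<n} (\<lambda>_. UNIV :: bool set)"
  \<comment> \<open>Only extensional assignments index the generators of the algebra; the outcome
    ignores \<open>w\<close> from \<open>n\<close> on.\<close>
  let ?w = "restrict w {..<n}"
  have "(\<lambda>\<omega>. \<lambda>(i, w)\<in>?I. potential_outcome n (Z n) (E n) i w \<omega>) \<in> measurable (OA n) (PiM ?I (\<lambda>_. borel))"
    unfolding outcomes_algebra_def by (rule measurable_vimage_algebra1) (auto simp: space_PiM)
  from measurable_compose[OF this measurable_component_singleton[of "(i, ?w)"]]
  have "potential_outcome n (Z n) (E n) i ?w \<in> borel_measurable (OA n)"
    using i by simp
  moreover have "potential_outcome n (Z n) (E n) i ?w = potential_outcome n (Z n) (E n) i w"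
    by (rule ext, rule potential_outcome_cong[OF i]) auto
  ultimately show ?thesis by simp
qed

definition cond_tau :: "nat \<Rightarrow> 'a \<Rightarrow> real" where
  "cond_tau n \<omega> = (1 / real n) * (\<Sum>i<n. EW n (\<lambda>w. dfun (Z n i \<omega>) (frac_treated n (Gr n \<omega>) i w)))"

text \<open>Averaging over the design gives a version of the conditional expectation: it is a
  function of the potential outcomes, and on every event they generate the two integrals agree,
  since such events belong to \<open>GG n\<close>, which is independent of the treatments.\<close>

lemma tau_bar_DIR_AE:
  "AE \<omega> in M n. tau_bar_DIR (M n) n (Z n) (E n) (W n) \<omega> = cond_tau n \<omega>"
proof -
  interpret finite_measure_subalgebra "M n" "OA n"
    by unfold_locales (rule subalgebra_OA)
  have "AE \<omega> in M n. real_cond_exp (M n) (OA n)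
        (\<lambda>\<omega>. potential_outcome n (Z n) (E n) i ((\<lambda>j. W n j \<omega>)(i := True)) \<omega> -
             potential_outcome n (Z n) (E n) i ((\<lambda>j. W n j \<omega>)(i := False)) \<omega>) \<omega> =
        EW n (\<lambda>w. dfun (Z n i \<omega>) (frac_treated n (Gr n \<omega>) i w))" if i: "i < n" for i
  proof -
    define F where "F \<omega> w = potential_outcome n (Z n) (E n) i (w(i := True)) \<omega> -
             potential_outcome n (Z n) (E n) i (w(i := False)) \<omega>" for \<omega> w
    have Fd: "F \<omega> w = dfun (Z n i \<omega>) (frac_treated n (Gr n \<omega>) i w)" for \<omega> w
      by (simp add: F_def potential_outcome_eq dfun_def)
    have FW: "potential_outcome n (Z n) (E n) i ((\<lambda>j. W n j \<omega>)(i := True)) \<omega> -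
             potential_outcome n (Z n) (E n) i ((\<lambda>j. W n j \<omega>)(i := False)) \<omega> = F \<omega> (wv n \<omega>)" for \<omega>
      unfolding F_def by (intro arg_cong2[where f = "(-)"] potential_outcome_cong i) (auto simp: wv_def)
    have FO: "(\<lambda>\<omega>. F \<omega> w) \<in> borel_measurable (OA n)" for w
      unfolding F_def by (intro borel_measurable_diff po_OA i)
    have FG: "(\<lambda>\<omega>. F \<omega> w) \<in> borel_measurable (GG n)" for w
      unfolding F_def by (intro borel_measurable_diff po_GG i)
    have bound: "\<bar>F \<omega> w\<bar> \<le> 2 * B" if "\<omega> \<in> space (M n)" for \<omega> w
      unfolding Fd by (rule dfun_bound[OF Z_space[OF i that] frac_treated_range])
    have int: "integrable (M n) (\<lambda>\<omega>. F \<omega> w)" for w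
      by (rule M.integrable_const_bound[where B="2 * B"]) (auto simp: bound GG_to_M[OF FG])
    have "AE \<omega> in M n. real_cond_exp (M n) (OA n) (\<lambda>\<omega>. F \<omega> (wv n \<omega>)) \<omega> = EW n (F \<omega>)"
    proof (rule real_cond_exp_charact)
      fix A assume A: "A \<in> sets (OA n)"
      then have AG: "A \<in> sets (GG n)" using sets_OA by auto
      then have AM: "A \<in> sets (M n)" using subalgebra_GG[of n] by (auto simp: subalgebra_def)
      have "(LINT \<omega>|M n. indicator A \<omega> * F \<omega> (wv n \<omega>)) = (LINT \<omega>|M n. EW n (\<lambda>w. indicator A \<omega> * F \<omega> w))"
      proof (rule integral_wv[where F = "\<lambda>\<omega> w. indicator A \<omega> * F \<omega> w"])
        show "(\<lambda>\<omega>. indicator A \<omega> * F \<omega> w) \<in> borel_measurable (GG n)" for w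
          by (intro borel_measurable_times borel_measurable_indicator AG FG)
        show "integrable (M n) (\<lambda>\<omega>. indicator A \<omega> * F \<omega> w)" for w
          using integrable_real_mult_indicator[OF AM int[of w]] by (simp only: mult.commute)
      qed
      also have "(\<lambda>\<omega>. EW n (\<lambda>w. indicator A \<omega> * F \<omega> w)) = (\<lambda>\<omega>. indicator A \<omega> * EW n (F \<omega>))"
        by (rule ext) (rule integral_mult_right_zero)
      finally show "(\<integral>\<omega>\<in>A. F \<omega> (wv n \<omega>) \<partial>M n) = (\<integral>\<omega>\<in>A. EW n (F \<omega>) \<partial>M n)"
        unfolding set_lebesgue_integral_def real_scaleR_def .
    next
      show "integrable (M n) (\<lambda>\<omega>. F \<omega> (wv n \<omega>))" by (rule integrable_wv[OF FG int])
      show "integrable (M n) (\<lambda>\<omega>. EW n (F \<omega>))" by (rule integrable_EW[OF FG int])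
      show "(\<lambda>\<omega>. EW n (F \<omega>)) \<in> borel_measurable (OA n)" by (rule EW_measurable[OF FO])
    qed
    then show ?thesis unfolding FW Fd[symmetric] .
  qed
  then have "AE \<omega> in M n. \<forall>i\<in>{..<n}. real_cond_exp (M n) (OA n)
        (\<lambda>\<omega>. potential_outcome n (Z n) (E n) i ((\<lambda>j. W n j \<omega>)(i := True)) \<omega> -
             potential_outcome n (Z n) (E n) i ((\<lambda>j. W n j \<omega>)(i := False)) \<omega>) \<omega> =
        EW n (\<lambda>w. dfun (Z n i \<omega>) (frac_treated n (Gr n \<omega>) i w))"
    by (intro AE_finite_allI) auto
  then show ?thesis
    by eventually_elim (simp add: tau_bar_DIR_def cond_tau_def)
qed

end

section \<open>The neighbourhood of a unit\<close>

text \<open>Edges are indexed by pairs \<open>i < j\<close>, so those at \<open>c\<close> are the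
  pairs \<open>(min c j, max c j)\<close>. Letting all other pairs contribute 1 allows a product
  over the star to be merged with the product over all pairs in the law of the graph.\<close>

lemma prod_star_pairs:
  fixes \<phi> :: "nat \<Rightarrow> nat \<times> nat \<Rightarrow> 'b::comm_monoid_mult"
  assumes c: "c < n"
  shows "(\<Prod>x\<in>{(i, j). i < j \<and> j < n}. if fst x = c then \<phi> (snd x) x else if snd x = c then \<phi> (fst x) x else 1) =
    (\<Prod>j\<in>{..<n} - {c}. \<phi> j (min c j, max c j))"
proof -
  let ?P = "{(i, j). i < j \<and> j < n}"
  let ?f = "\<lambda>x. if fst x = c then \<phi> (snd x) x else if snd x = c then \<phi> (fst x) x else 1"
  have fin: "finite ?P" by (rule finite_subset[of _ "{..<n} \<times> {..<n}"]) auto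
  have img: "(\<lambda>j. (min c j, max c j)) ` ({..<n} - {c}) = {x \<in> ?P. fst x = c \<or> snd x = c}"
  proof (intro set_eqI iffI)
    fix x assume "x \<in> (\<lambda>j. (min c j, max c j)) ` ({..<n} - {c})"
    then show "x \<in> {x \<in> ?P. fst x = c \<or> snd x = c}" using c by (auto simp: min_def max_def split: if_splits)
  next
    fix x assume x: "x \<in> {x \<in> ?P. fst x = c \<or> snd x = c}"
    then have "x = (\<lambda>j. (min c j, max c j)) (if fst x = c then snd x else fst x)"
      by (cases x) (auto simp: min_def max_def)
    moreover have "(if fst x = c then snd x else fst x) \<in> {..<n} - {c}"
      using x by (cases x) auto
    ultimately show "x \<in> (\<lambda>j. (min c j, max c j)) ` ({..<n} - {c})" by (rule image_eqI)
  qed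
  have inj: "inj_on (\<lambda>j. (min c j, max c j)) ({..<n} - {c})"
    by (auto simp: inj_on_def min_def max_def split: if_splits)
  have "(\<Prod>x\<in>?P. ?f x) = (\<Prod>x\<in>{x \<in> ?P. fst x = c \<or> snd x = c}. ?f x)"
    by (rule prod.mono_neutral_right) (use fin in auto)
  also have "\<dots> = (\<Prod>j\<in>{..<n} - {c}. ?f (min c j, max c j))"
    unfolding img[symmetric] by (subst prod.reindex[OF inj]) (simp add: comp_def)
  also have "\<dots> = (\<Prod>j\<in>{..<n} - {c}. \<phi> j (min c j, max c j))"
    by (intro prod.cong) (auto simp: min_def max_def)
  finally show ?thesis .
qed

context network_interference
begin

definition pr :: "nat \<Rightarrow> unit_type \<Rightarrow> unit_type \<Rightarrow> real" where
  "pr n z z' = edge_prob \<rho> G n (fst z) (fst z')"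

lemma G_D_measurable [measurable]: "(\<lambda>x. G (fst (fst x)) (fst (snd x))) \<in> borel_measurable (D \<Otimes>\<^sub>M D)"
proof -
  have "(\<lambda>x. (fst (fst x), fst (snd x))) \<in> measurable (D \<Otimes>\<^sub>M D) (restrict_space borel ({0..1} \<times> {0..1}))"
  proof (rule measurable_restrict_space2)
    show "(\<lambda>x. (fst (fst x), fst (snd x))) \<in> space (D \<Otimes>\<^sub>M D) \<rightarrow> {0..1} \<times> {0..1}"
      by (auto simp: space_pair_measure space_D)
    show "(\<lambda>x. (fst (fst x), fst (snd x))) \<in> borel_measurable (D \<Otimes>\<^sub>M D)"
      unfolding borel_prod[symmetric] by measurable
  qed
  from measurable_compose[OF this G_measurable] show ?thesis by simp
qed

lemma G_compose_measurable [measurable (raw)]: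
  assumes "f \<in> measurable N D" "g \<in> measurable N D"
  shows "(\<lambda>x. G (fst (f x)) (fst (g x))) \<in> borel_measurable N"
  using measurable_compose[OF measurable_Pair[OF assms] G_D_measurable] by simp

lemma pr_measurable [measurable (raw)]:
  assumes "f \<in> measurable N D" "g \<in> measurable N D"
  shows "(\<lambda>x. pr n (f x) (g x)) \<in> borel_measurable N"
  unfolding pr_def edge_prob_def using G_compose_measurable[OF assms] by measurable

lemma G_D_nonneg: "z \<in> space D \<Longrightarrow> z' \<in> space D \<Longrightarrow> 0 \<le> G (fst z) (fst z')"
  by (intro G_nonneg fst_D)

text \<open>\<open>pr_ge\<close> rests on \<open>\<rho> n \<le> 1\<close>. It converts the lower
  bound on the integral of \<open>min 1 G\<close> into the bound \<open>\<rho> n * c\<^sub>l\<close>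
  for edge probabilities averaged over one end, in the dense and the sparse case alike.\<close>

lemma
  assumes z: "z \<in> space D" "z' \<in> space D"
  shows pr_nonneg: "0 \<le> pr n z z'" and pr_le_1: "pr n z z' \<le> 1"
    and pr_sym: "pr n z z' = pr n z' z" and pr_le_G: "pr n z z' \<le> \<rho> n * G (fst z) (fst z')"
    and pr_ge: "\<rho> n * min 1 (G (fst z) (fst z')) \<le> pr n z z'"
proof -
  have r: "0 < \<rho> n" "\<rho> n \<le> 1" using rho_range[of n] by auto
  have g: "0 \<le> G (fst z) (fst z')" by (rule G_D_nonneg[OF z])
  show "0 \<le> pr n z z'" "pr n z z' \<le> 1" "pr n z z' \<le> \<rho> n * G (fst z) (fst z')"
    using r g by (auto simp: pr_def edge_prob_def)
  show "pr n z z' = pr n z' z"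
    unfolding pr_def edge_prob_def using G_sym[OF fst_D[OF z(1)] fst_D[OF z(2)]] by simp
  show "\<rho> n * min 1 (G (fst z) (fst z')) \<le> pr n z z'"
    using r g mult_right_mono[OF r(2) g] by (auto simp: pr_def edge_prob_def min_def)
qed

abbreviation UA :: "nat \<Rightarrow> 'a measure" where
  "UA n \<equiv> units_algebra (M n) D n (Z n)"

lemma space_UA [simp]: "space (UA n) = space (M n)"
  by (simp add: units_algebra_def)

lemma Zvec_measurable: "(\<lambda>\<omega>. \<lambda>i\<in>{..<n}. Z n i \<omega>) \<in> measurable (M n) (PiM {..<n} (\<lambda>_. D))"
  by (rule measurable_restrict) simp

lemma subalgebra_UA: "subalgebra (M n) (UA n)"
  unfolding subalgebra_def
proof
  show "sets (UA n) \<subseteq> sets (M n)"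
    unfolding units_algebra_def sets_vimage_algebra using Zvec_measurable[of n]
    by (intro sets.sigma_sets_subset) (auto simp: measurable_def)
qed simp

lemma Z_UA [measurable]:
  assumes i: "i < n"
  shows "Z n i \<in> measurable (UA n) D"
proof -
  have "(\<lambda>\<omega>. \<lambda>i\<in>{..<n}. Z n i \<omega>) \<in> measurable (UA n) (PiM {..<n} (\<lambda>_. D))"
    unfolding units_algebra_def
    by (rule measurable_vimage_algebra1) (use measurable_space[OF Zvec_measurable] in blast)
  from measurable_compose[OF this measurable_component_singleton[of i]]
  show ?thesis using i by simp
qed

lemma distr_Zvec:
  assumes "0 < n"
  shows "distr (M n) (PiM {..<n} (\<lambda>_. D)) (\<lambda>\<omega>. \<lambda>i\<in>{..<n}. Z n i \<omega>) = PiM {..<n} (\<lambda>_. D)"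
proof -
  have "distr (M n) (PiM {..<n} (\<lambda>_. D)) (\<lambda>\<omega>. \<lambda>i\<in>{..<n}. Z n i \<omega>) = PiM {..<n} (\<lambda>i. distr (M n) D (Z n i))"
    by (subst M.indep_vars_iff_distr_eq_PiM'[symmetric]) (use assms Z_indep[of n] in auto)
  also have "\<dots> = PiM {..<n} (\<lambda>_. D)"
    by (intro PiM_cong) (auto simp: Z_distr)
  finally show ?thesis .
qed

text \<open>
  Given \<open>Z\<^sub>c\<close>, the pairs \<open>(Z\<^sub>j, E\<^sub>c\<^sub>j)\<close> with \<open>j \<noteq> c\<close> are independent; nothing else about the
  joint law of the graph is needed.
\<close>

lemma star_law:
  fixes \<psi> :: "nat \<Rightarrow> unit_type \<Rightarrow> unit_type \<Rightarrow> bool \<Rightarrow> real"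
  assumes c: "c < n"
    and meas: "\<And>j b. (\<lambda>x. \<psi> j (fst x) (snd x) b) \<in> borel_measurable (D \<Otimes>\<^sub>M D)"
    and bound: "\<And>j z z' b. z \<in> space D \<Longrightarrow> z' \<in> space D \<Longrightarrow> \<bar>\<psi> j z z' b\<bar> \<le> C"
  shows "(LINT \<omega>|M n. (\<Prod>j\<in>{..<n} - {c}. \<psi> j (Z n c \<omega>) (Z n j \<omega>) (E n c j \<omega>))) =
    (LINT z|D. (\<Prod>j\<in>{..<n} - {c}. (LINT z'|D. pr n z z' * \<psi> j z z' True + (1 - pr n z z') * \<psi> j z z' False)))"
proof -
  interpret UA: finite_measure_subalgebra "M n" "UA n"
    by unfold_locales (rule subalgebra_UA)
  interpret PD: product_sigma_finite "\<lambda>_::nat. D" by standard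
  define P where "P = {(i, j). i < j \<and> j < n}"
  define S where "S = PiE P (\<lambda>_. UNIV :: bool set)"
  define J where "J = {..<n} - {c}"
  define ev where "ev g = {\<omega> \<in> space (M n). \<forall>j<n. \<forall>i<j. E n i j \<omega> = g (i, j)}" for g
  define H where "H g \<omega> = (\<Prod>j\<in>J. \<psi> j (Z n c \<omega>) (Z n j \<omega>) (g (min c j, max c j)))" for g \<omega>
  define k where "k j z z' = pr n z z' * \<psi> j z z' True + (1 - pr n z z') * \<psi> j z z' False" for j z z'
  have finP: "finite P" unfolding P_def by (rule finite_subset[of _ "{..<n} \<times> {..<n}"]) auto
  have finS: "finite S" unfolding S_def using finP by (intro finite_PiE) auto
  have finJ: "finite J" "c \<notin> J" "{..<n} = {c} \<union> J" using c by (auto simp: J_def)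
  have meas': "(\<lambda>x. \<psi> j (f x) (g x) b) \<in> borel_measurable N"
    if "f \<in> measurable N D" "g \<in> measurable N D" for f g j b and N :: "'b measure"
    using measurable_compose[OF measurable_Pair[OF that] meas] by simp
  have meas'': "(\<lambda>x. \<psi> j (f x) (g x) b) \<in> borel_measurable N"
    if "f \<in> measurable N D" "g \<in> measurable N D" for f g j b and N :: "'a measure"
    using measurable_compose[OF measurable_Pair[OF that] meas] by simp
  have evM: "ev g \<in> sets (M n)" for g
  proof -
    have "{\<omega> \<in> space (M n). \<forall>j\<in>{..<n}. \<forall>i\<in>{..<j}. E n i j \<omega> = g (i, j)} \<in> sets (M n)"
    proof (intro sets.sets_Collect_finite_All)
      fix j i assume "j \<in> {..<n}" "i \<in> {..<j}"
      then have "i < n" "j < n" by auto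
      from measurable_sets[OF E_measurable[OF this], of "{g (i, j)}"]
      have "E n i j -` {g (i, j)} \<inter> space (M n) \<in> sets (M n)" by simp
      also have "E n i j -` {g (i, j)} \<inter> space (M n) = {\<omega> \<in> space (M n). E n i j \<omega> = g (i, j)}" by auto
      finally show "{\<omega> \<in> space (M n). E n i j \<omega> = g (i, j)} \<in> sets (M n)" .
    qed auto
    also have "{\<omega> \<in> space (M n). \<forall>j\<in>{..<n}. \<forall>i\<in>{..<j}. E n i j \<omega> = g (i, j)} = ev g"
      by (auto simp: ev_def)
    finally show ?thesis .
  qed
  have HU: "H g \<in> borel_measurable (UA n)" for g
    unfolding H_def J_def by (intro borel_measurable_prod meas'' Z_UA c) auto
  have HM: "H g \<in> borel_measurable (M n)" for g
    by (rule measurable_from_subalg[OF subalgebra_UA HU])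
  have Hb: "\<bar>H g \<omega>\<bar> \<le> C ^ card J" if "\<omega> \<in> space (M n)" for g \<omega>
  proof -
    have "\<bar>H g \<omega>\<bar> \<le> (\<Prod>j\<in>J. C)"
      unfolding H_def abs_prod by (intro prod_mono) (use that c in \<open>auto simp: J_def intro!: bound Z_space\<close>)
    then show ?thesis by simp
  qed
  have iH: "integrable (M n) (\<lambda>\<omega>. H g \<omega> * indicator (ev g) \<omega>)" for g
  proof (rule M.integrable_const_bound[where B = "\<bar>C ^ card J\<bar>"])
    show "AE \<omega> in M n. norm (H g \<omega> * indicator (ev g) \<omega>) \<le> \<bar>C ^ card J\<bar>"
      by (rule AE_I2) (use Hb in \<open>auto simp: indicator_def intro: order.trans[OF _ abs_ge_self]\<close>)
  qed (use HM evM in auto)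
  \<comment> \<open>The realised graph is one of finitely many. Splitting by it makes the edges
    deterministic, so that \<open>H g\<close> depends on the units only and can be pulled out of the
    conditional expectation given the units.\<close>
  have decomp: "(\<Prod>j\<in>J. \<psi> j (Z n c \<omega>) (Z n j \<omega>) (E n c j \<omega>)) = (\<Sum>g\<in>S. H g \<omega> * indicator (ev g) \<omega>)"
    if \<omega>: "\<omega> \<in> space (M n)" for \<omega>
  proof -
    define g0 where "g0 = (\<lambda>x\<in>P. E n (fst x) (snd x) \<omega>)"
    have g0S: "g0 \<in> S" by (simp add: S_def g0_def)
    have iff: "\<omega> \<in> ev g \<longleftrightarrow> g = g0" if "g \<in> S" for g
    proof
      assume "\<omega> \<in> ev g"
      then show "g = g0"
        by (intro PiE_ext[OF \<open>g \<in> S\<close>[unfolded S_def] g0S[unfolded S_def]]) (auto simp: ev_def g0_def P_def)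
    next
      assume "g = g0"
      then show "\<omega> \<in> ev g" using \<omega> by (auto simp: ev_def g0_def P_def)
    qed
    have "(\<Sum>g\<in>S. H g \<omega> * indicator (ev g) \<omega>) = (\<Sum>g\<in>S. if g = g0 then H g \<omega> else 0)"
      by (intro sum.cong) (auto simp: iff indicator_def)
    also have "\<dots> = H g0 \<omega>" using finS g0S by (simp add: sum.delta)
    also have "\<dots> = (\<Prod>j\<in>J. \<psi> j (Z n c \<omega>) (Z n j \<omega>) (E n c j \<omega>))"
      unfolding H_def
    proof (intro prod.cong refl)
      fix j assume "j \<in> J"
      then have j: "j < n" "j \<noteq> c" by (auto simp: J_def)
      then have "g0 (min c j, max c j) = E n c j \<omega>"
        using c E_sym[OF c j(1) \<omega>] by (auto simp: g0_def P_def min_def max_def)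
      then show "\<psi> j (Z n c \<omega>) (Z n j \<omega>) (g0 (min c j, max c j)) = \<psi> j (Z n c \<omega>) (Z n j \<omega>) (E n c j \<omega>)"
        by simp
    qed
    finally show ?thesis ..
  qed
  define f where "f \<omega> x b = pmf (bernoulli_pmf (pr n (Z n (fst x) \<omega>) (Z n (snd x) \<omega>))) b *
      (if fst x = c then \<psi> (snd x) (Z n c \<omega>) (Z n (snd x) \<omega>) b
       else if snd x = c then \<psi> (fst x) (Z n c \<omega>) (Z n (fst x) \<omega>) b else 1)" for \<omega> x b
  have Hf: "H g \<omega> * (\<Prod>(i, j)\<in>P. pmf (bernoulli_pmf (edge_prob \<rho> G n (fst (Z n i \<omega>)) (fst (Z n j \<omega>)))) (g (i, j)))
      = (\<Prod>x\<in>P. f \<omega> x (g x))" for g \<omega>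
  proof -
    have "H g \<omega> = (\<Prod>x\<in>P. if fst x = c then \<psi> (snd x) (Z n c \<omega>) (Z n (snd x) \<omega>) (g x)
        else if snd x = c then \<psi> (fst x) (Z n c \<omega>) (Z n (fst x) \<omega>) (g x) else 1)"
      unfolding H_def J_def P_def
      by (rule prod_star_pairs[OF c, where \<phi> = "\<lambda>j x. \<psi> j (Z n c \<omega>) (Z n j \<omega>) (g x)", symmetric])
    then show ?thesis
      by (simp add: f_def pr_def case_prod_unfold prod.distrib mult.commute)
  qed
  \<comment> \<open>A sum over all graphs of a product over the edges is a product over the edges of
    sums over two states. Edges away from \<open>c\<close> contribute total probability 1 and drop
    out.\<close>
  have star: "(\<Sum>g\<in>S. \<Prod>x\<in>P. f \<omega> x (g x)) = (\<Prod>j\<in>J. k j (Z n c \<omega>) (Z n j \<omega>))"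
    if \<omega>: "\<omega> \<in> space (M n)" for \<omega>
  proof -
    have "(\<Sum>g\<in>S. \<Prod>x\<in>P. f \<omega> x (g x)) = (\<Prod>x\<in>P. \<Sum>b\<in>UNIV. f \<omega> x b)"
      unfolding S_def by (rule prod_sum_PiE[symmetric]) (use finP in auto)
    also have "\<dots> = (\<Prod>x\<in>P. if fst x = c then k (snd x) (Z n c \<omega>) (Z n (snd x) \<omega>)
        else if snd x = c then k (fst x) (Z n c \<omega>) (Z n (fst x) \<omega>) else 1)"
    proof (intro prod.cong refl)
      fix x assume "x \<in> P"
      then have x: "fst x < n" "snd x < n" "fst x \<noteq> snd x" by (auto simp: P_def)
      note zs = Z_space[OF x(1) \<omega>] Z_space[OF x(2) \<omega>]
      show "(\<Sum>b\<in>UNIV. f \<omega> x b) = (if fst x = c then k (snd x) (Z n c \<omega>) (Z n (snd x) \<omega>)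
          else if snd x = c then k (fst x) (Z n c \<omega>) (Z n (fst x) \<omega>) else 1)"
        using pr_nonneg[OF zs, of n] pr_le_1[OF zs, of n] pr_sym[OF zs, of n] x(3)
        by (auto simp: UNIV_bool f_def k_def)
    qed
    also have "\<dots> = (\<Prod>j\<in>J. k j (Z n c \<omega>) (Z n j \<omega>))"
      unfolding J_def P_def by (rule prod_star_pairs[OF c, where \<phi> = "\<lambda>j x. k j (Z n c \<omega>) (Z n j \<omega>)"])
    finally show ?thesis .
  qed
  have step: "(LINT \<omega>|M n. H g \<omega> * indicator (ev g) \<omega>) = (LINT \<omega>|M n. (\<Prod>x\<in>P. f \<omega> x (g x)))"
    "integrable (M n) (\<lambda>\<omega>. (\<Prod>x\<in>P. f \<omega> x (g x)))" for g
  proof -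
    have ind: "(indicator (ev g) :: 'a \<Rightarrow> real) \<in> borel_measurable (M n)" using evM[of g] by simp
    have law: "AE \<omega> in M n. H g \<omega> * real_cond_exp (M n) (UA n) (indicator (ev g)) \<omega> = (\<Prod>x\<in>P. f \<omega> x (g x))"
      using E_cond_law[of n "\<lambda>i j. g (i, j)"]
    proof eventually_elim
      case (elim \<omega>)
      then show ?case unfolding ev_def Hf[symmetric] P_def[symmetric] by simp
    qed
    have fm: "(\<lambda>\<omega>. \<Prod>x\<in>P. f \<omega> x (g x)) \<in> borel_measurable (M n)"
    proof -
      \<comment> \<open>Realised units lie in \<open>space D\<close>, where \<open>pr\<close> is a
        probability; there \<open>pmf\<close> can be replaced by \<open>pr\<close> or
        \<open>1 - pr\<close>, whose measurability is known.\<close>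
      have "(\<lambda>\<omega>. \<Prod>x\<in>P. f \<omega> x (g x)) \<in> borel_measurable (M n) \<longleftrightarrow>
        (\<lambda>\<omega>. H g \<omega> * (\<Prod>x\<in>P. if g x then pr n (Z n (fst x) \<omega>) (Z n (snd x) \<omega>) else 1 - pr n (Z n (fst x) \<omega>) (Z n (snd x) \<omega>))) \<in> borel_measurable (M n)"
      proof (rule measurable_cong)
        fix \<omega> assume \<omega>: "\<omega> \<in> space (M n)"
        show "(\<Prod>x\<in>P. f \<omega> x (g x)) = H g \<omega> * (\<Prod>x\<in>P. if g x then pr n (Z n (fst x) \<omega>) (Z n (snd x) \<omega>) else 1 - pr n (Z n (fst x) \<omega>) (Z n (snd x) \<omega>))"
          unfolding Hf[symmetric] case_prod_unfold pr_def[symmetric]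
        proof (intro arg_cong2[where f = "(*)"] refl prod.cong)
          fix x assume "x \<in> P"
          then have x: "fst x < n" "snd x < n" by (auto simp: P_def)
          note zs = Z_space[OF x(1) \<omega>] Z_space[OF x(2) \<omega>]
          show "pmf (bernoulli_pmf (pr n (Z n (fst x) \<omega>) (Z n (snd x) \<omega>))) (g (fst x, snd x)) =
              (if g x then pr n (Z n (fst x) \<omega>) (Z n (snd x) \<omega>) else 1 - pr n (Z n (fst x) \<omega>) (Z n (snd x) \<omega>))"
            using pr_nonneg[OF zs, of n] pr_le_1[OF zs, of n] by (cases "g x") auto
        qed
      qed
      moreover have "(\<lambda>\<omega>. if g x then pr n (Z n (fst x) \<omega>) (Z n (snd x) \<omega>) else 1 - pr n (Z n (fst x) \<omega>) (Z n (snd x) \<omega>)) \<in> borel_measurable (M n)"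
        if "x \<in> P" for x
      proof -
        have x: "fst x < n" "snd x < n" using that by (auto simp: P_def)
        have "(\<lambda>\<omega>. pr n (Z n (fst x) \<omega>) (Z n (snd x) \<omega>)) \<in> borel_measurable (M n)"
          by (intro pr_measurable Z_measurable x)
        then show ?thesis by simp
      qed
      ultimately show ?thesis using HM[of g] by auto
    qed
    note ci = UA.real_cond_exp_intg[OF iH HU ind]
    have "integrable (M n) (\<lambda>\<omega>. (\<Prod>x\<in>P. f \<omega> x (g x))) \<longleftrightarrow>
        integrable (M n) (\<lambda>\<omega>. H g \<omega> * real_cond_exp (M n) (UA n) (indicator (ev g)) \<omega>)"
      by (rule integrable_cong_AE[OF fm]) (use law ci(1) in \<open>auto simp: eq_commute\<close>)
    with ci(1) show "integrable (M n) (\<lambda>\<omega>. (\<Prod>x\<in>P. f \<omega> x (g x)))" by simp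
    have "(LINT \<omega>|M n. H g \<omega> * indicator (ev g) \<omega>) =
        (LINT \<omega>|M n. H g \<omega> * real_cond_exp (M n) (UA n) (indicator (ev g)) \<omega>)"
      by (rule ci(2)[symmetric])
    also have "\<dots> = (LINT \<omega>|M n. (\<Prod>x\<in>P. f \<omega> x (g x)))"
      by (rule integral_cong_AE) (use law ci(1) fm in auto)
    finally show "(LINT \<omega>|M n. H g \<omega> * indicator (ev g) \<omega>) = (LINT \<omega>|M n. (\<Prod>x\<in>P. f \<omega> x (g x)))" .
  qed
  have km: "(\<lambda>x. k j (f x) (g x)) \<in> borel_measurable N"
    if "f \<in> measurable N D" "g \<in> measurable N D" for f g j and N :: "(nat \<Rightarrow> unit_type) measure"
  proof -
    have "(\<lambda>x. \<psi> j (f x) (g x) b) \<in> borel_measurable N" for b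
      using measurable_compose[OF measurable_Pair[OF that] meas] by simp
    then show ?thesis
      unfolding k_def
      by (intro borel_measurable_add borel_measurable_times borel_measurable_diff borel_measurable_const pr_measurable that)
  qed
  have km1: "(\<lambda>z'. k j z z') \<in> borel_measurable D" if "z \<in> space D" for j z
  proof -
    have "(\<lambda>z'. (z, z')) \<in> measurable D (D \<Otimes>\<^sub>M D)" using that by simp
    from measurable_compose[OF this meas] have "(\<lambda>x. \<psi> j z x b) \<in> borel_measurable D" for b by simp
    moreover have "(\<lambda>x. pr n z x) \<in> borel_measurable D"
      by (rule pr_measurable) (use that in simp_all)
    ultimately show ?thesis
      unfolding k_def by (intro borel_measurable_add borel_measurable_times borel_measurable_diff borel_measurable_const)
  qed
  have kb: "\<bar>k j z z'\<bar> \<le> C" if "z \<in> space D" "z' \<in> space D" for j z z'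
  proof -
    note p = pr_nonneg[OF that, of n] pr_le_1[OF that, of n]
    have "\<bar>k j z z'\<bar> \<le> pr n z z' * C + (1 - pr n z z') * C"
      unfolding k_def using p
      by (intro order.trans[OF abs_triangle_ineq] add_mono) (auto simp: abs_mult intro!: mult_left_mono bound that)
    then show ?thesis by (simp add: algebra_simps)
  qed
  let ?\<Pi> = "PiM ({c} \<union> J) (\<lambda>_. D)"
  interpret P\<Pi>: prob_space ?\<Pi> by (rule prob_space_PiM) (rule prob_space_D)
  have zs: "x i \<in> space D" if "x \<in> space ?\<Pi>" "i \<in> {c} \<union> J" for x i
    using that by (auto simp: space_PiM PiE_def)
  have K\<Pi>: "(\<lambda>x. \<Prod>j\<in>J. k j (x c) (x j)) \<in> borel_measurable ?\<Pi>"
    by (intro borel_measurable_prod km measurable_component_singleton) auto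
  have iK: "integrable ?\<Pi> (\<lambda>x. \<Prod>j\<in>J. k j (x c) (x j))"
  proof (rule P\<Pi>.integrable_const_bound[where B = "C ^ card J"])
    have "(\<Prod>j\<in>J. \<bar>k j (x c) (x j)\<bar>) \<le> (\<Prod>j\<in>J. C)" if "x \<in> space ?\<Pi>" for x
      by (intro prod_mono) (auto intro!: kb zs[OF that])
    then show "AE x in ?\<Pi>. norm (\<Prod>j\<in>J. k j (x c) (x j)) \<le> C ^ card J"
      by (intro AE_I2) (simp add: abs_prod)
  qed (rule K\<Pi>)
  have "(LINT \<omega>|M n. (\<Prod>j\<in>J. \<psi> j (Z n c \<omega>) (Z n j \<omega>) (E n c j \<omega>))) =
      (LINT \<omega>|M n. (\<Sum>g\<in>S. H g \<omega> * indicator (ev g) \<omega>))"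
    by (rule Bochner_Integration.integral_cong[OF refl decomp])
  also have "\<dots> = (\<Sum>g\<in>S. (LINT \<omega>|M n. H g \<omega> * indicator (ev g) \<omega>))"
    by (rule Bochner_Integration.integral_sum) (rule iH)
  also have "\<dots> = (LINT \<omega>|M n. (\<Sum>g\<in>S. \<Prod>x\<in>P. f \<omega> x (g x)))"
    unfolding step(1) by (rule Bochner_Integration.integral_sum[symmetric]) (rule step(2))
  also have "\<dots> = (LINT \<omega>|M n. (\<lambda>x. \<Prod>j\<in>J. k j (x c) (x j)) (\<lambda>i\<in>{..<n}. Z n i \<omega>))"
  proof (rule Bochner_Integration.integral_cong[OF refl])
    fix \<omega> assume "\<omega> \<in> space (M n)"
    from star[OF this] show "(\<Sum>g\<in>S. \<Prod>x\<in>P. f \<omega> x (g x)) = (\<lambda>x. \<Prod>j\<in>J. k j (x c) (x j)) (\<lambda>i\<in>{..<n}. Z n i \<omega>)"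
      using c by (auto simp: J_def intro!: prod.cong)
  qed
  also have "\<dots> = (LINT x|distr (M n) (PiM {..<n} (\<lambda>_. D)) (\<lambda>\<omega>. \<lambda>i\<in>{..<n}. Z n i \<omega>). (\<Prod>j\<in>J. k j (x c) (x j)))"
    by (rule integral_distr[symmetric, OF Zvec_measurable]) (use K\<Pi> finJ(3) in simp)
  also have "\<dots> = (LINT x|?\<Pi>. (\<Prod>j\<in>J. k j (x c) (x j)))"
  proof -
    have "distr (M n) (PiM {..<n} (\<lambda>_. D)) (\<lambda>\<omega>. \<lambda>i\<in>{..<n}. Z n i \<omega>) = ?\<Pi>"
      unfolding finJ(3)[symmetric] by (rule distr_Zvec) (use c in simp)
    then show ?thesis by (simp only:)
  qed
  \<comment> \<open>The centre is integrated last, as it occurs in every factor; for a fixed centre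
    the factors depend on distinct units.\<close>
  also have "\<dots> = (LINT x|PiM {c} (\<lambda>_. D). (LINT y|PiM J (\<lambda>_. D). (\<Prod>j\<in>J. k j (merge {c} J (x, y) c) (merge {c} J (x, y) j))))"
    by (rule PD.product_integral_fold[OF _ _ _ iK]) (use finJ in auto)
  also have "\<dots> = (LINT x|PiM {c} (\<lambda>_. D). (\<lambda>z. \<Prod>j\<in>J. (LINT z'|D. k j z z')) (x c))"
  proof (rule Bochner_Integration.integral_cong[OF refl])
    fix x assume "x \<in> space (PiM {c} (\<lambda>_. D))"
    then have xc: "x c \<in> space D" by (auto simp: space_PiM PiE_def)
    have "(LINT y|PiM J (\<lambda>_. D). (\<Prod>j\<in>J. k j (merge {c} J (x, y) c) (merge {c} J (x, y) j))) =
        (LINT y|PiM J (\<lambda>_. D). (\<Prod>j\<in>J. k j (x c) (y j)))"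
      using finJ(2) by (intro Bochner_Integration.integral_cong prod.cong refl) (auto simp: merge_def)
    also have "\<dots> = (\<Prod>j\<in>J. (LINT z'|D. k j (x c) z'))"
    proof (rule PD.product_integral_prod[OF finJ(1)])
      show "integrable D (k j (x c))" for j
        by (rule D.integrable_const_bound[where B = C]) (use km1[OF xc, of j] kb[OF xc] in auto)
    qed
    finally show "(LINT y|PiM J (\<lambda>_. D). (\<Prod>j\<in>J. k j (merge {c} J (x, y) c) (merge {c} J (x, y) j))) =
        (\<lambda>z. \<Prod>j\<in>J. (LINT z'|D. k j z z')) (x c)" .
  qed
  also have "\<dots> = (LINT z|D. (\<Prod>j\<in>J. (LINT z'|D. k j z z')))"
  proof (rule PD.product_integral_singleton)
    have "case_prod (k j) \<in> borel_measurable (D \<Otimes>\<^sub>M D)" for j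
      unfolding k_def case_prod_unfold using meas[of j] pr_measurable[where f = fst and g = snd and n = n] by simp
    then have "(\<lambda>z. LINT z'|D. k j z z') \<in> borel_measurable D" for j
      by (rule D.borel_measurable_lebesgue_integral)
    then show "(\<lambda>z. \<Prod>j\<in>J. (LINT z'|D. k j z z')) \<in> borel_measurable D" by simp
  qed
  finally show ?thesis unfolding J_def k_def .
qed

end

section \<open>Degrees and influences\<close>

text \<open>For \<open>x = - y\<close> with \<open>y \<ge> 0\<close>, the product of
  \<open>1 - y + y^2\<close> and the lower Taylor polynomial \<open>1 + y + y^2 / 2\<close> of
  \<open>exp y\<close> multiplies out to at least 1. The quadratic bound is the one that the
  Chernoff estimate for the degrees uses.\<close>

lemma exp_le_quadratic:
  fixes x :: real
  assumes "\<bar>x\<bar> \<le> 1"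
  shows "exp x \<le> 1 + x + x\<^sup>2"
proof (cases "0 \<le> x")
  case True
  then show ?thesis using assms exp_bound[of x] by simp
next
  case False
  define y where "y = - x"
  have y: "0 \<le> y" using False by (simp add: y_def)
  have "1 * 1 \<le> 1 + y\<^sup>2 / 2 + y ^ 3 / 2 + y ^ 4 / 2" using y by simp
  also have "\<dots> = (1 - y + y\<^sup>2) * (1 + y + y\<^sup>2 / 2)"
    by (simp add: field_simps power2_eq_square power3_eq_cube power4_eq_xxxx)
  also have "\<dots> \<le> (1 - y + y\<^sup>2) * exp y"
  proof (rule mult_left_mono)
    show "1 + y + y\<^sup>2 / 2 \<le> exp y" by (rule exp_lower_Taylor_quadratic[OF y])
    have "0 \<le> (1 - y)\<^sup>2" by simp
    then show "0 \<le> 1 - y + y\<^sup>2" using y by (simp add: power2_diff) 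
  qed
  finally have "exp (- y) \<le> 1 - y + y\<^sup>2" by (simp add: exp_minus field_simps)
  then show ?thesis by (simp add: y_def)
qed

lemma (in prob_space) expectation_sq_le:
  fixes X :: "'a \<Rightarrow> real"
  assumes "X \<in> borel_measurable M" "integrable M (\<lambda>x. (X x)\<^sup>2)"
  shows "(expectation X)\<^sup>2 \<le> expectation (\<lambda>x. (X x)\<^sup>2)"
  using variance_eq[OF square_integrable_imp_integrable[OF assms] assms(2)] variance_positive[of X] by simp

lemma (in prob_space) AE_pair_snd:
  assumes "AE z in M. P z"
  shows "AE x in M \<Otimes>\<^sub>M M. P (snd x)"
proof -
  interpret MM: pair_prob_space M M by unfold_locales
  obtain N where N: "N \<in> null_sets M" "{z \<in> space M. \<not> P z} \<subseteq> N"
    using assms unfolding eventually_ae_filter by blast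
  then have Ns: "N \<in> sets M" "emeasure M N = 0" by auto
  show "AE x in M \<Otimes>\<^sub>M M. P (snd x)"
  proof (rule AE_I)
    show "{x \<in> space (M \<Otimes>\<^sub>M M). \<not> P (snd x)} \<subseteq> space M \<times> N"
      using N(2) by (auto simp: space_pair_measure)
    show "emeasure (M \<Otimes>\<^sub>M M) (space M \<times> N) = 0"
      using Ns by (subst emeasure_pair_measure_Times) auto
  qed (use Ns in auto)
qed

locale network_asymptotics = network_interference M FF D B G \<rho> \<pi> Z E W
  for M :: "nat \<Rightarrow> 'a measure" and FF D B G \<rho> \<pi> Z E W +
  fixes c\<^sub>l c\<^sub>u :: real
  assumes c\<^sub>l: "0 < c\<^sub>l" "\<And>u. u \<in> {0..1} \<Longrightarrow> c\<^sub>l \<le> (LINT t:{0..1}|lborel. min 1 (G u t))"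
    and c\<^sub>u: "\<And>k. k \<in> {1, 2} \<Longrightarrow>
      (\<integral>\<^sup>+((u, _), (v, _)). ennreal (G u v ^ k) \<partial>(D \<Otimes>\<^sub>M D)) \<le> ennreal (c\<^sub>u ^ k)"
    and sparsity: "liminf (\<lambda>n. ereal (ln (\<rho> n) / ln (real n))) > - 1"

lemma (in network_interference) integral_unit_fst:
  fixes h :: "real \<Rightarrow> real"
  assumes h: "h \<in> borel_measurable (restrict_space borel {0..1})"
  shows "(LINT z|D. h (fst z)) = (LINT t:{0..1}|lborel. h t)"
proof -
  \<comment> \<open>Cutting off outside \<open>{0..1}\<close> turns a function measurable on the
    unit interval into a Borel function on the line, as the change of variables requires.\<close>
  define h' where "h' t = indicator {0..1} t * h t" for t :: real
  have h'm [measurable]: "h' \<in> borel_measurable borel"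
    using h unfolding h'_def by (subst (asm) borel_measurable_restrict_space_iff) simp_all
  have "(LINT z|D. h (fst z)) = (LINT z|D. h' (fst z))"
    by (rule Bochner_Integration.integral_cong[OF refl]) (use fst_D in \<open>simp add: h'_def\<close>)
  also have "\<dots> = (LINT t|distr D borel fst. h' t)"
    by (rule integral_distr[symmetric]) auto
  also have "\<dots> = (LINT t|density lborel (\<lambda>t. ennreal (indicator {0..1} t)). h' t)"
    unfolding uniform_D uniform_measure_def by (simp add: divide_ennreal_def ennreal_indicator)
  also have "\<dots> = (LINT t|lborel. indicator {0..1} t *\<^sub>R h' t)"
    by (rule integral_density) auto
  also have "\<dots> = (LINT t:{0..1}|lborel. h t)"
    unfolding set_lebesgue_integral_def h'_def
    by (rule Bochner_Integration.integral_cong[OF refl]) (simp add: indicator_def)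
  finally show ?thesis .
qed

lemma (in network_interference) G_section_measurable:
  assumes "u \<in> {0..1}"
  shows "G u \<in> borel_measurable (restrict_space borel {0..1})"
proof -
  have "(\<lambda>t::real. (u, t)) \<in> borel_measurable borel"
    unfolding borel_prod[symmetric] by (rule measurable_Pair1') simp
  then have "(\<lambda>t::real. (u, t)) \<in> measurable (restrict_space borel {0..1}) (restrict_space borel ({0..1} \<times> {0..1}))"
    using assms by (rule_tac measurable_restrict_space3) auto
  from measurable_compose[OF this G_measurable] show ?thesis by simp
qed

definition (in network_interference) Gz :: "unit_type \<Rightarrow> unit_type \<Rightarrow> real" where
  "Gz z z' = G (fst z) (fst z')"

definition (in network_interference) gD :: "unit_type \<Rightarrow> real" where
  "gD z = (LINT z'|D. Gz z z')"

text \<open>The probability that a unit \<open>z\<close> is linked to another randomly drawn unit,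
  so that \<open>(real n - 1) * gn n z\<close> is its expected degree.\<close>

definition (in network_interference) gn :: "nat \<Rightarrow> unit_type \<Rightarrow> real" where
  "gn n z = (LINT z'|D. pr n z z')"

section \<open>Edge probabilities averaged over one end\<close>

context network_asymptotics
begin

sublocale DD: pair_prob_space D D by unfold_locales

lemma Gz_measurable [measurable (raw)]:
  "f \<in> measurable N D \<Longrightarrow> g \<in> measurable N D \<Longrightarrow> (\<lambda>x. Gz (f x) (g x)) \<in> borel_measurable N"
  unfolding Gz_def by (rule G_compose_measurable)

lemma Gz_nonneg: "z \<in> space D \<Longrightarrow> z' \<in> space D \<Longrightarrow> 0 \<le> Gz z z'"
  unfolding Gz_def by (rule G_D_nonneg)

lemma gD_eq: "z \<in> space D \<Longrightarrow> graphon_degree G (fst z) = gD z"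
  unfolding graphon_degree_def gD_def Gz_def using integral_unit_fst[OF G_section_measurable[OF fst_D]] by simp

lemma gD_measurable [measurable]: "gD \<in> borel_measurable D"
  unfolding gD_def by (rule D.borel_measurable_lebesgue_integral) simp

lemma gn_measurable [measurable]: "gn n \<in> borel_measurable D"
  unfolding gn_def by (rule D.borel_measurable_lebesgue_integral) simp

lemma pr_section_measurable: "z \<in> space D \<Longrightarrow> pr n z \<in> borel_measurable D"
  using pr_measurable[OF measurable_const measurable_ident_sets[OF refl]] by (simp only: id_def)

lemma Gz_section_measurable: "z \<in> space D \<Longrightarrow> Gz z \<in> borel_measurable D"
  using Gz_measurable[OF measurable_const measurable_ident_sets[OF refl]] by (simp only: id_def)

lemma integrable_pr: "z \<in> space D \<Longrightarrow> integrable D (pr n z)"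
  by (rule D.integrable_const_bound[where B=1])
    (auto simp: pr_section_measurable pr_nonneg pr_le_1)

lemma min_ge_cl: "z \<in> space D \<Longrightarrow> c\<^sub>l \<le> (LINT z'|D. min 1 (Gz z z'))"
proof -
  assume z: "z \<in> space D"
  have "(\<lambda>t. min 1 (G (fst z) t)) \<in> borel_measurable (restrict_space borel {0..1})"
    using G_section_measurable[OF fst_D[OF z]] by measurable
  from integral_unit_fst[OF this] c\<^sub>l(2)[OF fst_D[OF z]] show ?thesis by (simp add: Gz_def)
qed

lemma integrable_min: "z \<in> space D \<Longrightarrow> integrable D (\<lambda>z'. min 1 (Gz z z'))"
  by (rule D.integrable_const_bound[where B=1])
    (auto simp: Gz_nonneg intro!: AE_I2 borel_measurable_min Gz_section_measurable)

lemma
  assumes z: "z \<in> space D"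
  shows gn_ge: "\<rho> n * c\<^sub>l \<le> gn n z" and gn_pos: "0 < gn n z" and gn_le_1: "gn n z \<le> 1"
proof -
  have "\<rho> n * c\<^sub>l \<le> \<rho> n * (LINT z'|D. min 1 (Gz z z'))"
    using rho_range[of n] min_ge_cl[OF z] by (intro mult_left_mono) auto
  also have "\<dots> = (LINT z'|D. \<rho> n * min 1 (Gz z z'))" by simp
  also have "\<dots> \<le> gn n z"
    unfolding gn_def
  proof (rule integral_mono)
    show "integrable D (\<lambda>z'. \<rho> n * min 1 (Gz z z'))"
      by (intro integrable_mult_right impI integrable_min[OF z])
    show "\<rho> n * min 1 (Gz z z') \<le> pr n z z'" if "z' \<in> space D" for z'
      using pr_ge[OF z that, of n] by (simp add: Gz_def)
  qed (rule integrable_pr[OF z])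
  finally show *: "\<rho> n * c\<^sub>l \<le> gn n z" .
  have "0 < \<rho> n * c\<^sub>l" using rho_range[of n] c\<^sub>l(1) by simp
  with * show "0 < gn n z" by linarith
  have "gn n z \<le> (LINT z'|D. 1)"
    unfolding gn_def by (rule integral_mono[OF integrable_pr[OF z]]) (use pr_le_1[OF z] in auto)
  then show "gn n z \<le> 1" by (simp add: D.prob_space)
qed

lemma gD_ge: "z \<in> space D \<Longrightarrow> integrable D (Gz z) \<Longrightarrow> c\<^sub>l \<le> gD z"
  unfolding gD_def by (rule order.trans[OF min_ge_cl integral_mono[OF integrable_min]]) auto

lemma integrable_Gz_sq: "integrable (D \<Otimes>\<^sub>M D) (\<lambda>x. (Gz (fst x) (snd x))\<^sup>2)"
proof (rule integrableI_nonneg)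
  have "(\<integral>\<^sup>+x. ennreal ((Gz (fst x) (snd x))\<^sup>2) \<partial>(D \<Otimes>\<^sub>M D)) =
      (\<integral>\<^sup>+((u, _), (v, _)). ennreal (G u v ^ 2) \<partial>(D \<Otimes>\<^sub>M D))"
    by (simp add: Gz_def case_prod_unfold)
  also have "\<dots> \<le> ennreal (c\<^sub>u ^ 2)" by (rule c\<^sub>u) simp
  also have "\<dots> < \<infinity>" by simp
  finally show "(\<integral>\<^sup>+x. ennreal ((Gz (fst x) (snd x))\<^sup>2) \<partial>(D \<Otimes>\<^sub>M D)) < \<infinity>" .
qed auto

lemma integrable_Gz: "integrable (D \<Otimes>\<^sub>M D) (\<lambda>x. Gz (fst x) (snd x))"
  by (rule DD.P.square_integrable_imp_integrable[OF _ integrable_Gz_sq]) simp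

lemma AE_integrable_Gz: "AE z in D. integrable D (Gz z)"
  using DD.AE_integrable_fst'[OF integrable_Gz] by simp

definition G1 :: real where "G1 = (LINT x|(D \<Otimes>\<^sub>M D). Gz (fst x) (snd x))"

lemma AE_Gz_sq: "AE z in D. integrable D (\<lambda>z'. (Gz z z')\<^sup>2)"
  using DD.AE_integrable_fst'[OF integrable_Gz_sq] by simp

lemma integrable_gD_sq: "integrable D (\<lambda>z. (gD z)\<^sup>2)"
proof (rule Bochner_Integration.integrable_bound)
  show "integrable D (\<lambda>z. LINT z'|D. (Gz z z')\<^sup>2)"
    using DD.integrable_fst'[OF integrable_Gz_sq] by simp
  show "AE z in D. norm ((gD z)\<^sup>2) \<le> norm (LINT z'|D. (Gz z z')\<^sup>2)"
    using AE_Gz_sq AE_space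
  proof eventually_elim
    case (elim z)
    have "(gD z)\<^sup>2 \<le> (LINT z'|D. (Gz z z')\<^sup>2)"
      unfolding gD_def by (rule D.expectation_sq_le[OF Gz_section_measurable[OF elim(2)] elim(1)])
    then show ?case by simp
  qed
qed simp

text \<open>
  \<open>Qn\<close> is the conditional mean of the rescaled influence of a unit on its neighbours, \<open>Qf\<close> is its limit.
\<close>

definition Qn :: "nat \<Rightarrow> (unit_type \<Rightarrow> real) \<Rightarrow> unit_type \<Rightarrow> real" where
  "Qn n h z = (LINT z'|D. pr n z z' * (h z' / gn n z'))"

definition Qf :: "(unit_type \<Rightarrow> real) \<Rightarrow> unit_type \<Rightarrow> real" where
  "Qf h z = (LINT z'|D. Gz z z' * h z' / gD z')"

text \<open>The sparsity factor cancels in the second bound: edge probabilities are at most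
  \<open>\<rho> n * G\<close>, averaged ones at least \<open>\<rho> n * c\<^sub>l\<close>. This
  yields an envelope that does not depend on \<open>n\<close>.\<close>

lemma
  assumes z: "z \<in> space D" "z' \<in> space D" and h: "\<bar>h z'\<bar> \<le> C"
  shows h_over_gn_bound: "\<bar>h z' / gn n z'\<bar> \<le> C / (\<rho> n * c\<^sub>l)"
    and pr_h_bound: "\<bar>pr n z z' * (h z' / gn n z')\<bar> \<le> C / c\<^sub>l * Gz z z'"
proof -
  have r: "0 < \<rho> n * c\<^sub>l" using rho_range[of n] c\<^sub>l(1) by simp
  have C: "0 \<le> C" using h by linarith
  show *: "\<bar>h z' / gn n z'\<bar> \<le> C / (\<rho> n * c\<^sub>l)"
    unfolding abs_divide using gn_ge[OF z(2), of n] r h by (intro frac_le) auto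
  have "\<bar>pr n z z' * (h z' / gn n z')\<bar> \<le> (\<rho> n * Gz z z') * (C / (\<rho> n * c\<^sub>l))"
    unfolding abs_mult using pr_nonneg[OF z, of n] pr_le_G[OF z, of n] * r C
    by (intro mult_mono) (auto simp: Gz_def)
  also have "\<dots> = C / c\<^sub>l * Gz z z'" using rho_range[of n] by simp
  finally show "\<bar>pr n z z' * (h z' / gn n z')\<bar> \<le> C / c\<^sub>l * Gz z z'" .
qed

lemma integrable_pr_h:
  assumes z: "z \<in> space D" and h: "h \<in> borel_measurable D" "\<And>z'. z' \<in> space D \<Longrightarrow> \<bar>h z'\<bar> \<le> C"
  shows "integrable D (\<lambda>z'. pr n z z' * (h z' / gn n z'))"
proof (rule Bochner_Integration.integrable_bound)
  show "integrable D (\<lambda>z'. C / (\<rho> n * c\<^sub>l))" by simp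
  show "(\<lambda>z'. pr n z z' * (h z' / gn n z')) \<in> borel_measurable D"
    by (intro borel_measurable_times borel_measurable_divide h(1) pr_section_measurable[OF z] gn_measurable)
  show "AE z' in D. norm (pr n z z' * (h z' / gn n z')) \<le> norm (C / (\<rho> n * c\<^sub>l))"
  proof (rule AE_I2)
    fix z' assume z': "z' \<in> space D"
    have "\<bar>pr n z z' * (h z' / gn n z')\<bar> \<le> 1 * (C / (\<rho> n * c\<^sub>l))"
      unfolding abs_mult using pr_nonneg[OF z z', of n] pr_le_1[OF z z', of n]
        h_over_gn_bound[where h = h, OF z z' h(2)[OF z'], of n]
      by (intro mult_mono) auto
    then show "norm (pr n z z' * (h z' / gn n z')) \<le> norm (C / (\<rho> n * c\<^sub>l))"
      unfolding real_norm_def mult_1 by (rule order.trans[OF _ abs_ge_self])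
  qed
qed

lemma Qn_measurable: "h \<in> borel_measurable D \<Longrightarrow> Qn n h \<in> borel_measurable D"
  unfolding Qn_def by (rule D.borel_measurable_lebesgue_integral) simp

lemma Qf_measurable: "h \<in> borel_measurable D \<Longrightarrow> Qf h \<in> borel_measurable D"
  unfolding Qf_def by (rule D.borel_measurable_lebesgue_integral) simp

lemma Qn_bound:
  assumes z: "z \<in> space D" and h: "h \<in> borel_measurable D" "\<And>z'. z' \<in> space D \<Longrightarrow> \<bar>h z'\<bar> \<le> C"
  shows "\<bar>Qn n h z\<bar> \<le> C / (\<rho> n * c\<^sub>l)"
    and "integrable D (Gz z) \<Longrightarrow> \<bar>Qn n h z\<bar> \<le> C / c\<^sub>l * gD z"
proof -
  have i: "integrable D (\<lambda>z'. \<bar>pr n z z' * (h z' / gn n z')\<bar>)"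
    using integrable_pr_h[OF z h, of n] by (rule Bochner_Integration.integrable_abs)
  have b: "\<bar>pr n z z' * (h z' / gn n z')\<bar> \<le> C / (\<rho> n * c\<^sub>l)" if z': "z' \<in> space D" for z'
  proof -
    have "\<bar>pr n z z' * (h z' / gn n z')\<bar> \<le> 1 * (C / (\<rho> n * c\<^sub>l))"
      unfolding abs_mult using pr_nonneg[OF z z', of n] pr_le_1[OF z z', of n]
        h_over_gn_bound[where h = h, OF z z' h(2)[OF z'], of n]
      by (intro mult_mono) auto
    then show ?thesis by simp
  qed
  have a: "\<bar>Qn n h z\<bar> \<le> (LINT z'|D. \<bar>pr n z z' * (h z' / gn n z')\<bar>)"
    unfolding Qn_def by (rule integral_abs_bound)
  also have "\<dots> \<le> (LINT z'|D. C / (\<rho> n * c\<^sub>l))"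
    by (rule integral_mono[OF i]) (use b in auto)
  finally show "\<bar>Qn n h z\<bar> \<le> C / (\<rho> n * c\<^sub>l)" by (simp add: D.prob_space)
  assume G: "integrable D (Gz z)"
  have "(LINT z'|D. \<bar>pr n z z' * (h z' / gn n z')\<bar>) \<le> (LINT z'|D. C / c\<^sub>l * Gz z z')"
    by (rule integral_mono[OF i]) (use G pr_h_bound[OF z _ h(2)] in auto)
  with a show "\<bar>Qn n h z\<bar> \<le> C / c\<^sub>l * gD z" by (simp add: gD_def)
qed

text \<open>The rescaled influence of \<open>c\<close>, with the degree of each neighbour replaced
  by its conditional mean. This makes the summands independent and identically distributed given
  unit \<open>c\<close>, with mean \<open>Qn n h\<close>. Both the slope
  \<open>h = dslope \<pi>\<close> and the constant \<open>h = 1\<close> are used later.\<close>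

definition Qt :: "nat \<Rightarrow> (unit_type \<Rightarrow> real) \<Rightarrow> nat \<Rightarrow> 'a \<Rightarrow> real" where
  "Qt n h c \<omega> = (\<Sum>i\<in>{..<n} - {c}. of_bool (E n c i \<omega>) * (h (Z n i \<omega>) / gn n (Z n i \<omega>))) / (real n - 1)"

lemma prod_two:
  fixes f :: "'i \<Rightarrow> 'b::comm_monoid_mult"
  assumes "finite J" "i \<in> J" "k \<in> J" "i \<noteq> k"
  shows "(\<Prod>j\<in>J. if j \<in> {i, k} then f j else 1) = f i * f k"
proof -
  have "(\<Prod>j\<in>J. if j \<in> {i, k} then f j else 1) = (\<Prod>j\<in>J \<inter> {i, k}. f j)"
    using assms(1) by (rule prod.inter_restrict[symmetric])
  also have "J \<inter> {i, k} = {i, k}" using assms by auto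
  finally show ?thesis using assms(4) by simp
qed

lemma prod_one:
  fixes f :: "'i \<Rightarrow> 'b::comm_monoid_mult"
  assumes "finite J" "i \<in> J"
  shows "(\<Prod>j\<in>J. if j = i then f j else 1) = f i"
  using assms by (simp add: prod.delta)

text \<open>Given the centre, \<open>Qt\<close> is an average of \<open>n - 1\<close> independent
  variables with mean \<open>Qn\<close>, so its variance is that of one summand divided by
  \<open>n - 1\<close>. A summand is at most \<open>C / (\<rho> n * c\<^sub>l)\<close> and nonzero
  with probability at most \<open>\<rho> n * G\<close>, which leaves a single factor
  \<open>1 / \<rho> n\<close>.\<close>

lemma Qt_variance:
  assumes c: "c < n" and n: "2 \<le> n"
    and h: "h \<in> borel_measurable D" "\<And>z'. z' \<in> space D \<Longrightarrow> \<bar>h z'\<bar> \<le> C"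
  shows "integrable (M n) (\<lambda>\<omega>. (Qt n h c \<omega> - Qn n h (Z n c \<omega>))\<^sup>2)"
    and "(LINT \<omega>|M n. (Qt n h c \<omega> - Qn n h (Z n c \<omega>))\<^sup>2) \<le> C\<^sup>2 * G1 / ((real n - 1) * \<rho> n * c\<^sub>l\<^sup>2)"
proof -
  define \<phi> where "\<phi> z = h z / gn n z" for z
  define C1 where "C1 = C / (\<rho> n * c\<^sub>l)"
  define J where "J = {..<n} - {c}"
  define \<Xi> where "\<Xi> z z' b = of_bool b * \<phi> z' - Qn n h z" for z z' b
  define \<xi> where "\<xi> i \<omega> = \<Xi> (Z n c \<omega>) (Z n i \<omega>) (E n c i \<omega>)" for i \<omega>
  have r: "0 < \<rho> n" using rho_range[of n] by simp
  have cJ: "card J = n - 1" "finite J" using c by (auto simp: J_def)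
  have rn: "0 < real n - 1" "real (card J) = real n - 1" using n cJ by auto
  have \<phi>m: "\<phi> \<in> borel_measurable D" using h(1) by (simp add: \<phi>_def[abs_def])
  note Qm = Qn_measurable[OF h(1), of n]
  have \<phi>b: "\<bar>\<phi> z\<bar> \<le> C1" if "z \<in> space D" for z
    using h_over_gn_bound[where h = h, OF that that h(2)[OF that], of n] by (simp add: \<phi>_def C1_def)
  have Qb: "\<bar>Qn n h z\<bar> \<le> C1" if "z \<in> space D" for z
    using Qn_bound(1)[OF that h, of n] by (simp add: C1_def)
  obtain z0 where "z0 \<in> space D" using D.not_empty by auto
  then have C1: "0 \<le> C1" using \<phi>b[of z0] by linarith
  have \<Xi>m: "(\<lambda>x. \<Xi> (fst x) (snd x) b) \<in> borel_measurable (D \<Otimes>\<^sub>M D)" for b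
    unfolding \<Xi>_def using \<phi>m Qm by measurable
  have \<Xi>b: "\<bar>\<Xi> z z' b\<bar> \<le> 2 * C1" if "z \<in> space D" "z' \<in> space D" for z z' b
    using \<phi>b[OF that(2)] Qb[OF that(1)] by (cases b) (auto simp: \<Xi>_def)
  have \<xi>b: "\<bar>\<xi> i \<omega>\<bar> \<le> 2 * C1" if "i \<in> J" "\<omega> \<in> space (M n)" for i \<omega>
    unfolding \<xi>_def using that c by (intro \<Xi>b Z_space) (auto simp: J_def)
  have \<xi>m: "\<xi> i \<in> borel_measurable (M n)" if i: "i \<in> J" for i
  proof -
    have i: "i < n" using i by (simp add: J_def)
    have "(\<lambda>\<omega>. of_bool (E n c i \<omega>) :: real) \<in> borel_measurable (M n)"
      using measurable_compose[OF E_measurable[OF c i], of of_bool borel] by simp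
    then show ?thesis
      unfolding \<xi>_def \<Xi>_def
      using measurable_compose[OF Z_measurable[OF i] \<phi>m] measurable_compose[OF Z_measurable[OF c] Qm] by simp
  qed
  have int2: "integrable (M n) (\<lambda>\<omega>. \<xi> i \<omega> * \<xi> k \<omega>)" if "i \<in> J" "k \<in> J" for i k
  proof (rule M.integrable_const_bound[where B = "2 * C1 * (2 * C1)"])
    show "AE \<omega> in M n. norm (\<xi> i \<omega> * \<xi> k \<omega>) \<le> 2 * C1 * (2 * C1)"
    proof (rule AE_I2)
      fix \<omega> assume \<omega>: "\<omega> \<in> space (M n)"
      show "norm (\<xi> i \<omega> * \<xi> k \<omega>) \<le> 2 * C1 * (2 * C1)"
        unfolding real_norm_def abs_mult using C1
        by (intro mult_mono \<xi>b[OF that(1) \<omega>] \<xi>b[OF that(2) \<omega>]) auto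
    qed
  qed (use \<xi>m[OF that(1)] \<xi>m[OF that(2)] in simp)
  have ip: "integrable D (\<lambda>z'. pr n z z' * \<phi> z')" if "z \<in> space D" for z
    unfolding \<phi>_def by (rule integrable_pr_h[OF that h])
  have Qn_eq: "Qn n h z = (LINT z'|D. pr n z z' * \<phi> z')" for z
    by (simp add: Qn_def \<phi>_def)
  \<comment> \<open>The centred summands enter \<open>star_law\<close> as functions of centre,
    neighbour and edge, and all units other than \<open>i\<close> and \<open>k\<close> get the
    factor 1. The factor of neighbour \<open>i\<close> alone already integrates to 0.\<close>
  have cross: "(LINT \<omega>|M n. \<xi> i \<omega> * \<xi> k \<omega>) = 0" if ik: "i \<in> J" "k \<in> J" "i \<noteq> k" for i k
  proof -
    define \<psi> where "\<psi> j z z' b = (if j \<in> {i, k} then \<Xi> z z' b else 1)" for j z z' b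
    have "(LINT \<omega>|M n. \<xi> i \<omega> * \<xi> k \<omega>) =
        (LINT \<omega>|M n. (\<Prod>j\<in>{..<n} - {c}. \<psi> j (Z n c \<omega>) (Z n j \<omega>) (E n c j \<omega>)))"
      unfolding \<psi>_def J_def[symmetric] \<xi>_def
      by (subst prod_two[OF cJ(2) ik]) simp
    also have "\<dots> = (LINT z|D. (\<Prod>j\<in>{..<n} - {c}. (LINT z'|D. pr n z z' * \<psi> j z z' True + (1 - pr n z z') * \<psi> j z z' False)))"
    proof (rule star_law[OF c])
      show "(\<lambda>x. \<psi> j (fst x) (snd x) b) \<in> borel_measurable (D \<Otimes>\<^sub>M D)" for j b
        unfolding \<psi>_def using \<Xi>m[of b] by simp
      show "\<bar>\<psi> j z z' b\<bar> \<le> 1 + 2 * C1" if "z \<in> space D" "z' \<in> space D" for j z z' b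
        unfolding \<psi>_def using \<Xi>b[OF that, of b] C1 by auto
    qed
    also have "\<dots> = (LINT z|D. 0)"
    proof (rule Bochner_Integration.integral_cong[OF refl])
      fix z assume z: "z \<in> space D"
      have "(LINT z'|D. pr n z z' * \<psi> i z z' True + (1 - pr n z z') * \<psi> i z z' False) =
          (LINT z'|D. pr n z z' * \<phi> z' - Qn n h z)"
        by (rule Bochner_Integration.integral_cong[OF refl]) (simp add: \<psi>_def \<Xi>_def algebra_simps)
      also have "\<dots> = 0"
        using ip[OF z] by (simp add: Qn_eq[symmetric] D.prob_space)
      finally show "(\<Prod>j\<in>{..<n} - {c}. (LINT z'|D. pr n z z' * \<psi> j z z' True + (1 - pr n z z') * \<psi> j z z' False)) = 0"
        using ik(1) by (intro prod_zero) (auto simp: J_def)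
    qed
    finally show ?thesis by simp
  qed
  have diag: "(LINT \<omega>|M n. \<xi> i \<omega> * \<xi> i \<omega>) \<le> C\<^sup>2 * G1 / (\<rho> n * c\<^sub>l\<^sup>2)" if i: "i \<in> J" for i
  proof -
    define \<psi> where "\<psi> j z z' b = (if j = i then (\<Xi> z z' b)\<^sup>2 else 1)" for j z z' b
    have "(LINT \<omega>|M n. \<xi> i \<omega> * \<xi> i \<omega>) =
        (LINT \<omega>|M n. (\<Prod>j\<in>{..<n} - {c}. \<psi> j (Z n c \<omega>) (Z n j \<omega>) (E n c j \<omega>)))"
      unfolding \<psi>_def J_def[symmetric] \<xi>_def
      by (subst prod_one[OF cJ(2) i]) (simp add: power2_eq_square)
    also have "\<dots> = (LINT z|D. (\<Prod>j\<in>{..<n} - {c}. (LINT z'|D. pr n z z' * \<psi> j z z' True + (1 - pr n z z') * \<psi> j z z' False)))"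
    proof (rule star_law[OF c])
      show "(\<lambda>x. \<psi> j (fst x) (snd x) b) \<in> borel_measurable (D \<Otimes>\<^sub>M D)" for j b
        unfolding \<psi>_def using \<Xi>m[of b] by simp
      show "\<bar>\<psi> j z z' b\<bar> \<le> 1 + (2 * C1)\<^sup>2" if "z \<in> space D" "z' \<in> space D" for j z z' b
        unfolding \<psi>_def using power_mono[OF \<Xi>b[OF that, of b], of 2] C1 by auto
    qed
    also have "\<dots> \<le> (LINT z|D. C1\<^sup>2 * (LINT z'|D. \<rho> n * Gz z z'))"
    proof (rule integral_mono_AE')
      have "integrable D (\<lambda>z. LINT z'|D. Gz z z')" using DD.integrable_fst'[OF integrable_Gz] by simp
      then show "integrable D (\<lambda>z. C1\<^sup>2 * (LINT z'|D. \<rho> n * Gz z z'))" by simp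
      have le: "0 \<le> (\<Prod>j\<in>{..<n} - {c}. (LINT z'|D. pr n z z' * \<psi> j z z' True + (1 - pr n z z') * \<psi> j z z' False)) \<and>
          (integrable D (Gz z) \<longrightarrow> (\<Prod>j\<in>{..<n} - {c}. (LINT z'|D. pr n z z' * \<psi> j z z' True + (1 - pr n z z') * \<psi> j z z' False))
          \<le> C1\<^sup>2 * (LINT z'|D. \<rho> n * Gz z z'))" if z: "z \<in> space D" for z
      proof -
        have one: "(LINT z'|D. pr n z z' * \<psi> j z z' True + (1 - pr n z z') * \<psi> j z z' False) =
            (if j = i then (LINT z'|D. pr n z z' * (\<Xi> z z' True)\<^sup>2 + (1 - pr n z z') * (\<Xi> z z' False)\<^sup>2) else 1)" for j
          by (simp add: \<psi>_def D.prob_space)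
        have "(\<Prod>j\<in>{..<n} - {c}. (LINT z'|D. pr n z z' * \<psi> j z z' True + (1 - pr n z z') * \<psi> j z z' False)) =
            (LINT z'|D. pr n z z' * (\<Xi> z z' True)\<^sup>2 + (1 - pr n z z') * (\<Xi> z z' False)\<^sup>2)"
          unfolding one J_def[symmetric] by (rule prod_one[OF cJ(2) i])
        moreover have "0 \<le> (LINT z'|D. pr n z z' * (\<Xi> z z' True)\<^sup>2 + (1 - pr n z z') * (\<Xi> z z' False)\<^sup>2)"
          by (intro integral_nonneg_AE AE_I2 add_nonneg_nonneg mult_nonneg_nonneg)
            (use pr_nonneg[OF z] pr_le_1[OF z] in auto)
        moreover have "(LINT z'|D. pr n z z' * (\<Xi> z z' True)\<^sup>2 + (1 - pr n z z') * (\<Xi> z z' False)\<^sup>2) \<le>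
            C1\<^sup>2 * (LINT z'|D. \<rho> n * Gz z z')" if G: "integrable D (Gz z)"
        proof -
          have isq: "integrable D (\<lambda>z'. pr n z z' * (\<phi> z')\<^sup>2)"
          proof (rule D.integrable_const_bound[where B = "C1\<^sup>2"])
            have "pr n z z' * (\<phi> z')\<^sup>2 \<le> 1 * C1\<^sup>2" if "z' \<in> space D" for z'
              using power_mono[OF \<phi>b[OF that], of 2] pr_le_1[OF z that, of n] by (intro mult_mono) auto
            then show "AE z' in D. norm (pr n z z' * (\<phi> z')\<^sup>2) \<le> C1\<^sup>2"
              by (intro AE_I2) (simp add: abs_mult pr_nonneg[OF z])
          qed (intro borel_measurable_times borel_measurable_power pr_section_measurable[OF z] \<phi>m)
          have "(LINT z'|D. pr n z z' * (\<Xi> z z' True)\<^sup>2 + (1 - pr n z z') * (\<Xi> z z' False)\<^sup>2) =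
              (LINT z'|D. pr n z z' * (\<phi> z')\<^sup>2 - 2 * Qn n h z * (pr n z z' * \<phi> z') + (Qn n h z)\<^sup>2)"
            by (rule Bochner_Integration.integral_cong[OF refl]) (simp add: \<Xi>_def power2_eq_square algebra_simps)
          also have "\<dots> = (LINT z'|D. pr n z z' * (\<phi> z')\<^sup>2) - 2 * Qn n h z * Qn n h z + (Qn n h z)\<^sup>2"
            using isq ip[OF z] by (simp add: Qn_eq[symmetric] D.prob_space)
          also have "\<dots> \<le> (LINT z'|D. pr n z z' * (\<phi> z')\<^sup>2)" by (simp add: power2_eq_square)
          also have "\<dots> \<le> (LINT z'|D. (\<rho> n * Gz z z') * C1\<^sup>2)"
          proof (rule integral_mono[OF isq])
            show "integrable D (\<lambda>z'. (\<rho> n * Gz z z') * C1\<^sup>2)" using G by simp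
            fix z' assume z': "z' \<in> space D"
            show "pr n z z' * (\<phi> z')\<^sup>2 \<le> (\<rho> n * Gz z z') * C1\<^sup>2"
              using power_mono[OF \<phi>b[OF z'], of 2] pr_le_G[OF z z', of n] pr_nonneg[OF z z', of n]
              by (intro mult_mono) (auto simp: Gz_def)
          qed
          finally show ?thesis by (simp add: mult_ac)
        qed
        ultimately show ?thesis by simp
      qed
      show "AE z in D. (\<Prod>j\<in>{..<n} - {c}. (LINT z'|D. pr n z z' * \<psi> j z z' True + (1 - pr n z z') * \<psi> j z z' False))
          \<le> C1\<^sup>2 * (LINT z'|D. \<rho> n * Gz z z')"
        using AE_integrable_Gz AE_space by eventually_elim (use le in blast)
      show "AE z in D. 0 \<le> C1\<^sup>2 * (LINT z'|D. \<rho> n * Gz z z')"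
        by (intro AE_I2 mult_nonneg_nonneg integral_nonneg_AE) (use r Gz_nonneg in auto)
    qed
    also have "\<dots> = C1\<^sup>2 * (\<rho> n * G1)"
      unfolding G1_def using DD.integral_fst'[OF integrable_Gz] by simp
    also have "\<dots> = C\<^sup>2 * G1 / (\<rho> n * c\<^sub>l\<^sup>2)"
      using r by (simp add: C1_def power2_eq_square field_simps)
    finally show ?thesis .
  qed
  have expand: "(Qt n h c \<omega> - Qn n h (Z n c \<omega>))\<^sup>2 = (\<Sum>i\<in>J. \<Sum>k\<in>J. \<xi> i \<omega> * \<xi> k \<omega>) / (real n - 1)\<^sup>2" for \<omega>
  proof -
    have "(\<Sum>i\<in>J. \<xi> i \<omega>) = (\<Sum>i\<in>J. of_bool (E n c i \<omega>) * \<phi> (Z n i \<omega>)) - (real n - 1) * Qn n h (Z n c \<omega>)"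
      unfolding \<xi>_def \<Xi>_def sum_subtractf sum_constant using rn(2) by simp
    then have "Qt n h c \<omega> - Qn n h (Z n c \<omega>) = (\<Sum>i\<in>J. \<xi> i \<omega>) / (real n - 1)"
      unfolding Qt_def J_def[symmetric] \<phi>_def[symmetric] using rn(1) by (simp add: diff_divide_distrib)
    then show ?thesis
      by (simp add: power_divide power2_eq_square[of "sum _ _"] sum_product)
  qed
  show "integrable (M n) (\<lambda>\<omega>. (Qt n h c \<omega> - Qn n h (Z n c \<omega>))\<^sup>2)"
    unfolding expand by (intro integrable_divide Bochner_Integration.integrable_sum int2) auto
  have "(LINT \<omega>|M n. (Qt n h c \<omega> - Qn n h (Z n c \<omega>))\<^sup>2) = (\<Sum>i\<in>J. \<Sum>k\<in>J. (LINT \<omega>|M n. \<xi> i \<omega> * \<xi> k \<omega>)) / (real n - 1)\<^sup>2"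
    unfolding expand using int2 by (simp add: Bochner_Integration.integral_sum Bochner_Integration.integrable_sum)
  also have "(\<Sum>i\<in>J. \<Sum>k\<in>J. (LINT \<omega>|M n. \<xi> i \<omega> * \<xi> k \<omega>)) = (\<Sum>i\<in>J. \<Sum>k\<in>J. if k = i then (LINT \<omega>|M n. \<xi> i \<omega> * \<xi> i \<omega>) else 0)"
    by (intro sum.cong refl) (auto simp: cross)
  also have "\<dots> = (\<Sum>i\<in>J. (LINT \<omega>|M n. \<xi> i \<omega> * \<xi> i \<omega>))"
    using cJ(2) by (simp add: sum.delta)
  also have "\<dots> \<le> (\<Sum>i\<in>J. C\<^sup>2 * G1 / (\<rho> n * c\<^sub>l\<^sup>2))"
    by (intro sum_mono diag)
  also have "\<dots> = (real n - 1) * (C\<^sup>2 * G1 / (\<rho> n * c\<^sub>l\<^sup>2))"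
    unfolding sum_constant rn(2) ..
  finally have "(LINT \<omega>|M n. (Qt n h c \<omega> - Qn n h (Z n c \<omega>))\<^sup>2) \<le> (real n - 1) * (C\<^sup>2 * G1 / (\<rho> n * c\<^sub>l\<^sup>2)) / (real n - 1)\<^sup>2"
    by (simp add: divide_right_mono)
  also have "\<dots> = C\<^sup>2 * G1 / ((real n - 1) * \<rho> n * c\<^sub>l\<^sup>2)"
    using rn(1) by (simp add: power2_eq_square mult_ac)
  finally show "(LINT \<omega>|M n. (Qt n h c \<omega> - Qn n h (Z n c \<omega>))\<^sup>2) \<le> C\<^sup>2 * G1 / ((real n - 1) * \<rho> n * c\<^sub>l\<^sup>2)" .
qed

section \<open>Concentration of the degrees\<close>

lemma E_of_bool_measurable: "i < n \<Longrightarrow> j < n \<Longrightarrow> (\<lambda>\<omega>. of_bool (E n i j \<omega>) :: real) \<in> borel_measurable (GG n)"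
  using measurable_compose[OF E_GG, of i n j of_bool borel] by simp

lemma gn_Z_measurable: "i < n \<Longrightarrow> (\<lambda>\<omega>. gn n (Z n i \<omega>)) \<in> borel_measurable (GG n)"
  by (rule measurable_compose[OF Z_GG gn_measurable])

text \<open>Chernoff's bound, with \<open>s\<close> selecting the tail. Given unit \<open>i\<close>,
  the exponential moment is a product over the other units in which each factor is at most
  \<open>exp (- gn * \<delta>^2 / 4)\<close>.\<close>

lemma degree_tail_bound:
  assumes i: "i < n" and n: "2 \<le> n" and \<delta>: "0 < \<delta>" "\<delta> \<le> 1" and s: "s = 1 \<or> s = - 1"
  shows "measure (M n) {\<omega> \<in> space (M n). \<delta> * ((real n - 1) * gn n (Z n i \<omega>)) <
      s * (deg n (Gr n \<omega>) i - (real n - 1) * gn n (Z n i \<omega>))} \<le> exp (- ((real n - 1) * \<rho> n * c\<^sub>l * \<delta>\<^sup>2 / 4))"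
    (is "measure _ ?A \<le> _")
proof -
  define m where "m = real n - 1"
  define J where "J = {..<n} - {i}"
  have J: "real (card J) = m" "card J = n - 1" "finite J" using i n by (auto simp: J_def m_def)
  \<comment> \<open>The Chernoff parameter \<open>\<delta> / 2\<close> minimises
    \<open>x^2 - \<delta> * x\<close>, the bound on the exponent per unit of expected degree; the
    minimum is the origin of the constant 1/4.\<close>
  define \<psi> where "\<psi> j z z' b = exp (\<delta> / 2 * (s * (of_bool b - gn n z) - \<delta> * gn n z))"
    for j :: nat and z z' :: unit_type and b
  define Y where "Y \<omega> = (\<Prod>j\<in>J. \<psi> j (Z n i \<omega>) (Z n j \<omega>) (E n i j \<omega>))" for \<omega>
  have Y_eq: "Y \<omega> = exp (\<delta> / 2 * (s * (deg n (Gr n \<omega>) i - m * gn n (Z n i \<omega>)) - \<delta> * (m * gn n (Z n i \<omega>))))" for \<omega>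
  proof -
    have "(\<Sum>j\<in>J. \<delta> / 2 * (s * (of_bool (E n i j \<omega>) - gn n (Z n i \<omega>)) - \<delta> * gn n (Z n i \<omega>))) =
        \<delta> / 2 * (s * ((\<Sum>j\<in>J. of_bool (E n i j \<omega>)) - real (card J) * gn n (Z n i \<omega>)) - \<delta> * (real (card J) * gn n (Z n i \<omega>)))"
      by (simp only: sum_distrib_left[symmetric] sum_subtractf sum_constant right_diff_distrib mult.left_commute[of "real (card J)"])
    then show ?thesis
      unfolding Y_def \<psi>_def exp_sum[OF J(3), symmetric] J(1) deg_def J_def[symmetric] by simp
  qed
  have \<psi>b: "\<bar>\<psi> j z z' b\<bar> \<le> exp 3" if "z \<in> space D" for j z z' b
  proof -
    have g: "0 \<le> gn n z" "gn n z \<le> 1" using gn_pos[OF that, of n] gn_le_1[OF that, of n] by auto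
    have "s * (of_bool b - gn n z) \<le> 1" using s g by (cases b) auto
    moreover have "0 \<le> \<delta> * gn n z" using g \<delta> by simp
    ultimately have "\<delta> / 2 * (s * (of_bool b - gn n z) - \<delta> * gn n z) \<le> \<delta> / 2 * 1"
      using \<delta> by (intro mult_left_mono) linarith+
    also have "\<dots> \<le> 3" using \<delta> by simp
    finally show ?thesis by (simp add: \<psi>_def)
  qed
  have Ymeas: "Y \<in> borel_measurable (M n)"
    unfolding Y_eq[abs_def]
    using GG_to_M[OF deg_GG[OF i]] GG_to_M[OF gn_Z_measurable[OF i]] by measurable
  have A: "?A \<in> sets (M n)"
    using GG_to_M[OF deg_GG[OF i]] GG_to_M[OF gn_Z_measurable[OF i]] by measurable
  have Yb: "\<bar>Y \<omega>\<bar> \<le> exp 3 ^ card J" if "\<omega> \<in> space (M n)" for \<omega>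
  proof -
    have "\<bar>Y \<omega>\<bar> \<le> (\<Prod>j\<in>J. exp 3)"
      unfolding Y_def abs_prod by (intro prod_mono conjI \<psi>b Z_space[OF i that]) auto
    then show ?thesis by simp
  qed
  have iY: "integrable (M n) Y"
    by (rule M.integrable_const_bound[where B = "exp 3 ^ card J"]) (use Yb Ymeas in auto)
  have "measure (M n) ?A = (LINT \<omega>|M n. indicator ?A \<omega>)" using A by simp
  also have "\<dots> \<le> (LINT \<omega>|M n. Y \<omega>)"
  proof (rule integral_mono[OF _ iY])
    show "integrable (M n) (indicator ?A :: 'a \<Rightarrow> real)"
      using A by (intro integrable_real_indicator) (auto simp: M.emeasure_eq_measure)
    fix \<omega>
    have "1 \<le> Y \<omega>" if "\<omega> \<in> ?A" using that \<delta> unfolding Y_eq m_def by auto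
    moreover have "0 \<le> Y \<omega>" by (simp add: Y_eq)
    ultimately show "indicator ?A \<omega> \<le> Y \<omega>" by (auto simp: indicator_def)
  qed
  also have "\<dots> = (LINT z|D. (\<Prod>j\<in>{..<n} - {i}. (LINT z'|D. pr n z z' * \<psi> j z z' True + (1 - pr n z z') * \<psi> j z z' False)))"
    unfolding Y_def J_def
  proof (rule star_law[OF i])
    show "(\<lambda>x. \<psi> j (fst x) (snd x) b) \<in> borel_measurable (D \<Otimes>\<^sub>M D)" for j b
      unfolding \<psi>_def by measurable
    show "\<bar>\<psi> j z z' b\<bar> \<le> exp 3" if "z \<in> space D" "z' \<in> space D" for j z z' b
      by (rule \<psi>b[OF that(1)])
  qed
  also have "\<dots> \<le> (LINT z|D. exp (- (m * \<rho> n * c\<^sub>l * \<delta>\<^sup>2 / 4)))"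
  proof (rule integral_mono_AE')
    have k: "0 \<le> (LINT z'|D. pr n z z' * \<psi> j z z' True + (1 - pr n z z') * \<psi> j z z' False) \<and>
        (LINT z'|D. pr n z z' * \<psi> j z z' True + (1 - pr n z z') * \<psi> j z z' False) \<le> exp (- (\<rho> n * c\<^sub>l * \<delta>\<^sup>2 / 4))"
      if z: "z \<in> space D" for z j
    proof -
      define x where "x = s * \<delta> / 2"
      define t where "t = \<delta> / 2 * (- s * gn n z - \<delta> * gn n z)"
      have x: "\<bar>x\<bar> \<le> 1" "x\<^sup>2 = \<delta>\<^sup>2 / 4" using s \<delta> by (auto simp: x_def power2_eq_square)
      have g: "0 < gn n z" by (rule gn_pos[OF z])
      have \<psi>1: "\<psi> j z z' True = exp t * exp x" and \<psi>0: "\<psi> j z z' False = exp t" for z'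
        by (simp_all add: \<psi>_def t_def x_def algebra_simps flip: exp_add)
      have "(LINT z'|D. pr n z z' * \<psi> j z z' True + (1 - pr n z z') * \<psi> j z z' False) =
          (LINT z'|D. (exp t * (exp x - 1)) * pr n z z' + exp t)"
        unfolding \<psi>1 \<psi>0 by (rule Bochner_Integration.integral_cong[OF refl]) (simp add: algebra_simps)
      also have "\<dots> = (exp t * (exp x - 1)) * gn n z + exp t"
        using integrable_pr[OF z, of n] by (simp add: gn_def D.prob_space)
      also have "\<dots> = exp t * (1 + gn n z * (exp x - 1))" by (simp add: algebra_simps)
      finally have eq: "(LINT z'|D. pr n z z' * \<psi> j z z' True + (1 - pr n z z') * \<psi> j z z' False) =
          exp t * (1 + gn n z * (exp x - 1))" .
      have "1 + gn n z * (exp x - 1) \<le> exp (gn n z * (exp x - 1))" by (rule exp_ge_add_one_self)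
      also have "\<dots> \<le> exp (gn n z * (x + x\<^sup>2))"
        using exp_le_quadratic[OF x(1)] g by simp
      finally have "exp t * (1 + gn n z * (exp x - 1)) \<le> exp t * exp (gn n z * (x + x\<^sup>2))"
        by (intro mult_left_mono) auto
      also have "\<dots> = exp (- (gn n z * \<delta>\<^sup>2 / 4))"
        using s unfolding x(2) t_def x_def by (auto simp: algebra_simps power2_eq_square simp flip: exp_add)
      also have "\<dots> \<le> exp (- (\<rho> n * c\<^sub>l * \<delta>\<^sup>2 / 4))"
        using mult_right_mono[OF gn_ge[OF z, of n], of "\<delta>\<^sup>2 / 4"] by simp
      finally have "exp t * (1 + gn n z * (exp x - 1)) \<le> exp (- (\<rho> n * c\<^sub>l * \<delta>\<^sup>2 / 4))" .
      moreover have "0 \<le> exp t * (1 + gn n z * (exp x - 1))"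
      proof -
        have "0 \<le> gn n z * exp x" "gn n z \<le> 1" using g gn_le_1[OF z] by auto
        then show ?thesis by (intro mult_nonneg_nonneg) (auto simp: algebra_simps)
      qed
      ultimately show ?thesis unfolding eq by simp
    qed
    have "(\<Prod>j\<in>{..<n} - {i}. (LINT z'|D. pr n z z' * \<psi> j z z' True + (1 - pr n z z') * \<psi> j z z' False))
        \<le> exp (- (m * \<rho> n * c\<^sub>l * \<delta>\<^sup>2 / 4))" if z: "z \<in> space D" for z
    proof -
      have "(\<Prod>j\<in>J. (LINT z'|D. pr n z z' * \<psi> j z z' True + (1 - pr n z z') * \<psi> j z z' False))
          \<le> (\<Prod>j\<in>J. exp (- (\<rho> n * c\<^sub>l * \<delta>\<^sup>2 / 4)))"
        by (intro prod_mono k z)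
      also have "\<dots> = exp (real (card J) * - (\<rho> n * c\<^sub>l * \<delta>\<^sup>2 / 4))"
        by (simp only: prod_constant exp_of_nat_mult)
      also have "\<dots> = exp (- (m * \<rho> n * c\<^sub>l * \<delta>\<^sup>2 / 4))"
        unfolding J(1) by (simp add: mult_ac)
      finally show ?thesis by (simp add: J_def)
    qed
    then show "AE z in D. (\<Prod>j\<in>{..<n} - {i}. (LINT z'|D. pr n z z' * \<psi> j z z' True + (1 - pr n z z') * \<psi> j z z' False))
        \<le> exp (- (m * \<rho> n * c\<^sub>l * \<delta>\<^sup>2 / 4))" by (intro AE_I2)
  qed auto
  also have "\<dots> = exp (- (m * \<rho> n * c\<^sub>l * \<delta>\<^sup>2 / 4))" by (simp add: D.prob_space)
  finally show ?thesis by (simp add: m_def)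
qed

text \<open>
  The exponent makes \<open>deg_tol\<close> vanish while \<open>n \<rho>\<^sub>n deg_tol\<^sup>2 = (n \<rho>\<^sub>n)\<^sup>1\<^sup>/\<^sup>2\<close> still exceeds a power of \<open>n\<close>, so
  that the Chernoff bounds for the degrees survive the union bound over all units.
\<close>

definition deg_tol :: "nat \<Rightarrow> real" where "deg_tol n = (real n * \<rho> n) powr (- 1 / 4)"

definition Good :: "nat \<Rightarrow> 'a set" where
  "Good n = {\<omega> \<in> space (M n). \<forall>i\<in>{..<n}. \<bar>deg n (Gr n \<omega>) i - (real n - 1) * gn n (Z n i \<omega>)\<bar> \<le>
     deg_tol n * ((real n - 1) * gn n (Z n i \<omega>))}"

lemma Good_GG: "Good n \<in> sets (GG n)"
proof -
  have "{\<omega> \<in> space (GG n). \<forall>i\<in>{..<n}. \<bar>deg n (Gr n \<omega>) i - (real n - 1) * gn n (Z n i \<omega>)\<bar> \<le>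
     deg_tol n * ((real n - 1) * gn n (Z n i \<omega>))} \<in> sets (GG n)"
  proof (rule sets.sets_Collect_finite_All)
    fix i assume "i \<in> {..<n}"
    then have i: "i < n" by simp
    show "{\<omega> \<in> space (GG n). \<bar>deg n (Gr n \<omega>) i - (real n - 1) * gn n (Z n i \<omega>)\<bar> \<le>
        deg_tol n * ((real n - 1) * gn n (Z n i \<omega>))} \<in> sets (GG n)"
      using deg_GG[OF i] gn_Z_measurable[OF i] by measurable
  qed simp
  then show ?thesis by (simp add: Good_def)
qed

lemma Good_M: "Good n \<in> sets (M n)"
  using Good_GG subalgebra_GG by (auto simp: subalgebra_def)

text \<open>Any \<open>y\<close> strictly between -1 and the limit inferior satisfies
  \<open>n^y \<le> \<rho> n\<close> for large \<open>n\<close>, so \<open>y + 1\<close> serves as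
  \<open>\<epsilon>\<close>.\<close>

lemma sparsity_powr: "\<exists>\<epsilon>>0. \<forall>\<^sub>F n in sequentially. real n powr \<epsilon> \<le> real n * \<rho> n"
proof -
  obtain y where y: "- 1 < ereal y" "ereal y < liminf (\<lambda>n. ereal (ln (\<rho> n) / ln (real n)))"
    using ereal_dense2[OF sparsity] by auto
  have y1: "0 < y + 1" using y(1) by (simp add: one_ereal_def)
  have "\<forall>\<^sub>F n in sequentially. ereal y < ereal (ln (\<rho> n) / ln (real n))"
    by (rule less_LiminfD[OF y(2)])
  then have "\<forall>\<^sub>F n in sequentially. real n powr (y + 1) \<le> real n * \<rho> n"
    using eventually_ge_at_top[of 2]
  proof eventually_elim
    case (elim n)
    then have n: "2 \<le> n" "0 < ln (real n)" and r: "0 < \<rho> n" using rho_range[of n] by auto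
    have "y * ln (real n) < ln (\<rho> n)" using elim(1) n(2) by (simp add: field_simps)
    then have "real n powr y \<le> \<rho> n"
      using n r by (subst ln_le_cancel_iff[symmetric]) (auto simp: ln_powr)
    then have "real n * real n powr y \<le> real n * \<rho> n" by (intro mult_left_mono) auto
    then show ?case using n by (simp add: powr_add mult.commute)
  qed
  with y1 show ?thesis by blast
qed

lemma n_rho_at_top: "filterlim (\<lambda>n. real n * \<rho> n) at_top sequentially"
proof -
  obtain \<epsilon> where e: "\<epsilon> > 0" "\<forall>\<^sub>F n in sequentially. real n powr \<epsilon> \<le> real n * \<rho> n"
    using sparsity_powr by blast
  have "filterlim (\<lambda>n. real n powr \<epsilon>) at_top sequentially" using e(1) by real_asymp
  then show ?thesis by (rule filterlim_at_top_mono[OF _ e(2)])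
qed

lemma tendsto_inverse_n_rho: "(\<lambda>n. 1 / (real n * \<rho> n)) \<longlonglongrightarrow> 0"
  by (rule tendsto_divide_0[OF tendsto_const filterlim_at_top_imp_at_infinity[OF n_rho_at_top]])

lemma deg_tol_tendsto: "deg_tol \<longlonglongrightarrow> 0"
  unfolding deg_tol_def by (rule tendsto_neg_powr[OF _ n_rho_at_top]) simp

lemma deg_tol_small: "\<forall>\<^sub>F n in sequentially. 0 < deg_tol n \<and> deg_tol n \<le> 1 / 2"
proof -
  have "\<forall>\<^sub>F n in sequentially. deg_tol n < 1 / 2" using order_tendstoD(2)[OF deg_tol_tendsto, of "1/2"] by simp
  then show ?thesis using eventually_gt_at_top[of 0]
  proof eventually_elim
    case (elim n)
    then have "0 < real n * \<rho> n" using rho_range[of n] by simp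
    then have "0 < deg_tol n" unfolding deg_tol_def by (simp only: powr_gt_zero)
    with elim show ?case by simp
  qed
qed

lemma prob_Good: "(\<lambda>n. measure (M n) (space (M n) - Good n)) \<longlonglongrightarrow> 0"
proof -
  obtain \<epsilon> where e: "\<epsilon> > 0" "\<forall>\<^sub>F n in sequentially. real n powr \<epsilon> \<le> real n * \<rho> n"
    using sparsity_powr by blast
  \<comment> \<open>Union bound over \<open>n\<close> units and two tails. With
    \<open>n - 1 \<ge> n / 2\<close> and \<open>n * \<rho> n * deg_tol^2 = (n * \<rho> n)^(1/2)
    \<ge> n^(\<epsilon>/2)\<close>, the constant 1/4 of the tail bound becomes 1/8.\<close>
  define b where "b n = 2 * real n * exp (- (c\<^sub>l / 8 * real n powr (\<epsilon> / 2)))" for n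
  have b0: "b \<longlonglongrightarrow> 0" unfolding b_def using e(1) c\<^sub>l(1) by real_asymp
  show ?thesis
  proof (rule tendsto_sandwich[OF _ _ tendsto_const b0])
    show "\<forall>\<^sub>F n in sequentially. measure (M n) (space (M n) - Good n) \<le> b n"
      using e(2) deg_tol_small eventually_ge_at_top[of 2]
    proof eventually_elim
      case (elim n)
      define m where "m = real n - 1"
      define T where "T s i = {\<omega> \<in> space (M n). deg_tol n * (m * gn n (Z n i \<omega>)) <
          s * (deg n (Gr n \<omega>) i - m * gn n (Z n i \<omega>))}" for s i
      have Ts: "T s i \<in> sets (M n)" if "i < n" for s i
        unfolding T_def using GG_to_M[OF deg_GG[OF that]] GG_to_M[OF gn_Z_measurable[OF that]] by measurable
      have nr: "real n powr \<epsilon> \<le> real n * \<rho> n" "0 < real n * \<rho> n" using elim rho_range[of n] by auto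
      have expo: "c\<^sub>l / 8 * real n powr (\<epsilon> / 2) \<le> m * \<rho> n * c\<^sub>l * (deg_tol n)\<^sup>2 / 4"
      proof -
        have "(deg_tol n)\<^sup>2 = (real n * \<rho> n) powr (- 1 / 2)"
          by (simp add: deg_tol_def power2_eq_square flip: powr_add)
        moreover have "(real n * \<rho> n) powr (1 / 2) = (real n * \<rho> n) * (real n * \<rho> n) powr (- 1 / 2)"
          using nr powr_add[of "real n * \<rho> n" 1 "- 1 / 2"] by simp
        ultimately have d: "(real n * \<rho> n) * (deg_tol n)\<^sup>2 = (real n * \<rho> n) powr (1 / 2)" by simp
        have "real n powr (\<epsilon> / 2) = (real n powr \<epsilon>) powr (1 / 2)" by (simp add: powr_powr)
        also have "\<dots> \<le> (real n * \<rho> n) powr (1 / 2)" using nr by (intro powr_mono2) auto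
        also have "\<dots> \<le> (2 * m * \<rho> n) * (deg_tol n)\<^sup>2"
          unfolding d[symmetric] using elim(3) rho_range[of n] by (intro mult_right_mono) (auto simp: m_def)
        finally have "c\<^sub>l / 8 * real n powr (\<epsilon> / 2) \<le> c\<^sub>l / 8 * ((2 * m * \<rho> n) * (deg_tol n)\<^sup>2)"
          using c\<^sub>l(1) by (intro mult_left_mono) auto
        then show ?thesis by (simp add: mult_ac)
      qed
      have tail: "measure (M n) (T s i) \<le> exp (- (c\<^sub>l / 8 * real n powr (\<epsilon> / 2)))" if "i < n" "s = 1 \<or> s = - 1" for s i
      proof -
        have "measure (M n) (T s i) \<le> exp (- (m * \<rho> n * c\<^sub>l * (deg_tol n)\<^sup>2 / 4))"
          unfolding T_def m_def by (rule degree_tail_bound) (use elim that in auto)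
        also have "\<dots> \<le> exp (- (c\<^sub>l / 8 * real n powr (\<epsilon> / 2)))" using expo by simp
        finally show ?thesis .
      qed
      have sub: "space (M n) - Good n \<subseteq> (\<Union>i\<in>{..<n}. T 1 i \<union> T (- 1) i)"
        by (auto simp: Good_def T_def m_def abs_le_iff not_le)
      have "measure (M n) (space (M n) - Good n) \<le> measure (M n) (\<Union>i\<in>{..<n}. T 1 i \<union> T (- 1) i)"
        by (rule M.finite_measure_mono[OF sub]) (use Ts in auto)
      also have "\<dots> \<le> (\<Sum>i\<in>{..<n}. measure (M n) (T 1 i \<union> T (- 1) i))"
        by (rule measure_UNION_le) (use Ts in auto)
      also have "\<dots> \<le> (\<Sum>i\<in>{..<n}. 2 * exp (- (c\<^sub>l / 8 * real n powr (\<epsilon> / 2))))"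
      proof (rule sum_mono)
        fix i assume "i \<in> {..<n}"
        then have i: "i < n" by simp
        have "measure (M n) (T 1 i \<union> T (- 1) i) \<le> measure (M n) (T 1 i) + measure (M n) (T (- 1) i)"
          by (rule measure_Un_le) (use Ts i in auto)
        with tail[OF i, of 1] tail[OF i, of "- 1"]
        show "measure (M n) (T 1 i \<union> T (- 1) i) \<le> 2 * exp (- (c\<^sub>l / 8 * real n powr (\<epsilon> / 2)))" by simp
      qed
      also have "\<dots> = b n" by (simp add: b_def)
      finally show ?case .
    qed
  qed auto
qed

text \<open>The cap at 1 never acts in the dense case and stops acting for large \<open>n\<close> in
  the sparse one, but only for each pair separately because \<open>G\<close> may be unbounded.
  Limits of integrals therefore go through dominated convergence.\<close>

lemma pr_over_rho_tendsto:
  assumes z: "z \<in> space D" "z' \<in> space D"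
  shows "(\<lambda>n. pr n z z' / \<rho> n) \<longlonglongrightarrow> Gz z z'"
  using dense_or_sparse
proof
  assume "(\<forall>n. \<rho> n = 1) \<and> (\<forall>u\<in>{0..1}. \<forall>v\<in>{0..1}. G u v \<le> 1)"
  then have "pr n z z' / \<rho> n = Gz z z'" for n
    using fst_D[OF z(1)] fst_D[OF z(2)] by (simp add: pr_def edge_prob_def Gz_def)
  then show ?thesis by simp
next
  assume *: "\<rho> \<longlonglongrightarrow> 0 \<and> filterlim (\<lambda>n. real n * \<rho> n) at_top sequentially"
  have "(\<lambda>n. \<rho> n * Gz z z') \<longlonglongrightarrow> 0 * Gz z z'" using * by (intro tendsto_intros) auto
  then have "\<forall>\<^sub>F n in sequentially. \<rho> n * Gz z z' < 1"
    by (rule order_tendstoD) simp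
  then have "\<forall>\<^sub>F n in sequentially. pr n z z' / \<rho> n = Gz z z'"
  proof eventually_elim
    case (elim n)
    then show ?case using rho_range[of n] by (simp add: pr_def edge_prob_def Gz_def)
  qed
  then show ?thesis by (rule tendsto_eventually)
qed

lemma gn_over_rho_tendsto:
  assumes z: "z \<in> space D" and G: "integrable D (Gz z)"
  shows "(\<lambda>n. gn n z / \<rho> n) \<longlonglongrightarrow> gD z"
proof -
  have "(\<lambda>n. LINT z'|D. pr n z z' / \<rho> n) \<longlonglongrightarrow> (LINT z'|D. Gz z z')"
  proof (rule integral_dominated_convergence[OF _ _ G])
    show "(\<lambda>z'. pr n z z' / \<rho> n) \<in> borel_measurable D" for n
      by (intro borel_measurable_divide pr_section_measurable[OF z] borel_measurable_const)
    show "AE z' in D. (\<lambda>n. pr n z z' / \<rho> n) \<longlonglongrightarrow> Gz z z'"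
      by (rule AE_I2) (rule pr_over_rho_tendsto[OF z])
    show "AE z' in D. norm (pr n z z' / \<rho> n) \<le> Gz z z'" for n
    proof (rule AE_I2)
      fix z' assume z': "z' \<in> space D"
      show "norm (pr n z z' / \<rho> n) \<le> Gz z z'"
        using pr_le_G[OF z z', of n] pr_nonneg[OF z z', of n] rho_range[of n]
        by (simp add: Gz_def field_simps)
    qed
  qed (rule Gz_section_measurable[OF z])
  then show ?thesis by (simp add: gn_def gD_def)
qed

text \<open>Both ratios lie between 0 and \<open>G / c\<^sub>l\<close>, hence so does the distance
  between them.\<close>

lemma kernel_ratio_bound:
  assumes z: "z \<in> space D" "z' \<in> space D" and G: "integrable D (Gz z')"
  shows "\<bar>pr n z z' / gn n z' - Gz z z' / gD z'\<bar> \<le> Gz z z' / c\<^sub>l"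
proof -
  have r: "0 < \<rho> n" using rho_range[of n] by simp
  have "pr n z z' / gn n z' \<le> (\<rho> n * Gz z z') / (\<rho> n * c\<^sub>l)"
    using pr_le_G[OF z, of n] gn_ge[OF z(2), of n] pr_nonneg[OF z, of n] r c\<^sub>l(1)
    by (intro frac_le) (auto simp: Gz_def)
  then have a: "pr n z z' / gn n z' \<le> Gz z z' / c\<^sub>l" using r by simp
  have b: "Gz z z' / gD z' \<le> Gz z z' / c\<^sub>l"
    using gD_ge[OF z(2) G] c\<^sub>l(1) Gz_nonneg[OF z] by (intro divide_left_mono) auto
  have "0 \<le> pr n z z' / gn n z'" "0 \<le> Gz z z' / gD z'"
    using pr_nonneg[OF z, of n] gn_pos[OF z(2), of n] gD_ge[OF z(2) G] c\<^sub>l(1) Gz_nonneg[OF z] by auto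
  with a b show ?thesis by linarith
qed

text \<open>The squared mean square distance between the kernels of \<open>Qn\<close> and
  \<open>Qf\<close>. It controls \<open>Qn n h - Qf h\<close> for all \<open>h\<close> with a common
  bound at once.\<close>

definition Kn :: "nat \<Rightarrow> real" where
  "Kn n = (LINT x|(D \<Otimes>\<^sub>M D). (pr n (fst x) (snd x) / gn n (snd x) - Gz (fst x) (snd x) / gD (snd x))\<^sup>2)"

lemma AE_kernel_ratio_bound:
  "AE x in D \<Otimes>\<^sub>M D. (pr n (fst x) (snd x) / gn n (snd x) - Gz (fst x) (snd x) / gD (snd x))\<^sup>2 \<le>
     (Gz (fst x) (snd x))\<^sup>2 / c\<^sub>l\<^sup>2"
  using D.AE_pair_snd[OF AE_integrable_Gz] AE_space
proof eventually_elim
  case (elim x)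
  then have x: "fst x \<in> space D" "snd x \<in> space D" by (auto simp: space_pair_measure)
  have "\<bar>pr n (fst x) (snd x) / gn n (snd x) - Gz (fst x) (snd x) / gD (snd x)\<bar>\<^sup>2 \<le> (Gz (fst x) (snd x) / c\<^sub>l)\<^sup>2"
    by (intro power_mono kernel_ratio_bound x elim(1)) simp
  then show ?case by (simp add: power_divide)
qed

lemma kernel_measurable:
  "(\<lambda>x. (pr n (fst x) (snd x) / gn n (snd x) - Gz (fst x) (snd x) / gD (snd x))\<^sup>2) \<in> borel_measurable (D \<Otimes>\<^sub>M D)"
  by measurable

lemma integrable_kernel:
  "integrable (D \<Otimes>\<^sub>M D) (\<lambda>x. (pr n (fst x) (snd x) / gn n (snd x) - Gz (fst x) (snd x) / gD (snd x))\<^sup>2)"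
proof (rule Bochner_Integration.integrable_bound[OF _ kernel_measurable])
  show "integrable (D \<Otimes>\<^sub>M D) (\<lambda>x. (Gz (fst x) (snd x))\<^sup>2 / c\<^sub>l\<^sup>2)"
    by (intro integrable_divide integrable_Gz_sq) 
  show "AE x in D \<Otimes>\<^sub>M D. norm ((pr n (fst x) (snd x) / gn n (snd x) - Gz (fst x) (snd x) / gD (snd x))\<^sup>2)
      \<le> norm ((Gz (fst x) (snd x))\<^sup>2 / c\<^sub>l\<^sup>2)"
    using AE_kernel_ratio_bound[of n] by eventually_elim simp
qed

lemma Kn_tendsto: "Kn \<longlonglongrightarrow> 0"
proof -
  have "(\<lambda>n. LINT x|(D \<Otimes>\<^sub>M D). (pr n (fst x) (snd x) / gn n (snd x) - Gz (fst x) (snd x) / gD (snd x))\<^sup>2)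
      \<longlonglongrightarrow> (LINT x|(D \<Otimes>\<^sub>M D). 0)"
  proof (rule integral_dominated_convergence[where w = "\<lambda>x. (Gz (fst x) (snd x))\<^sup>2 / c\<^sub>l\<^sup>2"])
    show "integrable (D \<Otimes>\<^sub>M D) (\<lambda>x. (Gz (fst x) (snd x))\<^sup>2 / c\<^sub>l\<^sup>2)"
      by (intro integrable_divide integrable_Gz_sq)
    show "AE x in D \<Otimes>\<^sub>M D. (\<lambda>n. (pr n (fst x) (snd x) / gn n (snd x) - Gz (fst x) (snd x) / gD (snd x))\<^sup>2) \<longlonglongrightarrow> 0"
      using D.AE_pair_snd[OF AE_integrable_Gz] AE_space
    proof eventually_elim
      case (elim x)
      then have x: "fst x \<in> space D" "snd x \<in> space D" by (auto simp: space_pair_measure)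
      have g0: "gD (snd x) \<noteq> 0" using gD_ge[OF x(2) elim(1)] c\<^sub>l(1) by auto
      \<comment> \<open>In the sparse case numerator and denominator both tend to 0; after division
        by \<open>\<rho> n\<close> each of them has a limit, and that of the denominator is
        positive.\<close>
      have "(\<lambda>n. (pr n (fst x) (snd x) / \<rho> n) / (gn n (snd x) / \<rho> n)) \<longlonglongrightarrow> Gz (fst x) (snd x) / gD (snd x)"
        by (intro tendsto_divide pr_over_rho_tendsto gn_over_rho_tendsto x elim(1) g0)
      moreover have "(pr n (fst x) (snd x) / \<rho> n) / (gn n (snd x) / \<rho> n) = pr n (fst x) (snd x) / gn n (snd x)" for n
        using rho_range[of n] by simp
      ultimately have "(\<lambda>n. pr n (fst x) (snd x) / gn n (snd x)) \<longlonglongrightarrow> Gz (fst x) (snd x) / gD (snd x)" by (simp only:)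
      from tendsto_power[OF tendsto_diff[OF this tendsto_const], of "Gz (fst x) (snd x) / gD (snd x)" 2]
      show ?case by simp
    qed
    show "AE x in D \<Otimes>\<^sub>M D. norm ((pr n (fst x) (snd x) / gn n (snd x) - Gz (fst x) (snd x) / gD (snd x))\<^sup>2)
        \<le> (Gz (fst x) (snd x))\<^sup>2 / c\<^sub>l\<^sup>2" for n
      using AE_kernel_ratio_bound[of n] by eventually_elim simp
  qed (simp_all add: kernel_measurable)
  then show ?thesis by (simp add: Kn_def[abs_def])
qed

text \<open>Sections of \<open>G\<close> are integrable only at almost every point, so the claims
  hold almost everywhere. The second one bounds the square of a mean by the mean of the squares,
  applied to the difference of the kernels times \<open>h\<close>.\<close>

lemma
  assumes h: "h \<in> borel_measurable D" "\<And>z'. z' \<in> space D \<Longrightarrow> \<bar>h z'\<bar> \<le> C"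
  shows Qf_AE: "AE z in D. integrable D (\<lambda>z'. Gz z z' * h z' / gD z') \<and> \<bar>Qf h z\<bar> \<le> C / c\<^sub>l * gD z"
    and Qn_diff_AE: "AE z in D. (Qn n h z - Qf h z)\<^sup>2 \<le>
      C\<^sup>2 * (LINT z'|D. (pr n z z' / gn n z' - Gz z z' / gD z')\<^sup>2)"
proof -
  obtain z0 where "z0 \<in> space D" using D.not_empty by auto
  then have C: "0 \<le> C" using h(2)[of z0] by linarith
  \<comment> \<open>An envelope for the integrand of \<open>Qf\<close>. It needs the section at
    \<open>z'\<close> to be integrable, for only then is \<open>gD z'\<close> at least
    \<open>c\<^sub>l\<close>; elsewhere the integral defining it is 0 by convention.\<close>
  have arm_share: "AE z' in D. \<bar>Gz z z' * h z' / gD z'\<bar> \<le> C / c\<^sub>l * Gz z z'" if z: "z \<in> space D" for z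
    using AE_integrable_Gz AE_space
  proof eventually_elim
    case (elim z')
    have "\<bar>Gz z z' * h z' / gD z'\<bar> \<le> (Gz z z' * C) / c\<^sub>l"
      unfolding abs_divide abs_mult
      using Gz_nonneg[OF z elim(2)] h(2)[OF elim(2)] gD_ge[OF elim(2,1)] c\<^sub>l(1) C
      by (intro frac_le mult_mono) auto
    then show ?case by (simp add: mult_ac)
  qed
  have m: "(\<lambda>z'. Gz z z' * h z' / gD z') \<in> borel_measurable D" if z: "z \<in> space D" for z
    by (intro borel_measurable_times borel_measurable_divide Gz_section_measurable[OF z] h(1) gD_measurable)
  have int: "integrable D (\<lambda>z'. Gz z z' * h z' / gD z')" if z: "z \<in> space D" "integrable D (Gz z)" for z
  proof (rule Bochner_Integration.integrable_bound[OF _ m[OF z(1)]])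
    show "integrable D (\<lambda>z'. C / c\<^sub>l * Gz z z')" by (intro integrable_mult_right impI z(2))
    show "AE z' in D. norm (Gz z z' * h z' / gD z') \<le> norm (C / c\<^sub>l * Gz z z')"
      using arm_share[OF z(1)] by eventually_elim (unfold real_norm_def, erule order.trans[OF _ abs_ge_self])
  qed
  show "AE z in D. integrable D (\<lambda>z'. Gz z z' * h z' / gD z') \<and> \<bar>Qf h z\<bar> \<le> C / c\<^sub>l * gD z"
    using AE_integrable_Gz AE_space
  proof eventually_elim
    case (elim z)
    have "\<bar>Qf h z\<bar> \<le> (LINT z'|D. \<bar>Gz z z' * h z' / gD z'\<bar>)"
      unfolding Qf_def by (rule integral_abs_bound)
    also have "\<dots> \<le> (LINT z'|D. C / c\<^sub>l * Gz z z')"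
    proof (rule integral_mono_AE)
      show "integrable D (\<lambda>z'. \<bar>Gz z z' * h z' / gD z'\<bar>)"
        by (rule Bochner_Integration.integrable_abs[OF int[OF elim(2,1)]])
      show "integrable D (\<lambda>z'. C / c\<^sub>l * Gz z z')" by (intro integrable_mult_right impI elim(1))
    qed (rule arm_share[OF elim(2)])
    also have "\<dots> = C / c\<^sub>l * gD z" by (simp add: gD_def)
    finally show ?case using int[OF elim(2,1)] by simp
  qed
  show "AE z in D. (Qn n h z - Qf h z)\<^sup>2 \<le> C\<^sup>2 * (LINT z'|D. (pr n z z' / gn n z' - Gz z z' / gD z')\<^sup>2)"
    using AE_integrable_Gz AE_space DD.AE_integrable_fst'[OF integrable_kernel[of n]]
  proof eventually_elim
    case (elim z)
    define k where "k z' = pr n z z' / gn n z' - Gz z z' / gD z'" for z'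
    have km: "k \<in> borel_measurable D"
      unfolding k_def by (intro borel_measurable_diff borel_measurable_divide pr_section_measurable[OF elim(2)]
          Gz_section_measurable[OF elim(2)] gn_measurable gD_measurable)
    have k2: "integrable D (\<lambda>z'. (k z')\<^sup>2)" using elim(3) by (simp add: k_def)
    have le: "(k z' * h z')\<^sup>2 \<le> C\<^sup>2 * (k z')\<^sup>2" if "z' \<in> space D" for z'
    proof -
      have "\<bar>h z'\<bar>\<^sup>2 \<le> C\<^sup>2" by (intro power_mono h(2) that) simp
      then have "(k z')\<^sup>2 * (h z')\<^sup>2 \<le> (k z')\<^sup>2 * C\<^sup>2" by (intro mult_left_mono) auto
      then show ?thesis by (simp add: power_mult_distrib mult.commute)
    qed
    have kh2: "integrable D (\<lambda>z'. (k z' * h z')\<^sup>2)"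
    proof (rule Bochner_Integration.integrable_bound)
      show "integrable D (\<lambda>z'. C\<^sup>2 * (k z')\<^sup>2)" using k2 by simp
      show "(\<lambda>z'. (k z' * h z')\<^sup>2) \<in> borel_measurable D" using km h(1) by simp
      show "AE z' in D. norm ((k z' * h z')\<^sup>2) \<le> norm (C\<^sup>2 * (k z')\<^sup>2)" using le by (intro AE_I2) simp
    qed
    have "Qn n h z - Qf h z = (LINT z'|D. pr n z z' * (h z' / gn n z') - Gz z z' * h z' / gD z')"
      unfolding Qn_def Qf_def
      by (rule Bochner_Integration.integral_diff[symmetric, OF integrable_pr_h[OF elim(2) h] int[OF elim(2,1)]])
    also have "\<dots> = (LINT z'|D. k z' * h z')"
      by (rule Bochner_Integration.integral_cong[OF refl]) (simp add: k_def algebra_simps)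
    finally have "(Qn n h z - Qf h z)\<^sup>2 \<le> (LINT z'|D. (k z' * h z')\<^sup>2)"
      using D.expectation_sq_le[OF _ kh2] km h(1) by simp
    also have "\<dots> \<le> (LINT z'|D. C\<^sup>2 * (k z')\<^sup>2)"
      by (rule integral_mono[OF kh2]) (use k2 le in auto)
    finally show ?case by (simp add: k_def)
  qed
qed

lemma
  assumes h: "h \<in> borel_measurable D" "\<And>z'. z' \<in> space D \<Longrightarrow> \<bar>h z'\<bar> \<le> C"
  shows Qf_sq_integrable: "integrable D (\<lambda>z. (Qf h z)\<^sup>2)"
    and Qn_diff_sq_integrable: "integrable D (\<lambda>z. (Qn n h z - Qf h z)\<^sup>2)"
    and Qn_diff_sq: "(LINT z|D. (Qn n h z - Qf h z)\<^sup>2) \<le> C\<^sup>2 * Kn n"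
proof -
  note m = Qf_measurable[OF h(1)] Qn_measurable[OF h(1), of n]
  show "integrable D (\<lambda>z. (Qf h z)\<^sup>2)"
  proof (rule Bochner_Integration.integrable_bound)
    show "integrable D (\<lambda>z. (C / c\<^sub>l)\<^sup>2 * (gD z)\<^sup>2)" using integrable_gD_sq by simp
    show "AE z in D. norm ((Qf h z)\<^sup>2) \<le> norm ((C / c\<^sub>l)\<^sup>2 * (gD z)\<^sup>2)"
    proof -
      have "AE z in D. integrable D (\<lambda>z'. Gz z z' * h z' / gD z') \<and> \<bar>Qf h z\<bar> \<le> C / c\<^sub>l * gD z"
        by (rule Qf_AE[OF h])
      then show ?thesis
    proof eventually_elim
      case (elim z)
      then have "\<bar>Qf h z\<bar>\<^sup>2 \<le> (C / c\<^sub>l * gD z)\<^sup>2" by (intro power_mono) auto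
      then show ?case unfolding power_mult_distrib power2_abs by simp
    qed
    qed
  qed (use m in simp)
  have K: "integrable D (\<lambda>z. C\<^sup>2 * (LINT z'|D. (pr n z z' / gn n z' - Gz z z' / gD z')\<^sup>2))"
    using DD.integrable_fst'[OF integrable_kernel[of n]] by simp
  have AE: "AE z in D. (Qn n h z - Qf h z)\<^sup>2 \<le> C\<^sup>2 * (LINT z'|D. (pr n z z' / gn n z' - Gz z z' / gD z')\<^sup>2)"
    by (rule Qn_diff_AE[OF h])
  show i: "integrable D (\<lambda>z. (Qn n h z - Qf h z)\<^sup>2)"
  proof (rule Bochner_Integration.integrable_bound[OF K])
    show "AE z in D. norm ((Qn n h z - Qf h z)\<^sup>2) \<le> norm (C\<^sup>2 * (LINT z'|D. (pr n z z' / gn n z' - Gz z z' / gD z')\<^sup>2))"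
      using AE by eventually_elim simp
  qed (use m in simp)
  have "(LINT z|D. (Qn n h z - Qf h z)\<^sup>2) \<le> (LINT z|D. C\<^sup>2 * (LINT z'|D. (pr n z z' / gn n z' - Gz z z' / gD z')\<^sup>2))"
    by (rule integral_mono_AE[OF i K AE])
  also have "\<dots> = C\<^sup>2 * Kn n"
    unfolding Kn_def using DD.integral_fst'[OF integrable_kernel[of n]] by simp
  finally show "(LINT z|D. (Qn n h z - Qf h z)\<^sup>2) \<le> C\<^sup>2 * Kn n" .
qed

text \<open>Integrating out the second unit gives a version of the conditional expectation, by
  Fubini's theorem on events that concern the first unit only. It depends on the first unit only
  through its position \<open>u\<close>, as conditioning on \<open>u\<close> alone requires.\<close>

lemma Q_var_AE: "AE x in D \<Otimes>\<^sub>M D. Q_var D G \<pi> x = Qf (dslope \<pi>) (fst x)"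
proof -
  let ?u = "\<lambda>x :: unit_type \<times> unit_type. fst (fst x)"
  let ?F = "vimage_algebra (space (D \<Otimes>\<^sub>M D)) ?u borel"
  define f where "f x = G (fst (fst x)) (fst (snd x)) * (deriv01 (snd (snd x) True) \<pi> - deriv01 (snd (snd x) False) \<pi>) /
      graphon_degree G (fst (snd x))" for x :: "unit_type \<times> unit_type"
  \<comment> \<open>Factoring \<open>Qf\<close> through the position gives measurability with
    respect to the algebra generated by \<open>u\<close>, which may be coarser than that of the
    whole first unit.\<close>
  define qf where "qf u = (LINT z'|D. G u (fst z') * dslope \<pi> z' / gD z')" for u
  have Qv: "Q_var D G \<pi> = real_cond_exp (D \<Otimes>\<^sub>M D) ?F f"
    by (simp add: Q_var_def f_def[abs_def] case_prod_unfold)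
  have u: "?u \<in> borel_measurable (D \<Otimes>\<^sub>M D)" by measurable
  have setsF: "sets ?F = {?u -` A \<inter> space (D \<Otimes>\<^sub>M D) | A. A \<in> sets borel}"
    by (rule sets_vimage_algebra2) auto
  have sub: "subalgebra (D \<Otimes>\<^sub>M D) ?F"
    unfolding subalgebra_def using measurable_sets[OF u] by (auto simp: setsF)
  interpret F: finite_measure_subalgebra "D \<Otimes>\<^sub>M D" ?F
    by unfold_locales (rule sub)
  note h = dslope_measurable dslope_bound[OF _ pi01]
  have f_eq: "f x = Gz (fst x) (snd x) * dslope \<pi> (snd x) / gD (snd x)" if "x \<in> space (D \<Otimes>\<^sub>M D)" for x
    using that gD_eq[of "snd x"] by (auto simp: f_def Gz_def dslope_def space_pair_measure)
  have fm: "f \<in> borel_measurable (D \<Otimes>\<^sub>M D)"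
    by (subst measurable_cong[OF f_eq]) simp_all
  have fi: "integrable (D \<Otimes>\<^sub>M D) f"
  proof (rule Bochner_Integration.integrable_bound[OF _ fm])
    show "integrable (D \<Otimes>\<^sub>M D) (\<lambda>x. 2 * B / c\<^sub>l * Gz (fst x) (snd x))" using integrable_Gz by simp
    show "AE x in D \<Otimes>\<^sub>M D. norm (f x) \<le> norm (2 * B / c\<^sub>l * Gz (fst x) (snd x))"
      using D.AE_pair_snd[OF AE_integrable_Gz] AE_space
    proof eventually_elim
      case (elim x)
      then have x: "fst x \<in> space D" "snd x \<in> space D" by (auto simp: space_pair_measure)
      have "\<bar>f x\<bar> \<le> (Gz (fst x) (snd x) * (2 * B)) / c\<^sub>l"
        unfolding f_eq[OF elim(2)] abs_divide abs_mult
        using Gz_nonneg[OF x] h(2)[OF x(2)] gD_ge[OF x(2) elim(1)] c\<^sub>l(1) B_nonneg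
        by (intro frac_le mult_mono) auto
      also have "\<dots> = 2 * B / c\<^sub>l * Gz (fst x) (snd x)" by simp
      finally show ?case unfolding real_norm_def by (rule order.trans[OF _ abs_ge_self])
    qed
  qed
  have qf_eq: "Qf (dslope \<pi>) z = qf (fst z)" for z by (simp add: Qf_def qf_def Gz_def)
  have gm: "(\<lambda>x. Qf (dslope \<pi>) (fst x)) \<in> borel_measurable ?F"
  proof -
    have uF: "?u \<in> measurable ?F (restrict_space borel {0..1})"
    proof (rule measurable_restrict_space2)
      show "?u \<in> space ?F \<rightarrow> {0..1}" using fst_D by (auto simp: space_pair_measure)
      show "?u \<in> borel_measurable ?F" by (rule measurable_vimage_algebra1) auto
    qed
    have "(\<lambda>x. (fst x, fst (snd x))) \<in> measurable (restrict_space borel {0..1 :: real} \<Otimes>\<^sub>M D) (restrict_space borel ({0..1} \<times> {0..1}))"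
    proof (rule measurable_restrict_space2)
      show "(\<lambda>x. (fst x, fst (snd x))) \<in> space (restrict_space borel {0..1} \<Otimes>\<^sub>M D) \<rightarrow> {0..1} \<times> {0..1 :: real}"
        using fst_D by (auto simp: space_pair_measure space_restrict_space)
      have "fst \<in> measurable (restrict_space borel {0..1} \<Otimes>\<^sub>M D) (borel :: real measure)"
        using measurable_fst[of "restrict_space borel {0..1::real}" D] by (simp add: measurable_restrict_space2_iff)
      then show "(\<lambda>x. (fst x, fst (snd x))) \<in> borel_measurable (restrict_space borel {0..1 :: real} \<Otimes>\<^sub>M D)"
        by (intro borel_measurable_Pair measurable_compose[OF measurable_snd fst_measurable])
    qed
    from measurable_compose[OF this G_measurable]
    have "(\<lambda>x. G (fst x) (fst (snd x))) \<in> borel_measurable (restrict_space borel {0..1} \<Otimes>\<^sub>M D)" by simp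
    then have "(\<lambda>(u, z'). G u (fst z') * dslope \<pi> z' / gD z') \<in> borel_measurable (restrict_space borel {0..1} \<Otimes>\<^sub>M D)"
      unfolding case_prod_unfold by measurable
    then have "qf \<in> borel_measurable (restrict_space borel {0..1})"
      unfolding qf_def[abs_def] by (rule D.borel_measurable_lebesgue_integral)
    from measurable_compose[OF uF this] show ?thesis by (simp add: qf_eq)
  qed
  have fQ: "(LINT z'|D. f (z, z')) = Qf (dslope \<pi>) z" if "z \<in> space D" for z
    unfolding Qf_def
    by (rule Bochner_Integration.integral_cong[OF refl]) (use that f_eq in \<open>auto simp: space_pair_measure\<close>)
  have Q1: "integrable D (Qf (dslope \<pi>))"
    by (rule D.square_integrable_imp_integrable[OF Qf_measurable[OF h(1)] Qf_sq_integrable[OF h]])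
  have gi: "integrable (D \<Otimes>\<^sub>M D) (\<lambda>x. Qf (dslope \<pi>) (fst x))"
    using integrable_distr[of fst "D \<Otimes>\<^sub>M D" D "Qf (dslope \<pi>)"] Q1 by (simp add: D.distr_pair_fst)
  have "AE x in D \<Otimes>\<^sub>M D. real_cond_exp (D \<Otimes>\<^sub>M D) ?F f x = Qf (dslope \<pi>) (fst x)"
  proof (rule F.real_cond_exp_charact)
    fix A assume AF: "A \<in> sets ?F"
    then obtain S where S: "S \<in> sets borel" "A = ?u -` S \<inter> space (D \<Otimes>\<^sub>M D)" unfolding setsF by auto
    have AM: "A \<in> sets (D \<Otimes>\<^sub>M D)" using AF sub by (auto simp: subalgebra_def)
    have ind: "indicator A x = (indicator S (fst (fst x)) :: real)" if "x \<in> space (D \<Otimes>\<^sub>M D)" for x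
      using that by (auto simp: S(2) indicator_def)
    have fub: "(LINT x:A|(D \<Otimes>\<^sub>M D). q x) = (LINT z|D. indicator S (fst z) * (LINT z'|D. q (z, z')))"
      if q: "integrable (D \<Otimes>\<^sub>M D) q" for q :: "_ \<Rightarrow> real"
    proof -
      have i: "integrable (D \<Otimes>\<^sub>M D) (\<lambda>x. indicator S (fst (fst x)) * q x)"
      proof -
        have "integrable (D \<Otimes>\<^sub>M D) (\<lambda>x. indicator S (fst (fst x)) * q x) \<longleftrightarrow>
            integrable (D \<Otimes>\<^sub>M D) (\<lambda>x. q x * indicator A x)"
          by (rule Bochner_Integration.integrable_cong[OF refl]) (simp add: ind)
        with integrable_real_mult_indicator[OF AM q] show ?thesis by simp
      qed
      have "(LINT x:A|(D \<Otimes>\<^sub>M D). q x) = (LINT x|(D \<Otimes>\<^sub>M D). indicator S (fst (fst x)) * q x)"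
        unfolding set_lebesgue_integral_def
        by (rule Bochner_Integration.integral_cong[OF refl]) (simp add: ind)
      also have "\<dots> = (LINT z|D. (LINT z'|D. indicator S (fst z) * q (z, z')))"
        using DD.integral_fst'[OF i] by simp
      finally show ?thesis by simp
    qed
    show "(LINT x:A|(D \<Otimes>\<^sub>M D). f x) = (LINT x:A|(D \<Otimes>\<^sub>M D). Qf (dslope \<pi>) (fst x))"
      unfolding fub[OF fi] fub[OF gi]
      by (rule Bochner_Integration.integral_cong[OF refl]) (simp add: fQ D.prob_space)
  qed (fact fi gi gm)+
  then show ?thesis by (simp add: Qv)
qed

end

section \<open>The central limit theorem for the leading term\<close>

lemma square_integrable_add:
  fixes f g :: "'a \<Rightarrow> real"
  assumes "f \<in> borel_measurable M" "g \<in> borel_measurable M"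
    and "integrable M (\<lambda>x. (f x)\<^sup>2)" "integrable M (\<lambda>x. (g x)\<^sup>2)"
  shows "integrable M (\<lambda>x. (f x + g x)\<^sup>2)"
proof (rule Bochner_Integration.integrable_bound)
  show "integrable M (\<lambda>x. 2 * (f x)\<^sup>2 + 2 * (g x)\<^sup>2)" using assms by simp
  show "AE x in M. norm ((f x + g x)\<^sup>2) \<le> norm (2 * (f x)\<^sup>2 + 2 * (g x)\<^sup>2)"
  proof (rule AE_I2)
    fix x
    have "(f x + g x)\<^sup>2 \<le> 2 * (f x)\<^sup>2 + 2 * (g x)\<^sup>2"
      using sum_squares_bound[of "f x" "g x"] by (simp add: power2_sum)
    then show "norm ((f x + g x)\<^sup>2) \<le> norm (2 * (f x)\<^sup>2 + 2 * (g x)\<^sup>2)"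
      unfolding real_norm_def abs_power2 by (rule order.trans[OF _ abs_ge_self])
  qed
qed (use assms in simp)

lemma square_integrable_cmult:
  fixes f :: "'a \<Rightarrow> real"
  assumes "integrable M (\<lambda>x. (f x)\<^sup>2)"
  shows "integrable M (\<lambda>x. (c * f x)\<^sup>2)"
  using assms by (simp add: power_mult_distrib)

lemma square_integrable_sum:
  fixes f :: "'i \<Rightarrow> 'a \<Rightarrow> real"
  assumes "finite I" "\<And>i. i \<in> I \<Longrightarrow> f i \<in> borel_measurable M" "\<And>i. i \<in> I \<Longrightarrow> integrable M (\<lambda>x. (f i x)\<^sup>2)"
  shows "integrable M (\<lambda>x. (\<Sum>i\<in>I. f i x)\<^sup>2)"
  using assms
proof (induction rule: finite_induct)
  case (insert i I)
  have "integrable M (\<lambda>x. (f i x + (\<Sum>i\<in>I. f i x))\<^sup>2)"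
    by (rule square_integrable_add) (use insert in auto)
  then show ?case using insert.hyps by simp
qed simp

context network_interference
begin

text \<open>The sums to which the central limit theorem applies: \<open>\<alpha>\<close> carries the
  noise of the treatments, \<open>\<beta>\<close> that of sampling the units. The assignment is a
  separate argument so that it can be averaged for fixed units.\<close>

definition Tw :: "(unit_type \<Rightarrow> real) \<Rightarrow> (unit_type \<Rightarrow> real) \<Rightarrow> nat \<Rightarrow> 'a \<Rightarrow> (nat \<Rightarrow> bool) \<Rightarrow> real" where
  "Tw \<alpha> \<beta> n \<omega> w = (1 / sqrt (real n)) * (\<Sum>j<n. BD.eps j w * \<alpha> (Z n j \<omega>) + \<beta> (Z n j \<omega>))"

abbreviation T :: "(unit_type \<Rightarrow> real) \<Rightarrow> (unit_type \<Rightarrow> real) \<Rightarrow> nat \<Rightarrow> 'a \<Rightarrow> real" where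
  "T \<alpha> \<beta> n \<omega> \<equiv> Tw \<alpha> \<beta> n \<omega> (wv n \<omega>)"

lemma compose_Z: "h \<in> borel_measurable D \<Longrightarrow> i < n \<Longrightarrow> (\<lambda>\<omega>. h (Z n i \<omega>)) \<in> borel_measurable (GG n)"
  using measurable_compose[OF Z_GG] by blast

lemma compose_Z_M: "h \<in> borel_measurable D \<Longrightarrow> i < n \<Longrightarrow> (\<lambda>\<omega>. h (Z n i \<omega>)) \<in> borel_measurable (M n)"
  by (rule GG_to_M[OF compose_Z])

lemma
  fixes h :: "unit_type \<Rightarrow> 'b::{banach, second_countable_topology}"
  assumes h: "h \<in> borel_measurable D" and i: "i < n"
  shows integral_Z: "(LINT \<omega>|M n. h (Z n i \<omega>)) = (LINT z|D. h z)"
    and integrable_Z: "integrable (M n) (\<lambda>\<omega>. h (Z n i \<omega>)) \<longleftrightarrow> integrable D h"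
proof -
  have h': "h \<in> borel_measurable (distr (M n) D (Z n i))" using h by simp
  show "(LINT \<omega>|M n. h (Z n i \<omega>)) = (LINT z|D. h z)"
    using integral_distr[OF Z_measurable[OF i] h] by (simp add: Z_distr[OF i])
  show "integrable (M n) (\<lambda>\<omega>. h (Z n i \<omega>)) \<longleftrightarrow> integrable D h"
    using integrable_distr_eq[OF Z_measurable[OF i] h] by (simp add: Z_distr[OF i])
qed

lemma Tw_measurable:
  assumes "\<alpha> \<in> borel_measurable D" "\<beta> \<in> borel_measurable D"
  shows "(\<lambda>\<omega>. Tw \<alpha> \<beta> n \<omega> w) \<in> borel_measurable (GG n)"
  unfolding Tw_def
  by (intro borel_measurable_times borel_measurable_const borel_measurable_sum borel_measurable_add compose_Z assms) auto

lemma measurable_wv: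
  fixes F :: "'a \<Rightarrow> (nat \<Rightarrow> bool) \<Rightarrow> real"
  assumes F: "\<And>w. (\<lambda>\<omega>. F \<omega> w) \<in> borel_measurable (GG n)"
  shows "(\<lambda>\<omega>. F \<omega> (wv n \<omega>)) \<in> borel_measurable (M n)"
proof (rule measurable_compose_countable'[where I = "set_pmf (design n)" and f = "\<lambda>w \<omega>. F \<omega> w" and g = "wv n"])
  show "(\<lambda>\<omega>. F \<omega> w) \<in> borel_measurable (M n)" for w by (rule GG_to_M[OF F])
  show "wv n \<in> measurable (M n) (count_space (set_pmf (design n)))"
  proof (subst measurable_count_space_eq_countable[OF countable_set_pmf], intro conjI ballI)
    show "wv n \<in> space (M n) \<rightarrow> set_pmf (design n)" using wv_set by auto
    fix w assume "w \<in> set_pmf (design n)"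
    from wv_event_WW[OF this] M.indep_setD_ev1[OF indep_WW_GG, of n]
    have "{\<omega> \<in> space (M n). wv n \<omega> = w} \<in> sets (M n)" by blast
    also have "{\<omega> \<in> space (M n). wv n \<omega> = w} = wv n -` {w} \<inter> space (M n)" by auto
    finally show "wv n -` {w} \<inter> space (M n) \<in> sets (M n)" .
  qed
qed (rule countable_set_pmf)

lemma T_measurable:
  "\<alpha> \<in> borel_measurable D \<Longrightarrow> \<beta> \<in> borel_measurable D \<Longrightarrow> T \<alpha> \<beta> n \<in> borel_measurable (M n)"
  by (rule measurable_wv) (rule Tw_measurable)

lemma Tw_square_integrable:
  assumes "\<alpha> \<in> borel_measurable D" "\<beta> \<in> borel_measurable D"
    and "integrable D (\<lambda>z. (\<alpha> z)\<^sup>2)" "integrable D (\<lambda>z. (\<beta> z)\<^sup>2)"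
  shows "integrable (M n) (\<lambda>\<omega>. (Tw \<alpha> \<beta> n \<omega> w)\<^sup>2)"
  unfolding Tw_def
proof (intro square_integrable_cmult square_integrable_sum square_integrable_add)
  fix j assume "j \<in> {..<n}"
  then have j: "j < n" by simp
  note m = compose_Z_M[OF assms(1) j] compose_Z_M[OF assms(2) j]
  show "integrable (M n) (\<lambda>\<omega>. (\<alpha> (Z n j \<omega>))\<^sup>2)" "integrable (M n) (\<lambda>\<omega>. (\<beta> (Z n j \<omega>))\<^sup>2)"
    using integrable_Z[of "\<lambda>z. (\<alpha> z)\<^sup>2" j n] integrable_Z[of "\<lambda>z. (\<beta> z)\<^sup>2" j n] assms j by simp_all
  show "(\<lambda>\<omega>. BD.eps j w * \<alpha> (Z n j \<omega>)) \<in> borel_measurable (M n)" "(\<lambda>\<omega>. \<beta> (Z n j \<omega>)) \<in> borel_measurable (M n)"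
    "(\<lambda>\<omega>. BD.eps j w * \<alpha> (Z n j \<omega>) + \<beta> (Z n j \<omega>)) \<in> borel_measurable (M n)"
    using m by simp_all
qed simp

text \<open>The bound is uniform in \<open>n\<close>, which makes these sums tight. Over the
  treatments the part with \<open>\<alpha>\<close> has mean zero and is uncorrelated across units;
  the centred \<open>\<beta>\<close> are uncorrelated because the units are independent.\<close>

lemma T_second_moment:
  assumes m: "\<alpha> \<in> borel_measurable D" "\<beta> \<in> borel_measurable D"
    and i2: "integrable D (\<lambda>z. (\<alpha> z)\<^sup>2)" "integrable D (\<lambda>z. (\<beta> z)\<^sup>2)"
    and \<beta>0: "(LINT z|D. \<beta> z) = 0"
  shows "integrable (M n) (\<lambda>\<omega>. (T \<alpha> \<beta> n \<omega>)\<^sup>2)"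
    and "(LINT \<omega>|M n. (T \<alpha> \<beta> n \<omega>)\<^sup>2) \<le> (LINT z|D. (\<alpha> z)\<^sup>2) + (LINT z|D. (\<beta> z)\<^sup>2)"
proof -
  have Fm: "(\<lambda>\<omega>. (Tw \<alpha> \<beta> n \<omega> w)\<^sup>2) \<in> borel_measurable (GG n)" for w
    by (intro borel_measurable_power Tw_measurable m)
  note Fi = Tw_square_integrable[OF m i2]
  show "integrable (M n) (\<lambda>\<omega>. (T \<alpha> \<beta> n \<omega>)\<^sup>2)"
    by (rule integrable_wv[OF Fm Fi])
  have i\<alpha>: "integrable (M n) (\<lambda>\<omega>. (\<alpha> (Z n j \<omega>))\<^sup>2)" "(LINT \<omega>|M n. (\<alpha> (Z n j \<omega>))\<^sup>2) = (LINT z|D. (\<alpha> z)\<^sup>2)" if "j < n" for j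
    using integrable_Z[of "\<lambda>z. (\<alpha> z)\<^sup>2" j n] integral_Z[of "\<lambda>z. (\<alpha> z)\<^sup>2" j n] m i2 that by simp_all
  have i\<beta>: "integrable (M n) (\<lambda>\<omega>. (\<beta> (Z n j \<omega>))\<^sup>2)" "(LINT \<omega>|M n. (\<beta> (Z n j \<omega>))\<^sup>2) = (LINT z|D. (\<beta> z)\<^sup>2)" if "j < n" for j
    using integrable_Z[of "\<lambda>z. (\<beta> z)\<^sup>2" j n] integral_Z[of "\<lambda>z. (\<beta> z)\<^sup>2" j n] m i2 that by simp_all
  have \<beta>1: "integrable D \<beta>" by (rule D.square_integrable_imp_integrable[OF m(2) i2(2)])
  have \<beta>\<beta>: "integrable (M n) (\<lambda>\<omega>. \<beta> (Z n j \<omega>) * \<beta> (Z n k \<omega>)) \<and>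
      (LINT \<omega>|M n. \<beta> (Z n j \<omega>) * \<beta> (Z n k \<omega>)) = (if j = k then (LINT z|D. (\<beta> z)\<^sup>2) else 0)"
    if jk: "j < n" "k < n" for j k
  proof (cases "j = k")
    case True
    then show ?thesis using i\<beta>[OF jk(1)] by (simp add: power2_eq_square)
  next
    case False
    have "M.indep_vars n (\<lambda>_. borel) (\<lambda>i \<omega>. \<beta> (Z n i \<omega>)) {..<n}"
      by (rule M.indep_vars_compose2[OF Z_indep]) (rule m(2))
    then have ind: "M.indep_vars n (\<lambda>_. borel) (\<lambda>i \<omega>. \<beta> (Z n i \<omega>)) {j, k}"
      by (rule M.indep_vars_subset) (use jk in auto)
    have i: "integrable (M n) (\<lambda>\<omega>. \<beta> (Z n i \<omega>))" if "i \<in> {j, k}" for i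
      using integrable_Z[OF m(2), of i n] \<beta>1 that jk by auto
    show ?thesis
      using M.indep_vars_lebesgue_integral[OF _ ind i] M.indep_vars_integrable[OF _ ind i] False
        integral_Z[OF m(2) jk(1)] \<beta>0 by simp
  qed
  have EWT: "EW n (\<lambda>w. (Tw \<alpha> \<beta> n \<omega> w)\<^sup>2) =
      (1 / real n) * (\<pi> * (1 - \<pi>) * (\<Sum>j<n. (\<alpha> (Z n j \<omega>))\<^sup>2) + (\<Sum>j<n. \<Sum>k<n. \<beta> (Z n j \<omega>) * \<beta> (Z n k \<omega>)))" for \<omega>
  proof -
    define b where "b = (\<Sum>j<n. \<beta> (Z n j \<omega>))"
    define L where "L w = (\<Sum>j<n. \<alpha> (Z n j \<omega>) * BD.eps j w)" for w
    have "EW n (\<lambda>w. (Tw \<alpha> \<beta> n \<omega> w)\<^sup>2) = EW n (\<lambda>w. (1 / real n) * ((L w)\<^sup>2 + 2 * b * L w + b\<^sup>2))"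
      by (rule Bochner_Integration.integral_cong[OF refl])
        (simp add: Tw_def L_def b_def sum.distrib power_divide power2_sum mult_ac)
    also have "\<dots> = (1 / real n) * (EW n (\<lambda>w. (L w)\<^sup>2) + 2 * b * EW n L + b\<^sup>2)"
      by simp
    also have "EW n L = 0" unfolding L_def[abs_def] by (rule BD.EW_linear_eq_0) simp
    also have "EW n (\<lambda>w. (L w)\<^sup>2) = \<pi> * (1 - \<pi>) * (\<Sum>j<n. (\<alpha> (Z n j \<omega>))\<^sup>2)"
      unfolding L_def by (rule BD.EW_linear_sq) simp
    finally show ?thesis by (simp add: b_def power2_eq_square sum_product)
  qed
  have "(LINT \<omega>|M n. (T \<alpha> \<beta> n \<omega>)\<^sup>2) = (LINT \<omega>|M n. EW n (\<lambda>w. (Tw \<alpha> \<beta> n \<omega> w)\<^sup>2))"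
    by (rule integral_wv[OF Fm Fi])
  also have "\<dots> = (1 / real n) * (\<pi> * (1 - \<pi>) * (\<Sum>j<n. (LINT z|D. (\<alpha> z)\<^sup>2)) +
      (\<Sum>j<n. \<Sum>k<n. if j = k then (LINT z|D. (\<beta> z)\<^sup>2) else 0))"
  proof -
    have "integrable (M n) (\<lambda>\<omega>. \<Sum>j<n. (\<alpha> (Z n j \<omega>))\<^sup>2)"
      "(LINT \<omega>|M n. (\<Sum>j<n. (\<alpha> (Z n j \<omega>))\<^sup>2)) = (\<Sum>j<n. (LINT z|D. (\<alpha> z)\<^sup>2))"
      using i\<alpha> by (auto simp: Bochner_Integration.integral_sum)
    moreover have "integrable (M n) (\<lambda>\<omega>. \<Sum>j<n. \<Sum>k<n. \<beta> (Z n j \<omega>) * \<beta> (Z n k \<omega>))"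
      by (intro Bochner_Integration.integrable_sum) (use \<beta>\<beta> in auto)
    moreover have "(LINT \<omega>|M n. (\<Sum>j<n. \<Sum>k<n. \<beta> (Z n j \<omega>) * \<beta> (Z n k \<omega>))) =
        (\<Sum>j<n. \<Sum>k<n. if j = k then (LINT z|D. (\<beta> z)\<^sup>2) else 0)"
      by (subst Bochner_Integration.integral_sum, use \<beta>\<beta> in force, intro sum.cong refl,
          subst Bochner_Integration.integral_sum) (use \<beta>\<beta> in auto)
    ultimately show ?thesis unfolding EWT by simp
  qed
  also have "\<dots> \<le> (LINT z|D. (\<alpha> z)\<^sup>2) + (LINT z|D. (\<beta> z)\<^sup>2)"
  proof (cases "n = 0")
    case True
    then show ?thesis by simp
  next
    case False
    have "\<pi> * (1 - \<pi>) \<le> 1" using pi_range by (intro mult_le_one) auto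
    then have "\<pi> * (1 - \<pi>) * (LINT z|D. (\<alpha> z)\<^sup>2) \<le> 1 * (LINT z|D. (\<alpha> z)\<^sup>2)"
      by (intro mult_right_mono) auto
    moreover have "(1 / real n) * (\<pi> * (1 - \<pi>) * (\<Sum>j<n. (LINT z|D. (\<alpha> z)\<^sup>2)) +
        (\<Sum>j<n. \<Sum>k<n. if j = k then (LINT z|D. (\<beta> z)\<^sup>2) else 0)) =
        \<pi> * (1 - \<pi>) * (LINT z|D. (\<alpha> z)\<^sup>2) + (LINT z|D. (\<beta> z)\<^sup>2)"
      using False by (simp add: field_simps)
    ultimately show ?thesis by simp
  qed
  finally show "(LINT \<omega>|M n. (T \<alpha> \<beta> n \<omega>)\<^sup>2) \<le> (LINT z|D. (\<alpha> z)\<^sup>2) + (LINT z|D. (\<beta> z)\<^sup>2)" .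
qed

text \<open>The characteristic function is an exact \<open>n\<close>-th power: for a fixed
  assignment it factorises over the independent units, and the average over the assignments then
  factorises over the independent treatments. The variance has no mixed term in
  \<open>\<alpha>\<close> and \<open>\<beta>\<close> because a centred treatment has mean zero and
  is independent of the unit.\<close>

lemma char_T:
  assumes m: "\<alpha> \<in> borel_measurable D" "\<beta> \<in> borel_measurable D"
    and i2: "integrable D (\<lambda>z. (\<alpha> z)\<^sup>2)" "integrable D (\<lambda>z. (\<beta> z)\<^sup>2)"
    and \<beta>0: "(LINT z|D. \<beta> z) = 0"
  shows "(\<lambda>n. LINT \<omega>|M n. iexp (t * T \<alpha> \<beta> n \<omega>)) \<longlonglongrightarrow>
    char (normal_law 0 ((LINT z|D. (\<beta> z)\<^sup>2) + \<pi> * (1 - \<pi>) * (LINT z|D. (\<alpha> z)\<^sup>2))) t"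
proof -
  define \<psi> where "\<psi> z b = (of_bool b - \<pi>) * \<alpha> z + \<beta> z" for z b
  define v where "v = (LINT z|D. (\<beta> z)\<^sup>2) + \<pi> * (1 - \<pi>) * (LINT z|D. (\<alpha> z)\<^sup>2)"
  let ?BB = "measure_pmf (bernoulli_pmf \<pi>)"
  let ?PP = "?BB \<Otimes>\<^sub>M D"
  interpret BB: prob_space ?BB by (rule prob_space_measure_pmf)
  interpret PP: pair_prob_space ?BB D by unfold_locales
  have \<psi>m1: "(\<lambda>z. \<psi> z b) \<in> borel_measurable D" for b unfolding \<psi>_def using m by simp
  have \<psi>m: "(\<lambda>x. \<psi> (snd x) (fst x)) \<in> borel_measurable ?PP"
  proof -
    have "(\<lambda>x. of_bool (fst x) :: real) \<in> borel_measurable ?PP"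
      by (rule measurable_compose[OF measurable_fst]) simp
    then show ?thesis unfolding \<psi>_def using m by simp
  qed
  have BBint: "(LINT b|?BB. f b) = \<pi> *\<^sub>R f True + (1 - \<pi>) *\<^sub>R f False" for f :: "bool \<Rightarrow> 'c::{banach, second_countable_topology}"
    by (subst integral_measure_pmf[of UNIV]) (use pi_range in \<open>auto simp: UNIV_bool\<close>)
  have fub: "(LINT x|?PP. q x) = \<pi> *\<^sub>R (LINT z|D. q (True, z)) + (1 - \<pi>) *\<^sub>R (LINT z|D. q (False, z))"
    if "integrable ?PP q" for q :: "_ \<Rightarrow> 'c::{banach, second_countable_topology}"
    using PP.integral_fst'[OF that] by (simp add: BBint)
  have \<alpha>1: "integrable D \<alpha>" and \<beta>1: "integrable D \<beta>"
    using D.square_integrable_imp_integrable m i2 by blast+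
  have \<alpha>\<beta>: "integrable D (\<lambda>z. \<alpha> z * \<beta> z)"
  proof (rule Bochner_Integration.integrable_bound)
    show "integrable D (\<lambda>z. (\<alpha> z)\<^sup>2 + (\<beta> z)\<^sup>2)" using i2 by simp
    show "AE z in D. norm (\<alpha> z * \<beta> z) \<le> norm ((\<alpha> z)\<^sup>2 + (\<beta> z)\<^sup>2)"
    proof (rule AE_I2)
      fix z
      have "2 * (\<bar>\<alpha> z\<bar> * \<bar>\<beta> z\<bar>) \<le> (\<alpha> z)\<^sup>2 + (\<beta> z)\<^sup>2"
        using sum_squares_bound[of "\<bar>\<alpha> z\<bar>" "\<bar>\<beta> z\<bar>"] by simp
      moreover have "0 \<le> \<bar>\<alpha> z\<bar> * \<bar>\<beta> z\<bar>" by simp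
      ultimately show "norm (\<alpha> z * \<beta> z) \<le> norm ((\<alpha> z)\<^sup>2 + (\<beta> z)\<^sup>2)"
        unfolding real_norm_def abs_mult by linarith
    qed
  qed (use m in simp)
  have \<psi>2: "integrable D (\<lambda>z. (\<psi> z b)\<^sup>2)" for b
    unfolding \<psi>_def by (intro square_integrable_add square_integrable_cmult i2) (use m in auto)
  have iPP2: "integrable ?PP (\<lambda>x. (\<psi> (snd x) (fst x))\<^sup>2)"
  proof (rule PP.Fubini_integrable)
    show "integrable ?BB (\<lambda>b. LINT z|D. norm ((\<psi> (snd (b, z)) (fst (b, z)))\<^sup>2))"
      by (rule integrable_measure_pmf_finite) simp
    show "AE b in ?BB. integrable D (\<lambda>z. (\<psi> (snd (b, z)) (fst (b, z)))\<^sup>2)"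
      by (rule AE_I2) (simp add: \<psi>2)
  qed (use \<psi>m in simp)
  have iPP1: "integrable ?PP (\<lambda>x. \<psi> (snd x) (fst x))"
    by (rule PP.P.square_integrable_imp_integrable[OF \<psi>m iPP2])
  \<comment> \<open>The law of a single summand before division by \<open>sqrt n\<close>, with
    treatment and unit independent.\<close>
  define \<mu> where "\<mu> = distr ?PP borel (\<lambda>x. \<psi> (snd x) (fst x))"
  have rd: "real_distribution \<mu>" unfolding \<mu>_def by (rule PP.P.real_distribution_distr[OF \<psi>m])
  have m2: "integrable \<mu> (\<lambda>x. x\<^sup>2)"
    unfolding \<mu>_def using iPP2 by (subst integrable_distr_eq[OF \<psi>m]) auto
  have mean: "(LINT x|\<mu>. x) = 0"
  proof -
    have "(LINT x|\<mu>. x) = (LINT x|?PP. \<psi> (snd x) (fst x))"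
      unfolding \<mu>_def by (rule integral_distr[OF \<psi>m]) simp
    also have "\<dots> = \<pi> * ((1 - \<pi>) * (LINT z|D. \<alpha> z)) + (1 - \<pi>) * (- \<pi> * (LINT z|D. \<alpha> z))"
      unfolding fub[OF iPP1] using \<alpha>1 \<beta>1 \<beta>0 by (simp add: \<psi>_def)
    finally show ?thesis by (simp add: algebra_simps)
  qed
  have var: "(LINT x|\<mu>. x\<^sup>2) = v"
  proof -
    have sq: "(LINT z|D. (c * \<alpha> z + \<beta> z)\<^sup>2) = c\<^sup>2 * (LINT z|D. (\<alpha> z)\<^sup>2) + 2 * c * (LINT z|D. \<alpha> z * \<beta> z) + (LINT z|D. (\<beta> z)\<^sup>2)" for c
    proof -
      have "(LINT z|D. (c * \<alpha> z + \<beta> z)\<^sup>2) = (LINT z|D. c\<^sup>2 * (\<alpha> z)\<^sup>2 + 2 * c * (\<alpha> z * \<beta> z) + (\<beta> z)\<^sup>2)"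
        by (rule Bochner_Integration.integral_cong[OF refl]) (simp add: power2_sum power_mult_distrib)
      then show ?thesis using i2 \<alpha>\<beta> by simp
    qed
    have "(LINT x|\<mu>. x\<^sup>2) = (LINT x|?PP. (\<psi> (snd x) (fst x))\<^sup>2)"
      unfolding \<mu>_def by (rule integral_distr[OF \<psi>m]) simp
    also have "\<dots> = \<pi> * (LINT z|D. ((1 - \<pi>) * \<alpha> z + \<beta> z)\<^sup>2) + (1 - \<pi>) * (LINT z|D. (- \<pi> * \<alpha> z + \<beta> z)\<^sup>2)"
      unfolding fub[OF iPP2] by (simp add: \<psi>_def)
    also have "\<dots> = v" unfolding sq v_def by (simp add: power2_eq_square algebra_simps)
    finally show ?thesis .
  qed
  have v0: "0 \<le> v" unfolding var[symmetric] by (rule Bochner_Integration.integral_nonneg) simp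
  have char_n: "(LINT \<omega>|M n. iexp (t * T \<alpha> \<beta> n \<omega>)) = char \<mu> (t / sqrt (real n)) ^ n" for n
  proof -
    define s where "s = t / sqrt (real n)"
    define \<kappa> where "\<kappa> z b = iexp (s * \<psi> z b)" for z b
    define I where "I b = (LINT z|D. \<kappa> z b)" for b
    have \<kappa>m: "(\<lambda>z. \<kappa> z b) \<in> borel_measurable D" for b
      unfolding \<kappa>_def using \<psi>m1[of b] by measurable
    have n\<kappa>: "norm (\<kappa> z b) = 1" for z b unfolding \<kappa>_def by (simp add: norm_exp_i_times del: of_real_mult)
    have i\<kappa>: "integrable D (\<lambda>z. \<kappa> z b)" for b
      by (rule D.integrable_const_bound[where B=1]) (simp_all add: n\<kappa> \<kappa>m)
    define F where "F \<omega> w = (\<Prod>j<n. \<kappa> (Z n j \<omega>) (w j))" for \<omega> w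
    have Fm: "(\<lambda>\<omega>. F \<omega> w) \<in> borel_measurable (GG n)" for w
      unfolding F_def by (intro borel_measurable_prod) (use measurable_compose[OF Z_GG \<kappa>m] in auto)
    have Fi: "integrable (M n) (\<lambda>\<omega>. F \<omega> w)" for w
      by (rule M.integrable_const_bound[where B=1]) (auto simp: F_def prod_norm[symmetric] n\<kappa> GG_to_M[OF Fm[unfolded F_def]])
    have "iexp (t * T \<alpha> \<beta> n \<omega>) = F \<omega> (wv n \<omega>)" for \<omega>
    proof -
      have "t * T \<alpha> \<beta> n \<omega> = (\<Sum>j<n. s * \<psi> (Z n j \<omega>) (wv n \<omega> j))"
        by (simp add: Tw_def \<psi>_def s_def BD.eps_def sum_distrib_left)
      then have "\<i> * complex_of_real (t * T \<alpha> \<beta> n \<omega>) = (\<Sum>j<n. \<i> * complex_of_real (s * \<psi> (Z n j \<omega>) (wv n \<omega> j)))"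
        by (simp add: sum_distrib_left)
      then show ?thesis unfolding F_def \<kappa>_def by (simp only: exp_sum finite_lessThan)
    qed
    then have "(LINT \<omega>|M n. iexp (t * T \<alpha> \<beta> n \<omega>)) = (LINT \<omega>|M n. F \<omega> (wv n \<omega>))" by simp
    also have "\<dots> = (\<Sum>w\<in>set_pmf (design n). of_real (pmf (design n) w) * (LINT \<omega>|M n. F \<omega> w))"
      by (rule integral_wv_sum[OF Fm Fi])
    also have "\<dots> = (\<Sum>w\<in>set_pmf (design n). pmf (design n) w *\<^sub>R (\<Prod>j<n. I (w j)))"
    proof (intro sum.cong refl)
      fix w
      have "M.indep_vars n (\<lambda>_. borel) (\<lambda>j \<omega>. \<kappa> (Z n j \<omega>) (w j)) {..<n}"
        by (rule M.indep_vars_compose2[OF Z_indep]) (rule \<kappa>m)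
      then have "(LINT \<omega>|M n. F \<omega> w) = (\<Prod>j<n. (LINT \<omega>|M n. \<kappa> (Z n j \<omega>) (w j)))"
        unfolding F_def
        by (intro M.indep_vars_lebesgue_integral) (use integrable_Z[OF \<kappa>m] i\<kappa> in auto)
      also have "\<dots> = (\<Prod>j<n. I (w j))"
        unfolding I_def by (intro prod.cong refl integral_Z \<kappa>m) simp
      finally show "of_real (pmf (design n) w) * (LINT \<omega>|M n. F \<omega> w) = pmf (design n) w *\<^sub>R (\<Prod>j<n. I (w j))"
        by (simp add: scaleR_conv_of_real)
    qed
    also have "\<dots> = (LINT w|measure_pmf (design n). (\<Prod>j<n. I (w j)))"
      by (rule integral_measure_pmf[symmetric]) (use BD.finite_set_design in auto)
    also have "\<dots> = (\<Prod>j<n. (LINT w|measure_pmf (design n). I (w j)))"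
    proof (rule prob_space.indep_vars_lebesgue_integral[OF prob_space_measure_pmf])
      have "prob_space.indep_vars (measure_pmf (design n)) (\<lambda>_. count_space UNIV) (\<lambda>j w. w j) {..<n}"
        unfolding BD.design_def by (rule indep_vars_Pi_pmf) simp
      then show "prob_space.indep_vars (measure_pmf (design n)) (\<lambda>_. borel) (\<lambda>j w. I (w j)) {..<n}"
        by (rule prob_space.indep_vars_compose2[OF prob_space_measure_pmf]) simp
      show "integrable (measure_pmf (design n)) (\<lambda>w. I (w j))" for j
        by (rule integrable_measure_pmf_finite[OF BD.finite_set_design])
    qed simp
    also have "\<dots> = (\<Prod>j<n. char \<mu> s)"
    proof (intro prod.cong refl)
      fix j assume "j \<in> {..<n}"
      have "(LINT w|measure_pmf (design n). I (w j)) = (LINT b|measure_pmf (map_pmf (\<lambda>w. w j) (design n)). I b)"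
        by (rule integral_map_pmf[symmetric])
      also have "map_pmf (\<lambda>w. w j) (design n) = bernoulli_pmf \<pi>"
        unfolding BD.design_def using \<open>j \<in> {..<n}\<close> by (simp add: Pi_pmf_component)
      also have "(LINT b|?BB. I b) = (LINT x|?PP. \<kappa> (snd x) (fst x))"
      proof -
        have "(\<lambda>x. \<kappa> (snd x) (fst x)) \<in> borel_measurable ?PP"
          unfolding \<kappa>_def using \<psi>m by measurable
        then have "integrable ?PP (\<lambda>x. \<kappa> (snd x) (fst x))"
          by (intro PP.P.integrable_const_bound[where B=1]) (simp_all add: n\<kappa>)
        from fub[OF this] show ?thesis by (simp add: BBint I_def)
      qed
      also have "\<dots> = char \<mu> s"
        unfolding char_def \<mu>_def \<kappa>_def by (subst integral_distr[OF \<psi>m]) auto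
      finally show "(LINT w|measure_pmf (design n). I (w j)) = char \<mu> s" .
    qed
    finally show ?thesis by (simp add: s_def)
  qed
  show ?thesis
    unfolding char_n v_def[symmetric] char_normal_law[OF v0]
    by (rule char_power_tendsto_normal[OF rd m2 mean var])
qed

lemma conv_in_distribution_via_T:
  assumes m: "\<alpha> \<in> borel_measurable D" "\<beta> \<in> borel_measurable D"
    and i2: "integrable D (\<lambda>z. (\<alpha> z)\<^sup>2)" "integrable D (\<lambda>z. (\<beta> z)\<^sup>2)"
    and \<beta>0: "(LINT z|D. \<beta> z) = 0"
    and X: "\<And>n. X n \<in> borel_measurable (M n)"
    and close: "conv_prob_zero M (\<lambda>n \<omega>. X n \<omega> - T \<alpha> \<beta> n \<omega>)"
  shows "conv_in_distribution M X (normal_law 0 ((LINT z|D. (\<beta> z)\<^sup>2) + \<pi> * (1 - \<pi>) * (LINT z|D. (\<alpha> z)\<^sup>2)))"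
proof (rule weak_conv_via_approximation[OF prob_space_M X T_measurable[OF m]])
  show "real_distribution (normal_law 0 ((LINT z|D. (\<beta> z)\<^sup>2) + \<pi> * (1 - \<pi>) * (LINT z|D. (\<alpha> z)\<^sup>2)))"
    using pi_range by (intro real_distribution_normal_law add_nonneg_nonneg mult_nonneg_nonneg) auto
  show "(\<lambda>n. LINT \<omega>|M n. iexp (t * T \<alpha> \<beta> n \<omega>)) \<longlonglongrightarrow>
      char (normal_law 0 ((LINT z|D. (\<beta> z)\<^sup>2) + \<pi> * (1 - \<pi>) * (LINT z|D. (\<alpha> z)\<^sup>2))) t" for t
    by (rule char_T[OF m i2 \<beta>0])
qed (rule conv_prob_zeroD(2)[OF close])

end

section \<open>The Horvitz-Thompson estimator\<close>

lemma (in finite_measure) bounded_square_integrable: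
  fixes f :: "'a \<Rightarrow> real"
  assumes "f \<in> borel_measurable M" "\<And>x. x \<in> space M \<Longrightarrow> \<bar>f x\<bar> \<le> C"
  shows "integrable M (\<lambda>x. (f x)\<^sup>2)"
proof (rule integrable_const_bound[where B = "C\<^sup>2"])
  show "AE x in M. norm ((f x)\<^sup>2) \<le> C\<^sup>2"
  proof (rule AE_I2)
    fix x assume "x \<in> space M"
    from power_mono[OF assms(2)[OF this], of 2] show "norm ((f x)\<^sup>2) \<le> C\<^sup>2" by simp
  qed
qed (use assms(1) in simp)

lemma sum3_sq_le:
  fixes a b c :: real
  shows "(a + b + c)\<^sup>2 \<le> 3 * (a\<^sup>2 + b\<^sup>2 + c\<^sup>2)"
proof -
  have "0 \<le> (a - b)\<^sup>2 + (b - c)\<^sup>2 + (a - c)\<^sup>2" by simp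
  then show ?thesis by (simp add: power2_eq_square algebra_simps)
qed

context network_asymptotics
begin

abbreviation ds :: "unit_type \<Rightarrow> real" where "ds \<equiv> dslope \<pi>"

lemma ds_bound: "z \<in> space D \<Longrightarrow> \<bar>ds z\<bar> \<le> 2 * B"
  by (rule dslope_bound[OF _ pi01])

definition HTw :: "nat \<Rightarrow> 'a \<Rightarrow> (nat \<Rightarrow> bool) \<Rightarrow> real" where
  "HTw n \<omega> w = (1 / real n) * (\<Sum>i<n. dfun (Z n i \<omega>) (frac_treated n (Gr n \<omega>) i w) +
     BD.eps i w * rfun \<pi> (Z n i \<omega>) (frac_treated n (Gr n \<omega>) i w))"

lemma observed_outcome_wv:
  "i < n \<Longrightarrow> observed_outcome n (Z n) (E n) (W n) i \<omega> =
    snd (Z n i \<omega>) (wv n \<omega> i) (frac_treated n (Gr n \<omega>) i (wv n \<omega>))"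
  unfolding observed_outcome_def potential_outcome_eq
  by (subst frac_treated_cong[of n i _ "wv n \<omega>"]) (auto simp: wv_def)

lemma tau_HT_eq: "tau_HT \<pi> n (Z n) (E n) (W n) \<omega> = HTw n \<omega> (wv n \<omega>)"
proof -
  have t: "of_bool b * f b / \<pi> - (1 - of_bool b) * f b / (1 - \<pi>) =
      (f True - f False) + (of_bool b - \<pi>) * (f True / \<pi> + f False / (1 - \<pi>))" for b and f :: "bool \<Rightarrow> real"
    using pi_range by (cases b) (auto simp: field_simps)
  have "tau_HT \<pi> n (Z n) (E n) (W n) \<omega> = (1 / real n) * (\<Sum>i<n. of_bool (W n i \<omega>) * observed_outcome n (Z n) (E n) (W n) i \<omega> / \<pi> -
      (1 - of_bool (W n i \<omega>)) * observed_outcome n (Z n) (E n) (W n) i \<omega> / (1 - \<pi>))"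
    unfolding tau_HT_def sum_subtractf right_diff_distrib ..
  also have "\<dots> = HTw n \<omega> (wv n \<omega>)"
    unfolding HTw_def
  proof (intro arg_cong2[where f = "(*)"] sum.cong refl)
    fix i assume "i \<in> {..<n}"
    then have i: "i < n" by simp
    then have "W n i \<omega> = wv n \<omega> i" by (simp add: wv_def)
    then show "of_bool (W n i \<omega>) * observed_outcome n (Z n) (E n) (W n) i \<omega> / \<pi> -
        (1 - of_bool (W n i \<omega>)) * observed_outcome n (Z n) (E n) (W n) i \<omega> / (1 - \<pi>) =
        dfun (Z n i \<omega>) (frac_treated n (Gr n \<omega>) i (wv n \<omega>)) +
        BD.eps i (wv n \<omega>) * rfun \<pi> (Z n i \<omega>) (frac_treated n (Gr n \<omega>) i (wv n \<omega>))"
      unfolding observed_outcome_wv[OF i] dfun_def rfun_def BD.eps_def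
      using t[of "wv n \<omega> i" "\<lambda>b. snd (Z n i \<omega>) b (frac_treated n (Gr n \<omega>) i (wv n \<omega>))"] by simp
  qed
  finally show ?thesis .
qed

lemma dfun_GG: "i < n \<Longrightarrow> (\<lambda>\<omega>. dfun (Z n i \<omega>) (frac_treated n (Gr n \<omega>) i w)) \<in> borel_measurable (GG n)"
  unfolding dfun_def by (intro borel_measurable_diff response_GG)

lemma rfun_GG: "i < n \<Longrightarrow> (\<lambda>\<omega>. rfun \<pi> (Z n i \<omega>) (frac_treated n (Gr n \<omega>) i w)) \<in> borel_measurable (GG n)"
  unfolding rfun_def by (intro borel_measurable_add borel_measurable_divide response_GG borel_measurable_const)

lemma cond_tau_GG: "cond_tau n \<in> borel_measurable (GG n)"
  unfolding cond_tau_def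
  by (intro borel_measurable_times borel_measurable_const borel_measurable_sum EW_measurable dfun_GG) auto

lemma HTw_GG: "(\<lambda>\<omega>. HTw n \<omega> w) \<in> borel_measurable (GG n)"
  unfolding HTw_def
  by (intro borel_measurable_times borel_measurable_const borel_measurable_sum borel_measurable_add dfun_GG rfun_GG) auto

lemma abs_average_le:
  assumes "\<And>i. i < n \<Longrightarrow> \<bar>f i\<bar> \<le> C" "0 \<le> C"
  shows "\<bar>(1 / real n) * (\<Sum>i<n. f i)\<bar> \<le> C"
proof (cases "n = 0")
  case False
  have "\<bar>\<Sum>i<n. f i\<bar> \<le> (\<Sum>i<n. C)" by (rule order.trans[OF sum_abs sum_mono]) (use assms in auto)
  then show ?thesis using False by (simp add: abs_mult field_simps)
qed (use assms in simp)

lemma R_const_nonneg: "0 \<le> R_const"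
  using B_nonneg pi_range by (simp add: R_const_def)

lemma HTw_bound: "\<omega> \<in> space (M n) \<Longrightarrow> \<bar>HTw n \<omega> w\<bar> \<le> 2 * B + R_const"
  unfolding HTw_def
proof (rule abs_average_le)
  fix i assume \<omega>: "\<omega> \<in> space (M n)" and i: "i < n"
  note z = Z_space[OF i \<omega>]
  have "\<bar>BD.eps i w * rfun \<pi> (Z n i \<omega>) (frac_treated n (Gr n \<omega>) i w)\<bar> \<le> 1 * R_const"
    unfolding abs_mult using pi_range
    by (intro mult_mono rfun_bound[OF z frac_treated_range]) (auto simp: BD.eps_def)
  then show "\<bar>dfun (Z n i \<omega>) (frac_treated n (Gr n \<omega>) i w) +
      BD.eps i w * rfun \<pi> (Z n i \<omega>) (frac_treated n (Gr n \<omega>) i w)\<bar> \<le> 2 * B + R_const"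
    using dfun_bound[OF z frac_treated_range, of n "Gr n \<omega>" i w] by linarith
qed (use B_nonneg R_const_nonneg in auto)

lemma EW_abs_le: "(\<And>w. \<bar>F w\<bar> \<le> C) \<Longrightarrow> \<bar>EW n F\<bar> \<le> C"
proof -
  assume "\<And>w. \<bar>F w\<bar> \<le> C"
  then have "EW n (\<lambda>w. \<bar>F w\<bar>) \<le> EW n (\<lambda>_. C)" by (rule BD.EW_mono)
  then show ?thesis by (intro order.trans[OF BD.EW_abs]) simp
qed

lemma cond_tau_bound: "\<omega> \<in> space (M n) \<Longrightarrow> \<bar>cond_tau n \<omega>\<bar> \<le> 2 * B"
  unfolding cond_tau_def
  by (intro abs_average_le EW_abs_le dfun_bound Z_space frac_treated_range) (use B_nonneg in auto)

definition \<alpha>0 :: "unit_type \<Rightarrow> real" where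
  "\<alpha>0 z = rfun \<pi> z \<pi> + Qf ds z"

lemma Qf_ds_measurable: "Qf ds \<in> borel_measurable D"
  by (rule Qf_measurable) simp

lemma Qf_ds_sq: "integrable D (\<lambda>z. (Qf ds z)\<^sup>2)"
  by (rule Qf_sq_integrable[of ds "2 * B"]) (auto simp: ds_bound)

lemma \<alpha>0_measurable: "\<alpha>0 \<in> borel_measurable D"
  unfolding \<alpha>0_def[abs_def] using Qf_ds_measurable by simp

lemma \<alpha>0_sq: "integrable D (\<lambda>z. (\<alpha>0 z)\<^sup>2)"
  unfolding \<alpha>0_def
  by (intro square_integrable_add Qf_ds_measurable Qf_ds_sq rfun_pi_measurable
      D.bounded_square_integrable[where C = R_const] rfun_bound pi01)

definition HT_rem :: "nat \<Rightarrow> 'a \<Rightarrow> (nat \<Rightarrow> bool) \<Rightarrow> real" where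
  "HT_rem n \<omega> w = sqrt (real n) * (HTw n \<omega> w - cond_tau n \<omega>) - Tw \<alpha>0 (\<lambda>_. 0) n \<omega> w"

lemma HT_rem_GG: "(\<lambda>\<omega>. HT_rem n \<omega> w) \<in> borel_measurable (GG n)"
  unfolding HT_rem_def
  by (intro borel_measurable_diff borel_measurable_times borel_measurable_const HTw_GG cond_tau_GG Tw_measurable \<alpha>0_measurable)

lemma HT_rem_sq_integrable: "integrable (M n) (\<lambda>\<omega>. (HT_rem n \<omega> w)\<^sup>2)"
proof -
  have "integrable (M n) (\<lambda>\<omega>. (sqrt (real n) * (HTw n \<omega> w - cond_tau n \<omega>) + (- 1) * Tw \<alpha>0 (\<lambda>_. 0) n \<omega> w)\<^sup>2)"
  proof (intro square_integrable_add square_integrable_cmult)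
    show "integrable (M n) (\<lambda>\<omega>. (HTw n \<omega> w - cond_tau n \<omega>)\<^sup>2)"
    proof (rule M.bounded_square_integrable)
      show "(\<lambda>\<omega>. HTw n \<omega> w - cond_tau n \<omega>) \<in> borel_measurable (M n)"
        by (intro GG_to_M borel_measurable_diff HTw_GG cond_tau_GG)
      show "\<bar>HTw n \<omega> w - cond_tau n \<omega>\<bar> \<le> 4 * B + R_const" if "\<omega> \<in> space (M n)" for \<omega>
        using HTw_bound[OF that, of w] cond_tau_bound[OF that] by linarith
    qed
    show "integrable (M n) (\<lambda>\<omega>. (Tw \<alpha>0 (\<lambda>_. 0) n \<omega> w)\<^sup>2)"
      by (rule Tw_square_integrable[OF \<alpha>0_measurable _ \<alpha>0_sq]) auto
    show "(\<lambda>\<omega>. sqrt (real n) * (HTw n \<omega> w - cond_tau n \<omega>)) \<in> borel_measurable (M n)"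
      by (intro GG_to_M borel_measurable_times borel_measurable_const borel_measurable_diff HTw_GG cond_tau_GG)
    show "(\<lambda>\<omega>. - 1 * Tw \<alpha>0 (\<lambda>_. 0) n \<omega> w) \<in> borel_measurable (M n)"
      by (intro GG_to_M borel_measurable_times borel_measurable_const Tw_measurable \<alpha>0_measurable)
  qed
  then show ?thesis by (simp add: HT_rem_def)
qed

text \<open>The order of \<open>1 / deg\<close> on \<open>Good n\<close>, up to the factor
  \<open>2 / c\<^sub>l\<close>.\<close>

definition inv_deg :: "nat \<Rightarrow> real" where "inv_deg n = 1 / ((real n - 1) * \<rho> n)"

lemma inv_deg_tendsto: "inv_deg \<longlonglongrightarrow> 0"
proof -
  have "(\<lambda>n. real n / (real n - 1)) \<longlonglongrightarrow> 1" by real_asymp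
  from tendsto_mult[OF this tendsto_inverse_n_rho]
  have "(\<lambda>n. real n / (real n - 1) * (1 / (real n * \<rho> n))) \<longlonglongrightarrow> 0" by simp
  moreover have "\<forall>\<^sub>F n in sequentially. real n / (real n - 1) * (1 / (real n * \<rho> n)) = inv_deg n"
    using eventually_gt_at_top[of 0] by eventually_elim (simp add: inv_deg_def)
  ultimately show ?thesis by (rule Lim_transform_eventually)
qed

text \<open>With relative error at most 1/2, a degree is at least half of its conditional mean,
  which gives positivity and the upper bounds. The error of the reciprocal is
  \<open>|N - \<mu>| / (N * \<mu>)\<close>, where \<open>N\<close> is then bounded below by
  \<open>\<mu> / 2\<close>.\<close>

lemma good_graph:
  assumes \<omega>: "\<omega> \<in> Good n" and n: "2 \<le> n" and deg_tol: "deg_tol n \<le> 1 / 2"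
  shows "bernoulli_design_graph n \<pi> (Gr n \<omega>)"
    and "i < n \<Longrightarrow> 1 / deg n (Gr n \<omega>) i \<le> 2 / ((real n - 1) * gn n (Z n i \<omega>))"
    and "i < n \<Longrightarrow> 1 / deg n (Gr n \<omega>) i \<le> 2 * inv_deg n / c\<^sub>l"
    and "i < n \<Longrightarrow> \<bar>1 / deg n (Gr n \<omega>) i - 1 / ((real n - 1) * gn n (Z n i \<omega>))\<bar> \<le>
      2 * deg_tol n / ((real n - 1) * gn n (Z n i \<omega>))"
proof -
  have \<omega>M: "\<omega> \<in> space (M n)" using \<omega> by (simp add: Good_def)
  have main: "0 < deg n (Gr n \<omega>) i \<and> 1 / deg n (Gr n \<omega>) i \<le> 2 / ((real n - 1) * gn n (Z n i \<omega>)) \<and>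
      1 / deg n (Gr n \<omega>) i \<le> 2 * inv_deg n / c\<^sub>l \<and>
      \<bar>1 / deg n (Gr n \<omega>) i - 1 / ((real n - 1) * gn n (Z n i \<omega>))\<bar> \<le> 2 * deg_tol n / ((real n - 1) * gn n (Z n i \<omega>))"
    if i: "i < n" for i
  proof -
    define N where "N = deg n (Gr n \<omega>) i"
    define \<mu> where "\<mu> = (real n - 1) * gn n (Z n i \<omega>)"
    note z = Z_space[OF i \<omega>M]
    have \<mu>0: "0 < \<mu>" using n gn_pos[OF z, of n] by (simp add: \<mu>_def)
    have \<mu>ge: "(real n - 1) * (\<rho> n * c\<^sub>l) \<le> \<mu>" unfolding \<mu>_def using n gn_ge[OF z, of n] by (intro mult_left_mono) auto
    have r0: "0 < (real n - 1) * (\<rho> n * c\<^sub>l)" using n rho_range[of n] c\<^sub>l(1) by simp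
    have ab: "\<bar>N - \<mu>\<bar> \<le> deg_tol n * \<mu>" using \<omega> i by (simp add: Good_def N_def \<mu>_def)
    have "deg_tol n * \<mu> \<le> 1 / 2 * \<mu>" using deg_tol \<mu>0 by (intro mult_right_mono) auto
    with ab have N: "\<mu> / 2 \<le> N" by linarith
    then have N0: "0 < N" using \<mu>0 by linarith
    have "1 / N \<le> 1 / (\<mu> / 2)" using N \<mu>0 by (intro divide_left_mono) auto
    then have N1: "1 / N \<le> 2 / \<mu>" by simp
    also have "2 / \<mu> \<le> 2 / ((real n - 1) * (\<rho> n * c\<^sub>l))" using \<mu>ge r0 \<mu>0 by (intro divide_left_mono) auto
    also have "\<dots> = 2 * inv_deg n / c\<^sub>l" by (simp add: inv_deg_def)
    finally have N2: "1 / N \<le> 2 * inv_deg n / c\<^sub>l" .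
    have "\<bar>1 / N - 1 / \<mu>\<bar> = \<bar>N - \<mu>\<bar> * (1 / N) / \<mu>"
      using N0 \<mu>0 by (simp add: field_simps abs_divide abs_mult abs_minus_commute)
    also have "\<dots> \<le> (deg_tol n * \<mu>) * (2 / \<mu>) / \<mu>"
      using ab N1 \<mu>0 N0 by (intro divide_right_mono mult_mono) (auto intro: order.trans[OF abs_ge_zero])
    also have "\<dots> = 2 * deg_tol n / \<mu>" using \<mu>0 by simp
    finally show ?thesis using N0 N1 N2 by (simp add: N_def \<mu>_def)
  qed
  show "bernoulli_design_graph n \<pi> (Gr n \<omega>)"
  proof
    show "Gr n \<omega> i j = Gr n \<omega> j i" if "i < n" "j < n" for i j by (rule E_sym[OF that \<omega>M])
    show "\<not> Gr n \<omega> i i" if "i < n" for i by (rule E_irrefl[OF that \<omega>M])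
  qed (use main pi_range in auto)
  show "i < n \<Longrightarrow> 1 / deg n (Gr n \<omega>) i \<le> 2 / ((real n - 1) * gn n (Z n i \<omega>))"
    "i < n \<Longrightarrow> 1 / deg n (Gr n \<omega>) i \<le> 2 * inv_deg n / c\<^sub>l"
    "i < n \<Longrightarrow> \<bar>1 / deg n (Gr n \<omega>) i - 1 / ((real n - 1) * gn n (Z n i \<omega>))\<bar> \<le>
      2 * deg_tol n / ((real n - 1) * gn n (Z n i \<omega>))" using main by blast+
qed

text \<open>On \<open>Good n\<close> and for large \<open>n\<close>, \<open>2 * H n k\<close>
  dominates the weight \<open>sum_i E_ik / deg i\<close> with which \<open>k\<close> acts on its
  neighbours. The second moment of \<open>H\<close> is bounded, which makes this weight of order
  one.\<close>

abbreviation H :: "nat \<Rightarrow> nat \<Rightarrow> 'a \<Rightarrow> real" where "H n k \<omega> \<equiv> Qt n (\<lambda>_. 1) k \<omega>"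

text \<open>\<open>Qt\<close> is defined on the star at \<open>k\<close>, the form suited to
  \<open>star_law\<close>, whereas averages over the treatments produce sums over the units
  \<open>i\<close> that have \<open>k\<close> as a neighbour. Symmetry of the graph identifies the
  two.\<close>

lemma Qt_full_sum:
  assumes "\<omega> \<in> space (M n)" "k < n"
  shows "Qt n h k \<omega> = (\<Sum>i<n. of_bool (E n i k \<omega>) * (h (Z n i \<omega>) / ((real n - 1) * gn n (Z n i \<omega>))))"
proof -
  have "Qt n h k \<omega> = (\<Sum>i\<in>{..<n} - {k}. of_bool (E n k i \<omega>) * (h (Z n i \<omega>) / ((real n - 1) * gn n (Z n i \<omega>))))"
    unfolding Qt_def sum_divide_distrib by (intro sum.cong refl) simp
  also have "\<dots> = (\<Sum>i<n. of_bool (E n k i \<omega>) * (h (Z n i \<omega>) / ((real n - 1) * gn n (Z n i \<omega>))))"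
    by (rule sum.mono_neutral_left) (use E_irrefl[OF assms(2,1)] in auto)
  also have "\<dots> = (\<Sum>i<n. of_bool (E n i k \<omega>) * (h (Z n i \<omega>) / ((real n - 1) * gn n (Z n i \<omega>))))"
    using E_sym[OF assms(2) _ assms(1)] by (intro sum.cong refl) auto
  finally show ?thesis .
qed

text \<open>
  In this order, the terms account for the replacement of the exposures by \<open>\<pi>\<close> in \<open>R\<close>, the nonlinear
  part of the direct effects, the deviation of the degrees from their conditional means, and the
  replacement of the influence of a unit on its neighbours first by \<open>Qn\<close> and then by \<open>Qf\<close>.
\<close>

definition HT_rem_bound :: "nat \<Rightarrow> 'a \<Rightarrow> real" where
  "HT_rem_bound n \<omega> = 12 * R_const\<^sup>2 * inv_deg n / c\<^sub>l + (3 / real n) * (\<Sum>k<n.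
     (512 * B\<^sup>2 * inv_deg n / c\<^sub>l + 48 * B\<^sup>2 * (deg_tol n)\<^sup>2) * (H n k \<omega>)\<^sup>2 +
     3 * (Qt n ds k \<omega> - Qn n ds (Z n k \<omega>))\<^sup>2 + 3 * (Qn n ds (Z n k \<omega>) - Qf ds (Z n k \<omega>))\<^sup>2)"

lemma HT_rem_sq_bound:
  assumes \<omega>: "\<omega> \<in> Good n" and n: "2 \<le> n" and deg_tol: "0 < deg_tol n" "deg_tol n \<le> 1 / 2"
  shows "EW n (\<lambda>w. (HT_rem n \<omega> w)\<^sup>2) \<le> HT_rem_bound n \<omega>"
proof -
  interpret g: bernoulli_design_graph n \<pi> "Gr n \<omega>" by (rule good_graph(1)[OF \<omega> n deg_tol(2)])
  note gg = good_graph(2-4)[OF \<omega> n deg_tol(2)]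
  have \<omega>M: "\<omega> \<in> space (M n)" using \<omega> by (simp add: Good_def)
  note zs = Z_space[OF _ \<omega>M]
  define z where "z i = Z n i \<omega>" for i
  define m where "m = real n - 1"
  define q where "q i x = dfun (z i) x - ds (z i) * x" for i x
  define h where "h i x = rfun \<pi> (z i) x - rfun \<pi> (z i) \<pi>" for i x
  \<comment> \<open>The influence of \<open>j\<close> with the actual degrees. Below,
    \<open>S1\<close> collects the errors in \<open>R\<close>, \<open>S2\<close> the nonlinear part
    of the direct effects, and \<open>S3\<close> the error of replacing \<open>Qh\<close> by
    \<open>Qf\<close>.\<close>
  define Qh where "Qh j = (\<Sum>i<n. of_bool (E n i j \<omega>) * (ds (z i) / g.N i))" for j
  define S1 where "S1 w = (\<Sum>i<n. BD.eps i w * h i (g.X i w))" for w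
  define S2 where "S2 w = (\<Sum>i<n. q i (g.X i w))" for w
  define S3 where "S3 w = (\<Sum>j\<in>{..<n}. (Qh j - Qf ds (z j)) * BD.eps j w)" for w
  have n0: "0 < real n" "0 < m" using n by (auto simp: m_def)
  \<comment> \<open>Exchanging the sums turns deviations of exposures, indexed by the affected unit,
    into influences, indexed by the treated unit.\<close>
  have Xlin: "(\<Sum>i<n. ds (z i) * (g.X i w - \<pi>)) = (\<Sum>j<n. Qh j * BD.eps j w)" for w
  proof -
    have "(\<Sum>i<n. ds (z i) * (g.X i w - \<pi>)) = (\<Sum>i<n. \<Sum>j<n. of_bool (E n i j \<omega>) * (ds (z i) / g.N i) * BD.eps j w)"
    proof (intro sum.cong refl)
      fix i assume "i \<in> {..<n}"
      then have i: "i < n" by simp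
      have "g.X i w - \<pi> = (\<Sum>j<n. (of_bool (E n i j \<omega>) / g.N i) * BD.eps j w)"
        unfolding g.X_centred[OF i] by (rule sum.mono_neutral_left) (use g.e_irrefl[OF i] in auto)
      then show "ds (z i) * (g.X i w - \<pi>) = (\<Sum>j<n. of_bool (E n i j \<omega>) * (ds (z i) / g.N i) * BD.eps j w)"
        by (simp add: sum_distrib_left mult_ac)
    qed
    also have "\<dots> = (\<Sum>j<n. Qh j * BD.eps j w)"
      unfolding Qh_def by (subst sum.swap) (simp add: sum_distrib_right)
    finally show ?thesis .
  qed
  have decomp: "HT_rem n \<omega> w = (1 / sqrt (real n)) * (S1 w + (S2 w - EW n S2) + S3 w)" for w
  proof -
    \<comment> \<open>The exposure has mean exactly \<pi>, so the average removes the linear part of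
      a direct effect up to its value at \<pi>, and only the deviation of the exposure from \<pi>
      remains.\<close>
    have EWd: "EW n (\<lambda>w. dfun (z i) (g.X i w)) = EW n (\<lambda>w. q i (g.X i w)) + ds (z i) * \<pi>" if i: "i < n" for i
    proof -
      have "EW n (\<lambda>w. g.X i w - \<pi>) = 0" by (rule g.EW_X_centred[OF i])
      then have "EW n (\<lambda>w. g.X i w) = \<pi>" by simp
      moreover have "EW n (\<lambda>w. dfun (z i) (g.X i w)) = EW n (\<lambda>w. q i (g.X i w) + ds (z i) * g.X i w)"
        by (simp add: q_def)
      ultimately show ?thesis by simp
    qed
    have sq: "sqrt (real n) * ((1 / real n) * s) = (1 / sqrt (real n)) * s" for s
      using n0 by (simp add: real_div_sqrt field_simps)
    have "sqrt (real n) * (HTw n \<omega> w - cond_tau n \<omega>) = (1 / sqrt (real n)) * (\<Sum>i<n. dfun (z i) (g.X i w) +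
        BD.eps i w * rfun \<pi> (z i) (g.X i w) - EW n (\<lambda>w. dfun (z i) (g.X i w)))"
      unfolding HTw_def cond_tau_def z_def right_diff_distrib[symmetric] sq sum_subtractf by simp
    also have "(\<Sum>i<n. dfun (z i) (g.X i w) + BD.eps i w * rfun \<pi> (z i) (g.X i w) - EW n (\<lambda>w. dfun (z i) (g.X i w))) =
        (\<Sum>i<n. (BD.eps i w * h i (g.X i w) + BD.eps i w * rfun \<pi> (z i) \<pi>) +
          (q i (g.X i w) - EW n (\<lambda>w. q i (g.X i w))) + ds (z i) * (g.X i w - \<pi>))"
    proof (intro sum.cong refl)
      fix i assume "i \<in> {..<n}"
      then have i: "i < n" by simp
      have d: "dfun (z i) (g.X i w) = q i (g.X i w) + ds (z i) * g.X i w" by (simp add: q_def)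
      have r: "rfun \<pi> (z i) (g.X i w) = h i (g.X i w) + rfun \<pi> (z i) \<pi>" by (simp add: h_def)
      show "dfun (z i) (g.X i w) + BD.eps i w * rfun \<pi> (z i) (g.X i w) - EW n (\<lambda>w. dfun (z i) (g.X i w)) =
          BD.eps i w * h i (g.X i w) + BD.eps i w * rfun \<pi> (z i) \<pi> + (q i (g.X i w) - EW n (\<lambda>w. q i (g.X i w))) +
          ds (z i) * (g.X i w - \<pi>)"
        unfolding EWd[OF i] unfolding d r by (simp add: algebra_simps)
    qed
    also have "\<dots> = S1 w + (\<Sum>i<n. BD.eps i w * rfun \<pi> (z i) \<pi>) + (S2 w - EW n S2) + (\<Sum>j<n. Qh j * BD.eps j w)"
      unfolding sum.distrib sum_subtractf Xlin S1_def S2_def by simp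
    also have "\<dots> = (S1 w + (S2 w - EW n S2) + S3 w) + (\<Sum>j<n. BD.eps j w * \<alpha>0 (z j) + 0)"
      unfolding S3_def \<alpha>0_def by (simp add: algebra_simps sum.distrib sum_subtractf)
    finally show ?thesis
      unfolding HT_rem_def Tw_def z_def[symmetric] by (simp add: distrib_left)
  qed
  have imN: "1 / g.N i \<le> 2 * inv_deg n / c\<^sub>l" if "i < n" for i by (rule gg(2)[OF that])
  have im0: "0 \<le> 2 * inv_deg n / c\<^sub>l" using n rho_range[of n] c\<^sub>l(1) by (simp add: inv_deg_def)
  have H_eq: "H n k \<omega> = (\<Sum>i<n. of_bool (E n i k \<omega>) * (1 / (m * gn n (z i))))" if "k < n" for k
    unfolding Qt_full_sum[OF \<omega>M that] m_def z_def ..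
  have gpos: "0 < m * gn n (z i)" if "i < n" for i
    using n0 gn_pos[OF zs[OF that], of n] by (simp add: z_def)
  have H0: "0 \<le> H n k \<omega>" if "k < n" for k
    unfolding H_eq[OF that] using gpos by (intro sum_nonneg mult_nonneg_nonneg) (auto simp: less_imp_le)
  have I1: "EW n (\<lambda>w. (S1 w)\<^sup>2) \<le> real n * (4 * R_const\<^sup>2 * inv_deg n / c\<^sub>l)"
  proof -
    have "EW n (\<lambda>w. (S1 w)\<^sup>2) \<le> 2 * R_const\<^sup>2 * (\<Sum>i<n. 1 / g.N i)"
      unfolding S1_def
    proof (rule g.EW_eps_lipschitz_sq)
      show "\<bar>h i x - h i y\<bar> \<le> R_const * \<bar>x - y\<bar>" if "i < n" "x \<in> {0..1}" "y \<in> {0..1}" for i x y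
        using rfun_lipschitz[OF zs[OF that(1)] that(2,3)] by (simp add: h_def z_def)
    qed (simp add: h_def)
    also have "\<dots> \<le> 2 * R_const\<^sup>2 * (\<Sum>i<n. 2 * inv_deg n / c\<^sub>l)"
      by (intro mult_left_mono sum_mono imN) auto
    finally show ?thesis by (simp add: mult_ac)
  qed
  have I2: "EW n (\<lambda>w. (S2 w - EW n S2)\<^sup>2) \<le> (\<Sum>k<n. 512 * B\<^sup>2 * inv_deg n / c\<^sub>l * (H n k \<omega>)\<^sup>2)"
  proof -
    have "EW n (\<lambda>w. (S2 w - EW n S2)\<^sup>2) \<le>
        16 * (2 * B)\<^sup>2 * (\<Sum>k<n. (\<Sum>i<n. of_bool (E n i k \<omega>) / g.N i) * (\<Sum>i<n. of_bool (E n i k \<omega>) / (g.N i)\<^sup>2))"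
      unfolding S2_def
    proof (rule g.EW_second_order_var)
      show "\<bar>q i x - q i y\<bar> \<le> 2 * B * \<bar>x - y\<bar> * (\<bar>x - \<pi>\<bar> + \<bar>y - \<pi>\<bar>)" if "i < n" "x \<in> {0..1}" "y \<in> {0..1}" for i x y
        using dfun_remainder[OF zs[OF that(1)] that(2,3)] by (simp add: q_def z_def)
    qed (use B_nonneg in simp)
    \<comment> \<open>In the sum of inverse squares one factor \<open>1 / deg\<close> is bounded by
      its order and the sum over the other by \<open>2 * H\<close>. The constants multiply to
      \<open>16 * 4 * 2 * 2 * 2 = 512\<close>.\<close>
    also have "\<dots> \<le> 16 * (2 * B)\<^sup>2 * (\<Sum>k<n. (2 * H n k \<omega>) * (2 * inv_deg n / c\<^sub>l * (2 * H n k \<omega>)))"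
    proof (intro mult_left_mono sum_mono)
      fix k assume "k \<in> {..<n}"
      then have k: "k < n" by simp
      have a: "(\<Sum>i<n. of_bool (E n i k \<omega>) / g.N i) \<le> 2 * H n k \<omega>"
        unfolding H_eq[OF k] sum_distrib_left
        by (intro sum_mono) (use gg(1) in \<open>auto simp: m_def z_def\<close>)
      have "(\<Sum>i<n. of_bool (E n i k \<omega>) / (g.N i)\<^sup>2) \<le> (\<Sum>i<n. 2 * inv_deg n / c\<^sub>l * (of_bool (E n i k \<omega>) / g.N i))"
      proof (rule sum_mono)
        fix i assume "i \<in> {..<n}"
        then have i: "i < n" by simp
        have "(1 / g.N i) * (of_bool (E n i k \<omega>) / g.N i) \<le> 2 * inv_deg n / c\<^sub>l * (of_bool (E n i k \<omega>) / g.N i)"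
          by (intro mult_right_mono imN i) (simp add: deg_nonneg)
        then show "of_bool (E n i k \<omega>) / (g.N i)\<^sup>2 \<le> 2 * inv_deg n / c\<^sub>l * (of_bool (E n i k \<omega>) / g.N i)"
          by (simp add: power2_eq_square)
      qed
      also have "\<dots> \<le> 2 * inv_deg n / c\<^sub>l * (2 * H n k \<omega>)"
        unfolding sum_distrib_left[symmetric] by (rule mult_left_mono[OF a im0])
      finally have b: "(\<Sum>i<n. of_bool (E n i k \<omega>) / (g.N i)\<^sup>2) \<le> 2 * inv_deg n / c\<^sub>l * (2 * H n k \<omega>)" .
      show "(\<Sum>i<n. of_bool (E n i k \<omega>) / g.N i) * (\<Sum>i<n. of_bool (E n i k \<omega>) / (g.N i)\<^sup>2) \<le>
          (2 * H n k \<omega>) * (2 * inv_deg n / c\<^sub>l * (2 * H n k \<omega>))"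
        using H0[OF k] by (intro mult_mono[OF a b] sum_nonneg divide_nonneg_nonneg deg_nonneg) auto
    qed auto
    also have "\<dots> = (\<Sum>k<n. 512 * B\<^sup>2 * inv_deg n / c\<^sub>l * (H n k \<omega>)\<^sup>2)"
      unfolding sum_distrib_left by (intro sum.cong refl) (simp add: power2_eq_square)
    finally show ?thesis .
  qed
  have I3: "EW n (\<lambda>w. (S3 w)\<^sup>2) \<le> (\<Sum>k<n. 48 * B\<^sup>2 * (deg_tol n)\<^sup>2 * (H n k \<omega>)\<^sup>2 +
     3 * (Qt n ds k \<omega> - Qn n ds (z k))\<^sup>2 + 3 * (Qn n ds (z k) - Qf ds (z k))\<^sup>2)"
  proof -
    have "EW n (\<lambda>w. (S3 w)\<^sup>2) = \<pi> * (1 - \<pi>) * (\<Sum>j<n. (Qh j - Qf ds (z j))\<^sup>2)"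
      unfolding S3_def by (rule BD.EW_linear_sq) simp
    also have "\<dots> \<le> 1 * (\<Sum>j<n. (Qh j - Qf ds (z j))\<^sup>2)"
      using pi_range by (intro mult_right_mono mult_le_one sum_nonneg) auto
    also have "\<dots> \<le> (\<Sum>k<n. 48 * B\<^sup>2 * (deg_tol n)\<^sup>2 * (H n k \<omega>)\<^sup>2 +
     3 * (Qt n ds k \<omega> - Qn n ds (z k))\<^sup>2 + 3 * (Qn n ds (z k) - Qf ds (z k))\<^sup>2)"
      unfolding mult_1
    proof (rule sum_mono)
      fix k assume "k \<in> {..<n}"
      then have k: "k < n" by simp
      \<comment> \<open>The inverse degrees have relative error at most
        \<open>2 * deg_tol n\<close>, which factors out of the sum and leaves
        \<open>H\<close>.\<close>
      have "Qh k - Qt n ds k \<omega> = (\<Sum>i<n. of_bool (E n i k \<omega>) * (ds (z i) * (1 / g.N i - 1 / (m * gn n (z i)))))"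
        unfolding Qh_def Qt_full_sum[OF \<omega>M k] m_def[symmetric] z_def[symmetric] sum_subtractf[symmetric]
        by (intro sum.cong refl) (simp add: algebra_simps)
      then have "\<bar>Qh k - Qt n ds k \<omega>\<bar> \<le> (\<Sum>i<n. \<bar>of_bool (E n i k \<omega>) * (ds (z i) * (1 / g.N i - 1 / (m * gn n (z i))))\<bar>)"
        by (simp only: sum_abs)
      also have "\<dots> \<le> (\<Sum>i<n. of_bool (E n i k \<omega>) * ((2 * B) * (2 * deg_tol n / (m * gn n (z i)))))"
      proof (rule sum_mono)
        fix i assume "i \<in> {..<n}"
        then have i: "i < n" by simp
        have "\<bar>ds (z i) * (1 / g.N i - 1 / (m * gn n (z i)))\<bar> \<le> (2 * B) * (2 * deg_tol n / (m * gn n (z i)))"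
          unfolding abs_mult[of "ds (z i)"] using gg(3)[OF i] ds_bound[OF zs[OF i]] B_nonneg
          by (intro mult_mono) (auto simp: z_def m_def)
        then show "\<bar>of_bool (E n i k \<omega>) * (ds (z i) * (1 / g.N i - 1 / (m * gn n (z i))))\<bar> \<le>
            of_bool (E n i k \<omega>) * ((2 * B) * (2 * deg_tol n / (m * gn n (z i))))"
          by (cases "E n i k \<omega>") auto
      qed
      also have "\<dots> = 4 * B * deg_tol n * H n k \<omega>"
        unfolding H_eq[OF k] sum_distrib_left by (intro sum.cong refl) simp
      finally have "\<bar>Qh k - Qt n ds k \<omega>\<bar>\<^sup>2 \<le> (4 * B * deg_tol n * H n k \<omega>)\<^sup>2" by (intro power_mono) auto
      then have a: "(Qh k - Qt n ds k \<omega>)\<^sup>2 \<le> 16 * B\<^sup>2 * (deg_tol n)\<^sup>2 * (H n k \<omega>)\<^sup>2" by (simp add: power_mult_distrib)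
      have "(Qh k - Qf ds (z k))\<^sup>2 = ((Qh k - Qt n ds k \<omega>) + (Qt n ds k \<omega> - Qn n ds (z k)) + (Qn n ds (z k) - Qf ds (z k)))\<^sup>2"
        by simp
      also have "\<dots> \<le> 3 * ((Qh k - Qt n ds k \<omega>)\<^sup>2 + (Qt n ds k \<omega> - Qn n ds (z k))\<^sup>2 + (Qn n ds (z k) - Qf ds (z k))\<^sup>2)"
        by (rule sum3_sq_le)
      finally show "(Qh k - Qf ds (z k))\<^sup>2 \<le> 48 * B\<^sup>2 * (deg_tol n)\<^sup>2 * (H n k \<omega>)\<^sup>2 +
          3 * (Qt n ds k \<omega> - Qn n ds (z k))\<^sup>2 + 3 * (Qn n ds (z k) - Qf ds (z k))\<^sup>2"
        using a by simp
    qed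
    finally show ?thesis .
  qed
  have "EW n (\<lambda>w. (HT_rem n \<omega> w)\<^sup>2) \<le> EW n (\<lambda>w. (3 / real n) * ((S1 w)\<^sup>2 + (S2 w - EW n S2)\<^sup>2 + (S3 w)\<^sup>2))"
  proof (rule BD.EW_mono)
    fix w
    have "(HT_rem n \<omega> w)\<^sup>2 = (1 / real n) * (S1 w + (S2 w - EW n S2) + S3 w)\<^sup>2"
      unfolding decomp by (simp add: power_mult_distrib power_divide)
    also have "\<dots> \<le> (1 / real n) * (3 * ((S1 w)\<^sup>2 + (S2 w - EW n S2)\<^sup>2 + (S3 w)\<^sup>2))"
      by (intro mult_left_mono sum3_sq_le) simp
    finally show "(HT_rem n \<omega> w)\<^sup>2 \<le> (3 / real n) * ((S1 w)\<^sup>2 + (S2 w - EW n S2)\<^sup>2 + (S3 w)\<^sup>2)" by simp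
  qed
  also have "\<dots> = (3 / real n) * (EW n (\<lambda>w. (S1 w)\<^sup>2) + EW n (\<lambda>w. (S2 w - EW n S2)\<^sup>2) + EW n (\<lambda>w. (S3 w)\<^sup>2))"
    by (simp only: integral_mult_right_zero Bochner_Integration.integral_add BD.integrable_design)
  also have "\<dots> \<le> (3 / real n) * (real n * (4 * R_const\<^sup>2 * inv_deg n / c\<^sub>l) + (\<Sum>k<n. 512 * B\<^sup>2 * inv_deg n / c\<^sub>l * (H n k \<omega>)\<^sup>2) +
      (\<Sum>k<n. 48 * B\<^sup>2 * (deg_tol n)\<^sup>2 * (H n k \<omega>)\<^sup>2 +
     3 * (Qt n ds k \<omega> - Qn n ds (z k))\<^sup>2 + 3 * (Qn n ds (z k) - Qf ds (z k))\<^sup>2))"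
    by (intro mult_left_mono add_mono I1 I2 I3) simp
  also have "\<dots> = HT_rem_bound n \<omega>"
    unfolding HT_rem_bound_def z_def[symmetric] distrib_left[of "3 / real n"] add.assoc[symmetric]
    using n0 by (simp add: sum.distrib algebra_simps)
  finally show ?thesis .
qed

section \<open>Averaging the bound over the graph\<close>

definition gD_sq_mean :: real where "gD_sq_mean = (LINT z|D. (gD z)\<^sup>2)"

lemma Qt_measurable: "h \<in> borel_measurable D \<Longrightarrow> c < n \<Longrightarrow> Qt n h c \<in> borel_measurable (M n)"
proof -
  assume h: "h \<in> borel_measurable D" and c: "c < n"
  have m: "(\<lambda>z. h z / gn n z) \<in> borel_measurable D" using h by simp
  have "(\<lambda>\<omega>. of_bool (E n c i \<omega>) * (h (Z n i \<omega>) / gn n (Z n i \<omega>))) \<in> borel_measurable (M n)" if "i < n" for i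
    by (rule borel_measurable_times[OF GG_to_M[OF E_of_bool_measurable[OF c that]] compose_Z_M[OF m that]])
  then show ?thesis
    unfolding Qt_def[abs_def] by (intro borel_measurable_divide borel_measurable_sum borel_measurable_const) auto
qed

text \<open>The variance bound for \<open>Qt\<close> with \<open>h = 1\<close> controls the
  fluctuation; the conditional mean is at most \<open>gD / c\<^sub>l\<close>, which is square
  integrable because \<open>G\<close> is.\<close>

lemma H_sq:
  assumes k: "k < n" and n: "2 \<le> n"
  shows "integrable (M n) (\<lambda>\<omega>. (H n k \<omega>)\<^sup>2)"
    and "(LINT \<omega>|M n. (H n k \<omega>)\<^sup>2) \<le> 2 * (G1 * inv_deg n / c\<^sub>l\<^sup>2) + 2 * (gD_sq_mean / c\<^sub>l\<^sup>2)"
proof -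
  let ?h = "\<lambda>_. 1 :: real"
  have hm: "?h \<in> borel_measurable D" by simp
  have v: "integrable (M n) (\<lambda>\<omega>. (H n k \<omega> - Qn n ?h (Z n k \<omega>))\<^sup>2)"
    "(LINT \<omega>|M n. (H n k \<omega> - Qn n ?h (Z n k \<omega>))\<^sup>2) \<le> 1\<^sup>2 * G1 / ((real n - 1) * \<rho> n * c\<^sub>l\<^sup>2)"
    by (rule Qt_variance(1)[OF k n hm, where C = 1], simp) (rule Qt_variance(2)[OF k n hm, where C = 1], simp)
  have qm: "(\<lambda>\<omega>. Qn n ?h (Z n k \<omega>)) \<in> borel_measurable (M n)"
    by (rule compose_Z_M[OF Qn_measurable[OF hm] k])
  have Qn2: "integrable D (\<lambda>z. (Qn n ?h z)\<^sup>2)"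
    by (rule D.bounded_square_integrable[OF Qn_measurable[OF hm] Qn_bound(1)[OF _ hm, of _ 1]]) auto
  have le: "(LINT z|D. (Qn n ?h z)\<^sup>2) \<le> (LINT z|D. (gD z)\<^sup>2 / c\<^sub>l\<^sup>2)"
  proof (rule integral_mono_AE[OF Qn2])
    show "integrable D (\<lambda>z. (gD z)\<^sup>2 / c\<^sub>l\<^sup>2)" using integrable_gD_sq by simp
    show "AE z in D. (Qn n ?h z)\<^sup>2 \<le> (gD z)\<^sup>2 / c\<^sub>l\<^sup>2"
      using AE_integrable_Gz AE_space
    proof eventually_elim
      case (elim z)
      have "\<bar>Qn n ?h z\<bar> \<le> 1 / c\<^sub>l * gD z"
        by (rule Qn_bound(2)[OF elim(2) hm _ elim(1)]) simp
      then have "\<bar>Qn n ?h z\<bar>\<^sup>2 \<le> (1 / c\<^sub>l * gD z)\<^sup>2" by (intro power_mono) auto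
      then show ?case by (simp add: power_divide)
    qed
  qed
  have q: "integrable (M n) (\<lambda>\<omega>. (Qn n ?h (Z n k \<omega>))\<^sup>2)" "(LINT \<omega>|M n. (Qn n ?h (Z n k \<omega>))\<^sup>2) \<le> gD_sq_mean / c\<^sub>l\<^sup>2"
    using integrable_Z[of "\<lambda>z. (Qn n ?h z)\<^sup>2" k n] integral_Z[of "\<lambda>z. (Qn n ?h z)\<^sup>2" k n] Qn2 le k Qn_measurable[OF hm, of n]
    by (simp_all add: gD_sq_mean_def)
  have m1: "(\<lambda>\<omega>. H n k \<omega> - Qn n ?h (Z n k \<omega>)) \<in> borel_measurable (M n)"
    by (intro borel_measurable_diff Qt_measurable hm k qm)
  have "integrable (M n) (\<lambda>\<omega>. ((H n k \<omega> - Qn n ?h (Z n k \<omega>)) + Qn n ?h (Z n k \<omega>))\<^sup>2)"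
    by (rule square_integrable_add[OF m1 qm v(1) q(1)])
  then show i: "integrable (M n) (\<lambda>\<omega>. (H n k \<omega>)\<^sup>2)" by simp
  have "(LINT \<omega>|M n. (H n k \<omega>)\<^sup>2) \<le>
      (LINT \<omega>|M n. 2 * (H n k \<omega> - Qn n ?h (Z n k \<omega>))\<^sup>2 + 2 * (Qn n ?h (Z n k \<omega>))\<^sup>2)"
  proof (rule integral_mono[OF i])
    show "integrable (M n) (\<lambda>\<omega>. 2 * (H n k \<omega> - Qn n ?h (Z n k \<omega>))\<^sup>2 + 2 * (Qn n ?h (Z n k \<omega>))\<^sup>2)"
      using v(1) q(1) by simp
    fix \<omega>
    have "x\<^sup>2 \<le> 2 * (x - y)\<^sup>2 + 2 * y\<^sup>2" for x y :: real
    proof -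
      have "0 \<le> (x - 2 * y)\<^sup>2" by simp
      then show ?thesis by (simp add: power2_eq_square algebra_simps)
    qed
    then show "(H n k \<omega>)\<^sup>2 \<le> 2 * (H n k \<omega> - Qn n ?h (Z n k \<omega>))\<^sup>2 + 2 * (Qn n ?h (Z n k \<omega>))\<^sup>2" .
  qed
  also have "\<dots> = 2 * (LINT \<omega>|M n. (H n k \<omega> - Qn n ?h (Z n k \<omega>))\<^sup>2) + 2 * (LINT \<omega>|M n. (Qn n ?h (Z n k \<omega>))\<^sup>2)"
    using v(1) q(1) by simp
  also have "\<dots> \<le> 2 * (G1 * inv_deg n / c\<^sub>l\<^sup>2) + 2 * (gD_sq_mean / c\<^sub>l\<^sup>2)"
    using v(2) q(2) by (simp add: inv_deg_def)
  finally show "(LINT \<omega>|M n. (H n k \<omega>)\<^sup>2) \<le> 2 * (G1 * inv_deg n / c\<^sub>l\<^sup>2) + 2 * (gD_sq_mean / c\<^sub>l\<^sup>2)" .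
qed

text \<open>Every summand carries one of the vanishing factors \<open>inv_deg\<close>,
  \<open>deg_tol\<close> and \<open>Kn\<close>; the factor built from \<open>G1\<close> and
  \<open>gD_sq_mean\<close> is the bound on the second moment of \<open>H\<close> and stays
  bounded.\<close>

definition HT_rem_rate :: "nat \<Rightarrow> real" where
  "HT_rem_rate n = 12 * R_const\<^sup>2 * inv_deg n / c\<^sub>l + 3 * ((512 * B\<^sup>2 * inv_deg n / c\<^sub>l + 48 * B\<^sup>2 * (deg_tol n)\<^sup>2) *
     (2 * (G1 * inv_deg n / c\<^sub>l\<^sup>2) + 2 * (gD_sq_mean / c\<^sub>l\<^sup>2)) + 3 * ((2 * B)\<^sup>2 * G1 * inv_deg n / c\<^sub>l\<^sup>2) + 3 * ((2 * B)\<^sup>2 * Kn n))"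

lemma HT_rem_rate_tendsto: "HT_rem_rate \<longlonglongrightarrow> 0"
proof -
  have "HT_rem_rate \<longlonglongrightarrow> 12 * R_const\<^sup>2 * 0 / c\<^sub>l + 3 * ((512 * B\<^sup>2 * 0 / c\<^sub>l + 48 * B\<^sup>2 * 0\<^sup>2) *
     (2 * (G1 * 0 / c\<^sub>l\<^sup>2) + 2 * (gD_sq_mean / c\<^sub>l\<^sup>2)) + 3 * ((2 * B)\<^sup>2 * G1 * 0 / c\<^sub>l\<^sup>2) + 3 * ((2 * B)\<^sup>2 * 0))"
    unfolding HT_rem_rate_def[abs_def] using c\<^sub>l(1) by (intro tendsto_intros inv_deg_tendsto deg_tol_tendsto Kn_tendsto) auto
  then show ?thesis by simp
qed

lemma HT_rem_bound_expectation:
  assumes n: "2 \<le> n"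
  shows "integrable (M n) (HT_rem_bound n)" and "(LINT \<omega>|M n. HT_rem_bound n \<omega>) \<le> HT_rem_rate n"
proof -
  define c where "c = 512 * B\<^sup>2 * inv_deg n / c\<^sub>l + 48 * B\<^sup>2 * (deg_tol n)\<^sup>2"
  have c0: "0 \<le> c" using n rho_range[of n] c\<^sub>l(1) by (simp add: c_def inv_deg_def)
  have dm: "ds \<in> borel_measurable D" by simp
  have Q: "integrable (M n) (\<lambda>\<omega>. (Qt n ds k \<omega> - Qn n ds (Z n k \<omega>))\<^sup>2) \<and>
      (LINT \<omega>|M n. (Qt n ds k \<omega> - Qn n ds (Z n k \<omega>))\<^sup>2) \<le> (2 * B)\<^sup>2 * G1 * inv_deg n / c\<^sub>l\<^sup>2" if k: "k < n" for k
  proof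
    show "integrable (M n) (\<lambda>\<omega>. (Qt n ds k \<omega> - Qn n ds (Z n k \<omega>))\<^sup>2)"
      by (rule Qt_variance(1)[OF k n dm ds_bound])
    have "(LINT \<omega>|M n. (Qt n ds k \<omega> - Qn n ds (Z n k \<omega>))\<^sup>2) \<le> (2 * B)\<^sup>2 * G1 / ((real n - 1) * \<rho> n * c\<^sub>l\<^sup>2)"
      by (rule Qt_variance(2)[OF k n dm ds_bound])
    then show "(LINT \<omega>|M n. (Qt n ds k \<omega> - Qn n ds (Z n k \<omega>))\<^sup>2) \<le> (2 * B)\<^sup>2 * G1 * inv_deg n / c\<^sub>l\<^sup>2"
      by (simp add: inv_deg_def)
  qed
  have K: "integrable (M n) (\<lambda>\<omega>. (Qn n ds (Z n k \<omega>) - Qf ds (Z n k \<omega>))\<^sup>2) \<and>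
      (LINT \<omega>|M n. (Qn n ds (Z n k \<omega>) - Qf ds (Z n k \<omega>))\<^sup>2) \<le> (2 * B)\<^sup>2 * Kn n" if k: "k < n" for k
  proof -
    have m: "(\<lambda>z. (Qn n ds z - Qf ds z)\<^sup>2) \<in> borel_measurable D"
      using Qn_measurable[OF dm, of n] Qf_measurable[OF dm] by simp
    have i: "integrable D (\<lambda>z. (Qn n ds z - Qf ds z)\<^sup>2)"
      by (rule Qn_diff_sq_integrable[OF dm ds_bound])
    have l: "(LINT z|D. (Qn n ds z - Qf ds z)\<^sup>2) \<le> (2 * B)\<^sup>2 * Kn n"
      by (rule Qn_diff_sq[OF dm ds_bound])
    show ?thesis using integrable_Z[OF m k] integral_Z[OF m k] i l by simp
  qed
  note H = H_sq[OF _ n]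
  have trm: "integrable (M n) (\<lambda>\<omega>. c * (H n k \<omega>)\<^sup>2 + 3 * (Qt n ds k \<omega> - Qn n ds (Z n k \<omega>))\<^sup>2 +
      3 * (Qn n ds (Z n k \<omega>) - Qf ds (Z n k \<omega>))\<^sup>2)" if "k < n" for k
    using H(1)[OF that] Q[OF that] K[OF that] by simp
  show "integrable (M n) (HT_rem_bound n)"
    unfolding HT_rem_bound_def[abs_def] c_def[symmetric]
    by (intro Bochner_Integration.integrable_add M.integrable_const integrable_mult_right impI
        Bochner_Integration.integrable_sum trm) auto
  have "(LINT \<omega>|M n. HT_rem_bound n \<omega>) = 12 * R_const\<^sup>2 * inv_deg n / c\<^sub>l + (3 / real n) * (\<Sum>k<n. (LINT \<omega>|M n. c * (H n k \<omega>)\<^sup>2 +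
      3 * (Qt n ds k \<omega> - Qn n ds (Z n k \<omega>))\<^sup>2 + 3 * (Qn n ds (Z n k \<omega>) - Qf ds (Z n k \<omega>))\<^sup>2))"
  proof -
    define t where "t k \<omega> = c * (H n k \<omega>)\<^sup>2 + 3 * (Qt n ds k \<omega> - Qn n ds (Z n k \<omega>))\<^sup>2 +
      3 * (Qn n ds (Z n k \<omega>) - Qf ds (Z n k \<omega>))\<^sup>2" for k \<omega>
    have t: "integrable (M n) (t k)" if "k \<in> {..<n}" for k
      using trm[of k] that by (simp add: t_def[abs_def])
    have "(LINT \<omega>|M n. HT_rem_bound n \<omega>) = (LINT \<omega>|M n. 12 * R_const\<^sup>2 * inv_deg n / c\<^sub>l + (3 / real n) * (\<Sum>k<n. t k \<omega>))"
      unfolding HT_rem_bound_def c_def[symmetric] t_def ..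
    also have "\<dots> = 12 * R_const\<^sup>2 * inv_deg n / c\<^sub>l + (3 / real n) * (\<Sum>k<n. (LINT \<omega>|M n. t k \<omega>))"
    proof -
      have S: "integrable (M n) (\<lambda>\<omega>. \<Sum>k<n. t k \<omega>)" by (rule Bochner_Integration.integrable_sum[OF t])
      then have "integrable (M n) (\<lambda>\<omega>. (3 / real n) * (\<Sum>k<n. t k \<omega>))" by (rule integrable_mult_right)
      then have "(LINT \<omega>|M n. 12 * R_const\<^sup>2 * inv_deg n / c\<^sub>l + (3 / real n) * (\<Sum>k<n. t k \<omega>)) =
          12 * R_const\<^sup>2 * inv_deg n / c\<^sub>l + (LINT \<omega>|M n. (3 / real n) * (\<Sum>k<n. t k \<omega>))"
        by (subst Bochner_Integration.integral_add[OF M.integrable_const]) (simp_all add: M.prob_space)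
      also have "(LINT \<omega>|M n. (3 / real n) * (\<Sum>k<n. t k \<omega>)) = (3 / real n) * (LINT \<omega>|M n. (\<Sum>k<n. t k \<omega>))"
        by (rule integral_mult_right_zero)
      also have "(LINT \<omega>|M n. (\<Sum>k<n. t k \<omega>)) = (\<Sum>k<n. (LINT \<omega>|M n. t k \<omega>))"
        by (rule Bochner_Integration.integral_sum[OF t])
      finally show ?thesis .
    qed
    finally show ?thesis unfolding t_def .
  qed
  also have "\<dots> \<le> 12 * R_const\<^sup>2 * inv_deg n / c\<^sub>l + (3 / real n) * (\<Sum>k<n. c * (2 * (G1 * inv_deg n / c\<^sub>l\<^sup>2) + 2 * (gD_sq_mean / c\<^sub>l\<^sup>2)) +
      3 * ((2 * B)\<^sup>2 * G1 * inv_deg n / c\<^sub>l\<^sup>2) + 3 * ((2 * B)\<^sup>2 * Kn n))"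
  proof (intro add_left_mono mult_left_mono sum_mono)
    fix k assume "k \<in> {..<n}"
    then have k: "k < n" by simp
    have "(LINT \<omega>|M n. c * (H n k \<omega>)\<^sup>2 + 3 * (Qt n ds k \<omega> - Qn n ds (Z n k \<omega>))\<^sup>2 + 3 * (Qn n ds (Z n k \<omega>) - Qf ds (Z n k \<omega>))\<^sup>2) =
        c * (LINT \<omega>|M n. (H n k \<omega>)\<^sup>2) + 3 * (LINT \<omega>|M n. (Qt n ds k \<omega> - Qn n ds (Z n k \<omega>))\<^sup>2) +
        3 * (LINT \<omega>|M n. (Qn n ds (Z n k \<omega>) - Qf ds (Z n k \<omega>))\<^sup>2)"
      using H(1)[OF k] Q[OF k] K[OF k] by simp
    also have "\<dots> \<le> c * (2 * (G1 * inv_deg n / c\<^sub>l\<^sup>2) + 2 * (gD_sq_mean / c\<^sub>l\<^sup>2)) + 3 * ((2 * B)\<^sup>2 * G1 * inv_deg n / c\<^sub>l\<^sup>2) + 3 * ((2 * B)\<^sup>2 * Kn n)"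
      using Q[OF k] K[OF k] by (intro add_mono mult_left_mono H(2)[OF k] c0) auto
    finally show "(LINT \<omega>|M n. c * (H n k \<omega>)\<^sup>2 + 3 * (Qt n ds k \<omega> - Qn n ds (Z n k \<omega>))\<^sup>2 + 3 * (Qn n ds (Z n k \<omega>) - Qf ds (Z n k \<omega>))\<^sup>2)
        \<le> c * (2 * (G1 * inv_deg n / c\<^sub>l\<^sup>2) + 2 * (gD_sq_mean / c\<^sub>l\<^sup>2)) + 3 * ((2 * B)\<^sup>2 * G1 * inv_deg n / c\<^sub>l\<^sup>2) + 3 * ((2 * B)\<^sup>2 * Kn n)" .
  qed simp
  also have "\<dots> = HT_rem_rate n"
    unfolding HT_rem_rate_def c_def[symmetric] sum_constant using n by simp
  finally show "(LINT \<omega>|M n. HT_rem_bound n \<omega>) \<le> HT_rem_rate n" .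
qed

text \<open>Combines the two averages. Since \<open>Good n\<close> does not involve the treatments,
  the expectation over them may be taken first on this event; the resulting bound
  \<open>\<Psi>\<close> is then averaged over the graph.\<close>

lemma second_moment_on_Good:
  assumes F: "\<And>n w. (\<lambda>\<omega>. F n \<omega> w) \<in> borel_measurable (GG n)"
    and Fi: "\<And>n w. integrable (M n) (\<lambda>\<omega>. (F n \<omega> w)\<^sup>2)"
    and b: "\<forall>\<^sub>F n in sequentially. integrable (M n) (\<Psi> n) \<and> (LINT \<omega>|M n. \<Psi> n \<omega>) \<le> b n \<and> (\<forall>\<omega>\<in>space (M n). 0 \<le> \<Psi> n \<omega>) \<and>
      (\<forall>\<omega>\<in>Good n. EW n (\<lambda>w. (F n \<omega> w)\<^sup>2) \<le> \<Psi> n \<omega>)"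
    and b0: "b \<longlonglongrightarrow> 0"
  shows "conv_prob_zero M (\<lambda>n \<omega>. F n \<omega> (wv n \<omega>))"
proof (rule conv_prob_zeroI_second_moment[where A = Good, OF prob_space_M _ Good_M prob_Good _ _ b0])
  show "(\<lambda>\<omega>. F n \<omega> (wv n \<omega>)) \<in> borel_measurable (M n)" for n by (rule measurable_wv[OF F])
  have m: "(\<lambda>\<omega>. indicator (Good n) \<omega> * (F n \<omega> w)\<^sup>2) \<in> borel_measurable (GG n)" for n w
    by (intro borel_measurable_times borel_measurable_indicator Good_GG borel_measurable_power F)
  have i: "integrable (M n) (\<lambda>\<omega>. indicator (Good n) \<omega> * (F n \<omega> w)\<^sup>2)" for n w
    using integrable_real_mult_indicator[OF Good_M Fi] by (simp only: mult.commute)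
  show "\<forall>\<^sub>F n in sequentially. integrable (M n) (\<lambda>\<omega>. indicator (Good n) \<omega> * (F n \<omega> (wv n \<omega>))\<^sup>2)"
    by (intro always_eventually allI integrable_wv[where F = "\<lambda>\<omega> w. indicator (Good _) \<omega> * (F _ \<omega> w)\<^sup>2", OF m i])
  show "\<forall>\<^sub>F n in sequentially. (LINT \<omega>|M n. indicator (Good n) \<omega> * (F n \<omega> (wv n \<omega>))\<^sup>2) \<le> b n"
    using b
  proof eventually_elim
    case (elim n)
    have "(LINT \<omega>|M n. indicator (Good n) \<omega> * (F n \<omega> (wv n \<omega>))\<^sup>2) =
        (LINT \<omega>|M n. EW n (\<lambda>w. indicator (Good n) \<omega> * (F n \<omega> w)\<^sup>2))"
      by (rule integral_wv[where F = "\<lambda>\<omega> w. indicator (Good n) \<omega> * (F n \<omega> w)\<^sup>2", OF m i])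
    also have "\<dots> \<le> (LINT \<omega>|M n. \<Psi> n \<omega>)"
    proof (rule integral_mono)
      show "integrable (M n) (\<lambda>\<omega>. EW n (\<lambda>w. indicator (Good n) \<omega> * (F n \<omega> w)\<^sup>2))"
        by (rule integrable_EW[where F = "\<lambda>\<omega> w. indicator (Good n) \<omega> * (F n \<omega> w)\<^sup>2", OF m i])
      show "integrable (M n) (\<Psi> n)" using elim by simp
      show "EW n (\<lambda>w. indicator (Good n) \<omega> * (F n \<omega> w)\<^sup>2) \<le> \<Psi> n \<omega>" if "\<omega> \<in> space (M n)" for \<omega>
        using elim that by (cases "\<omega> \<in> Good n") auto
    qed
    also have "\<dots> \<le> b n" using elim by simp
    finally show ?case .
  qed
qed

lemma eventually_good: "\<forall>\<^sub>F n in sequentially. 2 \<le> n \<and> 0 < deg_tol n \<and> deg_tol n \<le> 1 / 2"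
  using deg_tol_small eventually_ge_at_top[of 2] by eventually_elim auto

lemma HT_remainder: "conv_prob_zero M (\<lambda>n \<omega>. HT_rem n \<omega> (wv n \<omega>))"
proof (rule second_moment_on_Good[where \<Psi> = HT_rem_bound, OF HT_rem_GG HT_rem_sq_integrable _ HT_rem_rate_tendsto])
  show "\<forall>\<^sub>F n in sequentially. integrable (M n) (HT_rem_bound n) \<and> (LINT \<omega>|M n. HT_rem_bound n \<omega>) \<le> HT_rem_rate n \<and> (\<forall>\<omega>\<in>space (M n). 0 \<le> HT_rem_bound n \<omega>) \<and>
      (\<forall>\<omega>\<in>Good n. EW n (\<lambda>w. (HT_rem n \<omega> w)\<^sup>2) \<le> HT_rem_bound n \<omega>)"
    using eventually_good
  proof eventually_elim
    case (elim n)
    have "0 \<le> inv_deg n" using elim rho_range[of n] by (simp add: inv_deg_def)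
    then have "0 \<le> HT_rem_bound n \<omega>" for \<omega>
      unfolding HT_rem_bound_def using c\<^sub>l(1) by (intro add_nonneg_nonneg mult_nonneg_nonneg sum_nonneg divide_nonneg_nonneg) auto
    then show ?case using HT_rem_bound_expectation[of n] HT_rem_sq_bound[of _ n] elim by auto
  qed
qed

end

section \<open>The limit of the estimand and the Hajek estimator\<close>

lemma conv_prob_zero_const:
  assumes prob: "\<And>n. prob_space (M n)" and c: "c \<longlonglongrightarrow> 0"
  shows "conv_prob_zero M (\<lambda>n _. c n)"
  unfolding conv_prob_zero_def
proof (intro conjI allI impI)
  fix \<eta> :: real assume "\<eta> > 0"
  then have "\<forall>\<^sub>F n in sequentially. \<bar>c n\<bar> < \<eta>"
    using order_tendstoD(2)[OF tendsto_rabs_zero[OF c]] by simp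
  then have "\<forall>\<^sub>F n in sequentially. measure (M n) {\<omega> \<in> space (M n). \<eta> < \<bar>c n\<bar>} = 0"
    by eventually_elim auto
  then show "(\<lambda>n. measure (M n) {\<omega> \<in> space (M n). \<eta> < \<bar>c n\<bar>}) \<longlonglongrightarrow> 0"
    by (rule tendsto_eventually)
qed simp

context network_asymptotics
begin

text \<open>The linear part of a direct effect cancels because the exposure has mean exactly \<pi>.
  What is left is quadratic, so the bias is of the order of the variance of the exposure and not of
  its standard deviation.\<close>

lemma EW_dfun_close:
  assumes \<omega>: "\<omega> \<in> Good n" and n: "2 \<le> n" and deg_tol: "deg_tol n \<le> 1 / 2"
  shows "\<bar>cond_tau n \<omega> - (1 / real n) * (\<Sum>i<n. dfun (Z n i \<omega>) \<pi>)\<bar> \<le> 4 * B * inv_deg n / c\<^sub>l"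
proof -
  interpret g: bernoulli_design_graph n \<pi> "Gr n \<omega>" by (rule good_graph(1)[OF \<omega> n deg_tol])
  have \<omega>M: "\<omega> \<in> space (M n)" using \<omega> by (simp add: Good_def)
  have im0: "0 \<le> inv_deg n" using n rho_range[of n] by (simp add: inv_deg_def)
  have "\<bar>EW n (\<lambda>w. dfun (Z n i \<omega>) (g.X i w)) - dfun (Z n i \<omega>) \<pi>\<bar> \<le> 4 * B * inv_deg n / c\<^sub>l" if i: "i < n" for i
  proof -
    note z = Z_space[OF i \<omega>M]
    define q where "q x = dfun (Z n i \<omega>) x - ds (Z n i \<omega>) * x" for x
    have X: "EW n (\<lambda>w. g.X i w) = \<pi>" using g.EW_X_centred[OF i] by simp
    have "EW n (\<lambda>w. q (g.X i w) - q \<pi>) = EW n (\<lambda>w. dfun (Z n i \<omega>) (g.X i w)) - dfun (Z n i \<omega>) \<pi>"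
      unfolding q_def using X by simp
    then have "\<bar>EW n (\<lambda>w. dfun (Z n i \<omega>) (g.X i w)) - dfun (Z n i \<omega>) \<pi>\<bar> = \<bar>EW n (\<lambda>w. q (g.X i w) - q \<pi>)\<bar>" by simp
    also have "\<dots> \<le> EW n (\<lambda>w. \<bar>q (g.X i w) - q \<pi>\<bar>)" by (rule BD.EW_abs)
    also have "\<dots> \<le> EW n (\<lambda>w. 2 * B * (g.X i w - \<pi>)\<^sup>2)"
    proof (rule BD.EW_mono)
      fix w
      have "\<bar>q (g.X i w) - q \<pi>\<bar> \<le> 2 * B * \<bar>g.X i w - \<pi>\<bar> * (\<bar>g.X i w - \<pi>\<bar> + \<bar>\<pi> - \<pi>\<bar>)"
        unfolding q_def by (rule dfun_remainder[OF z frac_treated_range pi01])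
      then show "\<bar>q (g.X i w) - q \<pi>\<bar> \<le> 2 * B * (g.X i w - \<pi>)\<^sup>2" by (simp add: power2_eq_square)
    qed
    also have "\<dots> = 2 * B * EW n (\<lambda>w. (g.X i w - \<pi>)\<^sup>2)" by simp
    also have "\<dots> \<le> 2 * B * (2 * inv_deg n / c\<^sub>l)"
      using g.EW_X_sq[OF i] good_graph(3)[OF \<omega> n deg_tol i] B_nonneg by (intro mult_left_mono) auto
    finally show ?thesis by simp
  qed
  then have "\<bar>(1 / real n) * (\<Sum>i<n. EW n (\<lambda>w. dfun (Z n i \<omega>) (g.X i w)) - dfun (Z n i \<omega>) \<pi>)\<bar> \<le> 4 * B * inv_deg n / c\<^sub>l"
    by (rule abs_average_le) (use B_nonneg im0 c\<^sub>l(1) in auto)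
  then show ?thesis unfolding cond_tau_def by (simp add: sum_subtractf right_diff_distrib)
qed

definition mean_direct :: real where "mean_direct = (LINT z|D. dfun z \<pi>)"

lemma avg_dfun_GG: "(\<lambda>\<omega>. (1 / real n) * (\<Sum>i<n. dfun (Z n i \<omega>) \<pi>)) \<in> borel_measurable (GG n)"
  by (intro borel_measurable_times borel_measurable_const borel_measurable_sum compose_Z[OF dfun_pi_measurable]) auto

lemma avg_dfun_bound: "\<omega> \<in> space (M n) \<Longrightarrow> \<bar>(1 / real n) * (\<Sum>i<n. dfun (Z n i \<omega>) \<pi>)\<bar> \<le> 2 * B"
  by (rule abs_average_le) (use B_nonneg in \<open>auto intro!: dfun_bound Z_space pi01 simp del: abs_mult\<close>)

lemma integrable_dfun: "integrable D (\<lambda>z. dfun z \<pi>)"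
  by (rule D.integrable_const_bound[where B = "2 * B"]) (auto simp: dfun_bound[OF _ pi01])

lemma integrable_cond_tau_diff: "integrable (M n) (\<lambda>\<omega>. cond_tau n \<omega> - (1 / real n) * (\<Sum>i<n. dfun (Z n i \<omega>) \<pi>))"
proof (rule M.integrable_const_bound[where B = "4 * B"])
  show "AE \<omega> in M n. norm (cond_tau n \<omega> - (1 / real n) * (\<Sum>i<n. dfun (Z n i \<omega>) \<pi>)) \<le> 4 * B"
  proof (rule AE_I2)
    fix \<omega> assume \<omega>: "\<omega> \<in> space (M n)"
    show "norm (cond_tau n \<omega> - (1 / real n) * (\<Sum>i<n. dfun (Z n i \<omega>) \<pi>)) \<le> 4 * B"
      unfolding real_norm_def using cond_tau_bound[OF \<omega>] avg_dfun_bound[OF \<omega>] by linarith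
  qed
qed (intro GG_to_M borel_measurable_diff cond_tau_GG avg_dfun_GG)

lemma integral_cond_tau_tendsto: "(\<lambda>n. LINT \<omega>|M n. cond_tau n \<omega>) \<longlonglongrightarrow> mean_direct"
proof -
  let ?d = "\<lambda>n \<omega>. cond_tau n \<omega> - (1 / real n) * (\<Sum>i<n. dfun (Z n i \<omega>) \<pi>)"
  \<comment> \<open>The second term accounts for the complement of \<open>Good n\<close>, where each
    of the two averages is still bounded by \<open>2 * B\<close>.\<close>
  define b where "b n = 4 * B * inv_deg n / c\<^sub>l + 4 * B * measure (M n) (space (M n) - Good n)" for n
  have "b \<longlonglongrightarrow> 4 * B * 0 / c\<^sub>l + 4 * B * 0"
    unfolding b_def using c\<^sub>l(1) by (intro tendsto_intros inv_deg_tendsto prob_Good) auto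
  then have b0: "b \<longlonglongrightarrow> 0" by simp
  have "(\<lambda>n. (LINT \<omega>|M n. cond_tau n \<omega>) - mean_direct) \<longlonglongrightarrow> 0"
  proof (rule Lim_null_comparison[OF _ b0])
    show "\<forall>\<^sub>F n in sequentially. norm ((LINT \<omega>|M n. cond_tau n \<omega>) - mean_direct) \<le> b n"
      using eventually_good
    proof eventually_elim
      case (elim n)
      have it: "integrable (M n) (\<lambda>\<omega>. dfun (Z n i \<omega>) \<pi>)" "(LINT \<omega>|M n. dfun (Z n i \<omega>) \<pi>) = mean_direct" if "i \<in> {..<n}" for i
        using integrable_Z[OF dfun_pi_measurable, of i n] integral_Z[OF dfun_pi_measurable, of i n] integrable_dfun that
        by (simp_all add: mean_direct_def)
      have S: "integrable (M n) (\<lambda>\<omega>. (1 / real n) * (\<Sum>i<n. dfun (Z n i \<omega>) \<pi>))"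
        by (intro integrable_mult_right impI Bochner_Integration.integrable_sum it)
      have "(LINT \<omega>|M n. (\<Sum>i<n. dfun (Z n i \<omega>) \<pi>)) = (\<Sum>i<n. (LINT \<omega>|M n. dfun (Z n i \<omega>) \<pi>))"
        by (rule Bochner_Integration.integral_sum[OF it(1)])
      also have "\<dots> = real n * mean_direct" using it(2) by simp
      finally have "(LINT \<omega>|M n. (1 / real n) * (\<Sum>i<n. dfun (Z n i \<omega>) \<pi>)) = mean_direct"
        using elim by simp
      moreover have "(LINT \<omega>|M n. cond_tau n \<omega>) = (LINT \<omega>|M n. ?d n \<omega> + (1 / real n) * (\<Sum>i<n. dfun (Z n i \<omega>) \<pi>))"
        by simp
      ultimately have "(LINT \<omega>|M n. cond_tau n \<omega>) - mean_direct = (LINT \<omega>|M n. ?d n \<omega>)"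
        using Bochner_Integration.integral_add[OF integrable_cond_tau_diff S] by simp
      also have "norm \<dots> \<le> (LINT \<omega>|M n. norm (?d n \<omega>))" by (rule integral_norm_bound)
      also have "\<dots> \<le> (LINT \<omega>|M n. 4 * B * inv_deg n / c\<^sub>l + 4 * B * indicator (space (M n) - Good n) \<omega>)"
      proof (rule integral_mono)
        show "integrable (M n) (\<lambda>\<omega>. norm (?d n \<omega>))" by (rule integrable_norm[OF integrable_cond_tau_diff])
        show "integrable (M n) (\<lambda>\<omega>. 4 * B * inv_deg n / c\<^sub>l + 4 * B * indicator (space (M n) - Good n) \<omega>)"
          using Good_M[of n] by (intro Bochner_Integration.integrable_add M.integrable_const integrable_mult_right impI
              integrable_real_indicator) (auto simp: M.emeasure_eq_measure)
        fix \<omega> assume \<omega>: "\<omega> \<in> space (M n)"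
        have im0: "0 \<le> 4 * B * inv_deg n / c\<^sub>l" using elim rho_range[of n] c\<^sub>l(1) B_nonneg by (simp add: inv_deg_def)
        show "norm (?d n \<omega>) \<le> 4 * B * inv_deg n / c\<^sub>l + 4 * B * indicator (space (M n) - Good n) \<omega>"
        proof (cases "\<omega> \<in> Good n")
          case True
          then show ?thesis using EW_dfun_close[OF True] elim by simp
        next
          case False
          have "\<bar>?d n \<omega>\<bar> \<le> 4 * B" using cond_tau_bound[OF \<omega>] avg_dfun_bound[OF \<omega>] by linarith
          then show ?thesis using False \<omega> im0 by simp
        qed
      qed
      also have "\<dots> = b n"
        using Good_M[of n] by (subst Bochner_Integration.integral_add[OF M.integrable_const])
          (auto simp: b_def M.prob_space M.emeasure_eq_measure intro!: integrable_mult_right integrable_real_indicator)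
      finally show ?case .
    qed
  qed
  then show ?thesis by (simp add: LIM_zero_iff)
qed

lemma tau_bar_measurable: "tau_bar_DIR (M n) n (Z n) (E n) (W n) \<in> borel_measurable (M n)"
proof -
  have "real_cond_exp (M n) (OA n) f \<in> borel_measurable (M n)" for f
    by (rule measurable_from_subalg[OF subalgebra_OA borel_measurable_cond_exp])
  then show ?thesis
    unfolding tau_bar_DIR_def[abs_def]
    by (intro borel_measurable_times borel_measurable_const borel_measurable_sum)
qed

lemma tau_DIR_eq: "tau_DIR M Z E W = mean_direct"
proof -
  have "(LINT \<omega>|M n. tau_bar_DIR (M n) n (Z n) (E n) (W n) \<omega>) = (LINT \<omega>|M n. cond_tau n \<omega>)" for n
    by (rule integral_cong_AE[OF tau_bar_measurable GG_to_M[OF cond_tau_GG] tau_bar_DIR_AE])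
  then have "(\<lambda>n. LINT \<omega>|M n. tau_bar_DIR (M n) n (Z n) (E n) (W n) \<omega>) \<longlonglongrightarrow> mean_direct"
    using integral_cond_tau_tendsto by simp
  then show ?thesis unfolding tau_DIR_def by (rule limI)
qed

definition \<beta>d :: "unit_type \<Rightarrow> real" where "\<beta>d z = dfun z \<pi> - mean_direct"

lemma \<beta>d_measurable: "\<beta>d \<in> borel_measurable D"
  unfolding \<beta>d_def[abs_def] by simp

lemma \<beta>d_sq: "integrable D (\<lambda>z. (\<beta>d z)\<^sup>2)"
proof (rule D.bounded_square_integrable[OF \<beta>d_measurable])
  show "\<bar>\<beta>d z\<bar> \<le> 2 * B + \<bar>mean_direct\<bar>" if "z \<in> space D" for z
    using dfun_bound[OF that pi01] by (simp add: \<beta>d_def)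
qed

lemma \<beta>d_mean: "(LINT z|D. \<beta>d z) = 0"
  unfolding \<beta>d_def using integrable_dfun by (simp add: mean_direct_def D.prob_space)

text \<open>This is where the growth of \<open>sqrt n * \<rho> n\<close> enters: the bias is of
  order \<open>1 / (n * \<rho> n)\<close> and is multiplied by \<open>sqrt n\<close>.\<close>

lemma cond_tau_remainder:
  assumes "filterlim (\<lambda>n. sqrt (real n) * \<rho> n) at_top sequentially"
  shows "conv_prob_zero M (\<lambda>n \<omega>. sqrt (real n) * (cond_tau n \<omega> - mean_direct) - T (\<lambda>_. 0) \<beta>d n \<omega>)"
proof -
  \<comment> \<open>The assignment is a dummy argument, added so that the criterion for functions of
    graph and treatments applies.\<close>
  define F where "F n \<omega> (w :: nat \<Rightarrow> bool) = sqrt (real n) * (cond_tau n \<omega> - (1 / real n) * (\<Sum>i<n. dfun (Z n i \<omega>) \<pi>))"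
    for n \<omega> w
  define \<gamma> where "\<gamma> n = sqrt (real n) * (4 * B * inv_deg n / c\<^sub>l)" for n
  have "(\<lambda>n. 1 / (sqrt (real n) * \<rho> n)) \<longlonglongrightarrow> 0"
    by (rule tendsto_divide_0[OF tendsto_const filterlim_at_top_imp_at_infinity[OF assms]])
  moreover have "(\<lambda>n. real n / (real n - 1)) \<longlonglongrightarrow> 1" by real_asymp
  ultimately have "(\<lambda>n. 4 * B / c\<^sub>l * (real n / (real n - 1) * (1 / (sqrt (real n) * \<rho> n)))) \<longlonglongrightarrow> 4 * B / c\<^sub>l * (1 * 0)"
    by (intro tendsto_mult tendsto_const)
  moreover have "\<forall>\<^sub>F n in sequentially. 4 * B / c\<^sub>l * (real n / (real n - 1) * (1 / (sqrt (real n) * \<rho> n))) = \<gamma> n"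
    using eventually_gt_at_top[of 0]
  proof eventually_elim
    case (elim n)
    have s: "real n / (real n - 1) * (1 / (s * r)) = s * (1 / ((real n - 1) * r))" if "s * s = real n" "s \<noteq> 0" for s r :: real
      unfolding that(1)[symmetric] using that(2) by simp
    have "real n / (real n - 1) * (1 / (sqrt (real n) * \<rho> n)) = sqrt (real n) * inv_deg n"
      unfolding inv_deg_def by (rule s) (use elim in auto)
    then show ?case by (simp add: \<gamma>_def)
  qed
  ultimately have \<gamma>0: "\<gamma> \<longlonglongrightarrow> 0" by (simp add: Lim_transform_eventually)
  have FG: "(\<lambda>\<omega>. F n \<omega> w) \<in> borel_measurable (GG n)" for n w
    unfolding F_def by (intro borel_measurable_times borel_measurable_const borel_measurable_diff cond_tau_GG avg_dfun_GG)
  have Fi: "integrable (M n) (\<lambda>\<omega>. (F n \<omega> w)\<^sup>2)" for n w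
    unfolding F_def
  proof (intro square_integrable_cmult M.bounded_square_integrable[where C = "4 * B"])
    show "(\<lambda>\<omega>. cond_tau n \<omega> - (1 / real n) * (\<Sum>i<n. dfun (Z n i \<omega>) \<pi>)) \<in> borel_measurable (M n)"
      by (intro GG_to_M borel_measurable_diff cond_tau_GG avg_dfun_GG)
    show "\<bar>cond_tau n \<omega> - (1 / real n) * (\<Sum>i<n. dfun (Z n i \<omega>) \<pi>)\<bar> \<le> 4 * B" if "\<omega> \<in> space (M n)" for \<omega>
      using cond_tau_bound[OF that] avg_dfun_bound[OF that] by linarith
  qed
  have "conv_prob_zero M (\<lambda>n \<omega>. F n \<omega> (wv n \<omega>))"
  proof (rule second_moment_on_Good[where \<Psi> = "\<lambda>n _. (\<gamma> n)\<^sup>2" and b = "\<lambda>n. (\<gamma> n)\<^sup>2", OF FG Fi])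
    show "(\<lambda>n. (\<gamma> n)\<^sup>2) \<longlonglongrightarrow> 0" using tendsto_power[OF \<gamma>0, of 2] by simp
    show "\<forall>\<^sub>F n in sequentially. integrable (M n) (\<lambda>_. (\<gamma> n)\<^sup>2) \<and> (LINT \<omega>|M n. (\<gamma> n)\<^sup>2) \<le> (\<gamma> n)\<^sup>2 \<and>
        (\<forall>\<omega>\<in>space (M n). 0 \<le> (\<gamma> n)\<^sup>2) \<and> (\<forall>\<omega>\<in>Good n. EW n (\<lambda>w. (F n \<omega> w)\<^sup>2) \<le> (\<gamma> n)\<^sup>2)"
      using eventually_good
    proof eventually_elim
      case (elim n)
      have "EW n (\<lambda>w. (F n \<omega> w)\<^sup>2) \<le> (\<gamma> n)\<^sup>2" if "\<omega> \<in> Good n" for \<omega>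
      proof -
        have "\<bar>F n \<omega> w\<bar> \<le> \<gamma> n" for w
        proof -
          have "\<bar>cond_tau n \<omega> - (1 / real n) * (\<Sum>i<n. dfun (Z n i \<omega>) \<pi>)\<bar> \<le> 4 * B * inv_deg n / c\<^sub>l"
            using EW_dfun_close[OF that] elim by simp
          then show ?thesis
            unfolding F_def \<gamma>_def abs_mult abs_of_nonneg[OF real_sqrt_ge_zero[OF of_nat_0_le_iff]]
            by (rule mult_left_mono) simp
        qed
        then have "(F n \<omega> w)\<^sup>2 \<le> (\<gamma> n)\<^sup>2" for w using power_mono[of "\<bar>F n \<omega> w\<bar>" "\<gamma> n" 2] by simp
        then have "EW n (\<lambda>w. (F n \<omega> w)\<^sup>2) \<le> EW n (\<lambda>w. (\<gamma> n)\<^sup>2)" by (rule BD.EW_mono)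
        then show ?thesis by simp
      qed
      then show ?case by (simp add: M.prob_space)
    qed
  qed
  then show ?thesis
  proof (rule conv_prob_zero_cong[OF prob_space_M])
    show "(\<lambda>\<omega>. sqrt (real n) * (cond_tau n \<omega> - mean_direct) - T (\<lambda>_. 0) \<beta>d n \<omega>) \<in> borel_measurable (M n)" for n
      by (intro borel_measurable_diff borel_measurable_times borel_measurable_const GG_to_M[OF cond_tau_GG] T_measurable \<beta>d_measurable)
    show "\<forall>\<^sub>F n in sequentially. AE \<omega> in M n. sqrt (real n) * (cond_tau n \<omega> - mean_direct) - T (\<lambda>_. 0) \<beta>d n \<omega> = F n \<omega> (wv n \<omega>)"
      using eventually_gt_at_top[of 0]
    proof eventually_elim
      case (elim n)
      have s: "(1 / sqrt (real n)) * x = sqrt (real n) * ((1 / real n) * x)" for x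
        using elim by (simp add: real_div_sqrt field_simps)
      have "T (\<lambda>_. 0) \<beta>d n \<omega> = sqrt (real n) * ((1 / real n) * (\<Sum>i<n. dfun (Z n i \<omega>) \<pi>) - mean_direct)" for \<omega>
        unfolding Tw_def s \<beta>d_def using elim by (simp add: sum_subtractf right_diff_distrib)
      then show ?case by (intro AE_I2) (simp add: F_def right_diff_distrib)
    qed
  qed
qed

section \<open>The two arms of the Hajek estimator\<close>

definition arm_prob :: "bool \<Rightarrow> real" where "arm_prob b = (if b then \<pi> else 1 - \<pi>)"
definition arm_sign :: "bool \<Rightarrow> real" where "arm_sign b = (if b then 1 else - 1)"
definition mean_response :: "bool \<Rightarrow> real" where "mean_response b = (LINT z|D. snd z b \<pi>)"
definition mean_R :: real where "mean_R = (LINT z|D. rfun \<pi> z \<pi>)"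

definition arm_mean :: "bool \<Rightarrow> nat \<Rightarrow> 'a \<Rightarrow> (nat \<Rightarrow> bool) \<Rightarrow> real" where
  "arm_mean b n \<omega> w = (1 / real n) * (\<Sum>i<n. of_bool (w i = b) * snd (Z n i \<omega>) b (frac_treated n (Gr n \<omega>) i w))"

definition arm_share :: "bool \<Rightarrow> nat \<Rightarrow> (nat \<Rightarrow> bool) \<Rightarrow> real" where
  "arm_share b n w = (1 / real n) * (\<Sum>i<n. of_bool (w i = b))"

text \<open>For \<open>n > 0\<close>, \<open>S n\<close> is \<open>sqrt n\<close> times the
  deviation of the treated share from \<pi>.\<close>

abbreviation S :: "nat \<Rightarrow> 'a \<Rightarrow> real" where "S \<equiv> T (\<lambda>_. 1) (\<lambda>_. 0)"

lemma of_bool_eps: "of_bool (w i = b) = arm_prob b + arm_sign b * BD.eps i w"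
  by (cases b; cases "w i") (auto simp: arm_prob_def arm_sign_def BD.eps_def)

lemma arm_prob_pos: "0 < arm_prob b" using pi_range by (simp add: arm_prob_def)

lemma snd_pi_integrable: "integrable D (\<lambda>z. snd z b \<pi>)"
  by (rule D.integrable_const_bound[where B = B]) (auto simp: snd_bound[OF _ pi01])

lemma mean_R_eq: "mean_R = mean_response True / \<pi> + mean_response False / (1 - \<pi>)"
  unfolding mean_R_def mean_response_def rfun_def using snd_pi_integrable by simp

lemma S_second_moment: "integrable (M n) (\<lambda>\<omega>. (S n \<omega>)\<^sup>2)" "(LINT \<omega>|M n. (S n \<omega>)\<^sup>2) \<le> 1"
  using T_second_moment[of "\<lambda>_. 1" "\<lambda>_. 0" n] by (simp_all add: D.prob_space)

lemma inverse_sqrt_conv: "conv_prob_zero M (\<lambda>n _. 1 / sqrt (real n))"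
  by (rule conv_prob_zero_const[OF prob_space_M]) real_asymp

lemma arm_share_minus_arm_prob: "0 < n \<Longrightarrow> arm_share b n (wv n \<omega>) - arm_prob b = arm_sign b * ((1 / sqrt (real n)) * S n \<omega>)"
  unfolding arm_share_def of_bool_eps Tw_def by (simp add: sum.distrib sum_distrib_left field_simps)

lemma arm_share_GG: "(\<lambda>\<omega>. arm_share b n w) \<in> borel_measurable (GG n)" by simp

lemma arm_share_conv: "conv_prob_zero M (\<lambda>n \<omega>. arm_share b n (wv n \<omega>) - arm_prob b)"
proof (rule conv_prob_zero_cong[OF prob_space_M])
  show "conv_prob_zero M (\<lambda>n \<omega>. arm_sign b * ((1 / sqrt (real n)) * S n \<omega>))"
    by (intro conv_prob_zero_cmult prob_space_M
        conv_prob_zero_mult_bounded_second_moment[OF prob_space_M inverse_sqrt_conv T_measurable S_second_moment]) auto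
  show "(\<lambda>\<omega>. arm_share b n (wv n \<omega>) - arm_prob b) \<in> borel_measurable (M n)" for n
    by (intro borel_measurable_diff borel_measurable_const measurable_wv arm_share_GG)
  show "\<forall>\<^sub>F n in sequentially. AE \<omega> in M n. arm_share b n (wv n \<omega>) - arm_prob b = arm_sign b * ((1 / sqrt (real n)) * S n \<omega>)"
    using eventually_gt_at_top[of 0] by eventually_elim (intro AE_I2 arm_share_minus_arm_prob)
qed

lemma arm_mean_GG: "(\<lambda>\<omega>. arm_mean b n \<omega> w) \<in> borel_measurable (GG n)"
  unfolding arm_mean_def
  by (intro borel_measurable_times borel_measurable_const borel_measurable_sum response_GG) auto

lemma average_sq_le: "((1 / real n) * (\<Sum>i<n. f i))\<^sup>2 \<le> (1 / real n) * (\<Sum>i<n. (f i)\<^sup>2)"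
proof (cases "n = 0")
  case False
  have "(\<Sum>i<n. 1 * f i)\<^sup>2 \<le> (\<Sum>i<n. 1\<^sup>2) * (\<Sum>i<n. (f i)\<^sup>2)" by (rule Cauchy_Schwarz_ineq_sum)
  then have "(\<Sum>i<n. f i)\<^sup>2 \<le> real n * (\<Sum>i<n. (f i)\<^sup>2)" by simp
  then have "(\<Sum>i<n. f i)\<^sup>2 / (real n)\<^sup>2 \<le> real n * (\<Sum>i<n. (f i)\<^sup>2) / (real n)\<^sup>2" by (rule divide_right_mono) simp
  then show ?thesis using False by (simp add: power_mult_distrib power_divide power2_eq_square)
qed simp

text \<open>Replacing the exposures by \<pi> costs at most the variance of the exposure on
  \<open>Good n\<close>, in mean square; the centred responses of the arm then obey a weak law of
  large numbers.\<close>

lemma arm_mean_conv: "conv_prob_zero M (\<lambda>n \<omega>. arm_mean b n \<omega> (wv n \<omega>) - mean_response b * arm_share b n (wv n \<omega>))"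
proof -
  \<comment> \<open>Splitting the indicator of arm \<open>b\<close> as in \<open>of_bool_eps\<close>
    brings the centred responses into the form \<open>Tw \<alpha> \<beta>\<close>; dividing by a
    further \<open>sqrt n\<close> gives the weak law.\<close>
  define \<alpha> where "\<alpha> z = arm_sign b * (snd z b \<pi> - mean_response b)" for z :: unit_type
  define \<beta> where "\<beta> z = arm_prob b * (snd z b \<pi> - mean_response b)" for z :: unit_type
  define F where "F n \<omega> w = (1 / real n) * (\<Sum>i<n. of_bool (w i = b) *
      (snd (Z n i \<omega>) b (frac_treated n (Gr n \<omega>) i w) - snd (Z n i \<omega>) b \<pi>))" for n \<omega> w
  have m: "\<alpha> \<in> borel_measurable D" "\<beta> \<in> borel_measurable D" unfolding \<alpha>_def[abs_def] \<beta>_def[abs_def] by simp_all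
  have s: "integrable D (\<lambda>z. (snd z b \<pi> - mean_response b)\<^sup>2)"
  proof (rule D.bounded_square_integrable[where C = "B + \<bar>mean_response b\<bar>"])
    show "\<bar>snd z b \<pi> - mean_response b\<bar> \<le> B + \<bar>mean_response b\<bar>" if "z \<in> space D" for z
      using snd_bound[OF that pi01, of b] by linarith
  qed simp
  have i2: "integrable D (\<lambda>z. (\<alpha> z)\<^sup>2)" "integrable D (\<lambda>z. (\<beta> z)\<^sup>2)"
    unfolding \<alpha>_def \<beta>_def by (intro square_integrable_cmult s)+
  have b0: "(LINT z|D. \<beta> z) = 0"
    unfolding \<beta>_def using snd_pi_integrable by (simp add: mean_response_def D.prob_space)
  have FG: "(\<lambda>\<omega>. F n \<omega> w) \<in> borel_measurable (GG n)" for n w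
    unfolding F_def
    by (intro borel_measurable_times borel_measurable_const borel_measurable_sum borel_measurable_diff response_GG
        compose_Z[OF eval_pi_measurable]) auto
  have Fi: "integrable (M n) (\<lambda>\<omega>. (F n \<omega> w)\<^sup>2)" for n w
  proof (rule M.bounded_square_integrable[OF GG_to_M[OF FG]])
    show "\<bar>F n \<omega> w\<bar> \<le> 2 * B" if \<omega>: "\<omega> \<in> space (M n)" for \<omega>
      unfolding F_def
    proof (rule abs_average_le)
      fix i assume i: "i < n"
      note z = Z_space[OF i \<omega>]
      show "\<bar>of_bool (w i = b) * (snd (Z n i \<omega>) b (frac_treated n (Gr n \<omega>) i w) - snd (Z n i \<omega>) b \<pi>)\<bar> \<le> 2 * B"
        using snd_bound[OF z frac_treated_range, of b n "Gr n \<omega>" i w] snd_bound[OF z pi01, of b] B_nonneg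
        by (cases "w i = b") auto
    qed (use B_nonneg in simp)
  qed
  have F0: "conv_prob_zero M (\<lambda>n \<omega>. F n \<omega> (wv n \<omega>))"
  proof (rule second_moment_on_Good[where \<Psi> = "\<lambda>n _. B\<^sup>2 * (2 * inv_deg n / c\<^sub>l)" and b = "\<lambda>n. B\<^sup>2 * (2 * inv_deg n / c\<^sub>l)", OF FG Fi])
    have "(\<lambda>n. B\<^sup>2 * (2 * inv_deg n / c\<^sub>l)) \<longlonglongrightarrow> B\<^sup>2 * (2 * 0 / c\<^sub>l)"
      using c\<^sub>l(1) by (intro tendsto_intros inv_deg_tendsto) auto
    then show "(\<lambda>n. B\<^sup>2 * (2 * inv_deg n / c\<^sub>l)) \<longlonglongrightarrow> 0" by simp
    show "\<forall>\<^sub>F n in sequentially. integrable (M n) (\<lambda>_. B\<^sup>2 * (2 * inv_deg n / c\<^sub>l)) \<and>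
        (LINT \<omega>|M n. B\<^sup>2 * (2 * inv_deg n / c\<^sub>l)) \<le> B\<^sup>2 * (2 * inv_deg n / c\<^sub>l) \<and>
        (\<forall>\<omega>\<in>space (M n). 0 \<le> B\<^sup>2 * (2 * inv_deg n / c\<^sub>l)) \<and> (\<forall>\<omega>\<in>Good n. EW n (\<lambda>w. (F n \<omega> w)\<^sup>2) \<le> B\<^sup>2 * (2 * inv_deg n / c\<^sub>l))"
      using eventually_good
    proof eventually_elim
      case (elim n)
      have im0: "0 \<le> inv_deg n" using elim rho_range[of n] by (simp add: inv_deg_def)
      have "EW n (\<lambda>w. (F n \<omega> w)\<^sup>2) \<le> B\<^sup>2 * (2 * inv_deg n / c\<^sub>l)" if \<omega>: "\<omega> \<in> Good n" for \<omega>
      proof -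
        interpret g: bernoulli_design_graph n \<pi> "Gr n \<omega>" using good_graph(1)[OF \<omega>] elim by simp
        have \<omega>M: "\<omega> \<in> space (M n)" using \<omega> by (simp add: Good_def)
        have "EW n (\<lambda>w. (F n \<omega> w)\<^sup>2) \<le> EW n (\<lambda>w. (1 / real n) * (\<Sum>i<n. B\<^sup>2 * (g.X i w - \<pi>)\<^sup>2))"
        proof (rule BD.EW_mono)
          fix w
          have "(F n \<omega> w)\<^sup>2 \<le> (1 / real n) * (\<Sum>i<n. (of_bool (w i = b) * (snd (Z n i \<omega>) b (g.X i w) - snd (Z n i \<omega>) b \<pi>))\<^sup>2)"
            unfolding F_def by (rule average_sq_le)
          also have "\<dots> \<le> (1 / real n) * (\<Sum>i<n. B\<^sup>2 * (g.X i w - \<pi>)\<^sup>2)"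
          proof (intro mult_left_mono sum_mono)
            fix i assume "i \<in> {..<n}"
            then have i: "i < n" by simp
            have "\<bar>of_bool (w i = b) * (snd (Z n i \<omega>) b (g.X i w) - snd (Z n i \<omega>) b \<pi>)\<bar> \<le> B * \<bar>g.X i w - \<pi>\<bar>"
              using snd_lipschitz[OF Z_space[OF i \<omega>M] frac_treated_range pi01, of b n "Gr n \<omega>" i w] B_nonneg
              by (cases "w i = b") auto
            from power_mono[OF this abs_ge_zero, of 2]
            show "(of_bool (w i = b) * (snd (Z n i \<omega>) b (g.X i w) - snd (Z n i \<omega>) b \<pi>))\<^sup>2 \<le> B\<^sup>2 * (g.X i w - \<pi>)\<^sup>2"
              unfolding power2_abs power_mult_distrib[of B] .
          qed simp
          finally show "(F n \<omega> w)\<^sup>2 \<le> (1 / real n) * (\<Sum>i<n. B\<^sup>2 * (g.X i w - \<pi>)\<^sup>2)" .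
        qed
        also have "\<dots> = (1 / real n) * (\<Sum>i<n. B\<^sup>2 * EW n (\<lambda>w. (g.X i w - \<pi>)\<^sup>2))"
          by simp
        also have "\<dots> \<le> (1 / real n) * (\<Sum>i<n. B\<^sup>2 * (2 * inv_deg n / c\<^sub>l))"
        proof (intro mult_left_mono sum_mono)
          fix i assume "i \<in> {..<n}"
          then have i: "i < n" by simp
          show "EW n (\<lambda>w. (g.X i w - \<pi>)\<^sup>2) \<le> 2 * inv_deg n / c\<^sub>l"
            using g.EW_X_sq[OF i] good_graph(3)[OF \<omega> _ _ i] elim by simp
        qed auto
        also have "\<dots> = B\<^sup>2 * (2 * inv_deg n / c\<^sub>l)" using elim by simp
        finally show ?thesis .
      qed
      then show ?case using im0 c\<^sub>l(1) by (simp add: M.prob_space)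
    qed
  qed
  have "conv_prob_zero M (\<lambda>n \<omega>. (1 / sqrt (real n)) * T \<alpha> \<beta> n \<omega>)"
    by (rule conv_prob_zero_mult_bounded_second_moment[OF prob_space_M inverse_sqrt_conv T_measurable[OF m]
          T_second_moment[OF m i2 b0]])
  from conv_prob_zero_add[OF prob_space_M F0 this]
  have "conv_prob_zero M (\<lambda>n \<omega>. F n \<omega> (wv n \<omega>) + (1 / sqrt (real n)) * T \<alpha> \<beta> n \<omega>)" .
  moreover have "F n \<omega> (wv n \<omega>) + (1 / sqrt (real n)) * T \<alpha> \<beta> n \<omega> = arm_mean b n \<omega> (wv n \<omega>) - mean_response b * arm_share b n (wv n \<omega>)" for n \<omega>
  proof -
    define s where "s = sqrt (real n)"
    have s: "1 / real n = (1 / s) * (1 / s)" by (simp add: s_def)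
    define e a a' :: "nat \<Rightarrow> real" where "e i = of_bool (wv n \<omega> i = b)"
      and "a i = snd (Z n i \<omega>) b (frac_treated n (Gr n \<omega>) i (wv n \<omega>))" and "a' i = snd (Z n i \<omega>) b \<pi>" for i
    have "T \<alpha> \<beta> n \<omega> = (1 / s) * (\<Sum>i<n. e i * (a' i - mean_response b))"
      unfolding Tw_def \<alpha>_def \<beta>_def e_def a'_def of_bool_eps s_def by (simp add: algebra_simps)
    then have "F n \<omega> (wv n \<omega>) + (1 / s) * T \<alpha> \<beta> n \<omega> =
        (1 / real n) * ((\<Sum>i<n. e i * (a i - a' i)) + (\<Sum>i<n. e i * (a' i - mean_response b)))"
      unfolding F_def e_def[symmetric] a_def[symmetric] a'_def[symmetric] s by (simp add: distrib_left)
    also have "\<dots> = (1 / real n) * (\<Sum>i<n. e i * a i) - mean_response b * ((1 / real n) * (\<Sum>i<n. e i))"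
      by (simp add: right_diff_distrib sum_subtractf sum_distrib_right[symmetric])
    finally show ?thesis unfolding s_def arm_mean_def arm_share_def e_def a_def .
  qed
  ultimately show ?thesis by simp
qed

text \<open>When the Hajek ratio is expanded around the Horvitz-Thompson one, the deviation of the
  treated share is multiplied by such a quotient in each arm. This is the error of the quotient
  against its limit.\<close>

definition arm_ratio_err :: "bool \<Rightarrow> nat \<Rightarrow> 'a \<Rightarrow> real" where
  "arm_ratio_err b n \<omega> = arm_mean b n \<omega> (wv n \<omega>) / (arm_prob b * arm_share b n (wv n \<omega>)) - mean_response b / arm_prob b"

lemma arm_ratio_err_conv: "conv_prob_zero M (arm_ratio_err b)"
proof (rule conv_prob_zero_union_bound[OF prob_space_M arm_mean_conv[of b] arm_share_conv[of b]])
  show "arm_ratio_err b n \<in> borel_measurable (M n)" for n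
    unfolding arm_ratio_err_def[abs_def]
    by (intro borel_measurable_diff borel_measurable_divide borel_measurable_times borel_measurable_const
        measurable_wv arm_mean_GG arm_share_GG)
  fix \<eta> :: real assume \<eta>: "\<eta> > 0"
  define p where "p = arm_prob b"
  have p: "0 < p" using arm_prob_pos by (simp add: p_def)
  \<comment> \<open>If \<open>q\<close> is within \<open>p / 2\<close> of \<open>p\<close>, the
    denominator \<open>p * q\<close> is at least \<open>p^2 / 2\<close>, which determines the first
    threshold.\<close>
  have key: "\<eta> * p\<^sup>2 / 2 < \<bar>A - m * q\<bar> \<or> p / 2 < \<bar>q - p\<bar>" if "\<eta> < \<bar>A / (p * q) - m / p\<bar>" for A m q :: real
  proof (rule ccontr)
    assume "\<not> ?thesis"
    then have c: "\<bar>A - m * q\<bar> \<le> \<eta> * p\<^sup>2 / 2" "\<bar>q - p\<bar> \<le> p / 2" by auto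
    then have q: "p / 2 \<le> q" "0 < q" using p by linarith+
    have "A / (p * q) - m / p = (A - m * q) / (p * q)" using p q by (simp add: field_simps)
    then have "\<bar>A / (p * q) - m / p\<bar> = \<bar>A - m * q\<bar> / (p * q)" using p q by (simp add: abs_divide abs_mult)
    also have "\<dots> \<le> (\<eta> * p\<^sup>2 / 2) / (p * (p / 2))"
      using c q p \<eta> by (intro frac_le mult_left_mono) auto
    also have "\<dots> = \<eta>" using p by (simp add: power2_eq_square)
    finally show False using that by simp
  qed
  have "\<eta> * p\<^sup>2 / 2 > 0" "p / 2 > 0" using p \<eta> by simp_all
  then show "\<exists>a>0. \<exists>c>0. \<forall>\<^sub>F n in sequentially. AE \<omega> in M n. \<eta> < \<bar>arm_ratio_err b n \<omega>\<bar> \<longrightarrow>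
      a < \<bar>arm_mean b n \<omega> (wv n \<omega>) - mean_response b * arm_share b n (wv n \<omega>)\<bar> \<or> c < \<bar>arm_share b n (wv n \<omega>) - arm_prob b\<bar>"
    using key unfolding arm_ratio_err_def p_def[symmetric] by (intro exI conjI always_eventually allI AE_I2) blast+
qed

lemma tau_HT_arm_mean: "tau_HT \<pi> n (Z n) (E n) (W n) \<omega> = arm_mean True n \<omega> (wv n \<omega>) / \<pi> - arm_mean False n \<omega> (wv n \<omega>) / (1 - \<pi>)"
  and tau_HAJ_arm_mean: "0 < n \<Longrightarrow> tau_HAJ n (Z n) (E n) (W n) \<omega> =
    arm_mean True n \<omega> (wv n \<omega>) / arm_share True n (wv n \<omega>) - arm_mean False n \<omega> (wv n \<omega>) / arm_share False n (wv n \<omega>)"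
proof -
  have W: "W n i \<omega> = wv n \<omega> i" if "i < n" for i using that by (simp add: wv_def)
  have A1: "(\<Sum>i<n. of_bool (W n i \<omega>) * observed_outcome n (Z n) (E n) (W n) i \<omega>) =
      (\<Sum>i<n. of_bool (wv n \<omega> i = True) * snd (Z n i \<omega>) True (frac_treated n (Gr n \<omega>) i (wv n \<omega>)))"
    by (intro sum.cong refl) (auto simp: W observed_outcome_wv)
  have A0: "(\<Sum>i<n. (1 - of_bool (W n i \<omega>)) * observed_outcome n (Z n) (E n) (W n) i \<omega>) =
      (\<Sum>i<n. of_bool (wv n \<omega> i = False) * snd (Z n i \<omega>) False (frac_treated n (Gr n \<omega>) i (wv n \<omega>)))"
    by (intro sum.cong refl) (auto simp: W observed_outcome_wv)
  have P1: "(\<Sum>i<n. of_bool (W n i \<omega>) :: real) = (\<Sum>i<n. of_bool (wv n \<omega> i = True))"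
    by (intro sum.cong refl) (auto simp: W)
  have P0: "(\<Sum>i<n. 1 - of_bool (W n i \<omega>) :: real) = (\<Sum>i<n. of_bool (wv n \<omega> i = False))"
    by (intro sum.cong refl) (auto simp: W)
  show "tau_HT \<pi> n (Z n) (E n) (W n) \<omega> = arm_mean True n \<omega> (wv n \<omega>) / \<pi> - arm_mean False n \<omega> (wv n \<omega>) / (1 - \<pi>)"
    unfolding tau_HT_def arm_mean_def sum_divide_distrib[symmetric] A1 A0 by (simp only: times_divide_eq_right)
  have r: "x / y = (1 / real n * x) / (1 / real n * y)" if "0 < n" for x y :: real using that by simp
  show "tau_HAJ n (Z n) (E n) (W n) \<omega> =
    arm_mean True n \<omega> (wv n \<omega>) / arm_share True n (wv n \<omega>) - arm_mean False n \<omega> (wv n \<omega>) / arm_share False n (wv n \<omega>)" if "0 < n"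
    unfolding tau_HAJ_def A1 A0 P1 P0 arm_mean_def arm_share_def by (subst (1 2) r[OF that]) (rule refl)
qed

lemma tau_HT_measurable: "tau_HT \<pi> n (Z n) (E n) (W n) \<in> borel_measurable (M n)"
  unfolding tau_HT_eq[abs_def] by (rule measurable_wv[OF HTw_GG])

lemma tau_HAJ_measurable: "tau_HAJ n (Z n) (E n) (W n) \<in> borel_measurable (M n)"
proof (cases "n = 0")
  case True
  have "tau_HAJ n (Z n) (E n) (W n) = (\<lambda>_. 0)" by (rule ext) (simp add: tau_HAJ_def True)
  then show ?thesis by simp
next
  case False
  then have "tau_HAJ n (Z n) (E n) (W n) = (\<lambda>\<omega>. arm_mean True n \<omega> (wv n \<omega>) / arm_share True n (wv n \<omega>) - arm_mean False n \<omega> (wv n \<omega>) / arm_share False n (wv n \<omega>))"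
    by (intro ext tau_HAJ_arm_mean) simp
  then show ?thesis
    by (simp only:) (intro borel_measurable_diff borel_measurable_divide measurable_wv arm_mean_GG arm_share_GG)
qed

text \<open>As long as the treated share \<open>p\<close> stays inside (0, 1), the difference of the
  two estimators is exactly \<open>- (p - \<pi>)\<close> times the sum of \<open>mean_R\<close> and
  the two ratio errors. In the control arm the share deviates by \<open>- (p - \<pi>)\<close>; the
  minus sign in front of that arm cancels this one, so the coefficients of the arms add up to the
  mean of \<open>R\<close>.\<close>

lemma HAJ_remainder:
  "conv_prob_zero M (\<lambda>n \<omega>. sqrt (real n) * (tau_HAJ n (Z n) (E n) (W n) \<omega> - tau_HT \<pi> n (Z n) (E n) (W n) \<omega>) + mean_R * S n \<omega>)"
proof (rule conv_prob_zero_union_bound[OF prob_space_M _ arm_share_conv[of True]])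
  show "conv_prob_zero M (\<lambda>n \<omega>. (arm_ratio_err True n \<omega> + arm_ratio_err False n \<omega>) * S n \<omega>)"
    by (rule conv_prob_zero_mult_bounded_second_moment[OF prob_space_M conv_prob_zero_add[OF prob_space_M arm_ratio_err_conv arm_ratio_err_conv]
          T_measurable S_second_moment]) auto
  show "(\<lambda>\<omega>. sqrt (real n) * (tau_HAJ n (Z n) (E n) (W n) \<omega> - tau_HT \<pi> n (Z n) (E n) (W n) \<omega>) + mean_R * S n \<omega>) \<in> borel_measurable (M n)" for n
    by (intro borel_measurable_add borel_measurable_times borel_measurable_const borel_measurable_diff
        tau_HAJ_measurable tau_HT_measurable T_measurable)
  fix \<eta> :: real assume \<eta>: "\<eta> > 0"
  \<comment> \<open>Half of the smaller arm probability: within this distance of \<pi> the treated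
    share leaves neither arm empty.\<close>
  define c where "c = min \<pi> (1 - \<pi>) / 2"
  have c: "0 < c" using pi_range by (simp add: c_def)
  have "\<forall>\<^sub>F n in sequentially. AE \<omega> in M n.
      \<eta> < \<bar>sqrt (real n) * (tau_HAJ n (Z n) (E n) (W n) \<omega> - tau_HT \<pi> n (Z n) (E n) (W n) \<omega>) + mean_R * S n \<omega>\<bar> \<longrightarrow>
      \<eta> < \<bar>(arm_ratio_err True n \<omega> + arm_ratio_err False n \<omega>) * S n \<omega>\<bar> \<or> c < \<bar>arm_share True n (wv n \<omega>) - arm_prob True\<bar>"
    using eventually_gt_at_top[of 0]
  proof eventually_elim
    case (elim n)
    have "sqrt (real n) * (tau_HAJ n (Z n) (E n) (W n) \<omega> - tau_HT \<pi> n (Z n) (E n) (W n) \<omega>) + mean_R * S n \<omega> =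
        - ((arm_ratio_err True n \<omega> + arm_ratio_err False n \<omega>) * S n \<omega>)" if small: "\<bar>arm_share True n (wv n \<omega>) - arm_prob True\<bar> \<le> c" for \<omega>
    proof -
      define p q A1 A0 where "p = arm_share True n (wv n \<omega>)" and "q = arm_share False n (wv n \<omega>)"
        and "A1 = arm_mean True n \<omega> (wv n \<omega>)" and "A0 = arm_mean False n \<omega> (wv n \<omega>)"
      have "\<bar>p - \<pi>\<bar> \<le> c" using small by (simp add: p_def arm_prob_def)
      moreover have "2 * c \<le> \<pi>" "2 * c \<le> 1 - \<pi>" by (auto simp: c_def)
      ultimately have p01: "0 < p" "p < 1" using pi_range by linarith+
      have "p + q = (1 / real n) * (\<Sum>i<n. of_bool (wv n \<omega> i = True) + of_bool (wv n \<omega> i = False))"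
        unfolding p_def q_def arm_share_def by (simp only: distrib_left sum.distrib)
      also have "(\<Sum>i<n. of_bool (wv n \<omega> i = True) + of_bool (wv n \<omega> i = False) :: real) = (\<Sum>i<n. 1)"
        by (intro sum.cong) auto
      finally have q: "q = 1 - p" using elim by simp
      have "p - \<pi> = (1 / sqrt (real n)) * S n \<omega>"
        using arm_share_minus_arm_prob[OF elim, of True \<omega>] by (simp add: p_def arm_prob_def arm_sign_def)
      then have S: "S n \<omega> = sqrt (real n) * (p - \<pi>)" using elim by (simp add: field_simps)
      have V1: "arm_ratio_err True n \<omega> = A1 / (\<pi> * p) - mean_response True / \<pi>" and V0: "arm_ratio_err False n \<omega> = A0 / ((1 - \<pi>) * q) - mean_response False / (1 - \<pi>)"
        by (simp_all add: arm_ratio_err_def A1_def A0_def p_def q_def arm_prob_def)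
      have inv: "a / x - a / y = - ((x - y) * (a / (x * y)))" if "0 < x" "0 < y" for a x y :: real
        using that by (simp add: field_simps)
      have e1: "A1 / p - A1 / \<pi> = - ((p - \<pi>) * (A1 / (\<pi> * p)))" using p01 pi_range by (simp add: field_simps)
      have e0: "A0 / (1 - \<pi>) - A0 / (1 - p) = - ((p - \<pi>) * (A0 / ((1 - \<pi>) * (1 - p))))"
        using inv[of "1 - \<pi>" "1 - p" A0] p01 pi_range by simp
      have "tau_HAJ n (Z n) (E n) (W n) \<omega> - tau_HT \<pi> n (Z n) (E n) (W n) \<omega> = (A1 / p - A1 / \<pi>) + (A0 / (1 - \<pi>) - A0 / (1 - p))"
        unfolding tau_HAJ_arm_mean[OF elim] tau_HT_arm_mean A1_def[symmetric] A0_def[symmetric] p_def[symmetric] q_def[symmetric] q by simp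
      also have "\<dots> = - ((p - \<pi>) * (arm_ratio_err True n \<omega> + arm_ratio_err False n \<omega> + mean_R))"
        unfolding e1 e0 V1 V0 mean_R_eq q by (simp add: algebra_simps)
      finally have e: "tau_HAJ n (Z n) (E n) (W n) \<omega> - tau_HT \<pi> n (Z n) (E n) (W n) \<omega> =
        - ((p - \<pi>) * (arm_ratio_err True n \<omega> + arm_ratio_err False n \<omega> + mean_R))" .
      show ?thesis unfolding e S by (simp add: algebra_simps)
    qed
    then show ?case by (intro AE_I2) (metis abs_minus not_less)
  qed
  with \<eta> c show "\<exists>a>0. \<exists>b>0. \<forall>\<^sub>F n in sequentially. AE \<omega> in M n.
      \<eta> < \<bar>sqrt (real n) * (tau_HAJ n (Z n) (E n) (W n) \<omega> - tau_HT \<pi> n (Z n) (E n) (W n) \<omega>) + mean_R * S n \<omega>\<bar> \<longrightarrow>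
      a < \<bar>(arm_ratio_err True n \<omega> + arm_ratio_err False n \<omega>) * S n \<omega>\<bar> \<or> b < \<bar>arm_share True n (wv n \<omega>) - arm_prob True\<bar>"
    by blast
qed

section \<open>Assembling the expansions and identifying the variances\<close>

definition \<alpha>1 :: "unit_type \<Rightarrow> real" where "\<alpha>1 z = \<alpha>0 z - mean_R"

lemma \<alpha>1_measurable: "\<alpha>1 \<in> borel_measurable D"
  unfolding \<alpha>1_def[abs_def] using \<alpha>0_measurable by simp

lemma \<alpha>1_sq: "integrable D (\<lambda>z. (\<alpha>1 z)\<^sup>2)"
proof -
  have "integrable D (\<lambda>z. (\<alpha>0 z + (- mean_R))\<^sup>2)"
    by (rule square_integrable_add[OF \<alpha>0_measurable _ \<alpha>0_sq]) auto
  then show ?thesis by (simp add: \<alpha>1_def)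
qed

text \<open>Centring the coefficient of the treatments by \<open>mean_R\<close> is exactly the Hajek
  correction \<open>mean_R * S\<close>.\<close>

lemma T_\<alpha>1: "T \<alpha>1 \<beta> n \<omega> = T \<alpha>0 \<beta> n \<omega> - mean_R * S n \<omega>"
  unfolding Tw_def \<alpha>1_def by (simp add: algebra_simps sum.distrib sum_subtractf sum_distrib_left)

lemma T_split: "T \<alpha> \<beta> n \<omega> = T \<alpha> (\<lambda>_. 0) n \<omega> + T (\<lambda>_. 0) \<beta> n \<omega>"
  unfolding Tw_def by (simp add: sum.distrib distrib_left)

lemma conv_HT:
  "conv_prob_zero M (\<lambda>n \<omega>. sqrt (real n) * (tau_HT \<pi> n (Z n) (E n) (W n) \<omega> - tau_bar_DIR (M n) n (Z n) (E n) (W n) \<omega>) -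
     T \<alpha>0 (\<lambda>_. 0) n \<omega>)"
proof (rule conv_prob_zero_cong[OF prob_space_M HT_remainder])
  show "(\<lambda>\<omega>. sqrt (real n) * (tau_HT \<pi> n (Z n) (E n) (W n) \<omega> - tau_bar_DIR (M n) n (Z n) (E n) (W n) \<omega>) - T \<alpha>0 (\<lambda>_. 0) n \<omega>)
      \<in> borel_measurable (M n)" for n
    by (intro borel_measurable_diff borel_measurable_times borel_measurable_const tau_HT_measurable tau_bar_measurable
        T_measurable \<alpha>0_measurable)
  show "\<forall>\<^sub>F n in sequentially. AE \<omega> in M n. sqrt (real n) * (tau_HT \<pi> n (Z n) (E n) (W n) \<omega> -
      tau_bar_DIR (M n) n (Z n) (E n) (W n) \<omega>) - T \<alpha>0 (\<lambda>_. 0) n \<omega> = HT_rem n \<omega> (wv n \<omega>)"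
  proof (rule always_eventually, rule allI)
    fix n
    show "AE \<omega> in M n. sqrt (real n) * (tau_HT \<pi> n (Z n) (E n) (W n) \<omega> -
      tau_bar_DIR (M n) n (Z n) (E n) (W n) \<omega>) - T \<alpha>0 (\<lambda>_. 0) n \<omega> = HT_rem n \<omega> (wv n \<omega>)"
      using tau_bar_DIR_AE[of n] by eventually_elim (simp add: HT_rem_def tau_HT_eq)
  qed
qed

lemma conv_HAJ:
  "conv_prob_zero M (\<lambda>n \<omega>. sqrt (real n) * (tau_HAJ n (Z n) (E n) (W n) \<omega> - tau_bar_DIR (M n) n (Z n) (E n) (W n) \<omega>) -
     T \<alpha>1 (\<lambda>_. 0) n \<omega>)"
proof -
  have eq: "(sqrt (real n) * (tau_HT \<pi> n (Z n) (E n) (W n) \<omega> - tau_bar_DIR (M n) n (Z n) (E n) (W n) \<omega>) - T \<alpha>0 (\<lambda>_. 0) n \<omega>) +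
      (sqrt (real n) * (tau_HAJ n (Z n) (E n) (W n) \<omega> - tau_HT \<pi> n (Z n) (E n) (W n) \<omega>) + mean_R * S n \<omega>) =
      sqrt (real n) * (tau_HAJ n (Z n) (E n) (W n) \<omega> - tau_bar_DIR (M n) n (Z n) (E n) (W n) \<omega>) - T \<alpha>1 (\<lambda>_. 0) n \<omega>" for n \<omega>
    unfolding T_\<alpha>1 by (simp add: algebra_simps)
  show ?thesis using conv_prob_zero_add[OF prob_space_M conv_HT HAJ_remainder] unfolding eq .
qed

lemma conv_tau:
  assumes \<rho>: "filterlim (\<lambda>n. sqrt (real n) * \<rho> n) at_top sequentially"
    and X: "\<And>n. X n \<in> borel_measurable (M n)"
    and \<alpha>: "\<alpha> \<in> borel_measurable D"
    and c: "conv_prob_zero M (\<lambda>n \<omega>. sqrt (real n) * (X n \<omega> - tau_bar_DIR (M n) n (Z n) (E n) (W n) \<omega>) - T \<alpha> (\<lambda>_. 0) n \<omega>)"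
  shows "conv_prob_zero M (\<lambda>n \<omega>. sqrt (real n) * (X n \<omega> - tau_DIR M Z E W) - T \<alpha> \<beta>d n \<omega>)"
proof (rule conv_prob_zero_cong[OF prob_space_M conv_prob_zero_add[OF prob_space_M c cond_tau_remainder[OF \<rho>]]])
  show "(\<lambda>\<omega>. sqrt (real n) * (X n \<omega> - tau_DIR M Z E W) - T \<alpha> \<beta>d n \<omega>) \<in> borel_measurable (M n)" for n
    by (intro borel_measurable_diff borel_measurable_times borel_measurable_const X T_measurable \<alpha> \<beta>d_measurable)
  show "\<forall>\<^sub>F n in sequentially. AE \<omega> in M n. sqrt (real n) * (X n \<omega> - tau_DIR M Z E W) - T \<alpha> \<beta>d n \<omega> =
      (sqrt (real n) * (X n \<omega> - tau_bar_DIR (M n) n (Z n) (E n) (W n) \<omega>) - T \<alpha> (\<lambda>_. 0) n \<omega>) +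
      (sqrt (real n) * (cond_tau n \<omega> - mean_direct) - T (\<lambda>_. 0) \<beta>d n \<omega>)"
  proof (rule always_eventually, rule allI)
    fix n
    show "AE \<omega> in M n. sqrt (real n) * (X n \<omega> - tau_DIR M Z E W) - T \<alpha> \<beta>d n \<omega> =
      (sqrt (real n) * (X n \<omega> - tau_bar_DIR (M n) n (Z n) (E n) (W n) \<omega>) - T \<alpha> (\<lambda>_. 0) n \<omega>) +
      (sqrt (real n) * (cond_tau n \<omega> - mean_direct) - T (\<lambda>_. 0) \<beta>d n \<omega>)"
      using tau_bar_DIR_AE[of n]
    proof eventually_elim
      case (elim \<omega>)
      show ?case unfolding elim tau_DIR_eq T_split[of \<alpha> \<beta>d] by (simp add: algebra_simps)
    qed
  qed
qed

text \<open>Both variables are almost surely functions of the first unit, so expectations on the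
  product reduce to expectations under \<open>D\<close>.\<close>

lemma integral_RQ:
  fixes g :: "real \<Rightarrow> real"
  assumes g: "g \<in> borel_measurable borel"
  shows "(LINT x|(D \<Otimes>\<^sub>M D). g (R_var \<pi> x + Q_var D G \<pi> x)) = (LINT z|D. g (\<alpha>0 z))"
    and "(LINT x|(D \<Otimes>\<^sub>M D). Q_var D G \<pi> x) = (LINT z|D. Qf ds z)"
proof -
  have R: "R_var \<pi> x = rfun \<pi> (fst x) \<pi>" for x
    by (simp add: R_var_def rfun_def case_prod_unfold)
  have Qm: "Q_var D G \<pi> \<in> borel_measurable (D \<Otimes>\<^sub>M D)" unfolding Q_var_def by simp
  have m: "(\<lambda>z. g (\<alpha>0 z)) \<in> borel_measurable D" by (rule measurable_compose[OF \<alpha>0_measurable g])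
  have "(LINT x|(D \<Otimes>\<^sub>M D). g (R_var \<pi> x + Q_var D G \<pi> x)) = (LINT x|(D \<Otimes>\<^sub>M D). g (\<alpha>0 (fst x)))"
  proof (rule integral_cong_AE)
    have "(\<lambda>x. R_var \<pi> x + Q_var D G \<pi> x) \<in> borel_measurable (D \<Otimes>\<^sub>M D)"
      unfolding R by (intro borel_measurable_add Qm measurable_compose[OF measurable_fst rfun_pi_measurable])
    from measurable_compose[OF this g] show "(\<lambda>x. g (R_var \<pi> x + Q_var D G \<pi> x)) \<in> borel_measurable (D \<Otimes>\<^sub>M D)" .
    show "(\<lambda>x. g (\<alpha>0 (fst x))) \<in> borel_measurable (D \<Otimes>\<^sub>M D)" by (rule measurable_compose[OF measurable_fst m])
    show "AE x in D \<Otimes>\<^sub>M D. g (R_var \<pi> x + Q_var D G \<pi> x) = g (\<alpha>0 (fst x))"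
      using Q_var_AE by eventually_elim (simp add: R \<alpha>0_def)
  qed
  also have "\<dots> = (LINT z|distr (D \<Otimes>\<^sub>M D) D fst. g (\<alpha>0 z))"
    by (rule integral_distr[symmetric, OF measurable_fst m])
  finally show "(LINT x|(D \<Otimes>\<^sub>M D). g (R_var \<pi> x + Q_var D G \<pi> x)) = (LINT z|D. g (\<alpha>0 z))"
    by (simp add: D.distr_pair_fst)
  have "(LINT x|(D \<Otimes>\<^sub>M D). Q_var D G \<pi> x) = (LINT x|(D \<Otimes>\<^sub>M D). Qf ds (fst x))"
    by (rule integral_cong_AE[OF Qm measurable_compose[OF measurable_fst Qf_ds_measurable] Q_var_AE])
  also have "\<dots> = (LINT z|distr (D \<Otimes>\<^sub>M D) D fst. Qf ds z)"
    by (rule integral_distr[symmetric, OF measurable_fst Qf_ds_measurable])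
  finally show "(LINT x|(D \<Otimes>\<^sub>M D). Q_var D G \<pi> x) = (LINT z|D. Qf ds z)"
    by (simp add: D.distr_pair_fst)
qed

lemma expectation_RQ_sq: "(LINT x|(D \<Otimes>\<^sub>M D). (R_var \<pi> x + Q_var D G \<pi> x)\<^sup>2) = (LINT z|D. (\<alpha>0 z)\<^sup>2)"
  using integral_RQ(1)[of "\<lambda>x. x\<^sup>2"] by simp

text \<open>Both sides are the mean square of \<open>R + Q\<close> about \<open>mean_R\<close>: the
  mean of \<open>R + Q\<close> differs from \<open>mean_R\<close> by the mean of \<open>Q\<close>,
  whose square is added to the variance.\<close>

lemma variance_RQ:
  "DD.P.variance (\<lambda>x. R_var \<pi> x + Q_var D G \<pi> x) + (LINT x|(D \<Otimes>\<^sub>M D). Q_var D G \<pi> x)\<^sup>2 = (LINT z|D. (\<alpha>1 z)\<^sup>2)"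
proof -
  define c where "c = (LINT z|D. \<alpha>0 z)"
  have \<alpha>i: "integrable D \<alpha>0" by (rule D.square_integrable_imp_integrable[OF \<alpha>0_measurable \<alpha>0_sq])
  have Qi: "integrable D (Qf ds)" by (rule D.square_integrable_imp_integrable[OF Qf_ds_measurable Qf_ds_sq])
  have Ri: "integrable D (\<lambda>z. rfun \<pi> z \<pi>)"
    by (rule D.integrable_const_bound[where B = R_const]) (auto simp: rfun_bound[OF _ pi01])
  have c: "c = mean_R + (LINT z|D. Qf ds z)"
    unfolding c_def \<alpha>0_def mean_R_def using Ri Qi by simp
  have sq: "(LINT z|D. (\<alpha>0 z - s)\<^sup>2) = (LINT z|D. (\<alpha>0 z)\<^sup>2) - 2 * s * c + s\<^sup>2" for s
  proof -
    have "(LINT z|D. (\<alpha>0 z - s)\<^sup>2) = (LINT z|D. (\<alpha>0 z)\<^sup>2 - 2 * s * \<alpha>0 z + s\<^sup>2)"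
      by (rule Bochner_Integration.integral_cong[OF refl]) (simp add: power2_diff algebra_simps)
    then show ?thesis using \<alpha>0_sq \<alpha>i by (simp add: c_def D.prob_space)
  qed
  have "DD.P.variance (\<lambda>x. R_var \<pi> x + Q_var D G \<pi> x) = (LINT z|D. (\<alpha>0 z - c)\<^sup>2)"
    using integral_RQ(1)[of "\<lambda>x. (x - c)\<^sup>2"] integral_RQ(1)[of "\<lambda>x. x"] by (simp add: c_def)
  then show ?thesis
    unfolding sq integral_RQ(2)[OF borel_measurable_const[of 0]] \<alpha>1_def c by (simp add: power2_eq_square algebra_simps)
qed

lemma variance_dfun: "D.variance (\<lambda>(_, f). f True \<pi> - f False \<pi>) = (LINT z|D. (\<beta>d z)\<^sup>2)"
  by (simp add: \<beta>d_def mean_direct_def dfun_def case_prod_unfold)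

end

theorem theorem4:
  fixes M :: "nat \<Rightarrow> 'a measure"
    and FF :: "response measure"
    and D :: "unit_type measure"
    and B \<pi> c\<^sub>l c\<^sub>u :: real
    and G :: "real \<Rightarrow> real \<Rightarrow> real"
    and \<rho> :: "nat \<Rightarrow> real"
    and Z :: "nat \<Rightarrow> nat \<Rightarrow> 'a \<Rightarrow> unit_type"
    and E :: "nat \<Rightarrow> nat \<Rightarrow> nat \<Rightarrow> 'a \<Rightarrow> bool"
    and W :: "nat \<Rightarrow> nat \<Rightarrow> 'a \<Rightarrow> bool"
  assumes model: "network_interference M FF D B G \<rho> \<pi> Z E W"
    and c\<^sub>l: "0 < c\<^sub>l" "\<And>u. u \<in> {0..1} \<Longrightarrow> c\<^sub>l \<le> (LINT t:{0..1}|lborel. min 1 (G u t))"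
    and c\<^sub>u: "\<And>k. k \<in> {1, 2} \<Longrightarrow>
      (\<integral>\<^sup>+((u, _), (v, _)). ennreal (G u v ^ k) \<partial>(D \<Otimes>\<^sub>M D)) \<le> ennreal (c\<^sub>u ^ k)"
    and sparsity: "liminf (\<lambda>n. ereal (ln (\<rho> n) / ln (real n))) > - 1"
  shows
    "let R = R_var \<pi>;
         Q = Q_var D G \<pi>;
         \<sigma>0_sq = prob_space.variance D (\<lambda>(_, f). f True \<pi> - f False \<pi>)
     in
     conv_in_distribution M
       (\<lambda>n \<omega>. sqrt (real n) * (tau_HT \<pi> n (Z n) (E n) (W n) \<omega> - tau_bar_DIR (M n) n (Z n) (E n) (W n) \<omega>))
       (normal_law 0 (\<pi> * (1 - \<pi>) * prob_space.expectation (D \<Otimes>\<^sub>M D) (\<lambda>z. (R z + Q z)\<^sup>2))) \<and>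
     conv_in_distribution M
       (\<lambda>n \<omega>. sqrt (real n) * (tau_HAJ n (Z n) (E n) (W n) \<omega> - tau_bar_DIR (M n) n (Z n) (E n) (W n) \<omega>))
       (normal_law 0 (\<pi> * (1 - \<pi>) *
          (prob_space.variance (D \<Otimes>\<^sub>M D) (\<lambda>z. R z + Q z) +
           (prob_space.expectation (D \<Otimes>\<^sub>M D) Q)\<^sup>2))) \<and>
     (filterlim (\<lambda>n. sqrt (real n) * \<rho> n) at_top sequentially \<longrightarrow>
      conv_in_distribution M
        (\<lambda>n \<omega>. sqrt (real n) * (tau_HT \<pi> n (Z n) (E n) (W n) \<omega> - tau_DIR M Z E W))
        (normal_law 0 (\<sigma>0_sq +
           \<pi> * (1 - \<pi>) * prob_space.expectation (D \<Otimes>\<^sub>M D) (\<lambda>z. (R z + Q z)\<^sup>2))) \<and>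
      conv_in_distribution M
        (\<lambda>n \<omega>. sqrt (real n) * (tau_HAJ n (Z n) (E n) (W n) \<omega> - tau_DIR M Z E W))
        (normal_law 0 (\<sigma>0_sq + \<pi> * (1 - \<pi>) *
           (prob_space.variance (D \<Otimes>\<^sub>M D) (\<lambda>z. R z + Q z) +
            (prob_space.expectation (D \<Otimes>\<^sub>M D) Q)\<^sup>2))))"
proof -
  interpret network_asymptotics M FF D B G \<rho> \<pi> Z E W c\<^sub>l c\<^sub>u
    using model c\<^sub>l c\<^sub>u sparsity by (simp add: network_asymptotics_def network_asymptotics_axioms_def)
  note zero = borel_measurable_const[of 0 D]
  have i0: "integrable D (\<lambda>z. (0 :: real)\<^sup>2)" by simp
  have l0: "(LINT z|D. 0 :: real) = 0" by simp
  have m1: "(\<lambda>\<omega>. sqrt (real n) * (tau_HT \<pi> n (Z n) (E n) (W n) \<omega> - tau_bar_DIR (M n) n (Z n) (E n) (W n) \<omega>)) \<in> borel_measurable (M n)"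
    and m2: "(\<lambda>\<omega>. sqrt (real n) * (tau_HAJ n (Z n) (E n) (W n) \<omega> - tau_bar_DIR (M n) n (Z n) (E n) (W n) \<omega>)) \<in> borel_measurable (M n)"
    and m3: "(\<lambda>\<omega>. sqrt (real n) * (tau_HT \<pi> n (Z n) (E n) (W n) \<omega> - tau_DIR M Z E W)) \<in> borel_measurable (M n)"
    and m4: "(\<lambda>\<omega>. sqrt (real n) * (tau_HAJ n (Z n) (E n) (W n) \<omega> - tau_DIR M Z E W)) \<in> borel_measurable (M n)" for n
    by (intro borel_measurable_times borel_measurable_diff borel_measurable_const tau_HT_measurable tau_HAJ_measurable
        tau_bar_measurable)+
  \<comment> \<open>Relative to the conditional estimand there is no contribution from sampling the
    units, hence \<open>\<beta> = 0\<close> here; the fixed estimand below adds the centred direct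
    effects \<open>\<beta>d\<close>.\<close>
  note c1 = conv_in_distribution_via_T[OF \<alpha>0_measurable zero \<alpha>0_sq i0 l0 m1 conv_HT]
  note c2 = conv_in_distribution_via_T[OF \<alpha>1_measurable zero \<alpha>1_sq i0 l0 m2 conv_HAJ]
  note c3 = conv_in_distribution_via_T[OF \<alpha>0_measurable \<beta>d_measurable \<alpha>0_sq \<beta>d_sq \<beta>d_mean m3
      conv_tau[OF _ tau_HT_measurable \<alpha>0_measurable conv_HT]]
  note c4 = conv_in_distribution_via_T[OF \<alpha>1_measurable \<beta>d_measurable \<alpha>1_sq \<beta>d_sq \<beta>d_mean m4
      conv_tau[OF _ tau_HAJ_measurable \<alpha>1_measurable conv_HAJ]]
  show ?thesis
    unfolding Let_def expectation_RQ_sq variance_RQ variance_dfun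
    using c1 c2 c3 c4 by simp
qed

end
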